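(* Let $(W,S)$ be a Coxeter system, let $J\subseteq S$ be such that the parabolic subgroup $W_J$ is finite, let $w_J$ be the longest element of $W_J$, and let $\mathcal C\subseteq W$ be the Kazhdan–Lusztig left cell that contains $w_J$. Then $\mathcal C=\mathscr I_1w_J$, where $\mathscr I_1\subseteq D_J$ is a $W$-graph ideal with respect to $J$, and $\mathcal C_1=\{c^J_w\mid w\in\mathscr I_1\}$ is the maximal cell of $\Gamma(C_J)$ (that is, the unique maximal element of the set of cells of $\Gamma(C_J)$ under the partial order induced by $\le_{\Gamma(C_J)}$).
   Context: **Hecke algebra.** $(W,S)$ is a Coxeter system with length function $l$, Bruhat order $\le$, and left weak order $\le_L$ ($u\le_L w$ iff $l(w)=l(wu^{-1})+l(u)$, i.e. $u$ is a suffix of $w$). $\mathcal A=\mathbb Z[q,q^{-1}]$, $\mathcal A^+=\mathbb Z[q]$. $\mathcal H$ is the associative $\mathcal A$-algebra generated by $T_s$ ($s\in S$) with $T_s^2=1+(q-q^{-1})T_s$ and the braid relations; it has $\mathcal A$-basis $(T_w)_{w\in W}$. The involution $a\mapsto\overline a$ of $\mathcal A$ with $\overline q=q^{-1}$ extends to a ring involution of $\mathcal H$ with $\overline{T_s}=T_s^{-1}$. **$W$-graphs and cells.** A $W$-graph is a triple $\Gamma=(V,\mu,\tau)$, with $V$ a set, $\mu\colon V\times V\to\mathbb Z$, and $\tau$ a map from $V$ to the power set of $S$, such that the free $\mathcal A$-module on $V$ is an $\mathcal H$-module via $T_sv=-q^{-1}v$ if $s\in\tau(v)$ and $T_sv=qv+\sum_{u\in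 V,\,s\in\tau(u)}\mu(u,v)u$ if $s\notin\tau(v)$. The preorder $\le_\Gamma$ on $V$ is the reflexive transitive closure of the relation $u\leftarrow_\Gamma v$ defined by $\tau(u)\nsubseteq\tau(v)$ and $\mu(u,v)\neq0$. The cells of $\Gamma$ are the equivalence classes of the associated equivalence relation ($u\le_\Gamma v$ and $v\le_\Gamma u$); they are partially ordered by $\mathcal C\le_\Gamma\mathcal C'$ iff $u\le_\Gamma v$ for some (equivalently all) $u\in\mathcal C$, $v\in\mathcal C'$. **Left cells.** The Kazhdan–Lusztig $W$-graph $\Gamma(W)$ has vertex set $W$, $\tau(w)=\{s\in S\mid sw<w\}$, and $\mu(y,w)=\mu(w,y)$ equal, for $y<w$, to the coefficient of degree $(l(w)-l(y)-1)/2$ in the Kazhdan–Lusztig polynomial $P_{y,w}$ ($0$ if that number is not an integer; also $\mu=0$ on Bruhat-incomparable pairs). The left cells of $W$ are the cells of $\Gamma(W)$. **$W$-graph ideals.** $D_J=\{w\in W\mid l(ws)>l(w)\text{ for all }s\in J\}$ is the set of minimal left coset representatives of $W_J$. For $X\subseteq W$, $\mathrm{Pos}(X)=\{s\in S\mid l(xs)>l(x)\text{ for all }x\in X\}$. An ideal of $(W,\le_L)$ is a subset $\mathscr I\subseteq W$ containing every suffix of each of its elements. Let $\mathscr I$ be a nonempty ideal and $J\subseteq\mathrm{Pos}(\mathscr I)$ (so $\mathscr I\subseteq D_J$). For $w\in\mathscr I$ put $\mathrm{SA}(w)=\{s\in S\mid sw>w,\ sw\in\mathscr I\}$, $\mathrm{SD}(w)=\{s\in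 S\mid sw<w\}$, $\mathrm{WA}(w)=\{s\in S\mid sw>w,\ sw\in D_J\setminus\mathscr I\}$, $\mathrm{WD}(w)=\{s\in S\mid sw>w,\ sw\notin D_J\}$, and $\mathrm D(w)=\mathrm{SD}(w)\cup\mathrm{WD}(w)$. $\mathscr I$ is a $W$-graph ideal with respect to $J$ if: (i) there is an $\mathcal A$-free $\mathcal H$-module $\mathscr S(\mathscr I,J)$ with $\mathcal A$-basis $(b_w\mid w\in\mathscr I)$ such that $T_sb_w=b_{sw}$ if $s\in\mathrm{SA}(w)$; $T_sb_w=b_{sw}+(q-q^{-1})b_w$ if $s\in\mathrm{SD}(w)$; $T_sb_w=-q^{-1}b_w$ if $s\in\mathrm{WD}(w)$; $T_sb_w=qb_w-\sum_{y\in\mathscr I,\,y<sw}r^s_{y,w}b_y$ for some $r^s_{y,w}\in q\mathcal A^+$ if $s\in\mathrm{WA}(w)$; (ii) this module admits an $\mathcal A$-semilinear involution $\alpha\mapsto\overline\alpha$ with $\overline{b_1}=b_1$ and $\overline{h\alpha}=\overline h\,\overline\alpha$ for all $h\in\mathcal H$ and all $\alpha$ in the module. **Associated $W$-graph (known).** If $\mathscr I$ is a $W$-graph ideal with respect to $J$, then $\mathscr S(\mathscr I,J)$ has a unique $\mathcal A$-basis $(c_w\mid w\in\mathscr I)$ (the $W$-graph basis) with $\overline{c_w}=c_w$ and $b_w=c_w+q\sum_{y\in\mathscr I,\,y<w}q_{y,w}c_y$, $q_{y,w}\in\mathcal A^+$. Let $\mu_{y,w}$ be the constant term of $q_{y,w}$.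 Put $\mu(c_y,c_w)=\mu_{y,w}$ if $y<w$, $\mu_{w,y}$ if $w<y$, and $0$ otherwise, and $\tau(c_w)=\mathrm D(w)$. This defines a $W$-graph. **The graph $\Gamma(C_J)$.** It is known that $D_J$ is a $W$-graph ideal with respect to $J$, with module $\mathscr S_\phi=\mathcal H\otimes_{\mathcal H_J}\mathcal A_\phi$ and basis $b^J_w=T_w\otimes1$ ($w\in D_J$). Here $\mathcal H_J$ is the Hecke algebra of $(W_J,J)$ and $\mathcal A_\phi$ is $\mathcal A$ viewed as an $\mathcal H_J$-module via $\phi(T_u)=(-q)^{-l(u)}$ ($u\in W_J$). Let $C_J=(c^J_w\mid w\in D_J)$ be the resulting $W$-graph basis of $\mathscr S_\phi$ and $\Gamma(C_J)$ the corresponding $W$-graph. *)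

theory Defs
  imports
    "HOL-Algebra.QuotRing"
    "HOL-Algebra.Module"
    "HOL-Algebra.Multiplicative_Group"
    "HOL-Algebra.Free_Abelian_Groups"
    "HOL-Library.Poly_Mapping"
    "HOL-Computational_Algebra.Polynomial"
begin

section \<open>Laurent polynomials\<close>

text \<open>The ring of integral Laurent polynomials in $q$ is the group ring of the additive group of
  integers: \<^typ>\<open>int \<Rightarrow>\<^sub>0 int\<close> carries the convolution product.\<close>

type_synonym laurent = "int \<Rightarrow>\<^sub>0 int"

definition qv :: laurent where "qv = Poly_Mapping.single 1 1"

definition qinv :: laurent where "qinv = Poly_Mapping.single (-1) 1"

definition lbar :: "laurent \<Rightarrow> laurent" where "lbar = Poly_Mapping.map_key uminus"

definition Aplus :: "laurent set" where
  "Aplus = {p. Poly_Mapping.keys p \<subseteq> {0..}}"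


section \<open>Coxeter systems\<close>

definition alt_word :: "'s \<Rightarrow> 's \<Rightarrow> nat \<Rightarrow> 's list" where
  "alt_word s t n = map (\<lambda>i. if even i then s else t) [0..<n]"

definition word_prod :: "('w, 'x) monoid_scheme \<Rightarrow> 'w list \<Rightarrow> 'w" where
  "word_prod G ws = foldr (\<otimes>\<^bsub>G\<^esub>) ws \<one>\<^bsub>G\<^esub>"

text \<open>Deletion of a relator $(st)^m$ with $m$ the order of $st$.  For $s = t$ this is the relator
  $s^2$; for $st$ of infinite order \<^const>\<open>group.ord\<close> is $0$ and the relator is empty.\<close>

definition relator_del :: "('w, 'x) monoid_scheme \<Rightarrow> 'w set \<Rightarrow> 'w list \<Rightarrow> 'w list \<Rightarrow> bool" where
  "relator_del G S us vs \<longleftrightarrow>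
     (\<exists>x\<in>lists S. \<exists>y\<in>lists S. \<exists>s\<in>S. \<exists>t\<in>S.
        us = x @ alt_word s t (2 * group.ord G (s \<otimes>\<^bsub>G\<^esub> t)) @ y \<and> vs = x @ y)"

text \<open>The last axiom says that the relators $(st)^{m(s,t)}$ present the group.  Since the $s^2$ are
  among them, the monoid they present on the generators \<open>S\<close> is a group, so that positive words
  suffice.\<close>

locale coxeter_system = group W for W :: "('w, 'x) monoid_scheme" (structure) +
  fixes S :: "'w set"
  assumes S_carrier: "S \<subseteq> carrier W"
    and S_generate: "generate W S = carrier W"
    and S_ord: "\<And>s. s \<in> S \<Longrightarrow> ord s = 2"
    and presentation: "\<And>us vs. us \<in> lists S \<Longrightarrow> vs \<in> lists S \<Longrightarrow>
      word_prod W us = word_prod W vs \<Longrightarrow> equivclp (relator_del W S) us vs"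
begin

definition len :: "'w \<Rightarrow> nat" where
  "len w = (LEAST n. \<exists>ws\<in>lists S. length ws = n \<and> word_prod W ws = w)"

definition reduced :: "'w list \<Rightarrow> 'w \<Rightarrow> bool" where
  "reduced ws w \<longleftrightarrow> ws \<in> lists S \<and> word_prod W ws = w \<and> length ws = len w"

definition reflections :: "'w set" where
  "reflections = {x \<otimes> s \<otimes> inv x | x s. x \<in> carrier W \<and> s \<in> S}"

definition bruhat_step :: "'w \<Rightarrow> 'w \<Rightarrow> bool" where
  "bruhat_step u w \<longleftrightarrow>
     u \<in> carrier W \<and> (\<exists>t\<in>reflections. w = u \<otimes> t) \<and> len u < len w"

definition bruhat_le :: "'w \<Rightarrow> 'w \<Rightarrow> bool" where
  "bruhat_le u w \<longleftrightarrow> u \<in> carrier W \<and> w \<in> carrier W \<and> bruhat_step\<^sup>*\<^sup>* u w"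

definition bruhat_lt :: "'w \<Rightarrow> 'w \<Rightarrow> bool" where
  "bruhat_lt u w \<longleftrightarrow> bruhat_le u w \<and> u \<noteq> w"

definition left_weak_le :: "'w \<Rightarrow> 'w \<Rightarrow> bool" where
  "left_weak_le u w \<longleftrightarrow>
     u \<in> carrier W \<and> w \<in> carrier W \<and> len w = len (w \<otimes> inv u) + len u"

text \<open>The standard parabolic subgroup $W_J$ is \<^term>\<open>generate W J\<close>.\<close>

definition min_reps :: "'w set \<Rightarrow> 'w set" where
  "min_reps J = {w \<in> carrier W. \<forall>s\<in>J. len (w \<otimes> s) > len w}"

definition Pos :: "'w set \<Rightarrow> 'w set" where
  "Pos Y = {s \<in> S. \<forall>x\<in>Y. len (x \<otimes> s) > len x}"

definition weak_ideal :: "'w set \<Rightarrow> bool" where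
  "weak_ideal I \<longleftrightarrow> I \<subseteq> carrier W \<and> (\<forall>w\<in>I. \<forall>u. left_weak_le u w \<longrightarrow> u \<in> I)"

definition SA :: "'w set \<Rightarrow> 'w \<Rightarrow> 'w set" where
  "SA I w = {s \<in> S. bruhat_lt w (s \<otimes> w) \<and> s \<otimes> w \<in> I}"

definition SD :: "'w \<Rightarrow> 'w set" where
  "SD w = {s \<in> S. bruhat_lt (s \<otimes> w) w}"

definition WA :: "'w set \<Rightarrow> 'w set \<Rightarrow> 'w \<Rightarrow> 'w set" where
  "WA J I w = {s \<in> S. bruhat_lt w (s \<otimes> w) \<and> s \<otimes> w \<in> min_reps J - I}"

definition WD :: "'w set \<Rightarrow> 'w \<Rightarrow> 'w set" where
  "WD J w = {s \<in> S. bruhat_lt w (s \<otimes> w) \<and> s \<otimes> w \<notin> min_reps J}"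

definition Desc :: "'w set \<Rightarrow> 'w \<Rightarrow> 'w set" where
  "Desc J w = SD w \<union> WD J w"

end


section \<open>The Hecke algebra\<close>

text \<open>The free associative algebra over the Laurent polynomials on the set \<open>S\<close>: finitely supported
  functions on the words over \<open>S\<close>, with the product induced by concatenation.\<close>

definition free_algebra :: "'s set \<Rightarrow> ('s list \<Rightarrow>\<^sub>0 laurent) ring" where
  "free_algebra S =
     \<lparr>carrier = {f. Poly_Mapping.keys f \<subseteq> lists S},
      monoid.mult = (\<lambda>f g. \<Sum>u\<in>Poly_Mapping.keys f. \<Sum>v\<in>Poly_Mapping.keys g.
        Poly_Mapping.single (u @ v) (Poly_Mapping.lookup f u * Poly_Mapping.lookup g v)),
      one = Poly_Mapping.single [] 1, ring.zero = 0, add = (+)\<rparr>"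

type_synonym 'w hecke = "('w list \<Rightarrow>\<^sub>0 laurent) set"

locale left_module = R?: ring R + M?: abelian_group M
  for R :: "('r, 'y) ring_scheme" and M :: "('r, 'm, 'z) module_scheme" +
  assumes smult_closed: "\<lbrakk>a \<in> carrier R; x \<in> carrier M\<rbrakk> \<Longrightarrow> a \<odot>\<^bsub>M\<^esub> x \<in> carrier M"
    and smult_l_distr: "\<lbrakk>a \<in> carrier R; b \<in> carrier R; x \<in> carrier M\<rbrakk> \<Longrightarrow>
      (a \<oplus>\<^bsub>R\<^esub> b) \<odot>\<^bsub>M\<^esub> x = a \<odot>\<^bsub>M\<^esub> x \<oplus>\<^bsub>M\<^esub> b \<odot>\<^bsub>M\<^esub> x"
    and smult_r_distr: "\<lbrakk>a \<in> carrier R; x \<in> carrier M; y \<in> carrier M\<rbrakk> \<Longrightarrow>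
      a \<odot>\<^bsub>M\<^esub> (x \<oplus>\<^bsub>M\<^esub> y) = a \<odot>\<^bsub>M\<^esub> x \<oplus>\<^bsub>M\<^esub> a \<odot>\<^bsub>M\<^esub> y"
    and smult_assoc: "\<lbrakk>a \<in> carrier R; b \<in> carrier R; x \<in> carrier M\<rbrakk> \<Longrightarrow>
      (a \<otimes>\<^bsub>R\<^esub> b) \<odot>\<^bsub>M\<^esub> x = a \<odot>\<^bsub>M\<^esub> (b \<odot>\<^bsub>M\<^esub> x)"
    and smult_one: "x \<in> carrier M \<Longrightarrow> \<one>\<^bsub>R\<^esub> \<odot>\<^bsub>M\<^esub> x = x"

context coxeter_system
begin

definition hecke_relators :: "('w list \<Rightarrow>\<^sub>0 laurent) set" where
  "hecke_relators =
     {Poly_Mapping.single [s, s] 1 - Poly_Mapping.single [] 1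
        - Poly_Mapping.single [s] (qv - qinv) | s. s \<in> S} \<union>
     {Poly_Mapping.single (alt_word s t (ord (s \<otimes> t))) 1
        - Poly_Mapping.single (alt_word t s (ord (s \<otimes> t))) 1 | s t. s \<in> S \<and> t \<in> S \<and> s \<noteq> t}"

definition hecke_ideal :: "'w hecke" where
  "hecke_ideal = Idl\<^bsub>free_algebra S\<^esub> hecke_relators"

definition H :: "'w hecke ring" where
  "H = free_algebra S Quot hecke_ideal"

definition hclass :: "('w list \<Rightarrow>\<^sub>0 laurent) \<Rightarrow> 'w hecke" where
  "hclass f = hecke_ideal +>\<^bsub>free_algebra S\<^esub> f"

definition scal :: "laurent \<Rightarrow> 'w hecke" where
  "scal a = hclass (Poly_Mapping.single [] a)"

definition Tgen :: "'w \<Rightarrow> 'w hecke" where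
  "Tgen s = hclass (Poly_Mapping.single [s] 1)"

text \<open>$T_w = T_{s_1} \cdots T_{s_k}$ for any reduced expression $w = s_1 \cdots s_k$.\<close>

definition T :: "'w \<Rightarrow> 'w hecke" where
  "T w = hclass (Poly_Mapping.single (SOME ws. reduced ws w) 1)"

definition hbar :: "'w hecke \<Rightarrow> 'w hecke" where
  "hbar = (THE \<beta>. \<beta> \<in> extensional (carrier H) \<and> \<beta> \<in> ring_hom H H \<and>
     (\<forall>x\<in>carrier H. \<beta> (\<beta> x) = x) \<and>
     (\<forall>a. \<beta> (scal a) = scal (lbar a)) \<and>
     (\<forall>s\<in>S. \<beta> (Tgen s) = inv\<^bsub>H\<^esub> (Tgen s)))"

end


section \<open>W-graphs and cells\<close>

text \<open>The data $(V, \mu, \tau)$ of a W-graph.  Cells depend on nothing else.\<close>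

record ('v, 's) wgraph =
  verts :: "'v set"
  mu :: "'v \<Rightarrow> 'v \<Rightarrow> int"
  tau :: "'v \<Rightarrow> 's set"

definition wg_arrow :: "('v, 's) wgraph \<Rightarrow> 'v \<Rightarrow> 'v \<Rightarrow> bool" where
  "wg_arrow \<Gamma> u v \<longleftrightarrow>
     u \<in> verts \<Gamma> \<and> v \<in> verts \<Gamma> \<and> \<not> tau \<Gamma> u \<subseteq> tau \<Gamma> v \<and> mu \<Gamma> u v \<noteq> 0"

definition wg_le :: "('v, 's) wgraph \<Rightarrow> 'v \<Rightarrow> 'v \<Rightarrow> bool" where
  "wg_le \<Gamma> = (wg_arrow \<Gamma>)\<^sup>*\<^sup>*"

definition cells :: "('v, 's) wgraph \<Rightarrow> 'v set set" where
  "cells \<Gamma> =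
     verts \<Gamma> // {(u, v). u \<in> verts \<Gamma> \<and> v \<in> verts \<Gamma> \<and> wg_le \<Gamma> u v \<and> wg_le \<Gamma> v u}"

definition cell_le :: "('v, 's) wgraph \<Rightarrow> 'v set \<Rightarrow> 'v set \<Rightarrow> bool" where
  "cell_le \<Gamma> C C' \<longleftrightarrow> (\<exists>u\<in>C. \<exists>v\<in>C'. wg_le \<Gamma> u v)"

definition maximal_cells :: "('v, 's) wgraph \<Rightarrow> 'v set set" where
  "maximal_cells \<Gamma> = {C \<in> cells \<Gamma>. \<forall>C'\<in>cells \<Gamma>. cell_le \<Gamma> C C' \<longrightarrow> C' = C}"


section \<open>The Kazhdan--Lusztig W-graph and left cells\<close>

context coxeter_system
begin

text \<open>In the normalisation $T_s^2 = 1 + (q - q^{-1}) T_s$, where $q^2$ is the parameter of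
  Kazhdan and Lusztig, their basis is
  $C_w = \sum_{y \le w} (-1)^{l(w)-l(y)} q^{l(w)-l(y)} P_{y,w}(q^{-2}) T_y$.
  The $P_{y,w}$ are the unique polynomials, subject to the usual degree bound, for which all
  the $C_w$ are fixed by the bar involution.\<close>

definition KL_elem :: "('w \<Rightarrow> 'w \<Rightarrow> int poly) \<Rightarrow> 'w \<Rightarrow> 'w hecke" where
  "KL_elem P w = finsum H
     (\<lambda>y. scal ((- qv) ^ (len w - len y) * poly (map_poly of_int (P y w)) (qinv ^ 2)) \<otimes>\<^bsub>H\<^esub> T y)
     {y. bruhat_le y w}"

definition KL_poly :: "'w \<Rightarrow> 'w \<Rightarrow> int poly" where
  "KL_poly = (THE P.
     (\<forall>w\<in>carrier W. P w w = 1) \<and>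
     (\<forall>y w. \<not> bruhat_le y w \<longrightarrow> P y w = 0) \<and>
     (\<forall>y w. bruhat_lt y w \<longrightarrow> 2 * degree (P y w) + 1 \<le> len w - len y) \<and>
     (\<forall>w\<in>carrier W. hbar (KL_elem P w) = KL_elem P w))"

definition KL_mu_lt :: "'w \<Rightarrow> 'w \<Rightarrow> int" where
  "KL_mu_lt y w =
     (if odd (len w - len y) then coeff (KL_poly y w) ((len w - len y - 1) div 2) else 0)"

definition KL_graph :: "('w, 'w) wgraph" where
  "KL_graph =
     \<lparr>verts = carrier W,
      mu = (\<lambda>y w. if bruhat_lt y w then KL_mu_lt y w
                  else if bruhat_lt w y then KL_mu_lt w y else 0),
      tau = (\<lambda>w. {s \<in> S. bruhat_lt (s \<otimes> w) w})\<rparr>"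

definition left_cells :: "'w set set" where
  "left_cells = cells KL_graph"

end


section \<open>W-graph ideals\<close>

context coxeter_system
begin

text \<open>An \<^term>\<open>H\<close>-module is a module over the Laurent polynomials through \<^term>\<open>scal\<close>.\<close>

definition asmult :: "('w hecke, 'm) module \<Rightarrow> laurent \<Rightarrow> 'm \<Rightarrow> 'm" where
  "asmult M a x = scal a \<odot>\<^bsub>M\<^esub> x"

definition is_basis :: "('w hecke, 'm) module \<Rightarrow> 'w set \<Rightarrow> ('w \<Rightarrow> 'm) \<Rightarrow> bool" where
  "is_basis M I b \<longleftrightarrow> b \<in> I \<rightarrow> carrier M \<and>
     (\<forall>x\<in>carrier M. \<exists>!a :: 'w \<Rightarrow>\<^sub>0 laurent. Poly_Mapping.keys a \<subseteq> I \<and>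
        x = finsum M (\<lambda>w. asmult M (Poly_Mapping.lookup a w) (b w)) (Poly_Mapping.keys a))"

definition ideal_module ::
    "'w set \<Rightarrow> 'w set \<Rightarrow> ('w hecke, 'm) module \<Rightarrow> ('w \<Rightarrow> 'm) \<Rightarrow> bool" where
  "ideal_module J I M b \<longleftrightarrow> left_module H M \<and> is_basis M I b \<and>
     (\<forall>w\<in>I.
        (\<forall>s\<in>SA I w. Tgen s \<odot>\<^bsub>M\<^esub> b w = b (s \<otimes> w)) \<and>
        (\<forall>s\<in>SD w. Tgen s \<odot>\<^bsub>M\<^esub> b w = b (s \<otimes> w) \<oplus>\<^bsub>M\<^esub> asmult M (qv - qinv) (b w)) \<and>
        (\<forall>s\<in>WD J w. Tgen s \<odot>\<^bsub>M\<^esub> b w = asmult M (- qinv) (b w)) \<and>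
        (\<forall>s\<in>WA J I w. \<exists>r. (\<forall>y. r y \<in> (*) qv ` Aplus) \<and>
           Tgen s \<odot>\<^bsub>M\<^esub> b w = asmult M qv (b w) \<ominus>\<^bsub>M\<^esub>
             finsum M (\<lambda>y. asmult M (r y) (b y)) {y \<in> I. bruhat_lt y (s \<otimes> w)}))"

definition module_bar ::
    "('w hecke, 'm) module \<Rightarrow> ('w \<Rightarrow> 'm) \<Rightarrow> ('m \<Rightarrow> 'm) \<Rightarrow> bool" where
  "module_bar M b \<beta> \<longleftrightarrow> \<beta> \<in> carrier M \<rightarrow> carrier M \<and>
     (\<forall>x\<in>carrier M. \<forall>y\<in>carrier M. \<beta> (x \<oplus>\<^bsub>M\<^esub> y) = \<beta> x \<oplus>\<^bsub>M\<^esub> \<beta> y) \<and>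
     (\<forall>a. \<forall>x\<in>carrier M. \<beta> (asmult M a x) = asmult M (lbar a) (\<beta> x)) \<and>
     (\<forall>x\<in>carrier M. \<beta> (\<beta> x) = x) \<and>
     \<beta> (b \<one>) = b \<one> \<and>
     (\<forall>h\<in>carrier H. \<forall>x\<in>carrier M. \<beta> (h \<odot>\<^bsub>M\<^esub> x) = hbar h \<odot>\<^bsub>M\<^esub> \<beta> x)"

text \<open>A free module with a basis indexed by \<open>I\<close> is isomorphic to one whose elements are the
  finitely supported functions \<^typ>\<open>'w \<Rightarrow>\<^sub>0 laurent\<close> with support in \<open>I\<close>, so it is no restriction
  to look for the module on this type.\<close>

definition wgraph_ideal :: "'w set \<Rightarrow> 'w set \<Rightarrow> bool" where
  "wgraph_ideal J I \<longleftrightarrow> weak_ideal I \<and> I \<noteq> {} \<and> J \<subseteq> Pos I \<and>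
     (\<exists>(M :: ('w hecke, 'w \<Rightarrow>\<^sub>0 laurent) module) b \<beta>. ideal_module J I M b \<and> module_bar M b \<beta>)"

text \<open>The W-graph basis \<open>c\<close> together with the coefficients $q_{y,w}$, which are determined for
  $y < w$ in \<open>I\<close>.\<close>

definition wgraph_basis :: "'w set \<Rightarrow> ('w hecke, 'm) module \<Rightarrow> ('w \<Rightarrow> 'm) \<Rightarrow>
    ('w \<Rightarrow> 'm) \<Rightarrow> ('w \<Rightarrow> 'w \<Rightarrow> laurent) \<Rightarrow> bool" where
  "wgraph_basis I M b c Q \<longleftrightarrow> is_basis M I c \<and>
     (\<exists>\<beta>. module_bar M b \<beta> \<and> (\<forall>w\<in>I. \<beta> (c w) = c w)) \<and>
     (\<forall>y w. Q y w \<in> Aplus) \<and>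
     (\<forall>w\<in>I. b w = c w \<oplus>\<^bsub>M\<^esub>
        asmult M qv (finsum M (\<lambda>y. asmult M (Q y w) (c y)) {y \<in> I. bruhat_lt y w}))"

definition wbasis :: "'w set \<Rightarrow> ('w hecke, 'm) module \<Rightarrow> ('w \<Rightarrow> 'm) \<Rightarrow> 'w \<Rightarrow> 'm" where
  "wbasis I M b = fst (SOME (c, Q). wgraph_basis I M b c Q)"

definition wcoeff :: "'w set \<Rightarrow> ('w hecke, 'm) module \<Rightarrow> ('w \<Rightarrow> 'm) \<Rightarrow> 'w \<Rightarrow> 'w \<Rightarrow> laurent" where
  "wcoeff I M b = snd (SOME (c, Q). wgraph_basis I M b c Q)"

definition ideal_graph ::
    "'w set \<Rightarrow> 'w set \<Rightarrow> ('w hecke, 'm) module \<Rightarrow> ('w \<Rightarrow> 'm) \<Rightarrow> ('m, 'w) wgraph" where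
  "ideal_graph J I M b =
     (let c = wbasis I M b; ix = inv_into I c;
          m = (\<lambda>y w. Poly_Mapping.lookup (wcoeff I M b y w) 0)
      in \<lparr>verts = c ` I,
          mu = (\<lambda>u v. if bruhat_lt (ix u) (ix v) then m (ix u) (ix v)
                      else if bruhat_lt (ix v) (ix u) then m (ix v) (ix u) else 0),
          tau = (\<lambda>v. Desc J (ix v))\<rparr>)"

end


section \<open>The induced module and its W-graph\<close>

context coxeter_system
begin

text \<open>The tensor product of the right $H_J$-module \<^term>\<open>H\<close> with the left $H_J$-module
  $A_\phi$: the free abelian group on the symbols $h \otimes a$ modulo biadditivity and
  $hk \otimes a = h \otimes \phi(k) a$ for $k \in H_J$.  Here $H_J$ is identified with the span of
  the $T_u$ ($u \in W_J$) in \<^term>\<open>H\<close>; by biadditivity it is enough to impose the last relation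
  for $k = c\,T_u$ with a scalar $c$.\<close>

definition tensor_free :: "('w hecke \<times> laurent \<Rightarrow>\<^sub>0 int) monoid" where
  "tensor_free = free_Abelian_group (carrier H \<times> UNIV)"

definition tensor_relators :: "'w set \<Rightarrow> ('w hecke \<times> laurent \<Rightarrow>\<^sub>0 int) set" where
  "tensor_relators J =
     {frag_of (h \<oplus>\<^bsub>H\<^esub> h', a) - frag_of (h, a) - frag_of (h', a) | h h' a.
        h \<in> carrier H \<and> h' \<in> carrier H} \<union>
     {frag_of (h, a + a') - frag_of (h, a) - frag_of (h, a') | h a a'. h \<in> carrier H} \<union>
     {frag_of (h \<otimes>\<^bsub>H\<^esub> (scal c \<otimes>\<^bsub>H\<^esub> T u), a) - frag_of (h, c * (- qinv) ^ len u * a) | h c u a.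
        h \<in> carrier H \<and> u \<in> generate W J}"

definition tensor_kernel :: "'w set \<Rightarrow> ('w hecke \<times> laurent \<Rightarrow>\<^sub>0 int) set" where
  "tensor_kernel J = generate tensor_free (tensor_relators J)"

definition tensor :: "'w set \<Rightarrow> 'w hecke \<Rightarrow> laurent \<Rightarrow> ('w hecke \<times> laurent \<Rightarrow>\<^sub>0 int) set" where
  "tensor J h a = tensor_kernel J #>\<^bsub>tensor_free\<^esub> frag_of (h, a)"

text \<open>The action is $h' \cdot (h \otimes a) = h'h \otimes a$, extended additively and applied to
  the representatives of a coset.  The multiplicative part of the record is irrelevant for a
  module.\<close>

definition induced_module ::
    "'w set \<Rightarrow> ('w hecke, ('w hecke \<times> laurent \<Rightarrow>\<^sub>0 int) set) module" where
  "induced_module J =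
     \<lparr>carrier = carrier (tensor_free Mod tensor_kernel J),
      monoid.mult = undefined, one = undefined,
      ring.zero = \<one>\<^bsub>tensor_free Mod tensor_kernel J\<^esub>,
      add = (\<otimes>\<^bsub>tensor_free Mod tensor_kernel J\<^esub>),
      module.smult = (\<lambda>h' K. \<Union>p\<in>K. tensor_kernel J #>\<^bsub>tensor_free\<^esub>
        frag_extend (\<lambda>(h, a). frag_of (h' \<otimes>\<^bsub>H\<^esub> h, a)) p)\<rparr>"

definition bJ :: "'w set \<Rightarrow> 'w \<Rightarrow> ('w hecke \<times> laurent \<Rightarrow>\<^sub>0 int) set" where
  "bJ J w = tensor J (T w) 1"

definition cJ :: "'w set \<Rightarrow> 'w \<Rightarrow> ('w hecke \<times> laurent \<Rightarrow>\<^sub>0 int) set" where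
  "cJ J = wbasis (min_reps J) (induced_module J) (bJ J)"

definition Gamma_CJ :: "'w set \<Rightarrow> (('w hecke \<times> laurent \<Rightarrow>\<^sub>0 int) set, 'w) wgraph" where
  "Gamma_CJ J = ideal_graph J (min_reps J) (induced_module J) (bJ J)"

end

end

theory Submission
  imports Defs
begin

text \<open>Write $C_w$ for the Kazhdan--Lusztig basis element of $w$.  Since $T_u C_{w_J} = (-q)^{-l(u)}
  C_{w_J}$ for $u \in W_J$, the map $h \otimes a \mapsto a h C_{w_J}$ identifies the induced module
  with the left ideal $L$ generated by $C_{w_J}$, which consists of the $f$ with $f T_r = -q^{-1} f$ for all
  $r \in J$.  This ideal has the basis $C_{d w_J}$ ($d \in D_J$), and by uniqueness of bar invariant
  elements $C_{d w_J}$ corresponds to $c^J_d$.  Hence $\Gamma(C_J)$ is the full subgraph of the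
  Kazhdan--Lusztig graph on $D_J w_J$, a set that is closed under going down in the left preorder and whose
  top element is $w_J$; so its maximal cell is the left cell of $w_J$, of the form $I_1 w_J$.  The
  span of the other $C_{d w_J}$ is a left ideal, and in the quotient of $L$ by it the image of $b^J_x$ with
  $x \in D_J \setminus I_1$ is a combination with coefficients in $q\mathcal A^+$ of the images of the
  $b^J_y$ with $y \in I_1$, $y < x$.  This makes $I_1$ a W-graph ideal.

  Everything is computed in the free module on the set $W$ with its two commuting regular actions,
  which the map $h \mapsto h \cdot 1$ identifies with the Hecke algebra.\<close>

text \<open>\<open>H\<close> is a quotient by relators, so neither the independence of the
  \<open>T w\<close> nor the bar involution is given. Both come from the operators
  \<open>lam s\<close> and \<open>rho t\<close>, which commute by the exchange condition: every
  vector is reached from \<open>bvec \<one>\<close> by right operators, so an identity between left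
  operators need only be checked there. Call a coefficient small if it lies in \<open>q A+\<close>.
  A bar invariant vector that is small everywhere vanishes; this gives the uniqueness of the
  Kazhdan-Lusztig basis and of the W-graph basis. A sign has to be tracked: \<open>KL\<close>
  expands c in terms of b, while the W-graph coefficients expand b in terms of c. Inverting a
  unitriangular matrix with small entries negates the coefficients of q, because a product of two
  small entries starts with \<open>q^2\<close>; this cancels the sign that turns the coefficient of
  q in \<open>KL w\<close> into mu. The same matrix explains the ideal: \<open>b_x\<close> is
  \<open>c_x\<close> plus small multiples of lower \<open>c_y\<close>. For x outside the cell the
  leading \<open>c_x\<close> dies in the quotient; the rest is small, and stays so when re-expanded
  in the images of the \<open>b_y\<close>.\<close>

text \<open>The form in which the presentation of the group is used: a quantity that survives the
  deletion of one relator depends only on the group element. It is applied to the parity of the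
  length and to the parity of the multiplicity of a reflection.\<close>

lemma equivclp_invariant:
  assumes "equivclp R x y" and "\<And>x y. R x y \<Longrightarrow> f x = f y"
  shows "f x = f y"
  using assms(1)
proof (induction rule: equivclp_induct)
  case (step y z)
  then show ?case using assms(2) by metis
qed simp

lemma distinct_count: "distinct xs \<Longrightarrow> x \<in> set xs \<Longrightarrow> count_list xs x = 1"
  by (induction xs) auto

lemma alt_word_0 [simp]: "alt_word s t 0 = []"
  by (simp add: alt_word_def)

lemma alt_word_Suc: "alt_word s t (Suc n) = s # alt_word t s n"
  by (rule nth_equalityI) (auto simp: alt_word_def nth_Cons split: nat.split simp del: upt_Suc)

lemma length_alt_word [simp]: "length (alt_word s t n) = n"
  by (simp add: alt_word_def)

lemma alt_word_in_lists: "s \<in> S \<Longrightarrow> t \<in> S \<Longrightarrow> alt_word s t n \<in> lists S"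
  by (auto simp: alt_word_def)

text \<open>Alternating words indexed from their last letter.\<close>

fun ralt :: "'s \<Rightarrow> 's \<Rightarrow> nat \<Rightarrow> 's list" where
  "ralt z z' 0 = []"
| "ralt z z' (Suc n) = (if even n then z else z') # ralt z z' n"

lemma alt_word_ralt: "alt_word s t n = (if even n then ralt t s n else ralt s t n)"
  by (induction n arbitrary: s t) (auto simp: alt_word_Suc)

lemma ralt_in_lists: "s \<in> S \<Longrightarrow> t \<in> S \<Longrightarrow> ralt s t n \<in> lists S"
  by (induction n) auto

section \<open>Words, parity and the length function\<close>

context coxeter_system
begin

lemma S_closed [simp, intro]: "s \<in> S \<Longrightarrow> s \<in> carrier W"
  using S_carrier by blast

lemma S_sq [simp]: "s \<in> S \<Longrightarrow> s \<otimes> s = \<one>"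
  using pow_ord_eq_1 [of s] S_ord [of s] by (simp add: numeral_2_eq_2)

lemma S_inv [simp]: "s \<in> S \<Longrightarrow> inv s = s"
  by (simp add: inv_equality)

lemma S_not_one: "s \<in> S \<Longrightarrow> s \<noteq> \<one>"
  using S_ord by fastforce

lemma S_cancel [simp]: "s \<in> S \<Longrightarrow> x \<in> carrier W \<Longrightarrow> s \<otimes> (s \<otimes> x) = x"
  by (simp flip: m_assoc)

lemma S_cancel_right [simp]: "s \<in> S \<Longrightarrow> x \<in> carrier W \<Longrightarrow> (x \<otimes> s) \<otimes> s = x"
  by (simp add: m_assoc)

lemma rev_in_lists [simp]: "ws \<in> lists A \<Longrightarrow> rev ws \<in> lists A"
  by auto

lemma inv_cancel [simp]:
  "x \<in> carrier W \<Longrightarrow> y \<in> carrier W \<Longrightarrow> inv x \<otimes> (x \<otimes> y) = y"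
  "x \<in> carrier W \<Longrightarrow> y \<in> carrier W \<Longrightarrow> x \<otimes> (inv x \<otimes> y) = y"
  by (simp_all flip: m_assoc)

lemma word_prod_Nil [simp]: "word_prod W [] = \<one>"
  and word_prod_Cons [simp]: "word_prod W (s # ws) = s \<otimes> word_prod W ws"
  by (simp_all add: word_prod_def)

lemma word_prod_closed [simp, intro]: "ws \<in> lists S \<Longrightarrow> word_prod W ws \<in> carrier W"
  by (induction ws) auto

lemma word_prod_append: "xs \<in> lists S \<Longrightarrow> ys \<in> lists S \<Longrightarrow>
    word_prod W (xs @ ys) = word_prod W xs \<otimes> word_prod W ys"
  by (induction xs) (auto simp: m_assoc)

lemma word_prod_rev: "ws \<in> lists S \<Longrightarrow> word_prod W (rev ws) = inv (word_prod W ws)"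
  by (induction ws) (simp_all add: word_prod_append inv_mult_group)


lemma ex_word: "w \<in> carrier W \<Longrightarrow> \<exists>ws\<in>lists S. word_prod W ws = w"
proof -
  assume "w \<in> carrier W"
  then have "w \<in> generate W S" using S_generate by simp
  then show ?thesis
  proof induction
    case one
    show ?case by (rule bexI [of _ "[]"]) auto
  next
    case (incl h)
    then show ?case by (intro bexI [of _ "[h]"]) auto
  next
    case (inv h)
    then show ?case by (intro bexI [of _ "[h]"]) auto
  next
    case (eng h1 h2)
    then obtain xs ys where "xs \<in> lists S" "word_prod W xs = h1" "ys \<in> lists S" "word_prod W ys = h2"
      by auto
    then show ?case by (intro bexI [of _ "xs @ ys"]) (auto simp: word_prod_append)
  qed
qed

lemma ex_reduced: "w \<in> carrier W \<Longrightarrow> \<exists>ws. reduced ws w"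
proof -
  assume "w \<in> carrier W"
  then obtain ws where "ws \<in> lists S" "word_prod W ws = w" using ex_word by auto
  then have "\<exists>n. \<exists>ws\<in>lists S. length ws = n \<and> word_prod W ws = w" by auto
  from LeastI_ex [OF this] show ?thesis unfolding reduced_def len_def by auto
qed

lemma reducedD: "reduced ws w \<Longrightarrow> ws \<in> lists S" "reduced ws w \<Longrightarrow> word_prod W ws = w"
  "reduced ws w \<Longrightarrow> length ws = len w" "reduced ws w \<Longrightarrow> w \<in> carrier W"
  by (auto simp: reduced_def)

lemma len_le: "ws \<in> lists S \<Longrightarrow> len (word_prod W ws) \<le> length ws"
  unfolding len_def by (rule Least_le) auto

lemma len_one [simp]: "len \<one> = 0"
  using len_le [of "[]"] by simp

lemma len_eq_0: "w \<in> carrier W \<Longrightarrow> len w = 0 \<longleftrightarrow> w = \<one>"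
  using ex_reduced [of w] by (auto simp: reduced_def)

lemma len_mult_le: "x \<in> carrier W \<Longrightarrow> y \<in> carrier W \<Longrightarrow> len (x \<otimes> y) \<le> len x + len y"
proof -
  assume "x \<in> carrier W" "y \<in> carrier W"
  then obtain xs ys where "reduced xs x" "reduced ys y" using ex_reduced by meson
  then show ?thesis using len_le [of "xs @ ys"] by (auto simp: reduced_def word_prod_append)
qed

lemma len_inv [simp]: "w \<in> carrier W \<Longrightarrow> len (inv w) = len w"
proof -
  have le: "len (inv w) \<le> len w" if w: "w \<in> carrier W" for w
  proof -
    obtain ws where "reduced ws w" using ex_reduced [OF w] by blast
    then show ?thesis using len_le [of "rev ws"] by (auto simp: reduced_def word_prod_rev)
  qed
  assume "w \<in> carrier W"
  then show ?thesis using le [of w] le [of "inv w"] by simp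
qed

lemma len_S: "s \<in> S \<Longrightarrow> len s = 1"
  using len_le [of "[s]"] len_eq_0 [of s] S_not_one [of s] by auto

lemma relator_del_parity: "relator_del W S us vs \<Longrightarrow> even (length us) = even (length vs)"
  by (auto simp: relator_del_def)

text \<open>All relators have even length, so the sign character is well defined. It is the reason
  why multiplying by a generator never keeps the length.\<close>

lemma word_prod_eq_parity: "us \<in> lists S \<Longrightarrow> vs \<in> lists S \<Longrightarrow> word_prod W us = word_prod W vs \<Longrightarrow>
    even (length us) = even (length vs)"
  by (rule equivclp_invariant [OF presentation]) (auto dest: relator_del_parity)

lemma len_parity: "ws \<in> lists S \<Longrightarrow> even (len (word_prod W ws)) = even (length ws)"
proof -
  assume ws: "ws \<in> lists S"
  then have "word_prod W ws \<in> carrier W" by simp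
  then obtain us where "reduced us (word_prod W ws)" using ex_reduced by blast
  then show ?thesis using word_prod_eq_parity [of us ws] ws by (simp add: reduced_def)
qed

lemma len_mult_parity: "x \<in> carrier W \<Longrightarrow> y \<in> carrier W \<Longrightarrow>
    even (len (x \<otimes> y)) = even (len x + len y)"
proof -
  assume "x \<in> carrier W" "y \<in> carrier W"
  then obtain xs ys where "reduced xs x" "reduced ys y" using ex_reduced by meson
  then show ?thesis using len_parity [of "xs @ ys"] by (auto simp: reduced_def word_prod_append)
qed

lemma len_S_mult:
  assumes "s \<in> S" "w \<in> carrier W"
  shows "len (s \<otimes> w) = Suc (len w) \<or> len w = Suc (len (s \<otimes> w))"
proof -
  have "len (s \<otimes> w) \<le> Suc (len w)" using len_mult_le [of s w] assms by (simp add: len_S)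
  moreover have "len w \<le> Suc (len (s \<otimes> w))" using len_mult_le [of s "s \<otimes> w"] assms by (simp add: len_S)
  moreover have "even (len (s \<otimes> w)) = even (Suc (len w))"
    using len_mult_parity [of s w] assms by (simp add: len_S)
  moreover have "len (s \<otimes> w) \<noteq> len w" using calculation(3) by auto
  ultimately show ?thesis by linarith
qed

lemma len_mult_S:
  assumes "s \<in> S" "w \<in> carrier W"
  shows "len (w \<otimes> s) = Suc (len w) \<or> len w = Suc (len (w \<otimes> s))"
  using len_S_mult [of s "inv w"] assms
  by (metis S_closed S_inv inv_closed inv_mult_group len_inv m_closed)

subsection \<open>The strong exchange condition\<close>

text \<open>For a word \<open>s_1 ... s_k\<close> the i-th entry is the reflection whose
  multiplication from the right deletes the letter \<open>s_i\<close>. For an arbitrary word only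
  the parity of each multiplicity is an invariant of the product.\<close>

fun rinv :: "'w list \<Rightarrow> 'w list" where
  "rinv [] = []"
| "rinv (s # ws) = (inv (word_prod W ws) \<otimes> s \<otimes> word_prod W ws) # rinv ws"

lemma length_rinv [simp]: "length (rinv ws) = length ws"
  by (induction ws) auto

lemma rinv_closed: "ws \<in> lists S \<Longrightarrow> set (rinv ws) \<subseteq> carrier W"
  by (induction ws) auto

lemma rinv_append: "xs \<in> lists S \<Longrightarrow> ys \<in> lists S \<Longrightarrow>
    rinv (xs @ ys) = map (\<lambda>t. inv (word_prod W ys) \<otimes> t \<otimes> word_prod W ys) (rinv xs) @ rinv ys"
  by (induction xs) (auto simp: word_prod_append m_assoc inv_mult_group)

lemma conj_eq_iff:
  assumes "y \<in> carrier W" "u \<in> carrier W" "t \<in> carrier W"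
  shows "inv y \<otimes> u \<otimes> y = t \<longleftrightarrow> u = y \<otimes> t \<otimes> inv y"
proof
  assume "inv y \<otimes> u \<otimes> y = t"
  then show "u = y \<otimes> t \<otimes> inv y" using assms by (auto simp: m_assoc)
next
  assume "u = y \<otimes> t \<otimes> inv y"
  then show "inv y \<otimes> u \<otimes> y = t" using assms by (simp add: m_assoc)
qed

lemma count_list_conj:
  assumes "set xs \<subseteq> carrier W" "y \<in> carrier W" "t \<in> carrier W"
  shows "count_list (map (\<lambda>t. inv y \<otimes> t \<otimes> y) xs) t = count_list xs (y \<otimes> t \<otimes> inv y)"
  using assms(1) by (induction xs) (auto simp: conj_eq_iff assms)

text \<open>The cocycle rule: the reflections of \<open>xs\<close> reappear conjugated by the
  product of \<open>ys\<close>. Modulo 2 this is the reflection cocycle of the Coxeter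
  group.\<close>

lemma count_rinv_append:
  assumes "xs \<in> lists S" "ys \<in> lists S" "t \<in> carrier W"
  shows "count_list (rinv (xs @ ys)) t =
    count_list (rinv xs) (word_prod W ys \<otimes> t \<otimes> inv (word_prod W ys)) + count_list (rinv ys) t"
  using assms rinv_closed [of xs] by (simp add: rinv_append count_list_conj)

lemma pow_conj_S:
  assumes "s \<in> S" "t \<in> S"
  shows "inv ((t \<otimes> s) [^] k) \<otimes> s = s \<otimes> (t \<otimes> s) [^] (k :: nat)"
proof (induction k)
  case (Suc k)
  have "inv ((t \<otimes> s) [^] Suc k) \<otimes> s = inv (t \<otimes> s) \<otimes> (inv ((t \<otimes> s) [^] k) \<otimes> s)"
    using assms by (simp add: inv_mult_group m_assoc)
  also have "\<dots> = inv (t \<otimes> s) \<otimes> s \<otimes> (t \<otimes> s) [^] k" using Suc assms by (simp add: m_assoc)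
  also have "inv (t \<otimes> s) \<otimes> s = s \<otimes> (t \<otimes> s)" using assms by (simp add: inv_mult_group m_assoc)
  also have "s \<otimes> (t \<otimes> s) \<otimes> (t \<otimes> s) [^] k = s \<otimes> (t \<otimes> s) [^] Suc k"
    using assms nat_pow_Suc2 [of "t \<otimes> s" k] by (simp add: m_assoc)
  finally show ?case .
qed (use assms in simp)

lemma word_prod_ralt:
  assumes "s \<in> S" "t \<in> S"
  shows "word_prod W (ralt s t (2 * k)) = (t \<otimes> s) [^] k"
    "word_prod W (ralt s t (Suc (2 * k))) = s \<otimes> (t \<otimes> s) [^] k"
proof (induction k)
  case (Suc k)
  {
    case 1
    have "word_prod W (ralt s t (2 * Suc k)) = (t \<otimes> s) \<otimes> (t \<otimes> s) [^] k"
      using Suc(2) assms by (simp add: m_assoc del: nat_pow_Suc)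
    moreover have "(t \<otimes> s) [^] Suc k = (t \<otimes> s) \<otimes> (t \<otimes> s) [^] k"
      using assms by (intro nat_pow_Suc2) simp
    ultimately show ?case by (simp only:)
  } note 1 = this
  {
    case 2
    show ?case using 1 by simp
  }
qed (use assms in auto)

text \<open>In the dihedral group conjugation by \<open>s\<close> inverts the rotation
  \<open>t s\<close>, so every reflection of the word takes the form \<open>s (t s)^j\<close>.
  Indexing the word from its last letter makes the reflections of a suffix an initial part of this
  enumeration.\<close>

lemma rinv_ralt:
  assumes "s \<in> S" "t \<in> S"
  shows "rinv (ralt s t n) = rev (map (\<lambda>j. s \<otimes> (t \<otimes> s) [^] j) [0..<n])"
proof (induction n)
  case (Suc n)
  let ?c = "t \<otimes> s" and ?P = "word_prod W (ralt s t n)"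
  have c: "?c \<in> carrier W" using assms by simp
  have "inv ?P \<otimes> (if even n then s else t) \<otimes> ?P = s \<otimes> ?c [^] n"
  proof (cases "even n")
    case True
    then obtain k where n: "n = 2 * k" by auto
    have P: "?P = ?c [^] k" using word_prod_ralt(1) [OF assms] n by simp
    have "inv ?P \<otimes> s \<otimes> ?P = s \<otimes> (?c [^] k \<otimes> ?c [^] k)"
      unfolding P pow_conj_S [OF assms] using assms by (simp add: m_assoc)
    then show ?thesis using True n nat_pow_mult [OF c, of k k] by (simp add: mult_2)
  next
    case False
    then obtain k where n: "n = Suc (2 * k)" by (metis oddE Suc_eq_plus1)
    have P: "?P = s \<otimes> ?c [^] k" using word_prod_ralt(2) [OF assms] n by simp
    have "inv ?P \<otimes> t \<otimes> ?P = (inv (?c [^] k) \<otimes> s) \<otimes> (t \<otimes> s) \<otimes> ?c [^] k"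
      unfolding P using assms by (simp add: m_assoc inv_mult_group)
    also have "\<dots> = s \<otimes> (?c [^] k \<otimes> (?c \<otimes> ?c [^] k))"
      unfolding pow_conj_S [OF assms] using assms by (simp add: m_assoc)
    also have "?c \<otimes> ?c [^] k = ?c [^] Suc k" by (rule nat_pow_Suc2 [OF c, symmetric])
    finally show ?thesis using False n nat_pow_mult [OF c, of k "Suc k"] by (simp add: mult_2)
  qed
  then show ?case using Suc by simp
qed simp

lemma ord_commute: "s \<in> S \<Longrightarrow> t \<in> S \<Longrightarrow> ord (s \<otimes> t) = ord (t \<otimes> s)"
  using ord_inv [of "t \<otimes> s"] by (simp add: inv_mult_group)

lemma word_prod_relator:
  assumes "s \<in> S" "t \<in> S"
  shows "word_prod W (alt_word s t (2 * ord (s \<otimes> t))) = \<one>"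
  using word_prod_ralt(1) [OF assms(2,1)] assms by (simp add: alt_word_ralt)

text \<open>The reflections of \<open>(st)^m\<close> are \<open>t (st)^j\<close> with j below
  \<open>2m\<close>. Since \<open>(st)^m\<close> is trivial, the second half of the list repeats the
  first. For infinite order the relator is the empty word.\<close>

lemma even_count_relator:
  assumes "s \<in> S" "t \<in> S"
  shows "even (count_list (rinv (alt_word s t (2 * ord (s \<otimes> t)))) r)"
proof -
  let ?m = "ord (s \<otimes> t)" and ?g = "\<lambda>j. t \<otimes> (s \<otimes> t) [^] j"
  have "[0..<2 * ?m] = [0..<?m] @ [?m..<?m + ?m]"
    by (metis le_add1 le0 mult_2 upt_add_eq_append)
  also have "[?m..<?m + ?m] = map (\<lambda>j. j + ?m) [0..<?m]" by (simp add: map_add_upt)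
  finally have "map ?g [0..<2 * ?m] = map ?g [0..<?m] @ map (?g \<circ> (\<lambda>j. j + ?m)) [0..<?m]"
    by simp
  also have "?g \<circ> (\<lambda>j. j + ?m) = ?g"
    using assms by (auto simp flip: nat_pow_mult)
  finally show ?thesis using rinv_ralt [OF assms(2,1), of "2 * ?m"] by (simp add: alt_word_ralt count_list_rev)
qed

lemma count_rinv_relator_del:
  assumes "relator_del W S us vs" "r \<in> carrier W"
  shows "even (count_list (rinv us) r) = even (count_list (rinv vs) r)"
proof -
  obtain x y s t where xy: "x \<in> lists S" "y \<in> lists S" "s \<in> S" "t \<in> S"
    and us: "us = x @ alt_word s t (2 * ord (s \<otimes> t)) @ y" and vs: "vs = x @ y"
    using assms(1) by (auto simp: relator_del_def)
  have al: "alt_word s t (2 * ord (s \<otimes> t)) \<in> lists S" using xy alt_word_in_lists by metis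
  have "word_prod W (alt_word s t (2 * ord (s \<otimes> t)) @ y) = word_prod W y"
    using xy al word_prod_relator by (simp add: word_prod_append)
  then show ?thesis
    using xy al assms(2) even_count_relator [OF xy(3,4)]
    unfolding us vs by (simp add: count_rinv_append)
qed

text \<open>A deleted relator has trivial product, so it does not disturb the conjugation of what
  stands before it, and its own contribution is even.\<close>

lemma count_rinv_parity:
  assumes "us \<in> lists S" "vs \<in> lists S" "word_prod W us = word_prod W vs" "r \<in> carrier W"
  shows "even (count_list (rinv us) r) = even (count_list (rinv vs) r)"
  using presentation [OF assms(1-3)] by (rule equivclp_invariant) (rule count_rinv_relator_del [OF _ assms(4)])

lemma reflections_closed: "t \<in> reflections \<Longrightarrow> t \<in> carrier W"
  by (auto simp: reflections_def)

lemma reflection_sq: "t \<in> reflections \<Longrightarrow> t \<otimes> t = \<one>"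
proof -
  assume "t \<in> reflections"
  then obtain x s where t: "t = x \<otimes> s \<otimes> inv x" "x \<in> carrier W" "s \<in> S" by (auto simp: reflections_def)
  then show ?thesis by (simp add: m_assoc)
qed

lemma reflection_inv: "t \<in> reflections \<Longrightarrow> inv t = t"
  using reflection_sq reflections_closed inv_equality by blast

lemma reflection_conj:
  assumes "t \<in> reflections" "y \<in> carrier W"
  shows "y \<otimes> t \<otimes> inv y \<in> reflections"
proof -
  obtain x s where t: "t = x \<otimes> s \<otimes> inv x" "x \<in> carrier W" "s \<in> S"
    using assms by (auto simp: reflections_def)
  have "y \<otimes> t \<otimes> inv y = (y \<otimes> x) \<otimes> s \<otimes> inv (y \<otimes> x)" using t assms by (simp add: m_assoc inv_mult_group)
  then show ?thesis using t assms unfolding reflections_def by blast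
qed

lemma S_reflection: "s \<in> S \<Longrightarrow> s \<in> reflections"
  unfolding reflections_def by (rule CollectI, rule exI [of _ \<one>], rule exI [of _ s]) auto

text \<open>The palindrome \<open>xs s xs^-1\<close> works: without the middle letter the product is
  trivial and the multiplicity of \<open>t\<close> is even, and inserting \<open>s\<close> leaves
  the contributions of the two outer parts as they were and adds \<open>t\<close> exactly
  once.\<close>

lemma odd_count_reflection:
  assumes "t \<in> reflections"
  shows "\<exists>ts\<in>lists S. word_prod W ts = t \<and> odd (count_list (rinv ts) t)"
proof -
  obtain x s where t: "t = x \<otimes> s \<otimes> inv x" "x \<in> carrier W" "s \<in> S"
    using assms by (auto simp: reflections_def)
  obtain xs where xs: "xs \<in> lists S" "word_prod W xs = x" using ex_word t by blast
  have tc: "t \<in> carrier W" using assms reflections_closed by blast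
  have rx: "rev xs \<in> lists S" using xs(1) by (rule rev_in_lists)
  have p: "word_prod W (rev xs) = inv x" using xs word_prod_rev by simp
  have ct: "inv x \<otimes> t \<otimes> x = s" using t by (subst conj_eq_iff) auto
  have "even (count_list (rinv (xs @ rev xs)) t) = even (count_list (rinv []) t)"
    using xs rx tc p t by (intro count_rinv_parity) (auto simp: word_prod_append)
  then have e: "even (count_list (rinv xs) s + count_list (rinv (rev xs)) t)"
    using xs rx tc p t(2) ct by (simp add: count_rinv_append)
  have "count_list (rinv (xs @ [s] @ rev xs)) t =
      count_list (rinv xs) (s \<otimes> inv x \<otimes> t \<otimes> inv (s \<otimes> inv x)) + 1 + count_list (rinv (rev xs)) t"
    using xs rx tc p t(2,3) ct count_rinv_append [OF xs(1), of "s # rev xs" t]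
      count_rinv_append [of "[s]" "rev xs" t] by simp
  also have "s \<otimes> inv x \<otimes> t \<otimes> inv (s \<otimes> inv x) = s \<otimes> (inv x \<otimes> t \<otimes> x) \<otimes> s"
    using t tc by (simp add: m_assoc inv_mult_group)
  also have "\<dots> = s" using ct t(3) by (simp add: m_assoc)
  finally have "odd (count_list (rinv (xs @ [s] @ rev xs)) t)" using e by simp
  moreover have "word_prod W (xs @ [s] @ rev xs) = t" using xs rx p t by (simp add: word_prod_append m_assoc)
  ultimately show ?thesis using xs rx t(3) by (intro bexI [of _ "xs @ [s] @ rev xs"]) auto
qed

lemma rinv_delete:
  assumes "ws \<in> lists S" "t \<in> set (rinv ws)"
  shows "\<exists>as s bs. ws = as @ s # bs \<and> word_prod W ws \<otimes> t = word_prod W (as @ bs)"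
  using assms
proof (induction ws)
  case (Cons a ws)
  then have a: "a \<in> S" "ws \<in> lists S" by auto
  show ?case
  proof (cases "t \<in> set (rinv ws)")
    case True
    then obtain as s bs where "ws = as @ s # bs" "word_prod W ws \<otimes> t = word_prod W (as @ bs)"
      using Cons a by blast
    moreover have "t \<in> carrier W" using True a rinv_closed by blast
    ultimately have "a # ws = (a # as) @ s # bs \<and> word_prod W (a # ws) \<otimes> t = word_prod W ((a # as) @ bs)"
      using a by (simp add: m_assoc)
    then show ?thesis by blast
  next
    case False
    then have t: "t = inv (word_prod W ws) \<otimes> a \<otimes> word_prod W ws" using Cons.prems by simp
    have "a # ws = [] @ a # ws \<and> word_prod W (a # ws) \<otimes> t = word_prod W ([] @ ws)"
      unfolding t using a by (simp add: m_assoc)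
    then show ?thesis by blast
  qed
qed simp

text \<open>It suffices that \<open>t\<close> occurs an odd number of times among the reflections of
  \<open>ws\<close>. If it occurred an even number of times, the cocycle rule would make it occur an
  odd number of times for a reduced word of \<open>w t\<close>, and deleting the corresponding
  letter would make \<open>w\<close> shorter than \<open>w t\<close>.\<close>

theorem strong_exchange:
  assumes ws: "ws \<in> lists S" and t: "t \<in> reflections"
    and less: "len (word_prod W ws \<otimes> t) < len (word_prod W ws)"
  shows "\<exists>as s bs. ws = as @ s # bs \<and> word_prod W ws \<otimes> t = word_prod W (as @ bs)"
proof -
  have tc: "t \<in> carrier W" using t reflections_closed by blast
  have "odd (count_list (rinv ws) t)"
  proof (rule ccontr)
    assume even: "\<not> odd (count_list (rinv ws) t)"
    obtain ts where ts: "ts \<in> lists S" "word_prod W ts = t" "odd (count_list (rinv ts) t)"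
      using odd_count_reflection [OF t] by blast
    obtain vs where vs: "reduced vs (word_prod W ws \<otimes> t)" using ex_reduced ws tc by blast
    have "even (count_list (rinv vs) t) = even (count_list (rinv (ws @ ts)) t)"
      using vs ws ts tc by (intro count_rinv_parity) (auto simp: reduced_def word_prod_append)
    also have "count_list (rinv (ws @ ts)) t = count_list (rinv ws) (t \<otimes> t \<otimes> inv t) + count_list (rinv ts) t"
      using ws ts tc by (simp add: count_rinv_append)
    also have "t \<otimes> t \<otimes> inv t = t" using tc t by (simp add: reflection_inv reflection_sq)
    finally have "odd (count_list (rinv vs) t)" using even ts by simp
    then have "t \<in> set (rinv vs)" by (metis count_notin even_zero)
    from rinv_delete [OF reducedD(1) [OF vs] this]
    obtain as s bs where d: "vs = as @ s # bs" "word_prod W vs \<otimes> t = word_prod W (as @ bs)"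
      by blast
    have "word_prod W vs \<otimes> t = word_prod W ws"
      unfolding reducedD(2) [OF vs] using ws t tc by (simp add: m_assoc reflection_sq)
    moreover have "as @ bs \<in> lists S" using reducedD(1) [OF vs] d(1) by simp
    ultimately have "len (word_prod W ws) \<le> length (as @ bs)"
      using d(2) len_le [of "as @ bs"] by simp
    also have "\<dots> < len (word_prod W ws \<otimes> t)" using reducedD(3) [OF vs] d(1) by simp
    finally show False using less by simp
  qed
  then have "t \<in> set (rinv ws)" by (metis count_notin even_zero)
  then show ?thesis by (rule rinv_delete [OF ws])
qed

lemma exchange_left:
  assumes ws: "ws \<in> lists S" and s: "s \<in> S"
    and less: "len (s \<otimes> word_prod W ws) < len (word_prod W ws)"
  shows "\<exists>as t bs. ws = as @ t # bs \<and> s \<otimes> word_prod W ws = word_prod W (as @ bs)"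
proof -
  have inv: "word_prod W (rev ws) \<otimes> s = inv (s \<otimes> word_prod W ws)"
    using ws s by (simp add: word_prod_rev inv_mult_group)
  have r: "rev ws \<in> lists S" using ws by (rule rev_in_lists)
  have "len (word_prod W (rev ws) \<otimes> s) < len (word_prod W (rev ws))"
    using less ws s unfolding inv by (simp add: word_prod_rev)
  from strong_exchange [OF r S_reflection [OF s] this]
  obtain as t bs where d: "rev ws = as @ t # bs" "inv (s \<otimes> word_prod W ws) = word_prod W (as @ bs)"
    unfolding inv by blast
  have ws': "ws = rev bs @ t # rev as" using d(1) by (metis append.assoc append_Cons append_Nil rev_append rev_rev_ident rev_singleton_conv rev.simps(2))
  have "as @ bs \<in> lists S" using r d(1) by auto
  then have "s \<otimes> word_prod W ws = word_prod W (rev (as @ bs))"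
    using d(2) ws s by (metis S_closed inv_inv m_closed word_prod_closed word_prod_rev)
  then show ?thesis using ws' by auto
qed

text \<open>The dichotomy behind the lifting property of the Bruhat order.\<close>

lemma reflection_dichotomy:
  assumes u: "u \<in> carrier W" and t: "t \<in> reflections" and s: "s \<in> S"
    and less: "len u < len (u \<otimes> t)"
  shows "len (s \<otimes> u) < len (s \<otimes> (u \<otimes> t)) \<or> s \<otimes> u = u \<otimes> t"
proof (rule ccontr)
  assume con: "\<not> ?thesis"
  have tc: "t \<in> carrier W" using t reflections_closed by blast
  have odd: "odd (len t)"
  proof -
    obtain x r where x: "t = x \<otimes> r \<otimes> inv x" "x \<in> carrier W" "r \<in> S" using t by (auto simp: reflections_def)
    have "even (len t) = even (len x + len r + len (inv x))" using x by (simp add: len_mult_parity)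
    then show ?thesis using x by (simp add: len_S)
  qed
  \<comment> \<open>The odd length of \<open>t\<close> gives the two lengths opposite parity, so not
    being smaller means being larger.\<close>
  have ne: "len (s \<otimes> u) \<noteq> len (s \<otimes> (u \<otimes> t))"
    using len_mult_parity [of "s \<otimes> u" t] u s tc odd by (metis S_closed even_add m_assoc m_closed)
  obtain us where us: "reduced us u" using ex_reduced u by blast
  have p: "word_prod W (s # us) = s \<otimes> u" "s # us \<in> lists S" using us s by (auto simp: reduced_def)
  have "len (word_prod W (s # us) \<otimes> t) < len (word_prod W (s # us))"
    using con ne u s tc unfolding p by (simp add: m_assoc)
  from strong_exchange [OF p(2) t this]
  obtain as r bs where d: "s # us = as @ r # bs" "s \<otimes> u \<otimes> t = word_prod W (as @ bs)"
    unfolding p by blast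
  \<comment> \<open>The deleted letter is either \<open>s\<close> itself, which gives the
    exceptional alternative, or a letter of \<open>us\<close>, which would write \<open>u t\<close>
    with fewer letters than \<open>u\<close> has.\<close>
  show False
  proof (cases as)
    case Nil
    then have "s \<otimes> (u \<otimes> t) = u" using d us u s tc by (auto simp: reduced_def m_assoc)
    then have "u \<otimes> t = s \<otimes> u" using u s tc by (metis S_cancel m_closed)
    then show False using con by simp
  next
    case (Cons a as')
    then have l: "a = s" "us = as' @ r # bs" using d by auto
    have in_S: "as' @ bs \<in> lists S" using us l by (auto simp: reduced_def)
    have "s \<otimes> (u \<otimes> t) = s \<otimes> word_prod W (as' @ bs)" using d(2) Cons l u s tc by (simp add: m_assoc)
    then have "u \<otimes> t = word_prod W (as' @ bs)" using u s tc in_S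
      by (metis S_cancel m_closed word_prod_closed)
    then have "len (u \<otimes> t) \<le> length (as' @ bs)" using len_le [OF in_S] by simp
    also have "\<dots> < len u" using us l by (auto simp: reduced_def)
    finally show False using less by simp
  qed
qed

text \<open>The case of two generators. It is what makes the left and right regular operators
  commute, and what forces \<open>s w = w r\<close> when left multiplication by \<open>s\<close>
  leaves \<open>D_J\<close>.\<close>

lemma exchange_sides:
  assumes u: "u \<in> carrier W" and s: "s \<in> S" and t: "t \<in> S"
    and "len u < len (u \<otimes> t)" "len (s \<otimes> u \<otimes> t) < len (s \<otimes> u)"
  shows "s \<otimes> u = u \<otimes> t"
  using reflection_dichotomy [OF u S_reflection [OF t] s] assms by (auto simp: m_assoc)

subsection \<open>Dihedral words\<close>

lemma word_prod_alt_word: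
  assumes "s \<in> S" "t \<in> S"
  shows "word_prod W (alt_word s t n) \<otimes> inv (word_prod W (alt_word t s n)) = (s \<otimes> t) [^] n"
  using assms
proof (induction n arbitrary: s t)
  case (Suc n)
  have al: "alt_word s t n \<in> lists S" "alt_word t s n \<in> lists S" using Suc.prems alt_word_in_lists by metis+
  have "word_prod W (alt_word s t (Suc n)) \<otimes> inv (word_prod W (alt_word t s (Suc n))) =
      s \<otimes> (word_prod W (alt_word t s n) \<otimes> inv (word_prod W (alt_word s t n))) \<otimes> t"
    using Suc.prems al by (simp add: alt_word_Suc inv_mult_group m_assoc)
  also have "\<dots> = s \<otimes> (t \<otimes> s) [^] n \<otimes> t" using Suc by simp
  also have "\<dots> = (s \<otimes> t) [^] Suc n"
  proof -
    have "s \<otimes> (t \<otimes> s) [^] n = (s \<otimes> t) [^] n \<otimes> s" for n :: nat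
    proof (induction n)
      case (Suc n)
      have "s \<otimes> (t \<otimes> s) [^] Suc n = (s \<otimes> (t \<otimes> s) [^] n) \<otimes> (t \<otimes> s)" using \<open>s \<in> S\<close> \<open>t \<in> S\<close> by (simp add: m_assoc)
      also have "\<dots> = (s \<otimes> t) [^] n \<otimes> s \<otimes> (t \<otimes> s)" using Suc by simp
      finally show ?case using \<open>s \<in> S\<close> \<open>t \<in> S\<close> by (simp add: m_assoc)
    qed (use Suc.prems in simp)
    then show ?thesis using Suc.prems by (simp add: m_assoc)
  qed
  finally show ?case .
qed simp

lemma alt_word_eq_iff:
  assumes "s \<in> S" "t \<in> S"
  shows "word_prod W (alt_word s t n) = word_prod W (alt_word t s n) \<longleftrightarrow> (s \<otimes> t) [^] n = \<one>"
proof -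
  have eq_iff: "x = y \<longleftrightarrow> x \<otimes> inv y = \<one>" if "x \<in> carrier W" "y \<in> carrier W" for x y
    using that inv_equality [of x "inv y"] by auto
  show ?thesis unfolding word_prod_alt_word [OF assms, symmetric]
    using alt_word_in_lists [OF assms, of n] alt_word_in_lists [OF assms(2,1), of n] by (intro eq_iff) auto
qed

lemma braid_prod:
  assumes "s \<in> S" "t \<in> S"
  shows "word_prod W (alt_word s t (ord (s \<otimes> t))) = word_prod W (alt_word t s (ord (s \<otimes> t)))"
  using assms by (simp add: alt_word_eq_iff)

text \<open>A reflection of odd multiplicity must also occur in every other word for the same
  element, in particular in a reduced one, which therefore has at least that many letters.\<close>

lemma len_ge_card_odd:
  assumes "ws \<in> lists S"
  shows "card {r. odd (count_list (rinv ws) r)} \<le> len (word_prod W ws)"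
proof -
  obtain vs where vs: "reduced vs (word_prod W ws)" using ex_reduced assms by blast
  have sub: "{r. odd (count_list (rinv ws) r)} \<subseteq> set (rinv vs)"
  proof
    fix r assume "r \<in> {r. odd (count_list (rinv ws) r)}"
    then have o: "odd (count_list (rinv ws) r)" by simp
    then have "r \<in> set (rinv ws)" by (metis count_notin even_zero)
    then have "r \<in> carrier W" using rinv_closed assms by blast
    then have "odd (count_list (rinv vs) r)"
      using o vs assms count_rinv_parity [of vs ws r] by (auto simp: reduced_def)
    then show "r \<in> set (rinv vs)" by (metis count_notin even_zero)
  qed
  have "card {r. odd (count_list (rinv ws) r)} \<le> card (set (rinv vs))"
    by (rule card_mono [OF _ sub]) simp
  also have "\<dots> \<le> length (rinv vs)" by (rule card_length)
  finally show ?thesis using vs by (auto simp: reduced_def)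
qed

lemma len_distinct_rinv:
  assumes "ws \<in> lists S" "distinct (rinv ws)"
  shows "len (word_prod W ws) = length ws"
proof -
  have "set (rinv ws) \<subseteq> {r. odd (count_list (rinv ws) r)}"
    using assms(2) distinct_count by fastforce
  moreover have "finite {r. odd (count_list (rinv ws) r)}"
    by (rule finite_subset [of _ "set (rinv ws)"]) (auto, metis count_notin even_zero)
  ultimately have "card (set (rinv ws)) \<le> card {r. odd (count_list (rinv ws) r)}"
    by (rule card_mono [rotated])
  then show ?thesis using len_ge_card_odd [OF assms(1)] len_le [OF assms(1)] distinct_card [OF assms(2)] by simp
qed

text \<open>Powers of \<open>t s\<close> below its order are distinct, hence so are the reflections
  \<open>s (t s)^j\<close> of the word, and a word with distinct reflections is reduced.\<close>

lemma len_ralt: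
  assumes "s \<in> S" "t \<in> S" "n \<le> ord (t \<otimes> s)"
  shows "len (word_prod W (ralt s t n)) = n"
proof -
  have c: "t \<otimes> s \<in> carrier W" using assms by simp
  have "inj_on (\<lambda>j. (t \<otimes> s) [^] j) {0..<n}"
    using ord_inj [OF c] by (rule inj_on_subset) (use assms in auto)
  then have "inj_on (\<lambda>j. s \<otimes> (t \<otimes> s) [^] j) {0..<n}"
    using assms(1) c by (auto simp: inj_on_def)
  then have "distinct (rinv (ralt s t n))" using assms by (simp add: rinv_ralt distinct_map)
  then show ?thesis using len_distinct_rinv [of "ralt s t n"] ralt_in_lists [OF assms(1,2)]
    by (metis length_alt_word length_rinv rinv_ralt assms(1,2) length_rev length_map length_upt minus_nat.diff_0)
qed

lemma len_alt_word:
  assumes "s \<in> S" "t \<in> S" "n \<le> ord (s \<otimes> t)"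
  shows "len (word_prod W (alt_word s t n)) = n"
  using len_ralt [of s t n] len_ralt [of t s n] assms ord_commute [of s t] by (simp add: alt_word_ralt)

end

lemma take_alt_word: "k \<le> n \<Longrightarrow> take k (alt_word s t n) = alt_word s t k"
  by (simp add: alt_word_def take_map)

context coxeter_system
begin

subsection \<open>Matsumoto's theorem\<close>

lemma reduced_ConsD:
  assumes "reduced (s # x) w"
  shows "s \<in> S" "reduced x (s \<otimes> w)" "len (s \<otimes> w) < len w"
proof -
  have x: "s \<in> S" "x \<in> lists S" "w = s \<otimes> word_prod W x" "len w = Suc (length x)"
    using assms by (auto simp: reduced_def)
  then have e: "s \<otimes> w = word_prod W x" by simp
  have "len w \<le> Suc (len (s \<otimes> w))" using len_S_mult [of s w] x by auto
  then have "len (s \<otimes> w) = length x" using len_le [OF x(2)] x(4) e by simp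
  then show "s \<in> S" "reduced x (s \<otimes> w)" "len (s \<otimes> w) < len w" using x e by (simp_all add: reduced_def)
qed

lemma reduced_snocD:
  assumes "reduced (x @ [s]) w"
  shows "s \<in> S" "reduced x (w \<otimes> s)" "len (w \<otimes> s) < len w"
proof -
  have x: "s \<in> S" "x \<in> lists S" "w = word_prod W x \<otimes> s" "len w = Suc (length x)"
    using reducedD [OF assms] by (auto simp: word_prod_append)
  then have e: "w \<otimes> s = word_prod W x" by simp
  have "len w \<le> Suc (len (w \<otimes> s))" using len_mult_S [of s w] x by auto
  then have "len (w \<otimes> s) = length x" using len_le [OF x(2)] x(4) e by simp
  then show "s \<in> S" "reduced x (w \<otimes> s)" "len (w \<otimes> s) < len w" using x e by (simp_all add: reduced_def)
qed

lemma reduced_ConsI: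
  assumes "s \<in> S" "reduced x w" "len w < len (s \<otimes> w)"
  shows "reduced (s # x) (s \<otimes> w)"
  using assms reducedD [OF assms(2)] len_S_mult [of s w] by (auto simp: reduced_def)

lemma len_append_ge: "xs \<in> lists S \<Longrightarrow> ys \<in> lists S \<Longrightarrow>
    len (word_prod W (xs @ ys)) \<le> len (word_prod W xs) + length ys"
  using len_mult_le [of "word_prod W xs" "word_prod W ys"] len_le [of ys] by (simp add: word_prod_append)

text \<open>Equality of the two alternating products forces \<open>(ab)^n\<close> to be trivial, so
  the order m divides n. If n were larger than m, the braid relation would rewrite the prefix of
  length \<open>m + 1\<close> with \<open>m - 1\<close> letters.\<close>

lemma reduced_alt_words:
  assumes a: "a \<in> S" and b: "b \<in> S" and n: "n > 0"
    and red: "reduced (alt_word a b n) w" "reduced (alt_word b a n) w"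
  shows "n = ord (a \<otimes> b)"
proof -
  let ?m = "ord (a \<otimes> b)"
  have "(a \<otimes> b) [^] n = \<one>" using alt_word_eq_iff [OF a b, of n] reducedD(2) [OF red(1)] reducedD(2) [OF red(2)] by simp
  then have dvd: "?m dvd n" using pow_eq_id a b by simp
  have "\<not> ?m < n"
  proof
    assume less: "?m < n"
    have m: "?m > 0" using dvd n by (metis dvd_0_left gr0I less_irrefl)
    then obtain k where k: "?m = Suc k" using gr0_implies_Suc by blast
    have al: "alt_word x y j \<in> lists S" if "x \<in> {a, b}" "y \<in> {a, b}" for x y j
      using that a b by (intro alt_word_in_lists) auto
    have split: "alt_word a b n = alt_word a b (Suc ?m) @ drop (Suc ?m) (alt_word a b n)"
      using take_alt_word [of "Suc ?m" n a b] less by (metis Suc_leI append_take_drop_id)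
    have "word_prod W (alt_word a b (Suc ?m)) = a \<otimes> word_prod W (alt_word a b ?m)"
      using braid_prod [OF a b] by (simp add: alt_word_Suc)
    also have "\<dots> = word_prod W (alt_word b a k)" using a al by (simp add: k alt_word_Suc)
    finally have "len (word_prod W (alt_word a b (Suc ?m))) \<le> k" using len_le [OF al] by simp
    moreover have "drop (Suc ?m) (alt_word a b n) \<in> lists S" using al [of a b n] by (auto dest: in_set_dropD)
    ultimately have "len (word_prod W (alt_word a b n)) \<le> k + (n - Suc ?m)"
      using len_append_ge [OF al [of a b "Suc ?m"], of "drop (Suc ?m) (alt_word a b n)"] split by simp
    then show False using red(1) k less by (auto simp: reduced_def)
  qed
  then show ?thesis using dvd_imp_le [OF dvd n] by simp
qed

text \<open>Stated for an arbitrary congruence containing the braid relations, because it is needed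
  for two of them: equality of classes in \<open>H\<close> and equality of the operators
  \<open>wacti\<close>. Induction on the length: two inequivalent reduced words are driven towards
  alternating ones until a braid relation contradicts them.\<close>

theorem matsumoto:
  assumes refl: "\<And>x. x \<in> lists S \<Longrightarrow> R x x"
    and sym: "\<And>x y. R x y \<Longrightarrow> R y x"
    and trans: "\<And>x y z. R x y \<Longrightarrow> R y z \<Longrightarrow> R x z"
    and Cons: "\<And>s x y. s \<in> S \<Longrightarrow> x \<in> lists S \<Longrightarrow> y \<in> lists S \<Longrightarrow> R x y \<Longrightarrow> R (s # x) (s # y)"
    and snoc: "\<And>s x y. s \<in> S \<Longrightarrow> x \<in> lists S \<Longrightarrow> y \<in> lists S \<Longrightarrow> R x y \<Longrightarrow> R (x @ [s]) (y @ [s])"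
    and braid: "\<And>s t. s \<in> S \<Longrightarrow> t \<in> S \<Longrightarrow> s \<noteq> t \<Longrightarrow>
      R (alt_word s t (ord (s \<otimes> t))) (alt_word t s (ord (s \<otimes> t)))"
    and "reduced x w" "reduced y w"
  shows "R x y"
  using assms(7,8)
proof (induction "len w" arbitrary: w x y rule: less_induct)
  case less
  let ?n = "len w"
  \<comment> \<open>Exchanging the first letter of \<open>y\<close> into \<open>x\<close> deletes
    some letter of \<open>x\<close>. By induction the result is equivalent to \<open>y\<close>, with
    which it shares the first letter. If the deleted letter were not the last one, the result would
    share its last letter with \<open>x\<close> and be equivalent to \<open>x\<close> as
    well.\<close>
  have step: "reduced (hd y # butlast x) w \<and> \<not> R (hd y # butlast x) x"
    if xy: "reduced x w" "reduced y w" "\<not> R x y" "?n > 0" for x y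
  proof -
    obtain b y' where y: "y = b # y'" using xy by (cases y) (auto simp: reduced_def)
    note yD = reduced_ConsD [OF xy(2) [unfolded y]]
    have w: "word_prod W x = w" "x \<in> lists S" "length x = ?n" "w \<in> carrier W" using xy(1) reducedD by auto
    from exchange_left [OF w(2) yD(1)] yD(3)
    obtain as t bs where d: "x = as @ t # bs" "b \<otimes> w = word_prod W (as @ bs)" unfolding w by blast
    have red: "reduced (b # as @ bs) w"
    proof -
      have "word_prod W (b # as @ bs) = w" using d(2) w(4) yD(1) by (simp flip: d(2))
      then show ?thesis using d(1) w yD(1) by (simp add: reduced_def)
    qed
    have "R y' (as @ bs)" using less.hyps [OF yD(3,2) reduced_ConsD(2) [OF red]] .
    then have yR: "R y (b # as @ bs)" using Cons yD reducedD(1) [OF yD(2)] d(1) w(2) y by simp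
    have bs: "bs = []"
    proof (rule ccontr)
      assume "bs \<noteq> []"
      then obtain cs c where c: "bs = cs @ [c]" by (metis rev_exhaust)
      have r1: "reduced ((b # as @ cs) @ [c]) w" and r2: "reduced ((as @ t # cs) @ [c]) w"
        using red xy(1) d(1) c by simp_all
      have "R (b # as @ cs) (as @ t # cs)"
        using less.hyps [OF reduced_snocD(3) [OF r1] reduced_snocD(2) [OF r1] reduced_snocD(2) [OF r2]] .
      from snoc [OF reduced_snocD(1) [OF r1] _ _ this] have "R (b # as @ bs) x"
        using reducedD(1) [OF r1] reducedD(1) [OF r2] d(1) c by simp
      then show False using xy(3) yR trans sym by blast
    qed
    have "butlast x = as" using d(1) bs by simp
    moreover have "R y (b # as)" using yR bs by simp
    moreover from this have "\<not> R (b # as) x" using xy(3) trans sym by blast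
    ultimately show ?thesis using red bs y by simp
  qed
  show ?case
  proof (rule ccontr)
    assume neg: "\<not> R x y"
    have n: "?n > 0"
    proof (rule ccontr)
      assume "\<not> ?thesis"
      then have "x = []" "y = []" using less.prems by (auto simp: reduced_def)
      then show False using neg refl by simp
    qed
    \<comment> \<open>Apply \<open>step\<close> repeatedly, each time exchanging the roles of the
      new word and the old \<open>x\<close>: every round lengthens the alternating initial segment
      by one letter.\<close>
    have "\<exists>x y a b. reduced x w \<and> reduced y w \<and> \<not> R x y \<and> hd y = b \<and> a \<in> S \<and> b \<in> S \<and>
        take (Suc j) x = alt_word a b (Suc j) \<and> take j y = alt_word b a j" if "Suc j \<le> ?n" for j
      using that
    proof (induction j)
      case 0
      have "x \<noteq> []" "y \<noteq> []" using less.prems n by (auto simp: reduced_def)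
      moreover have "hd x \<in> S" "hd y \<in> S" using less.prems calculation reducedD(1) by (metis in_listsD hd_in_set)+
      ultimately show ?case using less.prems neg
        by (intro exI [of _ x] exI [of _ y] exI [of _ "hd x"] exI [of _ "hd y"])
          (auto simp: alt_word_Suc take_Suc)
    next
      case (Suc j)
      then obtain x y a b where IH: "reduced x w" "reduced y w" "\<not> R x y" "hd y = b" "a \<in> S" "b \<in> S"
        "take (Suc j) x = alt_word a b (Suc j)" "take j y = alt_word b a j" by auto
      note st = step [OF IH(1,2,3) n]
      have lx: "length x = ?n" using IH(1) reducedD by blast
      have "take (Suc (Suc j)) (hd y # butlast x) = b # take (Suc j) x"
        using IH(4) Suc.prems lx by (simp add: butlast_conv_take)
      also have "\<dots> = alt_word b a (Suc (Suc j))" unfolding IH(7) by (simp add: alt_word_Suc)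
      finally have "take (Suc (Suc j)) (hd y # butlast x) = alt_word b a (Suc (Suc j))" .
      moreover have "hd x = a" using IH(7) by (cases x) (auto simp: alt_word_Suc)
      ultimately show ?case using st IH(1,5,6,7)
        by (intro exI [of _ "hd y # butlast x"] exI [of _ x] exI [of _ b] exI [of _ a]) auto
    qed
    from this [of "?n - 1"] n obtain x y a b where xy: "reduced x w" "reduced y w" "\<not> R x y" "hd y = b"
      "a \<in> S" "b \<in> S" "take ?n x = alt_word a b ?n" by auto
    have x: "x = alt_word a b ?n" using xy(7) reducedD(3) [OF xy(1)] by simp
    have "butlast x = alt_word a b (?n - 1)" by (simp add: x butlast_conv_take take_alt_word)
    then have "hd y # butlast x = alt_word b a ?n" using xy(4) n alt_word_Suc [of b a "?n - 1"] by simp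
    then have st: "reduced (alt_word b a ?n) w" "\<not> R (alt_word b a ?n) (alt_word a b ?n)"
      using step [OF xy(1-3) n] x by simp_all
    have "?n = ord (a \<otimes> b)" using reduced_alt_words [OF xy(5,6) n] xy(1) x st(1) by simp
    moreover have "a \<noteq> b" using st(2) refl alt_word_in_lists xy(5) by metis
    ultimately show False using braid [OF xy(5,6)] st(2) sym by simp
  qed
qed

subsection \<open>The Bruhat order\<close>

lemma bruhat_stepI: "u \<in> carrier W \<Longrightarrow> t \<in> reflections \<Longrightarrow> len u < len (u \<otimes> t) \<Longrightarrow> bruhat_step u (u \<otimes> t)"
  by (auto simp: bruhat_step_def)

lemma bruhat_step_closed: "bruhat_step u v \<Longrightarrow> u \<in> carrier W \<and> v \<in> carrier W"
  by (auto simp: bruhat_step_def reflections_closed)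

lemma bruhat_leD: "bruhat_le u v \<Longrightarrow> u \<in> carrier W" "bruhat_le u v \<Longrightarrow> v \<in> carrier W"
  by (auto simp: bruhat_le_def)

lemma bruhat_le_refl [simp]: "u \<in> carrier W \<Longrightarrow> bruhat_le u u"
  by (simp add: bruhat_le_def)

lemma bruhat_le_trans: "bruhat_le u v \<Longrightarrow> bruhat_le v w \<Longrightarrow> bruhat_le u w"
  by (auto simp: bruhat_le_def)

lemma bruhat_step_le: "bruhat_step u v \<Longrightarrow> bruhat_le u v"
  by (auto simp: bruhat_le_def bruhat_step_closed)

lemma bruhat_le_induct [consumes 1, case_names refl step]:
  assumes "bruhat_le u v" "\<And>u. u \<in> carrier W \<Longrightarrow> P u u"
    "\<And>u v w. bruhat_le u v \<Longrightarrow> bruhat_step v w \<Longrightarrow> P u v \<Longrightarrow> P u w"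
  shows "P u v"
proof -
  have "bruhat_step\<^sup>*\<^sup>* u v" "u \<in> carrier W" using assms(1) by (auto simp: bruhat_le_def)
  then show ?thesis
  proof (induction rule: rtranclp_induct)
    case (step y z)
    then have "bruhat_le u y" by (auto simp: bruhat_le_def dest: bruhat_step_closed)
    then show ?case using step assms(3) by blast
  qed (use assms(2) in blast)
qed

lemma bruhat_le_converse_induct [consumes 1, case_names refl step]:
  assumes "bruhat_le u v" "\<And>u. u \<in> carrier W \<Longrightarrow> P u u"
    "\<And>u v w. bruhat_step u v \<Longrightarrow> bruhat_le v w \<Longrightarrow> P v w \<Longrightarrow> P u w"
  shows "P u v"
proof -
  have "bruhat_step\<^sup>*\<^sup>* u v" "v \<in> carrier W" using assms(1) by (auto simp: bruhat_le_def)
  then show ?thesis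
  proof (induction rule: converse_rtranclp_induct)
    case (step y z)
    then have "bruhat_le z v" by (auto simp: bruhat_le_def dest: bruhat_step_closed)
    then show ?case using step assms(3) by blast
  qed (use assms(2) in blast)
qed

lemma bruhat_le_len: "bruhat_le u v \<Longrightarrow> u = v \<or> len u < len v"
  by (induction rule: bruhat_le_induct) (auto simp: bruhat_step_def)

lemma bruhat_lt_len: "bruhat_lt u v \<Longrightarrow> len u < len v"
  using bruhat_le_len by (auto simp: bruhat_lt_def)

lemma bruhat_ltD: "bruhat_lt u v \<Longrightarrow> bruhat_le u v" "bruhat_lt u v \<Longrightarrow> u \<in> carrier W"
  "bruhat_lt u v \<Longrightarrow> v \<in> carrier W"
  by (auto simp: bruhat_lt_def bruhat_le_def)

lemma bruhat_lt_irrefl [simp]: "\<not> bruhat_lt u u"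
  by (simp add: bruhat_lt_def)

lemma bruhat_lt_le_trans: "bruhat_lt u v \<Longrightarrow> bruhat_le v w \<Longrightarrow> bruhat_lt u w"
  using bruhat_le_trans bruhat_lt_len bruhat_le_len unfolding bruhat_lt_def by fastforce

lemma bruhat_lt_trans: "bruhat_lt u v \<Longrightarrow> bruhat_lt v w \<Longrightarrow> bruhat_lt u w"
  using bruhat_lt_le_trans bruhat_ltD by blast

lemma bruhat_lt_asym: "bruhat_lt u v \<Longrightarrow> \<not> bruhat_lt v u"
  using bruhat_lt_len less_not_sym by blast

lemma bruhat_le_S_right:
  assumes "s \<in> S" "w \<in> carrier W" "len w < len (w \<otimes> s)" shows "bruhat_le w (w \<otimes> s)"
  using assms S_reflection by (intro bruhat_step_le bruhat_stepI) auto

lemma bruhat_step_left: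
  assumes "t \<in> reflections" "w \<in> carrier W" "len w < len (t \<otimes> w)" shows "bruhat_step w (t \<otimes> w)"
proof -
  have tc: "t \<in> carrier W" using assms reflections_closed by blast
  have "inv w \<otimes> t \<otimes> inv (inv w) \<in> reflections" using assms by (intro reflection_conj) auto
  moreover have "w \<otimes> (inv w \<otimes> t \<otimes> inv (inv w)) = t \<otimes> w" using assms tc by (simp add: m_assoc)
  ultimately show ?thesis using assms bruhat_stepI [of w "inv w \<otimes> t \<otimes> inv (inv w)"] by simp
qed

lemma bruhat_le_S_left:
  assumes "s \<in> S" "w \<in> carrier W" "len w < len (s \<otimes> w)" shows "bruhat_le w (s \<otimes> w)"
  using assms S_reflection by (intro bruhat_step_le bruhat_step_left) auto

lemma bruhat_lt_S_left_iff:
  assumes "s \<in> S" "w \<in> carrier W"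
  shows "bruhat_lt w (s \<otimes> w) \<longleftrightarrow> len w < len (s \<otimes> w)" "bruhat_lt (s \<otimes> w) w \<longleftrightarrow> len (s \<otimes> w) < len w"
proof -
  show "bruhat_lt w (s \<otimes> w) \<longleftrightarrow> len w < len (s \<otimes> w)"
    using bruhat_lt_len bruhat_le_S_left [OF assms] by (auto simp: bruhat_lt_def)
  show "bruhat_lt (s \<otimes> w) w \<longleftrightarrow> len (s \<otimes> w) < len w"
    using bruhat_lt_len bruhat_le_S_left [of s "s \<otimes> w"] assms by (auto simp: bruhat_lt_def)
qed

lemma bruhat_step_S_left:
  assumes "bruhat_step u v" "s \<in> S"
  shows "bruhat_step (s \<otimes> u) (s \<otimes> v) \<or> s \<otimes> u = v"
proof -
  obtain t where t: "t \<in> reflections" "v = u \<otimes> t" "u \<in> carrier W" "len u < len v"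
    using assms by (auto simp: bruhat_step_def)
  then show ?thesis using reflection_dichotomy [OF t(3,1) assms(2)] bruhat_stepI [of "s \<otimes> u" t] assms(2)
    by (auto simp: m_assoc reflections_closed)
qed

text \<open>The lifting property without a hypothesis on lengths, along a chain of reflections. By
  the dichotomy each link is either carried by \<open>s\<close> to a link again, or \<open>s\<close>
  maps its lower end to its upper end, and then the translated chain joins the original one.\<close>

lemma bruhat_S_upper:
  assumes "bruhat_le u v" "s \<in> S"
  shows "bruhat_le (s \<otimes> u) v \<or> bruhat_le (s \<otimes> u) (s \<otimes> v)"
  using assms(1)
proof (induction rule: bruhat_le_induct)
  case (step u v w)
  then show ?case using bruhat_step_S_left [OF step(2) assms(2)] bruhat_step_le bruhat_le_trans by metis
qed (use assms in simp)

lemma bruhat_S_lower: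
  assumes "bruhat_le u v" "s \<in> S"
  shows "bruhat_le u (s \<otimes> v) \<or> bruhat_le (s \<otimes> u) (s \<otimes> v)"
  using assms(1)
proof (induction rule: bruhat_le_converse_induct)
  case (step u v w)
  then show ?case using bruhat_step_S_left [OF step(1) assms(2)] bruhat_step_le bruhat_le_trans
    by (metis S_cancel assms(2) bruhat_step_closed)
qed (use assms in simp)

lemma bruhat_lift:
  assumes "bruhat_le u v" "s \<in> S" "len (s \<otimes> v) < len v"
  shows "bruhat_le (s \<otimes> u) v"
proof -
  have "v \<in> carrier W" using assms bruhat_leD by blast
  then have "bruhat_le (s \<otimes> v) v" using bruhat_lt_S_left_iff(2) [OF assms(2)] assms(3) bruhat_ltD by blast
  then show ?thesis using bruhat_S_upper [OF assms(1,2)] bruhat_le_trans by blast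
qed

lemma bruhat_le_inv:
  assumes "bruhat_le u v" shows "bruhat_le (inv u) (inv v)"
  using assms
proof (induction rule: bruhat_le_induct)
  case (step u v w)
  then obtain t where t: "t \<in> reflections" "w = v \<otimes> t" "v \<in> carrier W" "len v < len w"
    by (auto simp: bruhat_step_def)
  have tc: "t \<in> carrier W" using t reflections_closed by blast
  have "inv w = t \<otimes> inv v" using t tc by (simp add: inv_mult_group reflection_inv)
  then have "bruhat_step (inv v) (inv w)"
    using t tc bruhat_step_left [OF t(1), of "inv v"] by (metis inv_closed len_inv m_closed)
  then show ?case using step bruhat_step_le bruhat_le_trans by blast
qed simp

lemma bruhat_S_lower_right:
  assumes "bruhat_le u v" "s \<in> S"
  shows "bruhat_le u (v \<otimes> s) \<or> bruhat_le (u \<otimes> s) (v \<otimes> s)"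
proof -
  have c: "u \<in> carrier W" "v \<in> carrier W" using assms bruhat_leD by auto
  show ?thesis using bruhat_S_lower [OF bruhat_le_inv [OF assms(1)] assms(2)] c assms(2)
      bruhat_le_inv [of "inv u" "s \<otimes> inv v"] bruhat_le_inv [of "s \<otimes> inv u" "s \<otimes> inv v"]
    by (auto simp: inv_mult_group)
qed

lemma bruhat_lift_right:
  assumes "bruhat_le u v" "s \<in> S" "len (v \<otimes> s) < len v"
  shows "bruhat_le (u \<otimes> s) v"
proof -
  have c: "u \<in> carrier W" "v \<in> carrier W" using assms bruhat_leD by auto
  have e: "s \<otimes> inv v = inv (v \<otimes> s)" "s \<otimes> inv u = inv (u \<otimes> s)" using c assms(2) by (simp_all add: inv_mult_group)
  have "bruhat_le (inv (u \<otimes> s)) (inv v)"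
    using bruhat_lift [OF bruhat_le_inv [OF assms(1)] assms(2)] assms c unfolding e by simp
  then show ?thesis using bruhat_le_inv c assms(2) by fastforce
qed

lemma ex_left_descent:
  assumes "w \<in> carrier W" "w \<noteq> \<one>" shows "\<exists>s\<in>S. len (s \<otimes> w) < len w"
proof -
  obtain ws where ws: "reduced ws w" using ex_reduced assms by blast
  then obtain s x where "ws = s # x" using assms(2) by (cases ws) (auto simp: reduced_def)
  then show ?thesis using reduced_ConsD ws by blast
qed

lemma ex_right_descent:
  assumes "w \<in> carrier W" "w \<noteq> \<one>" shows "\<exists>s\<in>S. len (w \<otimes> s) < len w"
proof -
  obtain s where s: "s \<in> S" "len (s \<otimes> inv w) < len (inv w)"
    using ex_left_descent [of "inv w"] assms by (metis inv_closed inv_inv inv_one)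
  have "s \<otimes> inv w = inv (w \<otimes> s)" using s assms by (simp add: inv_mult_group)
  then show ?thesis using s assms by auto
qed

text \<open>The order is generated by reflections of arbitrary length, so finiteness is not
  immediate. By lifting, the interval below \<open>w\<close> is contained in
  \<open>B \<union> s B\<close>, where \<open>B\<close> is the interval below the shorter element
  \<open>s w\<close>.\<close>

lemma finite_bruhat_lower: "finite {y. bruhat_le y w}"
proof (induction "len w" arbitrary: w rule: less_induct)
  case less
  show ?case
  proof (cases "w \<in> carrier W \<and> w \<noteq> \<one>")
    case True
    then obtain s where s: "s \<in> S" "len (s \<otimes> w) < len w" using ex_left_descent by blast
    let ?B = "{y. bruhat_le y (s \<otimes> w)}"
    have "{y. bruhat_le y w} \<subseteq> ?B \<union> (\<lambda>y. s \<otimes> y) ` ?B"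
    proof
      fix y assume "y \<in> {y. bruhat_le y w}"
      then have y: "bruhat_le y w" "y \<in> carrier W" using bruhat_leD by auto
      have "y = s \<otimes> (s \<otimes> y)" using s y by simp
      then show "y \<in> ?B \<union> (\<lambda>y. s \<otimes> y) ` ?B" using bruhat_S_lower [OF y(1) s(1)] by auto
    qed
    then show ?thesis using less [OF s(2)] finite_subset by blast
  next
    case False
    have "{y. bruhat_le y w} \<subseteq> {w}" using False bruhat_le_len bruhat_leD by fastforce
    then show ?thesis using finite_subset by blast
  qed
qed

lemma finite_bruhat_lt: "finite {y \<in> A. bruhat_lt y w}"
  by (rule finite_subset [OF _ finite_bruhat_lower [of w]]) (auto simp: bruhat_lt_def)

subsection \<open>Parabolic subgroups\<close>

lemma parabolic_word:
  assumes "J \<subseteq> S" "u \<in> generate W J"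
  shows "\<exists>us\<in>lists J. word_prod W us = u"
  using assms(2)
proof induction
  case one
  show ?case by (rule bexI [of _ "[]"]) auto
next
  case (incl h)
  then show ?case using assms(1) by (intro bexI [of _ "[h]"]) auto
next
  case (inv h)
  then have "h \<in> S" using assms(1) by blast
  then show ?case using inv by (intro bexI [of _ "[h]"]) auto
next
  case (eng h1 h2)
  then obtain xs ys where xy: "xs \<in> lists J" "word_prod W xs = h1" "ys \<in> lists J" "word_prod W ys = h2"
    by auto
  moreover have "xs \<in> lists S" "ys \<in> lists S" using xy assms(1) lists_mono by blast+
  ultimately show ?case by (intro bexI [of _ "xs @ ys"]) (auto simp: word_prod_append)
qed

lemma word_prod_parabolic: "us \<in> lists J \<Longrightarrow> word_prod W us \<in> generate W J"
  by (induction us) (auto intro: generate.intros)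

lemma parabolic_closed: "J \<subseteq> S \<Longrightarrow> u \<in> generate W J \<Longrightarrow> u \<in> carrier W"
  using generate_in_carrier [of J u] S_carrier by blast

lemma parabolic_inv: "J \<subseteq> S \<Longrightarrow> u \<in> generate W J \<Longrightarrow> inv u \<in> generate W J"
  using generate_m_inv_closed [of J u] S_carrier by blast

text \<open>Here \<open>us\<close> is shortest only among the words over \<open>J\<close>. The case
  of trivial \<open>d\<close> shows afterwards that such a word is also reduced in the whole group,
  which is how lengths in the parabolic subgroup and in \<open>W\<close> are reconciled.\<close>

lemma len_minimal_mult:
  assumes J: "J \<subseteq> S" and d: "d \<in> carrier W" "\<And>x. x \<in> generate W J \<Longrightarrow> len d \<le> len (d \<otimes> x)"
    and "us \<in> lists J" "\<And>vs. vs \<in> lists J \<Longrightarrow> word_prod W vs = word_prod W us \<Longrightarrow> length us \<le> length vs"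
  shows "len (d \<otimes> word_prod W us) = len d + length us"
  using assms(4,5)
proof (induction us rule: rev_induct)
  case (snoc s us)
  have s: "s \<in> J" "s \<in> S" "us \<in> lists J" "us \<in> lists S" using snoc.prems J by auto
  have pr: "word_prod W (us @ [s]) = word_prod W us \<otimes> s" using s by (simp add: word_prod_append)
  have "length us \<le> length vs" if vs: "vs \<in> lists J" "word_prod W vs = word_prod W us" for vs
  proof -
    have "vs \<in> lists S" using vs J by auto
    then have "word_prod W (vs @ [s]) = word_prod W (us @ [s])" using vs s by (simp add: word_prod_append)
    then show ?thesis using snoc.prems(2) [of "vs @ [s]"] vs s by simp
  qed
  then have IH: "len (d \<otimes> word_prod W us) = len d + length us" using snoc.IH s by blast
  have e: "d \<otimes> word_prod W (us @ [s]) = d \<otimes> word_prod W us \<otimes> s" using pr s d by (simp add: m_assoc)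
  have "\<not> len (d \<otimes> word_prod W us \<otimes> s) < len (d \<otimes> word_prod W us)"
  proof
    assume less: "len (d \<otimes> word_prod W us \<otimes> s) < len (d \<otimes> word_prod W us)"
    obtain ds where ds: "reduced ds d" using ex_reduced d by blast
    note dsD = reducedD [OF ds]
    have pp: "word_prod W (ds @ us) = d \<otimes> word_prod W us" using dsD s by (simp add: word_prod_append)
    have "ds @ us \<in> lists S" using dsD s by simp
    from strong_exchange [OF this S_reflection [OF s(2)]] less
    obtain as r bs where x: "ds @ us = as @ r # bs" "d \<otimes> word_prod W us \<otimes> s = word_prod W (as @ bs)"
      unfolding pp by blast
    \<comment> \<open>A letter deleted from \<open>us\<close> leaves a shorter word over
      \<open>J\<close> for \<open>us s\<close>. A letter deleted from the word of \<open>d\<close>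
      shows that \<open>d\<close> times a conjugate of \<open>s\<close> inside the parabolic
      subgroup is shorter than \<open>d\<close>.\<close>
    from x(1) consider cs where "as = ds @ cs" "us = cs @ r # bs" | cs where "ds = as @ r # cs" "bs = cs @ us"
      by (auto simp: append_eq_append_conv2 append_eq_Cons_conv Cons_eq_append_conv)
    then show False
    proof cases
      case 1
      have csbs: "cs @ bs \<in> lists J" "cs @ bs \<in> lists S" using 1 s by auto
      have "d \<otimes> (word_prod W us \<otimes> s) = d \<otimes> word_prod W (cs @ bs)"
        using x(2) 1 csbs dsD s d by (simp add: word_prod_append m_assoc)
      then have "word_prod W (cs @ bs) = word_prod W (us @ [s])" using pr d s csbs by simp
      then show False using snoc.prems(2) [OF csbs(1)] 1 by simp
    next
      case 2
      have acs: "as @ cs \<in> lists S" using dsD 2 by auto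
      let ?U = "word_prod W us"
      have "d \<otimes> ?U \<otimes> s = word_prod W (as @ cs) \<otimes> ?U" using x(2) 2 acs s by (simp add: word_prod_append m_assoc)
      then have "d \<otimes> ?U \<otimes> s \<otimes> inv ?U = word_prod W (as @ cs) \<otimes> ?U \<otimes> inv ?U" by simp
      then have "d \<otimes> (?U \<otimes> s \<otimes> inv ?U) = word_prod W (as @ cs)" using acs s d by (simp add: m_assoc)
      moreover have "?U \<otimes> s \<otimes> inv ?U \<in> generate W J"
        using s J parabolic_inv word_prod_parabolic by (metis generate.incl generate.eng)
      ultimately have "len d \<le> length (as @ cs)" using d(2) len_le [OF acs] by fastforce
      then show False using dsD 2 by simp
    qed
  qed
  then show ?case using e IH len_mult_S [of s "d \<otimes> word_prod W us"] s d by auto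
qed (use assms in simp)

lemma parabolic_minimal_word:
  assumes "J \<subseteq> S" "u \<in> generate W J"
  obtains us where "us \<in> lists J" "word_prod W us = u"
    "\<And>vs. vs \<in> lists J \<Longrightarrow> word_prod W vs = u \<Longrightarrow> length us \<le> length vs"
proof -
  let ?P = "\<lambda>us. us \<in> lists J \<and> word_prod W us = u"
  have "\<exists>us. ?P us" using parabolic_word [OF assms] by blast
  then have "?P (ARG_MIN length us. ?P us) \<and> (\<forall>vs. ?P vs \<longrightarrow> length (ARG_MIN length us. ?P us) \<le> length vs)"
    using arg_min_nat_lemma [of ?P _ length] by blast
  then show thesis using that by blast
qed

lemma parabolic_reduced:
  assumes "J \<subseteq> S" "u \<in> generate W J"
  obtains us where "us \<in> lists J" "reduced us u"
proof -
  obtain us where us: "us \<in> lists J" "word_prod W us = u"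
    "\<And>vs. vs \<in> lists J \<Longrightarrow> word_prod W vs = u \<Longrightarrow> length us \<le> length vs"
    by (rule parabolic_minimal_word [OF assms]) blast
  have "us \<in> lists S" using us assms(1) by auto
  then have "reduced us u"
    using len_minimal_mult [OF assms(1), of \<one> us] us(2,3) us(1) parabolic_closed [OF assms]
    by (simp add: reduced_def)
  then show thesis using that us by blast
qed

lemma len_minimal_mult':
  assumes J: "J \<subseteq> S" and d: "d \<in> carrier W" "\<And>x. x \<in> generate W J \<Longrightarrow> len d \<le> len (d \<otimes> x)"
    and u: "u \<in> generate W J"
  shows "len (d \<otimes> u) = len d + len u"
proof -
  obtain us where us: "us \<in> lists J" "word_prod W us = u"
    "\<And>vs. vs \<in> lists J \<Longrightarrow> word_prod W vs = u \<Longrightarrow> length us \<le> length vs"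
    by (rule parabolic_minimal_word [OF J u]) blast
  have "len (d \<otimes> u) = len d + length us" using len_minimal_mult [OF J d, of us] us by blast
  moreover have "us \<in> lists S" using us J by auto
  then have "len u = length us" using len_minimal_mult [OF J, of \<one> us] us(2,3) us(1) parabolic_closed [OF J u] by simp
  ultimately show ?thesis by simp
qed

lemma min_reps_closed: "w \<in> min_reps J \<Longrightarrow> w \<in> carrier W"
  by (simp add: min_reps_def)

lemma ex_minimal_coset:
  assumes J: "J \<subseteq> S" and w: "w \<in> carrier W"
  shows "\<exists>d\<in>carrier W. \<exists>u\<in>generate W J. w = d \<otimes> u \<and> (\<forall>x\<in>generate W J. len d \<le> len (d \<otimes> x))"
proof -
  let ?P = "\<lambda>d. d \<in> carrier W \<and> (\<exists>u\<in>generate W J. w = d \<otimes> u)"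
  have "?P w" using w generate.one by force
  then have P: "?P (ARG_MIN len d. ?P d)" and min: "\<And>y. ?P y \<Longrightarrow> len (ARG_MIN len d. ?P d) \<le> len y"
    using arg_min_nat_lemma [of ?P w len] by blast+
  let ?d = "ARG_MIN len d. ?P d"
  obtain u where u: "u \<in> generate W J" "w = ?d \<otimes> u" "?d \<in> carrier W" using P by blast
  have "len ?d \<le> len (?d \<otimes> x)" if x: "x \<in> generate W J" for x
  proof (rule min)
    have c: "x \<in> carrier W" "u \<in> carrier W" using x u J parabolic_closed by auto
    have "w = (?d \<otimes> x) \<otimes> (inv x \<otimes> u)" using u(2,3) c by (simp add: m_assoc)
    moreover have "inv x \<otimes> u \<in> generate W J" using x u J parabolic_inv generate.eng by metis
    ultimately show "?P (?d \<otimes> x)" using u(3) c by blast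
  qed
  then show ?thesis using u by blast
qed

text \<open>Membership in \<open>min_reps J\<close> speaks only of single generators in
  \<open>J\<close>. Write \<open>w = d u\<close> with \<open>d\<close> shortest in the coset; a last
  letter of a reduced word of \<open>u\<close> would be a right descent of \<open>w\<close> in
  \<open>J\<close>.\<close>

lemma min_reps_minimal:
  assumes J: "J \<subseteq> S" and w: "w \<in> min_reps J" and x: "x \<in> generate W J"
  shows "len w \<le> len (w \<otimes> x)"
proof -
  obtain d u where d: "d \<in> carrier W" "u \<in> generate W J" "w = d \<otimes> u"
    "\<And>x. x \<in> generate W J \<Longrightarrow> len d \<le> len (d \<otimes> x)"
    using ex_minimal_coset [OF J min_reps_closed [OF w]] by blast
  obtain us where us: "us \<in> lists J" "reduced us u" using parabolic_reduced [OF J d(2)] .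
  have "us = []"
  proof (rule ccontr)
    assume "us \<noteq> []"
    then obtain cs s where cs: "us = cs @ [s]" by (metis rev_exhaust)
    note rs = reduced_snocD [OF us(2) [unfolded cs]]
    have s: "s \<in> J" using us cs by auto
    have c: "u \<in> carrier W" using d J parabolic_closed by blast
    have "u \<otimes> s \<in> generate W J" using d s generate.eng generate.incl by metis
    then have "len (d \<otimes> (u \<otimes> s)) = len d + len (u \<otimes> s)" using len_minimal_mult' [OF J d(1,4)] by blast
    moreover have "len w = len d + len u" using len_minimal_mult' [OF J d(1,4,2)] d(3) by simp
    moreover have "w \<otimes> s = d \<otimes> (u \<otimes> s)" using d c rs(1) by (simp add: m_assoc)
    ultimately have "len (w \<otimes> s) < len w" using rs(3) by simp
    then show False using w s by (auto simp: min_reps_def)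
  qed
  then have "w = d" using us d by (auto simp: reduced_def)
  then show ?thesis using d(4) x by blast
qed

lemma len_min_reps_mult:
  assumes "J \<subseteq> S" "w \<in> min_reps J" "u \<in> generate W J"
  shows "len (w \<otimes> u) = len w + len u"
  using len_minimal_mult' [OF assms(1) min_reps_closed [OF assms(2)] _ assms(3)] min_reps_minimal [OF assms(1,2)] by blast

lemma ex_min_reps:
  assumes J: "J \<subseteq> S" and w: "w \<in> carrier W"
  shows "\<exists>d\<in>min_reps J. \<exists>u\<in>generate W J. w = d \<otimes> u"
proof -
  obtain d u where d: "d \<in> carrier W" "u \<in> generate W J" "w = d \<otimes> u"
    "\<And>x. x \<in> generate W J \<Longrightarrow> len d \<le> len (d \<otimes> x)"
    using ex_minimal_coset [OF J w] by blast
  have "len d < len (d \<otimes> s)" if s: "s \<in> J" for s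
    using d(4) [OF generate.incl [OF s]] len_mult_S [of s d] d(1) s J by auto
  then have "d \<in> min_reps J" using d by (simp add: min_reps_def)
  then show ?thesis using d by blast
qed

lemma min_reps_unique:
  assumes J: "J \<subseteq> S" and d: "d \<in> min_reps J" "d' \<in> min_reps J" and u: "u \<in> generate W J" "u' \<in> generate W J"
    and eq: "d \<otimes> u = d' \<otimes> u'"
  shows "d = d'" "u = u'"
proof -
  have c: "d \<in> carrier W" "d' \<in> carrier W" "u \<in> carrier W" "u' \<in> carrier W"
    using d u min_reps_closed parabolic_closed [OF J] by auto
  let ?x = "u \<otimes> inv u'"
  have x: "?x \<in> generate W J" "inv ?x \<in> generate W J" using u J parabolic_inv generate.eng by metis+
  have "d' = d \<otimes> u \<otimes> inv u'" using eq c by (simp add: m_assoc)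
  then have d': "d' = d \<otimes> ?x" using c by (simp add: m_assoc)
  then have dd: "d = d' \<otimes> inv ?x" using c by (simp add: m_assoc inv_mult_group)
  have "len d' = len d + len ?x" using len_min_reps_mult [OF J d(1) x(1)] d' by simp
  moreover have "len d = len d' + len (inv ?x)" using len_min_reps_mult [OF J d(2) x(2)] dd by simp
  ultimately have "len ?x = 0" by simp
  then have "?x = \<one>" using len_eq_0 c by simp
  then show "d = d'" using d' c by simp
  then show "u = u'" using eq c by simp
qed

text \<open>Deodhar's lemma: outside \<open>min_reps J\<close> some \<open>r\<close> in
  \<open>J\<close> is a right descent of \<open>s w\<close> although it is none of \<open>w\<close>,
  and the exchange condition leaves only this possibility.\<close>

lemma min_reps_S_mult:
  assumes J: "J \<subseteq> S" and w: "w \<in> min_reps J" and s: "s \<in> S" and "s \<otimes> w \<notin> min_reps J"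
  shows "\<exists>r\<in>J. s \<otimes> w = w \<otimes> r"
proof -
  have wc: "w \<in> carrier W" using w min_reps_closed by blast
  obtain r where r: "r \<in> J" "\<not> len (s \<otimes> w) < len (s \<otimes> w \<otimes> r)"
    using assms(4) s wc by (auto simp: min_reps_def)
  then have rS: "r \<in> S" using J by blast
  have "len (s \<otimes> w \<otimes> r) < len (s \<otimes> w)" using len_mult_S [OF rS, of "s \<otimes> w"] r(2) s wc by auto
  moreover have "len w < len (w \<otimes> r)" using w r by (simp add: min_reps_def)
  ultimately show ?thesis using exchange_sides [OF wc s rS] r by blast
qed

lemma min_reps_suffix:
  assumes J: "J \<subseteq> S" and w: "w \<in> min_reps J" and s: "s \<in> S" and "len (s \<otimes> w) < len w"
  shows "s \<otimes> w \<in> min_reps J"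
  using min_reps_S_mult [OF J w s] assms(4) w by (fastforce simp: min_reps_def)

lemma bruhat_le_mult_parabolic:
  assumes J: "J \<subseteq> S" and d: "d \<in> min_reps J" and u: "u \<in> generate W J"
  shows "bruhat_le d (d \<otimes> u)"
proof -
  obtain us where us: "us \<in> lists J" "reduced us u" using parabolic_reduced [OF J u] .
  have dc: "d \<in> carrier W" using d min_reps_closed by blast
  show ?thesis using us
  proof (induction us arbitrary: u rule: rev_induct)
    case Nil
    then show ?case using dc by (auto simp: reduced_def)
  next
    case (snoc s us)
    note rs = reduced_snocD [OF snoc.prems(2)]
    have s: "s \<in> J" using snoc.prems by auto
    have uc: "u \<in> carrier W" using reducedD snoc.prems by blast
    have g: "u \<in> generate W J" "u \<otimes> s \<in> generate W J"
      using word_prod_parabolic [of "us @ [s]" J] word_prod_parabolic [of us J] snoc.prems reducedD(2) rs(2) by auto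
    have "len (d \<otimes> (u \<otimes> s)) < len (d \<otimes> u)"
      using rs(3) len_min_reps_mult [OF J d g(1)] len_min_reps_mult [OF J d g(2)] by simp
    then have "bruhat_le (d \<otimes> (u \<otimes> s)) (d \<otimes> (u \<otimes> s) \<otimes> s)"
      using rs(1) uc dc by (intro bruhat_le_S_right) (auto simp: m_assoc)
    then have "bruhat_le (d \<otimes> (u \<otimes> s)) (d \<otimes> u)" using rs(1) uc dc by (simp add: m_assoc)
    moreover have "bruhat_le d (d \<otimes> (u \<otimes> s))" using snoc.IH rs(2) snoc.prems by simp
    ultimately show ?case using bruhat_le_trans by blast
  qed
qed

text \<open>Projection to minimal coset representatives is monotone. Lifting on the right strips the
  letters of \<open>u'\<close> one by one; each time \<open>u\<close> is kept or multiplied by a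
  generator in \<open>J\<close>, so the coset of \<open>d\<close> never changes.\<close>

lemma bruhat_le_min_reps:
  assumes J: "J \<subseteq> S" and d: "d \<in> min_reps J" "d' \<in> min_reps J" and u: "u \<in> generate W J" "u' \<in> generate W J"
    and "bruhat_le (d \<otimes> u) (d' \<otimes> u')"
  shows "bruhat_le d d'"
proof -
  have c: "d \<in> carrier W" "d' \<in> carrier W" using d min_reps_closed by auto
  obtain us where us: "us \<in> lists J" "reduced us u'" using parabolic_reduced [OF J u(2)] .
  show ?thesis using us u(1) assms(6)
  proof (induction us arbitrary: u u' rule: rev_induct)
    case Nil
    then have "u' = \<one>" by (auto simp: reduced_def)
    then show ?case using Nil bruhat_le_mult_parabolic [OF J d(1) Nil(3)] c bruhat_le_trans by auto
  next
    case (snoc s us)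
    note rs = reduced_snocD [OF snoc.prems(2)]
    have s: "s \<in> J" using snoc.prems by auto
    have uc: "u \<in> carrier W" "u' \<in> carrier W" using reducedD snoc.prems parabolic_closed J by blast+
    have us: "us \<in> lists J" using snoc.prems by auto
    have g: "u \<otimes> s \<in> generate W J" using snoc.prems(3) s generate.incl generate.eng by metis
    have "bruhat_le (d \<otimes> u) (d' \<otimes> (u' \<otimes> s)) \<or> bruhat_le (d \<otimes> (u \<otimes> s)) (d' \<otimes> (u' \<otimes> s))"
      using bruhat_S_lower_right [OF snoc.prems(4) rs(1)] uc c rs(1) by (simp add: m_assoc)
    then show ?case using snoc.IH [OF us rs(2) snoc.prems(3)] snoc.IH [OF us rs(2) g] by blast
  qed
qed

end

section \<open>The longest element of a finite parabolic subgroup\<close>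

locale coxeter_parabolic = coxeter_system W S for W :: "('w, 'x) monoid_scheme" (structure) and S +
  fixes J :: "'w set" and wJ :: 'w
  assumes J_S: "J \<subseteq> S" and fin_J: "finite (generate W J)"
    and wJ_max: "is_arg_max len (\<lambda>u. u \<in> generate W J) wJ"
begin

abbreviation "WJ \<equiv> generate W J"
abbreviation "DJ \<equiv> min_reps J"

lemma wJ_WJ: "wJ \<in> WJ"
  and len_wJ: "u \<in> WJ \<Longrightarrow> len u \<le> len wJ"
  using wJ_max by (auto simp: is_arg_max_def not_less)

lemma one_DJ [simp]: "\<one> \<in> DJ"
  using len_S J_S by (auto simp: min_reps_def)

lemma DJ_lt: "d \<in> DJ \<Longrightarrow> r \<in> J \<Longrightarrow> len d < len (d \<otimes> r)"
  by (simp add: min_reps_def)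

lemma WJ_closed [simp]: "u \<in> WJ \<Longrightarrow> u \<in> carrier W"
  using parabolic_closed J_S by blast

lemma DJ_closed [simp]: "d \<in> DJ \<Longrightarrow> d \<in> carrier W"
  by (rule min_reps_closed)

lemma wJ_closed [simp]: "wJ \<in> carrier W"
  using wJ_WJ by simp

lemma J_in_S [simp]: "r \<in> J \<Longrightarrow> r \<in> S"
  using J_S by blast

lemma WJ_mult_J [simp]: "u \<in> WJ \<Longrightarrow> r \<in> J \<Longrightarrow> u \<otimes> r \<in> WJ" "u \<in> WJ \<Longrightarrow> r \<in> J \<Longrightarrow> r \<otimes> u \<in> WJ"
  by (metis generate.incl generate.eng)+

lemma wJ_descents: "r \<in> J \<Longrightarrow> len (wJ \<otimes> r) < len wJ" "r \<in> J \<Longrightarrow> len (r \<otimes> wJ) < len wJ"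
  using len_wJ [of "wJ \<otimes> r"] len_wJ [of "r \<otimes> wJ"] wJ_WJ len_mult_S [of r wJ] len_S_mult [of r wJ] by auto

text \<open>If every generator in \<open>J\<close> is a right descent of \<open>u\<close>, then
  lifting puts every product of letters from \<open>J\<close> below \<open>u\<close>, in particular
  \<open>wJ\<close>.\<close>

lemma wJ_unique:
  assumes u: "u \<in> WJ" and "\<And>r. r \<in> J \<Longrightarrow> len (u \<otimes> r) < len u"
  shows "u = wJ"
proof -
  have "bruhat_le (word_prod W xs) u" if "xs \<in> lists J" for xs
    using that
  proof (induction xs rule: rev_induct)
    case Nil
    show ?case using bruhat_le_mult_parabolic [OF J_S _ u, of \<one>] u by simp
  next
    case (snoc r xs)
    have "xs \<in> lists S" using snoc.prems J_S by auto
    then show ?case using bruhat_lift_right [of "word_prod W xs" u r] assms(2) snoc by (simp add: word_prod_append)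
  qed
  then have "bruhat_le wJ u" using parabolic_word [OF J_S wJ_WJ] by auto
  then show ?thesis using bruhat_le_len len_wJ [OF u] by fastforce
qed

lemma len_DJ_mult: "d \<in> DJ \<Longrightarrow> u \<in> WJ \<Longrightarrow> len (d \<otimes> u) = len d + len u"
  using len_min_reps_mult J_S by blast

lemma DJ_wJ_iff:
  assumes "w \<in> carrier W"
  shows "(\<exists>d\<in>DJ. w = d \<otimes> wJ) \<longleftrightarrow> (\<forall>r\<in>J. len (w \<otimes> r) < len w)"
proof
  assume "\<exists>d\<in>DJ. w = d \<otimes> wJ"
  then obtain d where d: "d \<in> DJ" "w = d \<otimes> wJ" by blast
  show "\<forall>r\<in>J. len (w \<otimes> r) < len w"
    using d wJ_descents(1) wJ_WJ len_DJ_mult [OF d(1)] by (simp add: m_assoc)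
next
  assume r: "\<forall>r\<in>J. len (w \<otimes> r) < len w"
  obtain d u where d: "d \<in> DJ" "u \<in> WJ" "w = d \<otimes> u" using ex_min_reps [OF J_S assms] by blast
  have "len (u \<otimes> r) < len u" if "r \<in> J" for r
    using r that d len_DJ_mult [OF d(1)] by (fastforce simp: m_assoc)
  then show "\<exists>d\<in>DJ. w = d \<otimes> wJ" using wJ_unique d by blast
qed

text \<open>The last inequality of each case carries the point: in the third one \<open>s\<close>
  goes up at \<open>d\<close> but down at \<open>d wJ\<close>. So weak descents of \<open>d\<close>
  turn into honest left descents of \<open>d wJ\<close>, and \<open>Desc J d\<close> is the left
  descent set of \<open>d wJ\<close>.\<close>

lemma DJ_S_cases:
  assumes d: "d \<in> DJ" and s: "s \<in> S"
  obtains (up) "s \<otimes> d \<in> DJ" "len d < len (s \<otimes> d)" "len (d \<otimes> wJ) < len (s \<otimes> (d \<otimes> wJ))"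
  | (down) "s \<otimes> d \<in> DJ" "len (s \<otimes> d) < len d" "len (s \<otimes> (d \<otimes> wJ)) < len (d \<otimes> wJ)"
  | (fixed) r where "r \<in> J" "s \<otimes> d = d \<otimes> r" "s \<otimes> d \<notin> DJ" "len d < len (s \<otimes> d)"
      "len (s \<otimes> (d \<otimes> wJ)) < len (d \<otimes> wJ)"
proof (cases "s \<otimes> d \<in> DJ")
  case True
  have "len (s \<otimes> (d \<otimes> wJ)) = len (s \<otimes> d) + len wJ" "len (d \<otimes> wJ) = len d + len wJ"
    using len_DJ_mult [OF True wJ_WJ] len_DJ_mult [OF d wJ_WJ] d s by (simp_all add: m_assoc)
  then show thesis using that(1,2) True len_S_mult [OF s, of d] d by fastforce
next
  case False
  then obtain r where r: "r \<in> J" "s \<otimes> d = d \<otimes> r" using min_reps_S_mult [OF J_S d s] by blast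
  have "s \<otimes> (d \<otimes> wJ) = (s \<otimes> d) \<otimes> wJ" using d s by (simp add: m_assoc)
  also have "\<dots> = d \<otimes> (r \<otimes> wJ)" using d r(1) unfolding r(2) by (simp add: m_assoc)
  finally have "len (s \<otimes> (d \<otimes> wJ)) < len (d \<otimes> wJ)"
    using len_DJ_mult [OF d] wJ_WJ wJ_descents(2) [OF r(1)] r(1) by simp
  moreover have "len d < len (s \<otimes> d)" using DJ_lt [OF d r(1)] r(2) by simp
  ultimately show thesis using that(3) r False by blast
qed

end

section \<open>Laurent polynomials and free modules over them\<close>

abbreviation lk :: "('v \<Rightarrow>\<^sub>0 'c::zero) \<Rightarrow> 'v \<Rightarrow> 'c" where "lk \<equiv> Poly_Mapping.lookup"

lemma pm_induct [case_names single add]: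
  assumes "\<And>k a. P (Poly_Mapping.single k a)" "\<And>f g. P f \<Longrightarrow> P g \<Longrightarrow> P (f + g)"
  shows "P (f :: 'a \<Rightarrow>\<^sub>0 'b :: comm_monoid_add)"
proof (induction f rule: update_induct)
  case const
  show ?case using assms(1) [of undefined 0] by simp
next
  case (update f k v)
  have "Poly_Mapping.update k v f = Poly_Mapping.single k v + f"
    using update.hyps by (intro poly_mapping_eqI) (auto simp: lookup_update lookup_add lookup_single when_def in_keys_iff)
  then show ?case using assms update by simp
qed

lemma lookup_single_mult: "lk (Poly_Mapping.single i c * a) k = c * lk a (k - i)"
  for a :: "laurent"
proof (induction a rule: pm_induct)
  case (single j a)
  show ?case by (auto simp: mult_single lookup_single when_def)
qed (simp add: algebra_simps lookup_add)

lemma lookup_qv_mult: "lk (qv * a) k = lk a (k - 1)"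
  by (simp add: qv_def lookup_single_mult)

lemma lookup_qinv_mult: "lk (qinv * a) k = lk a (k + 1)"
  by (simp add: qinv_def lookup_single_mult)

lemma qv_qinv [simp]: "qv * qinv = 1" "qinv * qv = 1" "qv * (qinv * a) = a" "qinv * (qv * a) = a"
  by (simp_all add: qv_def qinv_def mult_single flip: mult.assoc)

lemma lookup_lbar: "lk (lbar a) k = lk a (- k)"
  by (simp add: lbar_def map_key.rep_eq)

lemma lbar_zero [simp]: "lbar 0 = 0"
  and lbar_add: "lbar (a + b) = lbar a + lbar b"
  and lbar_minus: "lbar (- a) = - lbar a"
  and lbar_diff: "lbar (a - b) = lbar a - lbar b"
  and lbar_single: "lbar (Poly_Mapping.single k c) = Poly_Mapping.single (- k) c"
  and lbar_lbar [simp]: "lbar (lbar a) = a"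
  by (auto intro!: poly_mapping_eqI simp: lookup_lbar lookup_add lookup_minus lookup_single when_def)

lemma lbar_one [simp]: "lbar 1 = 1"
  using lbar_single [of 0 1] by simp

lemma lbar_qv [simp]: "lbar qv = qinv" and lbar_qinv [simp]: "lbar qinv = qv"
  by (simp_all add: qv_def qinv_def lbar_single)

lemma lbar_mult: "lbar (a * b) = lbar a * lbar b"
proof (induction a rule: pm_induct)
  case (single i c)
  show ?case
  proof (induction b rule: pm_induct)
    case (single j d)
    show ?case by (simp add: mult_single lbar_single)
  qed (simp add: algebra_simps lbar_add)
qed (simp add: algebra_simps lbar_add)

lemma Aplus_iff: "a \<in> Aplus \<longleftrightarrow> (\<forall>k<0. lk a k = 0)"
  unfolding Aplus_def by (auto simp: in_keys_iff subset_iff) (metis linorder_not_less)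

abbreviation (input) QA :: "laurent set" where "QA \<equiv> (*) qv ` Aplus"

lemma QA_iff: "a \<in> QA \<longleftrightarrow> (\<forall>k\<le>0. lk a k = 0)"
proof
  assume "\<forall>k\<le>0. lk a k = 0"
  then have "qinv * a \<in> Aplus" by (simp add: Aplus_iff lookup_qinv_mult)
  moreover have "a = qv * (qinv * a)" by simp
  ultimately show "a \<in> QA" by blast
qed (auto simp: Aplus_iff lookup_qv_mult)

lemma QA_qinv: "a \<in> QA \<Longrightarrow> qinv * a \<in> Aplus"
  by auto

lemma Aplus_zero [simp]: "0 \<in> Aplus"
  and QA_zero: "0 \<in> QA"
  and QA_add: "a \<in> QA \<Longrightarrow> b \<in> QA \<Longrightarrow> a + b \<in> QA"
  and QA_diff: "a \<in> QA \<Longrightarrow> b \<in> QA \<Longrightarrow> a - b \<in> QA"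
  and QA_minus: "a \<in> QA \<Longrightarrow> - a \<in> QA"
  unfolding QA_iff Aplus_iff by (simp_all add: lookup_add lookup_minus)

lemma QA_qv: "qv \<in> QA"
  unfolding QA_iff by (auto simp: qv_def lookup_single when_def)

lemma QA_sum: "(\<And>i. i \<in> A \<Longrightarrow> f i \<in> QA) \<Longrightarrow> sum f A \<in> QA"
proof (induction A rule: infinite_finite_induct)
  case (insert x F)
  then show ?case using QA_add [of "f x" "sum f F"] by simp
qed (use QA_zero in auto)

lemma Aplus_mult: "a \<in> Aplus \<Longrightarrow> b \<in> Aplus \<Longrightarrow> a * b \<in> Aplus"
  unfolding Aplus_def using keys_mult [of a b] by fastforce

text \<open>A product of two elements of \<open>q A+\<close> starts in degree two. This is why the
  coefficient of q behaves additively when unitriangular matrices are inverted.\<close>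

lemma QA_mult: "a \<in> QA \<Longrightarrow> b \<in> QA \<Longrightarrow> a * b \<in> QA"
  and QA_mult_lookup: "a \<in> QA \<Longrightarrow> b \<in> QA \<Longrightarrow> lk (a * b) 1 = 0"
proof -
  assume "a \<in> QA" "b \<in> QA"
  then obtain a' b' where ab: "a = qv * a'" "a' \<in> Aplus" "b = qv * b'" "b' \<in> Aplus" by blast
  have eq: "a * b = qv * (qv * (a' * b'))" by (simp add: ab algebra_simps)
  have "a' * b' \<in> Aplus" using ab Aplus_mult by blast
  then show "a * b \<in> QA" "lk (a * b) 1 = 0"
    unfolding eq QA_iff by (auto simp: lookup_qv_mult Aplus_iff)
qed

text \<open>The bar exchanges the degrees k and -k, and one of the two is not positive.\<close>

lemma QA_bar_invariant: "a \<in> QA \<Longrightarrow> lbar a = a \<Longrightarrow> a = 0"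
proof (rule poly_mapping_eqI)
  fix k
  assume a: "a \<in> QA" "lbar a = a"
  have "lk a k = lk a (- k)" using a(2) lookup_lbar by metis
  moreover have "k \<le> 0 \<or> - k \<le> 0" by auto
  ultimately show "lk a k = lk 0 k" using a(1) unfolding QA_iff by fastforce
qed

section \<open>Free modules, linear and semilinear maps\<close>

definition EE :: "'v set \<Rightarrow> ('v \<Rightarrow>\<^sub>0 laurent) set" where
  "EE A = {f. Poly_Mapping.keys f \<subseteq> A}"

definition bvec :: "'v \<Rightarrow> ('v \<Rightarrow>\<^sub>0 laurent)" where
  "bvec w = Poly_Mapping.single w 1"

definition smul :: "laurent \<Rightarrow> ('v \<Rightarrow>\<^sub>0 laurent) \<Rightarrow> ('v \<Rightarrow>\<^sub>0 laurent)" where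
  "smul a f = Poly_Mapping.map ((*) a) f"

definition lin :: "('v \<Rightarrow> ('w \<Rightarrow>\<^sub>0 laurent)) \<Rightarrow> ('v \<Rightarrow>\<^sub>0 laurent) \<Rightarrow> ('w \<Rightarrow>\<^sub>0 laurent)" where
  "lin g f = (\<Sum>w\<in>Poly_Mapping.keys f. smul (lk f w) (g w))"

definition bmap :: "('v \<Rightarrow>\<^sub>0 laurent) \<Rightarrow> ('v \<Rightarrow>\<^sub>0 laurent)" where
  "bmap f = Poly_Mapping.map lbar f"

definition restr :: "'v set \<Rightarrow> ('v \<Rightarrow>\<^sub>0 laurent) \<Rightarrow> ('v \<Rightarrow>\<^sub>0 laurent)" where
  "restr A f = lin (\<lambda>w. if w \<in> A then bvec w else 0) f"

lemma lookup_smul [simp]: "lk (smul a f) k = a * lk f k"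
  by (simp add: smul_def map.rep_eq when_def)

lemma lookup_bmap [simp]: "lk (bmap f) k = lbar (lk f k)"
  by (simp add: bmap_def map.rep_eq when_def)

lemma lookup_e: "lk (bvec w) k = (1 when w = k)"
  by (simp add: bvec_def lookup_single)

lemma EE_iff: "f \<in> EE A \<longleftrightarrow> (\<forall>k. k \<notin> A \<longrightarrow> lk f k = 0)"
  by (auto simp: EE_def in_keys_iff)

lemma EE_lookup: "f \<in> EE A \<Longrightarrow> k \<notin> A \<Longrightarrow> lk f k = 0"
  by (simp add: EE_iff)

lemma EE_zero [simp, intro]: "0 \<in> EE A"
  and EE_add [simp, intro]: "f \<in> EE A \<Longrightarrow> g \<in> EE A \<Longrightarrow> f + g \<in> EE A"
  and EE_diff [simp, intro]: "f \<in> EE A \<Longrightarrow> g \<in> EE A \<Longrightarrow> f - g \<in> EE A"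
  and EE_uminus [simp, intro]: "f \<in> EE A \<Longrightarrow> - f \<in> EE A"
  and EE_smul [simp, intro]: "f \<in> EE A \<Longrightarrow> smul a f \<in> EE A"
  and EE_bmap [simp, intro]: "f \<in> EE A \<Longrightarrow> bmap f \<in> EE A"
  and EE_e [simp, intro]: "w \<in> A \<Longrightarrow> bvec w \<in> EE A"
  and EE_single [simp, intro]: "w \<in> A \<Longrightarrow> Poly_Mapping.single w a \<in> EE A"
  by (auto simp: EE_iff lookup_add lookup_minus lookup_e lookup_single when_def)

lemma EE_sum [simp, intro]: "(\<And>i. i \<in> B \<Longrightarrow> f i \<in> EE A) \<Longrightarrow> sum f B \<in> EE A"
  by (induction B rule: infinite_finite_induct) auto

lemma EE_mono: "f \<in> EE A \<Longrightarrow> A \<subseteq> B \<Longrightarrow> f \<in> EE B"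
  by (auto simp: EE_def)

lemma smul_add: "smul a (f + g) = smul a f + smul a g"
  and smul_add_left: "smul (a + b) f = smul a f + smul b f"
  and smul_diff: "smul a (f - g) = smul a f - smul a g"
  and smul_diff_left: "smul (a - b) f = smul a f - smul b f"
  and smul_smul: "smul a (smul b f) = smul (a * b) f"
  and smul_one [simp]: "smul 1 f = f"
  and smul_zero [simp]: "smul a 0 = 0"
  and smul_zero_left [simp]: "smul 0 f = 0"
  and smul_minus_left: "smul (- a) f = - smul a f"
  by (auto intro!: poly_mapping_eqI simp: lookup_add lookup_minus algebra_simps)

lemma smul_sum: "smul a (sum f A) = (\<Sum>i\<in>A. smul a (f i))"
  by (induction A rule: infinite_finite_induct) (auto simp: smul_add)

lemma single_eq_smul: "Poly_Mapping.single w a = smul a (bvec w)"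
  by (intro poly_mapping_eqI) (auto simp: lookup_e lookup_single when_def)

lemma smul_single [simp]: "smul a (Poly_Mapping.single w b) = Poly_Mapping.single w (a * b)"
  by (intro poly_mapping_eqI) (auto simp: lookup_single when_def)

lemma EE_induct [consumes 1, case_names single zero add]:
  assumes "f \<in> EE A" "\<And>k a. k \<in> A \<Longrightarrow> P (Poly_Mapping.single k a)"
    "P 0" "\<And>f g. f \<in> EE A \<Longrightarrow> g \<in> EE A \<Longrightarrow> P f \<Longrightarrow> P g \<Longrightarrow> P (f + g)"
  shows "P f"
  using assms(1)
proof (induction f rule: update_induct)
  case const
  show ?case by (rule assms(3))
next
  case (update f k v)
  have eq: "Poly_Mapping.update k v f = Poly_Mapping.single k v + f"
    using update.hyps by (intro poly_mapping_eqI) (auto simp: lookup_update lookup_add lookup_single when_def in_keys_iff)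
  have "k \<in> A" using update by (auto simp: EE_iff lookup_update)
  moreover have "f \<in> EE A"
    using update.prems update.hyps by (auto simp: EE_iff lookup_update in_keys_iff) (metis update.prems EE_lookup lookup_update)
  ultimately show ?case unfolding eq using update assms by blast
qed

lemma pm_expand: "f = (\<Sum>w\<in>Poly_Mapping.keys f. smul (lk f w) (bvec w))"
proof (rule poly_mapping_eqI)
  fix k
  show "lk f k = lk (\<Sum>w\<in>Poly_Mapping.keys f. smul (lk f w) (bvec w)) k"
    unfolding lookup_sum lookup_smul lookup_e
    by (subst sum.cong [OF refl, of _ _ "\<lambda>w. if w = k then lk f w else 0"])
      (auto simp: in_keys_iff)
qed

lemma lin_superset:
  assumes "finite B" "Poly_Mapping.keys f \<subseteq> B"
  shows "lin g f = (\<Sum>w\<in>B. smul (lk f w) (g w))"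
  unfolding lin_def using assms by (intro sum.mono_neutral_left) (auto simp: in_keys_iff)

definition lmap :: "(('v \<Rightarrow>\<^sub>0 laurent) \<Rightarrow> ('w \<Rightarrow>\<^sub>0 laurent)) \<Rightarrow> bool" where
  "lmap \<phi> \<longleftrightarrow> (\<forall>f g. \<phi> (f + g) = \<phi> f + \<phi> g) \<and> (\<forall>a f. \<phi> (smul a f) = smul a (\<phi> f))"

definition smap :: "(('v \<Rightarrow>\<^sub>0 laurent) \<Rightarrow> ('w \<Rightarrow>\<^sub>0 laurent)) \<Rightarrow> bool" where
  "smap \<phi> \<longleftrightarrow> (\<forall>f g. \<phi> (f + g) = \<phi> f + \<phi> g) \<and> (\<forall>a f. \<phi> (smul a f) = smul (lbar a) (\<phi> f))"

lemma lin_add: "lin g (f + f') = lin g f + lin g f'"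
proof -
  let ?B = "Poly_Mapping.keys f \<union> Poly_Mapping.keys f'"
  have "lin g (f + f') = (\<Sum>w\<in>?B. smul (lk (f + f') w) (g w))"
    using keys_add [of f f'] by (intro lin_superset) auto
  then show ?thesis
    by (simp add: lookup_add smul_add_left sum.distrib lin_superset [of ?B f] lin_superset [of ?B f'])
qed

lemma lin_smul: "lin g (smul a f) = smul a (lin g f)"
proof -
  have "lin g (smul a f) = (\<Sum>w\<in>Poly_Mapping.keys f. smul (lk (smul a f) w) (g w))"
    by (intro lin_superset) (auto simp: in_keys_iff)
  then show ?thesis by (simp add: lin_def smul_sum smul_smul)
qed

lemma lmap_lin [simp]: "lmap (lin g)"
  by (simp add: lmap_def lin_add lin_smul)

lemma lin_e [simp]: "lin g (bvec w) = g w"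
  by (simp add: lin_def bvec_def)

lemma lin_single [simp]: "lin g (Poly_Mapping.single w a) = smul a (g w)"
  by (simp add: single_eq_smul lin_smul)

lemma lmap_add: "lmap \<phi> \<Longrightarrow> \<phi> (f + g) = \<phi> f + \<phi> g"
  and lmap_smul: "lmap \<phi> \<Longrightarrow> \<phi> (smul a f) = smul a (\<phi> f)"
  by (auto simp: lmap_def)

lemma lmap_zero: "lmap \<phi> \<Longrightarrow> \<phi> 0 = 0"
  using lmap_smul [of \<phi> 0 0] by simp

lemma lmap_minus: "lmap \<phi> \<Longrightarrow> \<phi> (- f) = - \<phi> f"
  using lmap_smul [of \<phi> "-1" f] by (simp add: smul_minus_left)

lemma lmap_diff: "lmap \<phi> \<Longrightarrow> \<phi> (f - g) = \<phi> f - \<phi> g"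
  using lmap_add [of \<phi> f "- g"] lmap_minus [of \<phi> g] by simp

lemma lmap_sum: "lmap \<phi> \<Longrightarrow> \<phi> (sum f A) = (\<Sum>i\<in>A. \<phi> (f i))"
  by (induction A rule: infinite_finite_induct) (auto simp: lmap_add lmap_zero)

lemma lmap_comp: "lmap \<phi> \<Longrightarrow> lmap \<psi> \<Longrightarrow> lmap (\<lambda>f. \<phi> (\<psi> f))"
  by (simp add: lmap_def)

lemma lmap_sub: "lmap \<phi> \<Longrightarrow> lmap \<psi> \<Longrightarrow> lmap (\<lambda>f. \<phi> f - \<psi> f)"
  and lmap_scale: "lmap \<phi> \<Longrightarrow> lmap (\<lambda>f. smul a (\<phi> f))"
  by (auto simp: lmap_def smul_add smul_diff smul_smul mult.commute)

lemma lmap_id: "lmap (\<lambda>f. f)"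
  by (simp add: lmap_def)

lemma lmap_lin_expand: "lmap \<phi> \<Longrightarrow> \<phi> (lin g f) = lin (\<lambda>w. \<phi> (g w)) f"
  by (simp add: lin_def lmap_sum lmap_smul)

lemma lmap_expand: "lmap \<phi> \<Longrightarrow> \<phi> f = lin (\<lambda>w. \<phi> (bvec w)) f"
proof -
  assume "lmap \<phi>"
  then have "\<phi> (\<Sum>w\<in>Poly_Mapping.keys f. smul (lk f w) (bvec w)) = lin (\<lambda>w. \<phi> (bvec w)) f"
    by (simp add: lin_def lmap_sum lmap_smul)
  then show ?thesis using pm_expand [of f] by metis
qed

lemma lin_cong: "f \<in> EE A \<Longrightarrow> (\<And>w. w \<in> A \<Longrightarrow> g w = h w) \<Longrightarrow> lin g f = lin h f"
  unfolding lin_def by (rule sum.cong) (auto simp: EE_def)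

lemma EE_lin: "f \<in> EE A \<Longrightarrow> (\<And>w. w \<in> A \<Longrightarrow> g w \<in> EE B) \<Longrightarrow> lin g f \<in> EE B"
  unfolding lin_def by (intro EE_sum EE_smul) (auto simp: EE_def)

lemma lin_lin: "lin g (lin h f) = lin (\<lambda>w. lin g (h w)) f"
  by (rule lmap_lin_expand) simp

lemma lin_id: "lin bvec f = f"
  using lmap_expand [OF lmap_id, of f] by simp

lemma lookup_lin: "lk (lin g f) y =
    (\<Sum>w\<in>Poly_Mapping.keys f. lk f w * lk (g w) y)"
  by (simp add: lin_def lookup_sum)

lemma bmap_add: "bmap (f + g) = bmap f + bmap g"
  and bmap_smul: "bmap (smul a f) = smul (lbar a) (bmap f)"
  and bmap_e [simp]: "bmap (bvec w) = bvec w"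
  and bmap_bmap [simp]: "bmap (bmap f) = f"
  by (auto intro!: poly_mapping_eqI simp: lookup_add lbar_add lbar_mult lookup_e when_def)

lemma smap_bmap [simp]: "smap bmap"
  by (simp add: smap_def bmap_add bmap_smul)

lemma smap_lmap: "smap \<phi> \<Longrightarrow> lmap (\<lambda>f. \<phi> (bmap f))"
  by (simp add: smap_def lmap_def bmap_add bmap_smul)

lemma lmap_smap: "lmap \<phi> \<Longrightarrow> smap \<psi> \<Longrightarrow> smap (\<lambda>f. \<phi> (\<psi> f))"
  by (simp add: smap_def lmap_def)

lemma smap_lmap': "smap \<psi> \<Longrightarrow> lmap \<phi> \<Longrightarrow> smap (\<lambda>f. \<psi> (\<phi> f))"
  by (simp add: smap_def lmap_def)

lemma smap_add: "smap \<phi> \<Longrightarrow> \<phi> (f + g) = \<phi> f + \<phi> g"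
  and smap_smul: "smap \<phi> \<Longrightarrow> \<phi> (smul a f) = smul (lbar a) (\<phi> f)"
  by (auto simp: smap_def)

lemma smap_zero: "smap \<phi> \<Longrightarrow> \<phi> 0 = 0"
  using smap_smul [of \<phi> 0 0] by simp

lemma smap_minus: "smap \<phi> \<Longrightarrow> \<phi> (- f) = - \<phi> f"
  using smap_smul [of \<phi> "-1" f] by (simp add: smul_minus_left lbar_minus)

lemma smap_diff: "smap \<phi> \<Longrightarrow> \<phi> (f - g) = \<phi> f - \<phi> g"
  using smap_add [of \<phi> f "- g"] smap_minus [of \<phi> g] by simp

lemma smap_expand: "smap \<phi> \<Longrightarrow> \<phi> f = lin (\<lambda>w. \<phi> (bvec w)) (bmap f)"
  using lmap_expand [OF smap_lmap, of \<phi> "bmap f"] by simp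

lemma smap_eqI:
  assumes "smap \<phi>" "smap \<psi>" "f \<in> EE A" "\<And>w. w \<in> A \<Longrightarrow> \<phi> (bvec w) = \<psi> (bvec w)"
  shows "\<phi> f = \<psi> f"
proof -
  have "lin (\<lambda>w. \<phi> (bvec w)) (bmap f) = lin (\<lambda>w. \<psi> (bvec w)) (bmap f)"
    using EE_bmap [OF assms(3)] assms(4) by (rule lin_cong)
  then show ?thesis using smap_expand [OF assms(1), of f] smap_expand [OF assms(2), of f] by simp
qed

lemma smap_lin:
  assumes "smap \<phi>" shows "\<phi> (lin g f) = lin (\<lambda>w. \<phi> (g w)) (bmap f)"
  using smap_expand [OF smap_lmap' [OF assms lmap_lin [of g]], of f] by simp

lemma lmap_restr [simp]: "lmap (restr A)"
  unfolding restr_def by simp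

lemma lookup_restr [simp]: "lk (restr A f) y = (if y \<in> A then lk f y else 0)"
proof (induction f rule: pm_induct)
  case (single k a)
  show ?case by (simp add: restr_def lookup_e lookup_single when_def)
qed (simp add: lmap_add [OF lmap_restr] lookup_add)

lemma restr_EE [simp, intro]: "f \<in> EE B \<Longrightarrow> restr A f \<in> EE (A \<inter> B)"
  by (auto simp: EE_iff)

lemma restr_id: "f \<in> EE A \<Longrightarrow> restr A f = f"
  by (intro poly_mapping_eqI) (auto simp: EE_iff)

lemma bmap_restr: "bmap (restr A f) = restr A (bmap f)"
  by (intro poly_mapping_eqI) auto

section \<open>Unitriangular families and their inverses\<close>

definition unitri :: "('v \<Rightarrow> 'v \<Rightarrow> bool) \<Rightarrow> 'v set \<Rightarrow> ('v \<Rightarrow> ('v \<Rightarrow>\<^sub>0 laurent)) \<Rightarrow> bool" where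
  "unitri R I v \<longleftrightarrow> (\<forall>w\<in>I. v w \<in> EE I \<and> lk (v w) w = 1 \<and>
     (\<forall>y. y \<noteq> w \<longrightarrow> lk (v w) y \<in> QA \<and> (lk (v w) y \<noteq> 0 \<longrightarrow> R y w)))"

text \<open>At an index of maximal level in the support only the diagonal entry can contribute, and
  nothing reaches a higher level. All leading term arguments of the proof rest on this.\<close>

lemma lin_coeff_max:
  fixes l :: "'v \<Rightarrow> nat"
  assumes tri: "\<And>w. w \<in> I \<Longrightarrow> lk (v w) w = 1 \<and>
      (\<forall>y. lk (v w) y \<noteq> 0 \<longrightarrow> y = w \<or> l y < l w)"
    and f: "f \<in> EE I" and w: "w \<in> Poly_Mapping.keys f" "\<And>y. y \<in> Poly_Mapping.keys f \<Longrightarrow> l y \<le> l w"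
  shows "lk (lin v f) w = lk f w"
    and "l w < l z \<Longrightarrow> lk (lin v f) z = 0"
proof -
  have "(\<Sum>y\<in>Poly_Mapping.keys f. lk f y * lk (v y) w) =
      (\<Sum>y\<in>{w}. lk f y * lk (v y) w)"
  proof (rule sum.mono_neutral_right)
    show "\<forall>i\<in>Poly_Mapping.keys f - {w}. lk f i * lk (v i) w = 0"
      using tri f w(2) by (fastforce simp: EE_def)
  qed (use w in auto)
  moreover have "w \<in> I" using w f by (auto simp: EE_def)
  ultimately show "lk (lin v f) w = lk f w" using tri by (simp add: lookup_lin)
  assume "l w < l z"
  then have "lk f y * lk (v y) z = 0" if "y \<in> Poly_Mapping.keys f" for y
    using tri [of y] f w(2) [OF that] that by (fastforce simp: EE_def)
  then show "lk (lin v f) z = 0" unfolding lookup_lin by (intro sum.neutral) blast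
qed

lemma ex_max_key:
  fixes l :: "'v \<Rightarrow> nat"
  assumes "f \<noteq> 0"
  obtains w where "w \<in> Poly_Mapping.keys f" "\<And>y. y \<in> Poly_Mapping.keys f \<Longrightarrow> l y \<le> l w"
proof -
  have "Max (l ` Poly_Mapping.keys f) \<in> l ` Poly_Mapping.keys f" using assms by (intro Max_in) simp_all
  then obtain w where w: "w \<in> Poly_Mapping.keys f" "l w = Max (l ` Poly_Mapping.keys f)" by force
  show thesis by (rule that [OF w(1)]) (simp add: w(2))
qed

lemma lin_triangular_inj:
  fixes l :: "'v \<Rightarrow> nat"
  assumes tri: "\<And>w. w \<in> I \<Longrightarrow> lk (v w) w = 1 \<and>
      (\<forall>y. lk (v w) y \<noteq> 0 \<longrightarrow> y = w \<or> l y < l w)"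
    and f: "f \<in> EE I" "g \<in> EE I" "lin v f = lin v g"
  shows "f = g"
proof (rule ccontr)
  assume "f \<noteq> g"
  then have "f - g \<noteq> 0" by simp
  then obtain w where w: "w \<in> Poly_Mapping.keys (f - g)" "\<And>y. y \<in> Poly_Mapping.keys (f - g) \<Longrightarrow> l y \<le> l w"
    using ex_max_key [of "f - g" l] by blast
  have "lk (lin v (f - g)) w = lk (f - g) w"
    using lin_coeff_max(1) [OF tri EE_diff [OF f(1,2)] w] by blast
  moreover have "lin v (f - g) = 0" using f(3) by (simp add: lmap_diff [OF lmap_lin])
  ultimately show False using w(1) by (simp add: in_keys_iff)
qed

lemma unitri_tri:
  assumes "unitri R I v" "\<And>x y. R x y \<Longrightarrow> (l x :: nat) < l y" "w \<in> I"
  shows "lk (v w) w = 1 \<and> (\<forall>y. lk (v w) y \<noteq> 0 \<longrightarrow> y = w \<or> l y < l w)"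
  using assms unfolding unitri_def by metis

text \<open>Column by column along the level. The last conclusion is what the W-graph coefficients
  need: to first order in q the inverse of the identity plus small entries is the identity minus
  these entries.\<close>

lemma unitri_inverse:
  fixes l :: "'v \<Rightarrow> nat"
  assumes v: "unitri R I v" and l: "\<And>x y. R x y \<Longrightarrow> l x < l y"
    and trans: "\<And>x y z. R x y \<Longrightarrow> R y z \<Longrightarrow> R x z"
  shows "\<exists>u. unitri R I u \<and> (\<forall>w\<in>I. lin v (u w) = bvec w \<and> lin u (v w) = bvec w) \<and>
    (\<forall>w\<in>I. \<forall>y. y \<noteq> w \<longrightarrow> lk (lk (u w) y) 1 =
       - lk (lk (v w) y) 1)"
proof -
  let ?good = "\<lambda>w u. u \<in> EE I \<and> lk u w = 1 \<and>
     (\<forall>y. y \<noteq> w \<longrightarrow> lk u y \<in> QA \<and> (lk u y \<noteq> 0 \<longrightarrow> R y w) \<and>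
       lk (lk u y) 1 = - lk (lk (v w) y) 1) \<and>
     lin v u = bvec w"
  have ex: "\<exists>u. ?good w u" if "w \<in> I" for w
    using that
  proof (induction "l w" arbitrary: w rule: less_induct)
    case less
    let ?K = "Poly_Mapping.keys (v w) - {w}" and ?c = "lk (v w)"
    have vw: "v w \<in> EE I" "?c w = 1" "\<And>y. y \<noteq> w \<Longrightarrow> ?c y \<in> QA" "\<And>y. y \<in> ?K \<Longrightarrow> R y w"
      using v less.prems by (auto simp: unitri_def in_keys_iff)
    have K: "y \<in> I" "l y < l w" if "y \<in> ?K" for y using vw that l by (auto simp: EE_def)
    have "\<forall>y\<in>?K. \<exists>u. ?good y u" using less.hyps K by blast
    then obtain u where u: "\<And>y. y \<in> ?K \<Longrightarrow> ?good y (u y)" by metis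
    \<comment> \<open>Applying \<open>v\<close> to this vector gives \<open>v w\<close> minus its
      lower terms. The correction of its coefficients beyond \<open>- ?c x\<close> consists of
      products of two small elements.\<close>
    define z where "z = bvec w - (\<Sum>y\<in>?K. smul (?c y) (u y))"
    have lz: "lk z x = (1 when w = x) - (\<Sum>y\<in>?K. ?c y * lk (u y) x)" for x
      by (simp add: z_def lookup_minus lookup_sum lookup_e)
    have irrefl: "\<not> R w w" using l by blast
    have uw: "lk (u y) w = 0" if "y \<in> ?K" for y
    proof (rule ccontr)
      assume "lk (u y) w \<noteq> 0"
      moreover have "w \<noteq> y" using that by auto
      ultimately have "R w y" using u [OF that] by blast
      then show False using vw(4) [OF that] trans irrefl by blast
    qed
    have zw: "lk z w = 1" using uw by (simp add: lz)
    have zx: "lk z x = - ?c x - (\<Sum>y\<in>?K - {x}. ?c y * lk (u y) x)" if "x \<noteq> w" for x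
    proof (cases "x \<in> ?K")
      case True
      have "(\<Sum>y\<in>?K. ?c y * lk (u y) x) = ?c x * lk (u x) x
          + (\<Sum>y\<in>?K - {x}. ?c y * lk (u y) x)"
        using True by (intro sum.remove) auto
      then show ?thesis using True that u [OF True] by (simp add: lz)
    next
      case False
      then have "?c x = 0" "?K - {x} = ?K" using that by (auto simp: in_keys_iff)
      then show ?thesis using that by (simp add: lz)
    qed
    have "lin v z = lin v (bvec w) - (\<Sum>y\<in>?K. smul (?c y) (lin v (u y)))"
      unfolding z_def by (simp add: lmap_diff [OF lmap_lin] lmap_sum [OF lmap_lin] lin_smul)
    also have "\<dots> = v w - (\<Sum>y\<in>?K. smul (?c y) (bvec y))" using u by simp
    also have "\<dots> = bvec w"
    proof -
      have "v w = smul (?c w) (bvec w) + (\<Sum>y\<in>?K. smul (?c y) (bvec y))"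
        using pm_expand [of "v w"] sum.remove [of "Poly_Mapping.keys (v w)" w "\<lambda>y. smul (?c y) (bvec y)"] vw(2)
        by (metis finite_keys in_keys_iff zero_neq_one)
      then show ?thesis using vw(2) by (simp add: algebra_simps)
    qed
    finally have "lin v z = bvec w" .
    moreover have "z \<in> EE I" unfolding z_def using less.prems u by (intro EE_diff EE_sum EE_smul EE_e) auto
    moreover have "lk z x \<in> QA" if x: "x \<noteq> w" for x
    proof -
      have "?c y * lk (u y) x \<in> QA" if y: "y \<in> ?K - {x}" for y
        using u [of y] vw(3) [of y] y by (intro QA_mult) auto
      then show ?thesis unfolding zx [OF x] using vw(3) [OF x] by (intro QA_diff QA_minus QA_sum) auto
    qed
    moreover have "R x w" if x: "x \<noteq> w" "lk z x \<noteq> 0" for x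
    proof (cases "x \<in> ?K")
      case False
      then have "?c x = 0" using x by (auto simp: in_keys_iff)
      then have "(\<Sum>y\<in>?K - {x}. ?c y * lk (u y) x) \<noteq> 0" using x zx by simp
      then obtain y where y: "y \<in> ?K - {x}" "?c y * lk (u y) x \<noteq> 0" by (meson sum.not_neutral_contains_not_neutral)
      then have "R x y" using u [of y] by force
      then show ?thesis using vw(4) y trans by blast
    qed (use vw in blast)
    moreover have "lk (lk z x) 1 = - lk (?c x) 1" if x: "x \<noteq> w" for x
    proof -
      have "lk (?c y * lk (u y) x) 1 = 0" if y: "y \<in> ?K - {x}" for y
        using u [of y] vw(3) [of y] y by (intro QA_mult_lookup) auto
      then show ?thesis unfolding zx [OF x] by (simp add: lookup_minus lookup_sum)
    qed
    ultimately show ?case using zw by blast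
  qed
  then have "\<forall>w\<in>I. \<exists>u. ?good w u" by blast
  then obtain u where u: "\<And>w. w \<in> I \<Longrightarrow> ?good w (u w)" by metis
  have un: "unitri R I u" unfolding unitri_def using u by blast
  have vu: "lin v (u w) = bvec w" if "w \<in> I" for w using u that by blast
  \<comment> \<open>The construction gives a right inverse only; it is a left inverse because
    \<open>lin v\<close> is injective and sends both sides to \<open>v w\<close>.\<close>
  have "lin u (v w) = bvec w" if w: "w \<in> I" for w
  proof (rule lin_triangular_inj [where v = v and I = I and l = l])
    show "lk (v w) w = 1 \<and>
      (\<forall>y. lk (v w) y \<noteq> 0 \<longrightarrow> y = w \<or> l y < l w)" if "w \<in> I" for w
      using unitri_tri [where l = l, OF v _ that] l by blast
    have vE: "v w \<in> EE I" using v w by (auto simp: unitri_def)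
    then show "lin u (v w) \<in> EE I" using un by (intro EE_lin) (auto simp: unitri_def)
    have "lin v (lin u (v w)) = lin bvec (v w)" unfolding lin_lin using vE vu by (intro lin_cong) auto
    then show "lin v (lin u (v w)) = lin v (bvec w)" by (simp add: lin_id)
  qed (use w in auto)
  then show ?thesis using u un by blast
qed

lemma unitri_bij:
  fixes l :: "'v \<Rightarrow> nat"
  assumes v: "unitri R I v" and l: "\<And>x y. R x y \<Longrightarrow> l x < l y"
    and trans: "\<And>x y z. R x y \<Longrightarrow> R y z \<Longrightarrow> R x z"
  shows "bij_betw (lin v) (EE I) (EE I)"
  unfolding bij_betw_def
proof
  have tri: "lk (v w) w = 1 \<and>
      (\<forall>y. lk (v w) y \<noteq> 0 \<longrightarrow> y = w \<or> l y < l w)" if "w \<in> I" for w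
    using unitri_tri [where l = l, OF v _ that] l by blast
  show "inj_on (lin v) (EE I)"
    using lin_triangular_inj [where v = v and I = I and l = l, OF tri] by (auto intro!: inj_onI)
  have vE: "v w \<in> EE I" if "w \<in> I" for w using v that by (auto simp: unitri_def)
  obtain u where u: "unitri R I u" "\<And>w. w \<in> I \<Longrightarrow> lin v (u w) = bvec w"
    using unitri_inverse [where l = l and R = R and v = v and I = I] v l trans by metis
  have "f \<in> lin v ` EE I" if f: "f \<in> EE I" for f
  proof (rule image_eqI)
    show "lin u f \<in> EE I" using f u by (intro EE_lin) (auto simp: unitri_def)
    have "lin v (lin u f) = lin bvec f" unfolding lin_lin using f u by (intro lin_cong) auto
    then show "f = lin v (lin u f)" by (simp add: lin_id)
  qed
  moreover have "lin v f \<in> EE I" if "f \<in> EE I" for f using that vE by (rule EE_lin)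
  ultimately show "lin v ` EE I = EE I" by blast
qed

lemma rev_alt_word: "rev (alt_word s t n) = (if even n then alt_word t s n else alt_word s t n)"
proof (rule nth_equalityI)
  fix i assume i: "i < length (rev (alt_word s t n))"
  have "even (n - Suc i) \<longleftrightarrow> (if even n then odd i else even i)" using i by auto
  then show "rev (alt_word s t n) ! i = (if even n then alt_word t s n else alt_word s t n) ! i"
    using i by (auto simp: rev_nth alt_word_def)
qed simp

context coxeter_system
begin

section \<open>The regular representation\<close>

definition lam :: "'w \<Rightarrow> ('w \<Rightarrow>\<^sub>0 laurent) \<Rightarrow> ('w \<Rightarrow>\<^sub>0 laurent)" where
  "lam s = lin (\<lambda>w. if len w < len (s \<otimes> w) then bvec (s \<otimes> w) else bvec (s \<otimes> w) + smul (qv - qinv) (bvec w))"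

definition rho :: "'w \<Rightarrow> ('w \<Rightarrow>\<^sub>0 laurent) \<Rightarrow> ('w \<Rightarrow>\<^sub>0 laurent)" where
  "rho s = lin (\<lambda>w. if len w < len (w \<otimes> s) then bvec (w \<otimes> s) else bvec (w \<otimes> s) + smul (qv - qinv) (bvec w))"

abbreviation "EW \<equiv> EE (carrier W)"

lemma lmap_lam [simp]: "lmap (lam s)" and lmap_rho [simp]: "lmap (rho s)"
  by (simp_all add: lam_def rho_def)

lemma lam_e: "lam s (bvec w) = (if len w < len (s \<otimes> w) then bvec (s \<otimes> w) else bvec (s \<otimes> w) + smul (qv - qinv) (bvec w))"
  and rho_e: "rho s (bvec w) = (if len w < len (w \<otimes> s) then bvec (w \<otimes> s) else bvec (w \<otimes> s) + smul (qv - qinv) (bvec w))"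
  by (simp_all add: lam_def rho_def)

lemma lam_EW [simp, intro]: "s \<in> S \<Longrightarrow> f \<in> EW \<Longrightarrow> lam s f \<in> EW"
  and rho_EW [simp, intro]: "s \<in> S \<Longrightarrow> f \<in> EW \<Longrightarrow> rho s f \<in> EW"
  unfolding lam_def rho_def by (auto intro!: EE_lin)

lemma S_mult_eq_iff: "s \<in> S \<Longrightarrow> x \<in> carrier W \<Longrightarrow> y \<in> carrier W \<Longrightarrow> s \<otimes> x = y \<longleftrightarrow> x = s \<otimes> y"
  and mult_S_eq_iff: "s \<in> S \<Longrightarrow> x \<in> carrier W \<Longrightarrow> y \<in> carrier W \<Longrightarrow> x \<otimes> s = y \<longleftrightarrow> x = y \<otimes> s"
  by auto

lemma lookup_lam:
  assumes "s \<in> S" "f \<in> EW" "y \<in> carrier W"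
  shows "lk (lam s f) y = lk f (s \<otimes> y) + (if len (s \<otimes> y) < len y then (qv - qinv) * lk f y else 0)"
  using assms(2)
proof (induction rule: EE_induct)
  case (single k a)
  have "len (s \<otimes> k) < len k \<longleftrightarrow> \<not> len k < len (s \<otimes> k)" using len_S_mult [of s k] assms single by auto
  moreover have "s \<otimes> k = y \<longleftrightarrow> k = s \<otimes> y" by (rule S_mult_eq_iff) (use assms single in auto)
  ultimately show ?case using assms
    by (auto simp: single_eq_smul lmap_smul lam_e lookup_e lookup_add when_def)
qed (auto simp: lmap_zero lmap_add lookup_add algebra_simps)

lemma lookup_rho:
  assumes "s \<in> S" "f \<in> EW" "y \<in> carrier W"
  shows "lk (rho s f) y = lk f (y \<otimes> s) + (if len (y \<otimes> s) < len y then (qv - qinv) * lk f y else 0)"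
  using assms(2)
proof (induction rule: EE_induct)
  case (single k a)
  have "len (k \<otimes> s) < len k \<longleftrightarrow> \<not> len k < len (k \<otimes> s)" using len_mult_S [of s k] assms single by auto
  moreover have "k \<otimes> s = y \<longleftrightarrow> k = y \<otimes> s" by (rule mult_S_eq_iff) (use assms single in auto)
  ultimately show ?case using assms
    by (auto simp: single_eq_smul lmap_smul rho_e lookup_e lookup_add when_def)
qed (auto simp: lmap_zero lmap_add lookup_add algebra_simps)

lemma EW_eqI: "f \<in> EW \<Longrightarrow> g \<in> EW \<Longrightarrow> (\<And>y. y \<in> carrier W \<Longrightarrow> lk f y = lk g y) \<Longrightarrow> f = g"
  by (rule poly_mapping_eqI) (metis EE_lookup)

text \<open>Look at the four elements \<open>y\<close>, \<open>s y\<close>, \<open>y t\<close>,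
  \<open>s y t\<close>. Either parallel edges of this square go in the same direction, and then the
  two coefficients are symmetric expressions, or \<open>s y = y t\<close>, the square collapses and
  the two correction terms coincide.\<close>

lemma lam_rho:
  assumes s: "s \<in> S" and t: "t \<in> S" and f: "f \<in> EW"
  shows "lam s (rho t f) = rho t (lam s f)"
proof (rule EW_eqI)
  fix y assume y: "y \<in> carrier W"
  let ?z = "s \<otimes> y \<otimes> t"
  have z: "s \<otimes> (y \<otimes> t) = ?z" using s t y by (simp add: m_assoc)
  have c: "?z \<in> carrier W" using s t y by simp
  have "(len ?z < len (s \<otimes> y) \<longleftrightarrow> len (y \<otimes> t) < len y) \<or> s \<otimes> y = y \<otimes> t"
  proof (cases "len y < len (y \<otimes> t)")
    case True
    then show ?thesis using exchange_sides [OF y s t True] len_mult_S [OF t y] by auto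
  next
    case False
    then have less: "len (y \<otimes> t) < len (y \<otimes> t \<otimes> t)" using len_mult_S [OF t y] t y by auto
    have "s \<otimes> (y \<otimes> t) = y \<otimes> t \<otimes> t" if "len (s \<otimes> y) < len ?z"
      using exchange_sides [OF _ s t less] that s t y by (simp add: z)
    then show ?thesis using len_mult_S [OF t, of "s \<otimes> y"] len_mult_S [OF t y] s t y False
      by (metis S_cancel S_cancel_right S_closed m_closed less_Suc_eq not_less_eq)
  qed
  then show "lk (lam s (rho t f)) y = lk (rho t (lam s f)) y"
  proof
    assume iff: "len ?z < len (s \<otimes> y) \<longleftrightarrow> len (y \<otimes> t) < len y"
    then have "len ?z < len (y \<otimes> t) \<longleftrightarrow> len (s \<otimes> y) < len y"
      using len_mult_S [OF t, of "s \<otimes> y"] len_mult_S [OF t y] len_S_mult [OF s y] len_S_mult [OF s, of "y \<otimes> t"]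
        s t y unfolding z by (simp; linarith)
    then show ?thesis using iff s t f y by (simp add: lookup_lam lookup_rho z algebra_simps)
  next
    assume eq: "s \<otimes> y = y \<otimes> t"
    then have "?z = y" using t y by simp
    then show ?thesis using eq s t f y len_S_mult [OF s y] by (auto simp: lookup_lam lookup_rho z algebra_simps)
  qed
qed (use assms in auto)

lemma lam_lam:
  assumes s: "s \<in> S" and f: "f \<in> EW"
  shows "lam s (lam s f) = f + smul (qv - qinv) (lam s f)"
proof (rule EW_eqI)
  fix y assume y: "y \<in> carrier W"
  define x where "x = qv - qinv"
  have sy: "s \<otimes> y \<in> carrier W" "s \<otimes> (s \<otimes> y) = y" using s y by simp_all
  have "len y < len (s \<otimes> y) \<longleftrightarrow> \<not> len (s \<otimes> y) < len y" using len_S_mult [OF s y] by linarith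
  then show "lk (lam s (lam s f)) y = lk (f + smul (qv - qinv) (lam s f)) y"
    using s f y sy unfolding lookup_add lookup_smul x_def [symmetric]
    by (simp add: lookup_lam distrib_left flip: x_def)
qed (use assms in simp_all)

definition lami :: "'w \<Rightarrow> ('w \<Rightarrow>\<^sub>0 laurent) \<Rightarrow> ('w \<Rightarrow>\<^sub>0 laurent)" where
  "lami s f = lam s f - smul (qv - qinv) f"

lemma lmap_lami [simp]: "lmap (lami s)"
  unfolding lami_def by (intro lmap_sub lmap_scale lmap_id) simp

lemma lami_EW [simp, intro]: "s \<in> S \<Longrightarrow> f \<in> EW \<Longrightarrow> lami s f \<in> EW"
  by (simp add: lami_def)

lemma lam_lami [simp]: "s \<in> S \<Longrightarrow> f \<in> EW \<Longrightarrow> lam s (lami s f) = f"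
  and lami_lam [simp]: "s \<in> S \<Longrightarrow> f \<in> EW \<Longrightarrow> lami s (lam s f) = f"
  by (simp_all add: lami_def lmap_diff lmap_smul lam_lam)

definition wact :: "'w list \<Rightarrow> ('w \<Rightarrow>\<^sub>0 laurent) \<Rightarrow> ('w \<Rightarrow>\<^sub>0 laurent)" where
  "wact ws = foldr lam ws"

definition wacti :: "'w list \<Rightarrow> ('w \<Rightarrow>\<^sub>0 laurent) \<Rightarrow> ('w \<Rightarrow>\<^sub>0 laurent)" where
  "wacti ws = foldr lami ws"

lemma wact_simps [simp]: "wact [] f = f" "wact (s # ws) f = lam s (wact ws f)"
  "wact (us @ vs) f = wact us (wact vs f)"
  and wacti_simps [simp]: "wacti [] f = f" "wacti (s # ws) f = lami s (wacti ws f)"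
  "wacti (us @ vs) f = wacti us (wacti vs f)"
  by (simp_all add: wact_def wacti_def)

lemma wact_EW [simp, intro]: "ws \<in> lists S \<Longrightarrow> f \<in> EW \<Longrightarrow> wact ws f \<in> EW"
  and wacti_EW [simp, intro]: "ws \<in> lists S \<Longrightarrow> f \<in> EW \<Longrightarrow> wacti ws f \<in> EW"
  by (induction ws) simp_all

lemma lmap_wact [simp]: "lmap (wact ws)"
proof (induction ws)
  case Nil
  have "wact [] = (\<lambda>f. f)" by auto
  then show ?case by (simp add: lmap_id)
next
  case (Cons s ws)
  have "wact (s # ws) = (\<lambda>f. lam s (wact ws f))" by auto
  then show ?case using lmap_comp [OF lmap_lam Cons] by simp
qed

lemma wact_rho: "ws \<in> lists S \<Longrightarrow> t \<in> S \<Longrightarrow> f \<in> EW \<Longrightarrow> wact ws (rho t f) = rho t (wact ws f)"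
  by (induction ws) (simp_all add: lam_rho)

lemma wact_e_one:
  assumes "reduced ws w" shows "wact ws (bvec \<one>) = bvec w"
  using assms
proof (induction ws arbitrary: w)
  case Nil
  then show ?case by (auto simp: reduced_def)
next
  case (Cons s ws)
  note r = reduced_ConsD [OF Cons.prems]
  have "w \<in> carrier W" using Cons.prems reducedD by blast
  then show ?case using Cons.IH [OF r(2)] r by (simp add: lam_e)
qed

text \<open>Right operators generate everything from \<open>bvec \<one>\<close>, so a property that
  the right action preserves needs to be checked at a single vector.\<close>

lemma EW_rho_induct [consumes 1, case_names one rho add smul]:
  assumes f: "f \<in> EW" and one: "P (bvec \<one>)" and rho: "\<And>s f. s \<in> S \<Longrightarrow> f \<in> EW \<Longrightarrow> P f \<Longrightarrow> P (rho s f)"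
    and add: "\<And>f g. f \<in> EW \<Longrightarrow> g \<in> EW \<Longrightarrow> P f \<Longrightarrow> P g \<Longrightarrow> P (f + g)"
    and smul: "\<And>a f. f \<in> EW \<Longrightarrow> P f \<Longrightarrow> P (smul a f)"
  shows "P f"
proof -
  have "P (bvec w)" if "w \<in> carrier W" for w
    using that
  proof (induction "len w" arbitrary: w rule: less_induct)
    case less
    show ?case
    proof (cases "w = \<one>")
      case False
      then obtain s where s: "s \<in> S" "len (w \<otimes> s) < len w" using ex_right_descent less.prems by blast
      then have "P (rho s (bvec (w \<otimes> s)))" using less by (intro rho) auto
      then show ?thesis using s less.prems by (simp add: rho_e)
    qed (use one in simp)
  qed
  with f show ?thesis
  proof (induction rule: EE_induct)
    case (single k a)
    then show ?case using smul [of "bvec k" a] by (simp add: single_eq_smul)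
  next
    case zero
    show ?case using smul [OF _ one, of 0] by simp
  qed (use add in auto)
qed

lemma EW_lam_induct [consumes 1, case_names one lam add smul]:
  assumes f: "f \<in> EW" and one: "P (bvec \<one>)" and lam: "\<And>s f. s \<in> S \<Longrightarrow> f \<in> EW \<Longrightarrow> P f \<Longrightarrow> P (lam s f)"
    and add: "\<And>f g. f \<in> EW \<Longrightarrow> g \<in> EW \<Longrightarrow> P f \<Longrightarrow> P g \<Longrightarrow> P (f + g)"
    and smul: "\<And>a f. f \<in> EW \<Longrightarrow> P f \<Longrightarrow> P (smul a f)"
  shows "P f"
proof -
  have "P (bvec w)" if "w \<in> carrier W" for w
    using that
  proof (induction "len w" arbitrary: w rule: less_induct)
    case less
    show ?case
    proof (cases "w = \<one>")
      case False
      then obtain s where s: "s \<in> S" "len (s \<otimes> w) < len w" using ex_left_descent less.prems by blast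
      then have "P (lam s (bvec (s \<otimes> w)))" using less by (intro lam) auto
      then show ?thesis using s less.prems by (simp add: lam_e)
    qed (use one in simp)
  qed
  with f show ?thesis
  proof (induction rule: EE_induct)
    case (single k a)
    then show ?case using smul [of "bvec k" a] by (simp add: single_eq_smul)
  next
    case zero
    show ?case using smul [OF _ one, of 0] by simp
  qed (use add in auto)
qed

text \<open>At \<open>bvec \<one>\<close> both alternating words are reduced words of the same
  element and give the same basis vector; since left operators commute with right ones, the equality
  spreads to all vectors.\<close>

lemma wact_braid:
  assumes s: "s \<in> S" and t: "t \<in> S" and f: "f \<in> EW"
  shows "wact (alt_word s t (ord (s \<otimes> t))) f = wact (alt_word t s (ord (s \<otimes> t))) f"
proof -
  let ?m = "ord (s \<otimes> t)"
  have al: "alt_word s t ?m \<in> lists S" "alt_word t s ?m \<in> lists S" using alt_word_in_lists s t by metis+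
  have red: "reduced (alt_word s t ?m) (word_prod W (alt_word s t ?m))"
    "reduced (alt_word t s ?m) (word_prod W (alt_word s t ?m))"
    using al len_alt_word [OF s t, of ?m] braid_prod [OF s t] by (simp_all add: reduced_def)
  show ?thesis using f
  proof (induction rule: EW_rho_induct)
    case one
    show ?case using wact_e_one red by metis
  next
    case (rho r f)
    then show ?case using al by (simp add: wact_rho)
  qed (simp_all add: lmap_add lmap_smul)
qed

lemma wacti_rev: "ws \<in> lists S \<Longrightarrow> f \<in> EW \<Longrightarrow> wacti (rev ws) (wact ws f) = f"
  "ws \<in> lists S \<Longrightarrow> f \<in> EW \<Longrightarrow> wact ws (wacti (rev ws) f) = f"
  by (induction ws arbitrary: f) simp_all

lemma wacti_braid:
  assumes s: "s \<in> S" and t: "t \<in> S" and f: "f \<in> EW"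
  shows "wacti (alt_word s t (ord (s \<otimes> t))) f = wacti (alt_word t s (ord (s \<otimes> t))) f"
proof -
  let ?u = "alt_word s t (ord (s \<otimes> t))" and ?v = "alt_word t s (ord (s \<otimes> t))"
  have al: "?u \<in> lists S" "?v \<in> lists S" using alt_word_in_lists s t by metis+
  have "wacti (rev ?v) f = wacti (rev ?v) (wact ?u (wacti (rev ?u) f))" using al f by (simp only: wacti_rev)
  also have "\<dots> = wacti (rev ?v) (wact ?v (wacti (rev ?u) f))"
    using al f s t by (subst wact_braid) auto
  also have "\<dots> = wacti (rev ?u) f" using al f by (intro wacti_rev) auto
  \<comment> \<open>Reversal maps the pair of alternating words to itself, interchanging them
    exactly when the length is even; either way the same equation results.\<close>
  finally show ?thesis by (simp add: rev_alt_word split: if_splits)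
qed

definition word :: "'w \<Rightarrow> 'w list" where "word w = (SOME ws. reduced ws w)"

lemma reduced_word: "w \<in> carrier W \<Longrightarrow> reduced (word w) w"
  unfolding word_def using ex_reduced by (rule someI_ex)

lemma wacti_reduced:
  assumes "reduced us w" "reduced vs w" "f \<in> EW"
  shows "wacti us f = wacti vs f"
proof -
  let ?R = "\<lambda>us vs. \<forall>f\<in>EW. wacti us f = wacti vs f"
  have "?R us vs"
    by (rule matsumoto [where R = ?R, OF _ _ _ _ _ _ assms(1,2)]) (auto intro: wacti_braid)
  then show ?thesis using assms by blast
qed

section \<open>The bar involution on the free module\<close>

text \<open>The bar of \<open>T_w\<close> is the product of the inverse generators along a reduced
  word of \<open>w\<close>, that is, the inverse of \<open>T\<close> at \<open>w^-1\<close>;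
  Matsumoto's theorem makes the chosen word immaterial.\<close>

definition barE :: "('w \<Rightarrow>\<^sub>0 laurent) \<Rightarrow> ('w \<Rightarrow>\<^sub>0 laurent)" where
  "barE f = lin (\<lambda>w. wacti (word w) (bvec \<one>)) (bmap f)"

lemma smap_barE [simp]: "smap barE"
  unfolding barE_def by (rule lmap_smap) auto

lemma barE_e: "barE (bvec w) = wacti (word w) (bvec \<one>)"
  by (simp add: barE_def)

lemma word_one [simp]: "word \<one> = []"
  using reduced_word [of \<one>] by (simp add: reduced_def)

lemma barE_e_one [simp]: "barE (bvec \<one>) = bvec \<one>"
  by (simp add: barE_e)

lemma barE_EW [simp, intro]: "f \<in> EW \<Longrightarrow> barE f \<in> EW"
  unfolding barE_def using reducedD(1) [OF reduced_word]
  by (intro EE_lin [where A = "carrier W"] EE_bmap wacti_EW) simp_all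

lemma barE_e_S:
  assumes s: "s \<in> S" and w: "w \<in> carrier W" and less: "len w < len (s \<otimes> w)"
  shows "barE (bvec (s \<otimes> w)) = lami s (barE (bvec w))"
proof -
  have "reduced (s # word w) (s \<otimes> w)" using s reduced_word [OF w] less by (rule reduced_ConsI)
  from wacti_reduced [OF reduced_word this, of "bvec \<one>"] show ?thesis using s w by (simp add: barE_e)
qed

lemma lami_lami: "s \<in> S \<Longrightarrow> f \<in> EW \<Longrightarrow> lami s (lami s f) = f - smul (qv - qinv) (lami s f)"
  using lam_lami [of s f] by (metis lami_def)

text \<open>If \<open>s\<close> goes up at \<open>w\<close>, prefixing \<open>s\<close> to a reduced
  word is all there is. If it goes down, the claim is reduced to \<open>s w\<close> by the quadratic
  relation of the inverse generator.\<close>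

lemma barE_lam:
  assumes s: "s \<in> S" and f: "f \<in> EW"
  shows "barE (lam s f) = lami s (barE f)"
proof (rule smap_eqI [OF smap_lmap' [OF smap_barE lmap_lam] lmap_smap [OF lmap_lami smap_barE] f])
  fix w assume w: "w \<in> carrier W"
  show "barE (lam s (bvec w)) = lami s (barE (bvec w))"
  proof (cases "len w < len (s \<otimes> w)")
    case True
    then show ?thesis using barE_e_S s w by (simp add: lam_e)
  next
    case False
    then have "len (s \<otimes> w) < len (s \<otimes> (s \<otimes> w))" using len_S_mult [OF s w] s w by auto
    from barE_e_S [OF s _ this] have bw: "barE (bvec w) = lami s (barE (bvec (s \<otimes> w)))" using s w by simp
    have "barE (lam s (bvec w)) = barE (bvec (s \<otimes> w)) + smul (qinv - qv) (barE (bvec w))"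
      using False by (simp add: lam_e smap_add smap_smul lbar_diff)
    also have "\<dots> = lami s (barE (bvec w))" unfolding bw using s w
      by (simp add: lami_lami) (simp add: smul_diff_left)
    finally show ?thesis .
  qed
qed

lemma barE_lami:
  assumes s: "s \<in> S" and f: "f \<in> EW"
  shows "barE (lami s f) = lam s (barE f)"
  using barE_lam [OF s, of "lami s f"] s f lam_lami by fastforce

lemma barE_barE [simp]: "f \<in> EW \<Longrightarrow> barE (barE f) = f"
  by (induction rule: EW_lam_induct)
    (simp_all add: barE_lam barE_lami smap_add smap_smul)

definition lower :: "nat \<Rightarrow> ('w \<Rightarrow>\<^sub>0 laurent) \<Rightarrow> bool" where
  "lower n f \<longleftrightarrow> f \<in> EE {y \<in> carrier W. len y < n}"

lemma lower_lam: "s \<in> S \<Longrightarrow> lower n f \<Longrightarrow> lower (Suc n) (lam s f)"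
  unfolding lower_def lam_def
proof (erule EE_lin)
  fix w assume "s \<in> S" "w \<in> {y \<in> carrier W. len y < n}"
  then show "(if len w < len (s \<otimes> w) then bvec (s \<otimes> w) else bvec (s \<otimes> w) + smul (qv - qinv) (bvec w)) \<in>
      EE {y \<in> carrier W. len y < Suc n}"
    using len_S_mult [of s w] by auto
qed

text \<open>An inverse generator is \<open>T_s - (q - q^-1)\<close>, so prefixing it to a reduced
  word produces the expected leading vector and shorter ones only.\<close>

lemma barE_e_lower: "w \<in> carrier W \<Longrightarrow> lower (len w) (barE (bvec w) - bvec w)"
proof (induction "len w" arbitrary: w rule: less_induct)
  case less
  show ?case
  proof (cases "w = \<one>")
    case True
    then show ?thesis by (simp add: lower_def)
  next
    case False
    then obtain s where s: "s \<in> S" "len (s \<otimes> w) < len w" using ex_left_descent less.prems by blast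
    let ?v = "s \<otimes> w" and ?d = "barE (bvec (s \<otimes> w)) - bvec (s \<otimes> w)"
    have lw: "len w = Suc (len ?v)" using s len_S_mult [OF s(1) less.prems] by auto
    have v: "?v \<in> carrier W" "s \<otimes> ?v = w" using s less.prems by auto
    have IH: "lower (len ?v) ?d" using less.hyps s v by blast
    have "barE (bvec w) = lami s (bvec ?v + ?d)" using barE_e_S [OF s(1) v(1)] s(2) v(2) by simp
    also have "\<dots> = lam s (bvec ?v) + lam s ?d - smul (qv - qinv) (bvec ?v) - smul (qv - qinv) ?d"
      unfolding lami_def by (simp add: lmap_add lmap_diff [OF lmap_lam] smul_add smul_diff)
    also have "lam s (bvec ?v) = bvec w" using s v by (simp add: lam_e)
    finally have eq: "barE (bvec w) - bvec w = lam s ?d - smul (qv - qinv) (bvec ?v) - smul (qv - qinv) ?d" by simp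
    have "lower (len w) (lam s ?d)" using lower_lam [OF s(1) IH] lw by simp
    moreover have "lower (len w) (bvec ?v)" using v lw by (simp add: lower_def EE_e)
    moreover have "lower (len w) ?d" using IH lw unfolding lower_def by (elim EE_mono) auto
    ultimately show ?thesis unfolding eq lower_def by blast
  qed
qed

text \<open>At an element of maximal length in the support, \<^term>\<open>barE\<close> just conjugates the coefficient.\<close>

lemma barE_invariant_QA:
  assumes f: "f \<in> EW" and bar: "barE f = f" and QA: "\<And>y. lk f y \<in> QA"
  shows "f = 0"
proof (rule ccontr)
  assume "f \<noteq> 0"
  then obtain w where w: "w \<in> Poly_Mapping.keys f" "\<And>y. y \<in> Poly_Mapping.keys f \<Longrightarrow> len y \<le> len w"
    using ex_max_key [of f len] by blast
  have "lk (barE f) w = lk (bmap f) w"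
    unfolding barE_def
  proof (rule lin_coeff_max(1) [where I = "carrier W" and l = len])
    fix x assume x: "x \<in> carrier W"
    have lo: "lower (len x) (wacti (word x) (bvec \<one>) - bvec x)" using barE_e_lower [OF x] by (simp add: barE_e)
    have "lk (wacti (word x) (bvec \<one>)) y = lk (wacti (word x) (bvec \<one>) - bvec x) y + (1 when x = y)" for y
      by (simp add: lookup_minus lookup_e)
    moreover have "lk (wacti (word x) (bvec \<one>) - bvec x) y = 0" if "\<not> len y < len x" for y
      using lo that by (auto simp: lower_def EE_iff)
    ultimately show "lk (wacti (word x) (bvec \<one>)) x = 1 \<and>
        (\<forall>y. lk (wacti (word x) (bvec \<one>)) y \<noteq> 0 \<longrightarrow> y = x \<or> len y < len x)"
      by (auto simp: when_def split: if_splits)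
  next
    have k: "Poly_Mapping.keys (bmap f) = Poly_Mapping.keys f"
      by (auto simp: in_keys_iff) (metis lbar_lbar lbar_zero)
    show "bmap f \<in> EW" using f by simp
    show "w \<in> Poly_Mapping.keys (bmap f)" "\<And>y. y \<in> Poly_Mapping.keys (bmap f) \<Longrightarrow> len y \<le> len w"
      using w unfolding k by auto
  qed
  then have "lbar (lk f w) = lk f w" using bar by simp
  then show False using QA_bar_invariant [OF QA [of w]] w(1) by (simp add: in_keys_iff)
qed

section \<open>The Kazhdan--Lusztig basis\<close>

text \<open>The degrees that occur in \<open>q^n P(q^-2)\<close> when
  \<open>2 deg P + 1 \<le> n\<close>: those congruent to n between 1 and n. Smallness alone would
  fix the basis; the parity and the upper bound are what allow an honest polynomial \<open>P\<close>
  to be recovered.\<close>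

definition GG :: "nat \<Rightarrow> laurent set" where
  "GG n = {a. \<forall>k. lk a k \<noteq> 0 \<longrightarrow> 1 \<le> k \<and> k \<le> int n \<and> even (int n - k)}"

lemma GG_QA: "a \<in> GG n \<Longrightarrow> a \<in> QA"
  unfolding GG_def QA_iff by fastforce

definition isKL :: "'w \<Rightarrow> ('w \<Rightarrow>\<^sub>0 laurent) \<Rightarrow> bool" where
  "isKL w C \<longleftrightarrow> C \<in> EW \<and> barE C = C \<and> lk C w = 1 \<and>
     (\<forall>y. lk C y \<noteq> 0 \<longrightarrow> bruhat_le y w) \<and> (\<forall>y. y \<noteq> w \<longrightarrow> lk C y \<in> GG (len w - len y))"

lemma isKL_unique:
  assumes "f \<in> EW" "barE f = f" "lk f w = 1" "\<And>y. y \<noteq> w \<Longrightarrow> lk f y \<in> QA"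
    and "g \<in> EW" "barE g = g" "lk g w = 1" "\<And>y. y \<noteq> w \<Longrightarrow> lk g y \<in> QA"
  shows "f = g"
proof -
  have "lk (f - g) y \<in> QA" for y
    using assms(3,4,7,8) QA_zero QA_diff [of "lk f y" "lk g y"] by (cases "y = w") (auto simp: lookup_minus)
  then have "f - g = 0" using assms(1,2,5,6) by (intro barE_invariant_QA) (auto simp: smap_diff)
  then show ?thesis by simp
qed

text \<open>The coefficient of $q$ with its sign, so that it becomes $\mu(y,w)$.\<close>

definition mcoef :: "('w \<Rightarrow>\<^sub>0 laurent) \<Rightarrow> 'w \<Rightarrow> int" where
  "mcoef C y = - lk (lk C y) 1"

lemma parity_arith:
  fixes k N n y z :: int
  assumes "1 \<le> k" "k \<le> d" "even (d - k)" "d = z - y" "odd (n - z)" "z < n" "N = n - y + 1"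
  shows "k \<le> N \<and> even (N - k) \<and> 0 \<le> k"
  using assms by presburger

text \<open>The classical recursion. Multiplication by the bar invariant element
  \<open>T_s - q\<close> gives the right leading term, but coefficients at left descents of
  \<open>s\<close> may acquire a nonzero constant term; integer multiples of lower basis elements
  remove it without disturbing bar invariance.\<close>

lemma isKL_step:
  assumes C: "isKL w C" and s: "s \<in> S" and w: "w \<in> carrier W" and up: "len w < len (s \<otimes> w)"
    and D: "\<And>y. bruhat_lt y w \<Longrightarrow> isKL y (D y)"
    and Z: "Z = {y. bruhat_lt y w \<and> len (s \<otimes> y) < len y}"
  shows "isKL (s \<otimes> w) (lam s C - smul qv C - (\<Sum>y\<in>Z. smul (Poly_Mapping.single 0 (mcoef C y)) (D y)))"
proof -
  let ?n = "len w" and ?sw = "s \<otimes> w"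
  define X where "X = lam s C - smul qv C"
  define M where "M = (\<Sum>y\<in>Z. smul (Poly_Mapping.single 0 (mcoef C y)) (D y))"
  have lsw: "len ?sw = Suc ?n" using len_S_mult [OF s w] up by auto
  have finZ: "finite Z" unfolding Z by (rule finite_subset [OF _ finite_bruhat_lower [of w]]) (auto simp: bruhat_lt_def)
  have CE: "C \<in> EW" and barC: "barE C = C" and Cw: "lk C w = 1"
    and Cle: "\<And>y. lk C y \<noteq> 0 \<Longrightarrow> bruhat_le y w" and CG: "\<And>y. y \<noteq> w \<Longrightarrow> lk C y \<in> GG (?n - len y)"
    using C by (auto simp: isKL_def)
  have DE: "D y \<in> EW" if "y \<in> Z" for y using D that unfolding Z isKL_def by blast
  have wsw: "bruhat_le w ?sw" using bruhat_le_S_left [OF s w up] .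
  have lX: "lk X y = (if len (s \<otimes> y) < len y then lk C (s \<otimes> y) - qinv * lk C y else lk C (s \<otimes> y) - qv * lk C y)"
    if "y \<in> carrier W" for y
    using that s CE by (simp add: X_def lookup_minus lookup_lam algebra_simps)
  have XE: "X \<in> EW" and ME: "M \<in> EW" unfolding X_def M_def using s CE DE by auto
  have Csw: "lk C ?sw = 0"
  proof (rule ccontr)
    assume "lk C ?sw \<noteq> 0"
    then show False using bruhat_le_len [OF Cle] up by fastforce
  qed
  have lM: "lk M y = (\<Sum>z\<in>Z. Poly_Mapping.single 0 (mcoef C z) * lk (D z) y)" for y
    by (simp add: M_def lookup_sum)
  have lM': "lk (lk M y) k = (\<Sum>z\<in>Z. mcoef C z * lk (lk (D z) y) k)" for y k
    by (simp add: lM lookup_sum lookup_single_mult)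
  have lenZ: "len z < ?n" if "z \<in> Z" for z using that bruhat_lt_len unfolding Z by blast
  have parZ: "odd (?n - len z)" if "z \<in> Z" "mcoef C z \<noteq> 0" for z
  proof -
    have "z \<noteq> w" "lk (lk C z) 1 \<noteq> 0" using that by (auto simp: Z mcoef_def)
    then have "even (int (?n - len z) - 1)" using CG [of z] by (auto simp: GG_def)
    then show ?thesis by simp
  qed
  have lMsw: "lk M ?sw = 0"
  proof -
    have "lk (D z) ?sw = 0" if "z \<in> Z" for z
    proof (rule ccontr)
      assume "lk (D z) ?sw \<noteq> 0"
      then have "bruhat_le ?sw z" using D that unfolding Z isKL_def by blast
      then show False using bruhat_le_len [of ?sw z] lenZ [OF that] lsw by auto
    qed
    then show ?thesis by (simp add: lM)
  qed
  show "isKL ?sw (lam s C - smul qv C - (\<Sum>y\<in>Z. smul (Poly_Mapping.single 0 (mcoef C y)) (D y)))"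
    unfolding X_def [symmetric] M_def [symmetric] isKL_def
  proof (intro conjI allI impI)
    show "X - M \<in> EW" using XE ME by simp
    have "barE X = lami s C - smul qinv C"
      unfolding X_def using s CE barC by (simp add: smap_diff smap_smul barE_lam)
    then have "barE X = X" unfolding X_def lami_def by (simp add: smul_diff_left)
    moreover have "barE M = M"
    proof -
      have "barE M = (\<Sum>y\<in>Z. barE (smul (Poly_Mapping.single 0 (mcoef C y)) (D y)))"
        unfolding M_def using finZ by (induction rule: finite_induct) (auto simp: smap_zero smap_add)
      also have "\<dots> = M" unfolding M_def
        using D by (intro sum.cong) (auto simp: Z isKL_def smap_smul lbar_single)
      finally show ?thesis .
    qed
    ultimately show "barE (X - M) = X - M" by (simp add: smap_diff)
    show "lk (X - M) ?sw = 1" using lX [of ?sw] s w up lsw Cw Csw lMsw by (simp add: lookup_minus)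
  next
    fix y assume "lk (X - M) y \<noteq> 0"
    then have "lk X y \<noteq> 0 \<or> lk M y \<noteq> 0" by (auto simp: lookup_minus)
    then show "bruhat_le y ?sw"
    proof
      assume X: "lk X y \<noteq> 0"
      then have y: "y \<in> carrier W" using EE_lookup [OF XE, of y] by blast
      then have "lk C (s \<otimes> y) \<noteq> 0 \<or> lk C y \<noteq> 0" using X lX by (auto split: if_splits)
      then show ?thesis
      proof
        assume "lk C y \<noteq> 0"
        then show ?thesis by (rule bruhat_le_trans [OF Cle wsw])
      next
        assume "lk C (s \<otimes> y) \<noteq> 0"
        then have "bruhat_le (s \<otimes> (s \<otimes> y)) w \<or> bruhat_le (s \<otimes> (s \<otimes> y)) ?sw"
          by (rule bruhat_S_upper [OF Cle s])
        then show ?thesis using s y bruhat_le_trans [OF _ wsw] by auto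
      qed
    next
      assume "lk M y \<noteq> 0"
      then obtain z where "z \<in> Z" "lk (D z) y \<noteq> 0" unfolding lM by (metis (no_types, lifting) mult_zero_right sum.neutral)
      then have "bruhat_le y z" "bruhat_le z w" using D unfolding Z isKL_def bruhat_lt_def by blast+
      then show ?thesis using wsw bruhat_le_trans by blast
    qed
  next
    fix y assume ne: "y \<noteq> ?sw"
    show "lk (X - M) y \<in> GG (len ?sw - len y)"
    proof (cases "y \<in> carrier W \<and> len y \<le> ?n")
      case False
      have "lk X y = 0"
      proof (cases "y \<in> carrier W")
        case True
        then have l: "?n < len y" using False by simp
        have c0: "lk C y = 0" using Cle [of y] bruhat_le_len l by fastforce
        have "lk C (s \<otimes> y) = 0"
        proof (rule ccontr)
          assume nz: "lk C (s \<otimes> y) \<noteq> 0"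
          then have "s \<otimes> y = w \<or> len (s \<otimes> y) < ?n" using bruhat_le_len [OF Cle [OF nz]] by blast
          then show False using len_S_mult [OF s True] l ne s True by auto
        qed
        then show ?thesis using lX [OF True] c0 by simp
      next
        case False
        then show ?thesis by (rule EE_lookup [OF XE])
      qed
      moreover have "lk M y = 0"
      proof -
        have "lk (D z) y = 0" if z: "z \<in> Z" for z
        proof (rule ccontr)
          assume "lk (D z) y \<noteq> 0"
          then have "bruhat_le y z" using D z unfolding Z isKL_def by blast
          then show False using bruhat_le_len [of y z] lenZ [OF z] False bruhat_leD by fastforce
        qed
        then show ?thesis by (simp add: lM)
      qed
      ultimately show ?thesis by (simp add: lookup_minus GG_def)
    next
      case True
      then have y: "y \<in> carrier W" "len y \<le> ?n" by auto
      let ?N = "Suc ?n - len y"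
      have N: "int ?N = int ?n - int (len y) + 1" using y by auto
      have boundM: "k \<le> int ?N \<and> even (int ?N - k) \<and> 0 \<le> k" if k: "lk (lk M y) k \<noteq> 0" for k
      proof -
        obtain z where z: "z \<in> Z" "mcoef C z * lk (lk (D z) y) k \<noteq> 0"
          using k unfolding lM' by (meson sum.not_neutral_contains_not_neutral)
        have p: "odd (?n - len z)" "len z < ?n" using parZ lenZ z by auto
        have Dz: "isKL z (D z)" using D z unfolding Z by blast
        show ?thesis
        proof (cases "y = z")
          case True
          then have "k = 0" using Dz z(2) by (auto simp: isKL_def lookup_one when_def split: if_splits)
          moreover have "even ?N" using p True by (simp add: Suc_diff_le)
          ultimately show ?thesis by simp
        next
          case False
          have nz: "lk (D z) y \<noteq> 0" using z(2) by auto
          then have yz: "len y < len z" using Dz False bruhat_le_len unfolding isKL_def by blast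
          have "lk (D z) y \<in> GG (len z - len y)" using Dz False unfolding isKL_def by blast
          then have "1 \<le> k" "k \<le> int (len z - len y)" "even (int (len z - len y) - k)"
            using z(2) by (auto simp: GG_def)
          moreover have "int (len z - len y) = int (len z) - int (len y)" using yz by auto
          moreover have "odd (int ?n - int (len z))" using p by (simp add: even_diff_nat flip: of_nat_diff)
          moreover have "int (len z) < int ?n" using p by simp
          ultimately show ?thesis using N parity_arith by metis
        qed
      qed
      have boundC: "k \<le> int ?n - int (len x) \<and> even (int ?n - int (len x) - k) \<and> 0 \<le> k \<and> (k = 0 \<longrightarrow> x = w)"
        if k: "lk (lk C x) k \<noteq> 0" for x k
      proof (cases "x = w")
        case True
        then show ?thesis using k Cw by (auto simp: lookup_one when_def split: if_splits)
      next
        case False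
        have "lk C x \<noteq> 0" using k by auto
        then have "len x < ?n" using False bruhat_le_len Cle by blast
        moreover have "1 \<le> k" "k \<le> int (?n - len x)" "even (int (?n - len x) - k)"
          using CG [OF False] k by (auto simp: GG_def)
        ultimately show ?thesis by auto
      qed
      have boundX: "k \<le> int ?N \<and> even (int ?N - k) \<and> 0 \<le> k" if k: "lk (lk X y) k \<noteq> 0" for k
      proof (cases "len (s \<otimes> y) < len y")
        case True
        then have sy: "len y = Suc (len (s \<otimes> y))" using len_S_mult [OF s y(1)] by auto
        have "lk (lk C (s \<otimes> y)) k \<noteq> 0 \<or> lk (lk C y) (k + 1) \<noteq> 0"
          using k True lX [OF y(1)] by (auto simp: lookup_minus lookup_qinv_mult)
        then show ?thesis
        proof
          assume "lk (lk C (s \<otimes> y)) k \<noteq> 0"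
          from boundC [OF this] show ?thesis unfolding N using sy by auto
        next
          assume a: "lk (lk C y) (k + 1) \<noteq> 0"
          have "y \<noteq> w" using True up by auto
          then have "k + 1 \<noteq> 0" using boundC [OF a] by blast
          then show ?thesis unfolding N using boundC [OF a] by auto
        qed
      next
        case False
        then have sy: "len (s \<otimes> y) = Suc (len y)" using len_S_mult [OF s y(1)] by auto
        have "lk (lk C (s \<otimes> y)) k \<noteq> 0 \<or> lk (lk C y) (k - 1) \<noteq> 0"
          using k False lX [OF y(1)] by (auto simp: lookup_minus lookup_qv_mult)
        then show ?thesis
        proof
          assume "lk (lk C (s \<otimes> y)) k \<noteq> 0"
          from boundC [OF this] show ?thesis unfolding N using sy by auto
        next
          assume a: "lk (lk C y) (k - 1) \<noteq> 0"
          from boundC [OF a] show ?thesis unfolding N by auto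
        qed
      qed
      \<comment> \<open>The place where the multiples are forced. When \<open>s\<close> is a descent
        of \<open>y\<close>, the summand \<open>- qinv * lk C y\<close> moves the coefficient of q
        to the constant term, which becomes \<open>mcoef C y\<close>. In \<open>M\<close> only
        \<open>D y\<close> has a constant term at \<open>y\<close>, namely 1.\<close>
      have zero: "lk (lk (X - M) y) 0 = 0"
      proof -
        have D0: "lk (lk (D z) y) 0 = (if z = y then 1 else 0)" if z: "z \<in> Z" for z
        proof -
          have Dz: "isKL z (D z)" using D z unfolding Z by blast
          show ?thesis
          proof (cases "z = y")
            case False
            then have "lk (D z) y \<in> GG (len z - len y)" using Dz unfolding isKL_def by auto
            then show ?thesis using False by (auto simp: GG_def)
          qed (use Dz in \<open>auto simp: isKL_def\<close>)
        qed
        have "lk (lk M y) 0 = (\<Sum>z\<in>Z. if z = y then mcoef C z else 0)"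
          unfolding lM' using D0 by (intro sum.cong) auto
        also have "\<dots> = (if y \<in> Z then mcoef C y else 0)" using finZ by simp
        finally have M0: "lk (lk M y) 0 = (if y \<in> Z then mcoef C y else 0)" .
        have "s \<otimes> y \<noteq> w" using ne s y by auto
        then have Csy: "lk (lk C (s \<otimes> y)) 0 = 0" using boundC [of "s \<otimes> y" 0] by blast
        show ?thesis
        proof (cases "len (s \<otimes> y) < len y")
          case True
          have X0: "lk (lk X y) 0 = mcoef C y"
            using True lX [OF y(1)] Csy by (simp add: lookup_minus lookup_qinv_mult mcoef_def)
          have "y \<noteq> w" using True up by auto
          then have "lk C y = 0" if "y \<notin> Z"
            using that True Cle [of y] by (auto simp: Z bruhat_lt_def)
          then have "mcoef C y = 0" if "y \<notin> Z" using that by (simp add: mcoef_def)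
          then show ?thesis using X0 M0 by (auto simp: lookup_minus)
        next
          case False
          have "lk (lk C y) (-1) = 0" using boundC [of y "-1"] by auto
          then have X0: "lk (lk X y) 0 = 0"
            using False lX [OF y(1)] Csy by (simp add: lookup_minus lookup_qv_mult)
          moreover have "y \<notin> Z" using False by (simp add: Z)
          ultimately show ?thesis using M0 by (simp add: lookup_minus)
        qed
      qed
      have "1 \<le> k \<and> k \<le> int ?N \<and> even (int ?N - k)" if k: "lk (lk (X - M) y) k \<noteq> 0" for k
      proof -
        have "k \<noteq> 0" using k zero by metis
        moreover have "lk (lk X y) k \<noteq> 0 \<or> lk (lk M y) k \<noteq> 0" using k by (auto simp: lookup_minus)
        ultimately show ?thesis using boundX [of k] boundM [of k] by auto
      qed
      then show ?thesis unfolding lsw GG_def by blast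
    qed
  qed
qed

lemma isKL_one: "isKL \<one> (bvec \<one>)"
  by (auto simp: isKL_def lookup_e when_def GG_def)

lemma ex_isKL: "w \<in> carrier W \<Longrightarrow> \<exists>C. isKL w C"
proof (induction "len w" arbitrary: w rule: less_induct)
  case less
  show ?case
  proof (cases "w = \<one>")
    case False
    then obtain s where s: "s \<in> S" "len (s \<otimes> w) < len w" using ex_left_descent less.prems by blast
    let ?v = "s \<otimes> w"
    have v: "?v \<in> carrier W" "s \<otimes> ?v = w" using s less.prems by auto
    obtain C where C: "isKL ?v C" using less.hyps [OF s(2) v(1)] by blast
    have "\<exists>D. isKL y D" if "bruhat_lt y ?v" for y
      using less.hyps [of y] bruhat_lt_len [OF that] bruhat_ltD [OF that] s(2) by auto
    then obtain D where D: "\<And>y. bruhat_lt y ?v \<Longrightarrow> isKL y (D y)" by metis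
    from isKL_step [OF C s(1) v(1) _ D refl] show ?thesis unfolding v(2) using s(2) by blast
  qed (use isKL_one in blast)
qed

definition KL :: "'w \<Rightarrow> ('w \<Rightarrow>\<^sub>0 laurent)" where "KL w = (SOME C. isKL w C)"

lemma isKL_KL: "w \<in> carrier W \<Longrightarrow> isKL w (KL w)"
  unfolding KL_def by (rule someI_ex) (rule ex_isKL)

lemma KL_EW [simp, intro]: "w \<in> carrier W \<Longrightarrow> KL w \<in> EW"
  and barE_KL [simp]: "w \<in> carrier W \<Longrightarrow> barE (KL w) = KL w"
  and KL_self [simp]: "w \<in> carrier W \<Longrightarrow> lk (KL w) w = 1"
  and KL_le: "w \<in> carrier W \<Longrightarrow> lk (KL w) y \<noteq> 0 \<Longrightarrow> bruhat_le y w"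
  and KL_GG: "w \<in> carrier W \<Longrightarrow> y \<noteq> w \<Longrightarrow> lk (KL w) y \<in> GG (len w - len y)"
  using isKL_KL by (auto simp: isKL_def)

lemma KL_QA: "w \<in> carrier W \<Longrightarrow> y \<noteq> w \<Longrightarrow> lk (KL w) y \<in> QA"
  using KL_GG GG_QA by blast

text \<open>Only smallness of the lower coefficients is required; the Bruhat support and the degree
  conditions of \<open>isKL\<close> then hold automatically. Candidates of other origin, such as
  images under inversion or the sums built from Kazhdan-Lusztig polynomials, are identified with
  \<open>KL\<close> in this way.\<close>

lemma KL_eqI:
  assumes "w \<in> carrier W" "f \<in> EW" "barE f = f" "lk f w = 1" "\<And>y. y \<noteq> w \<Longrightarrow> lk f y \<in> QA"
  shows "f = KL w"
  using assms isKL_unique [of f w "KL w"] KL_QA by auto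

lemma isKL_eq: "w \<in> carrier W \<Longrightarrow> isKL w C \<Longrightarrow> C = KL w"
  by (rule KL_eqI) (auto simp: isKL_def GG_QA)

lemma unitri_KL: "unitri bruhat_lt (carrier W) KL"
  unfolding unitri_def using KL_QA KL_le by (auto simp: bruhat_lt_def)

definition Zset :: "'w \<Rightarrow> 'w \<Rightarrow> 'w set" where
  "Zset s w = {y. bruhat_lt y w \<and> len (s \<otimes> y) < len y}"

lemma lam_KL_up:
  assumes s: "s \<in> S" and w: "w \<in> carrier W" and up: "len w < len (s \<otimes> w)"
  shows "lam s (KL w) = smul qv (KL w) + KL (s \<otimes> w) +
    (\<Sum>y\<in>Zset s w. smul (Poly_Mapping.single 0 (mcoef (KL w) y)) (KL y))"
proof -
  have "isKL (s \<otimes> w) (lam s (KL w) - smul qv (KL w) -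
      (\<Sum>y\<in>Zset s w. smul (Poly_Mapping.single 0 (mcoef (KL w) y)) (KL y)))"
    using isKL_KL [OF w] s w up isKL_KL bruhat_ltD(2) by (intro isKL_step) (auto simp: Zset_def)
  from isKL_eq [OF _ this] show ?thesis using s w by (simp add: algebra_simps)
qed

text \<open>In the recursion from \<open>s w\<close> the main term is killed by
  \<open>T_s + q^-1\<close> because \<open>(T_s + q^-1)(T_s - q) = 0\<close>, and every correction
  term belongs to a shorter element with descent \<open>s\<close>, so induction applies to
  it.\<close>

lemma lam_KL_down:
  assumes s: "s \<in> S" and w: "w \<in> carrier W" and "len (s \<otimes> w) < len w"
  shows "lam s (KL w) = smul (- qinv) (KL w)"
  using w assms(3)
proof (induction "len w" arbitrary: w rule: less_induct)
  case less
  let ?v = "s \<otimes> w"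
  have v: "?v \<in> carrier W" "s \<otimes> ?v = w" using s less.prems by auto
  let ?m = "\<lambda>y. Poly_Mapping.single 0 (mcoef (KL ?v) y) :: laurent"
  have eq: "KL w = lam s (KL ?v) - smul qv (KL ?v) - (\<Sum>y\<in>Zset s ?v. smul (?m y) (KL y))"
    using lam_KL_up [OF s v(1)] less.prems(2) v(2) by simp
  have y: "lam s (KL y) = smul (- qinv) (KL y)" if "y \<in> Zset s ?v" for y
  proof -
    have "bruhat_lt y ?v" "len (s \<otimes> y) < len y" using that by (auto simp: Zset_def)
    then show ?thesis using less.hyps [of y] bruhat_lt_len bruhat_ltD(2) less.prems(2) by fastforce
  qed
  have "lam s (\<Sum>y\<in>Zset s ?v. smul (?m y) (KL y)) = (\<Sum>y\<in>Zset s ?v. smul (?m y) (lam s (KL y)))"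
    by (simp add: lmap_sum lmap_smul)
  also have "\<dots> = smul (- qinv) (\<Sum>y\<in>Zset s ?v. smul (?m y) (KL y))"
    unfolding smul_sum using y by (intro sum.cong) (auto simp: smul_smul mult.commute)
  finally have M: "lam s (\<Sum>y\<in>Zset s ?v. smul (?m y) (KL y)) = smul (- qinv) (\<Sum>y\<in>Zset s ?v. smul (?m y) (KL y))" .
  have X: "lam s (lam s (KL ?v) - smul qv (KL ?v)) = smul (- qinv) (lam s (KL ?v) - smul qv (KL ?v))"
    using s v(1) by (simp add: lmap_diff lmap_smul lam_lam smul_diff smul_diff_left smul_smul smul_minus_left)
  show ?case unfolding eq using M X by (simp add: lmap_diff [OF lmap_lam] smul_diff)
qed

subsection \<open>Right multiplication\<close>

text \<open>The anti-automorphism sending \<open>T_w\<close> to \<open>T\<close> at the inverse of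
  \<open>w\<close>. It turns statements about left operators into statements about right
  ones.\<close>

definition iot :: "('w \<Rightarrow>\<^sub>0 laurent) \<Rightarrow> ('w \<Rightarrow>\<^sub>0 laurent)" where
  "iot = lin (\<lambda>w. bvec (inv w))"

lemma lmap_iot [simp]: "lmap iot"
  by (simp add: iot_def)

lemma iot_EW [simp, intro]: "f \<in> EW \<Longrightarrow> iot f \<in> EW"
  unfolding iot_def by (auto intro!: EE_lin)

lemma lookup_iot: "f \<in> EW \<Longrightarrow> y \<in> carrier W \<Longrightarrow> lk (iot f) y = lk f (inv y)"
proof (induction rule: EE_induct)
  case (single k a)
  then have "inv k = y \<longleftrightarrow> k = inv y" by auto
  then show ?case by (simp add: iot_def lookup_e lookup_single when_def)
qed (simp_all add: lmap_zero lmap_add lookup_add)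

lemma iot_iot [simp]: "f \<in> EW \<Longrightarrow> iot (iot f) = f"
  by (rule EW_eqI) (auto simp: lookup_iot)

lemma iot_lam: "s \<in> S \<Longrightarrow> f \<in> EW \<Longrightarrow> iot (lam s f) = rho s (iot f)"
proof (rule EW_eqI)
  fix y assume a: "s \<in> S" "f \<in> EW" "y \<in> carrier W"
  then have i: "s \<otimes> inv y = inv (y \<otimes> s)" by (simp add: inv_mult_group)
  show "lk (iot (lam s f)) y = lk (rho s (iot f)) y"
    using a by (simp add: lookup_iot lookup_lam lookup_rho i)
qed auto

lemma iot_rho: "s \<in> S \<Longrightarrow> f \<in> EW \<Longrightarrow> iot (rho s f) = lam s (iot f)"
  using iot_lam [of s "iot f"] by (metis iot_EW iot_iot lam_EW rho_EW)

lemma barE_rho: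
  assumes s: "s \<in> S" and f: "f \<in> EW"
  shows "barE (rho s f) = rho s (barE f) - smul (qv - qinv) (barE f)"
  using f
proof (induction rule: EW_lam_induct)
  case one
  have "rho s (bvec \<one>) = lam s (bvec \<one>)" using s by (simp add: rho_e lam_e)
  then show ?case using s by (simp add: barE_lam lami_def)
next
  case (lam t f)
  then show ?case using s
    by (simp add: barE_lam lami_def lmap_diff lmap_smul smul_diff lam_rho flip: lam_rho)
qed (simp_all add: lmap_add lmap_smul smap_add smap_smul smul_add smul_diff smul_smul mult.commute)

lemma barE_iot: "f \<in> EW \<Longrightarrow> barE (iot f) = iot (barE f)"
proof (induction rule: EW_lam_induct)
  case one
  have "iot (bvec \<one>) = bvec \<one>" by (simp add: iot_def)
  then show ?case by simp
next
  case (lam s f)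
  then show ?case by (simp add: iot_lam barE_rho barE_lam lami_def lmap_diff lmap_smul)
qed (simp_all add: lmap_add lmap_smul smap_add smap_smul)

lemma iot_KL: "w \<in> carrier W \<Longrightarrow> iot (KL w) = KL (inv w)"
proof (rule KL_eqI)
  assume w: "w \<in> carrier W"
  fix y assume y: "y \<noteq> inv w"
  show "lk (iot (KL w)) y \<in> QA"
  proof (cases "y \<in> carrier W")
    case True
    then have "inv y \<noteq> w" using y by auto
    then show ?thesis using KL_QA w True by (simp add: lookup_iot)
  next
    case False
    then have "lk (iot (KL w)) y = 0" using EE_lookup [OF iot_EW [OF KL_EW [OF w]]] by blast
    then show ?thesis using QA_zero by simp
  qed
qed (auto simp: lookup_iot barE_iot)

lemma rho_KL_down:
  assumes s: "s \<in> S" and w: "w \<in> carrier W" and less: "len (w \<otimes> s) < len w"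
  shows "rho s (KL w) = smul (- qinv) (KL w)"
proof -
  have i: "s \<otimes> inv w = inv (w \<otimes> s)" using s w by (simp add: inv_mult_group)
  have "iot (rho s (KL w)) = lam s (KL (inv w))" using s w by (simp add: iot_rho iot_KL)
  also have "\<dots> = smul (- qinv) (iot (KL w))"
    using s w less by (subst lam_KL_down) (auto simp: i iot_KL)
  also have "\<dots> = iot (smul (- qinv) (KL w))" by (simp add: lmap_smul)
  finally show ?thesis using s w by (metis EE_smul KL_EW iot_iot rho_EW)
qed

end

lemma EE_in: "f \<in> EE A \<Longrightarrow> lk f k \<noteq> 0 \<Longrightarrow> k \<in> A"
  by (auto simp: EE_iff)

lemma single_eq_0 [simp]: "Poly_Mapping.single k c = 0 \<longleftrightarrow> c = 0"
  by (metis lookup_single_eq lookup_zero single_zero)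

context coxeter_system
begin

subsection \<open>The arrows of the Kazhdan--Lusztig graph\<close>

definition kmu :: "'w \<Rightarrow> 'w \<Rightarrow> int" where
  "kmu y w = (if bruhat_lt y w then mcoef (KL w) y else if bruhat_lt w y then mcoef (KL y) w else 0)"

definition ldes :: "'w \<Rightarrow> 'w set" where
  "ldes w = {s \<in> S. len (s \<otimes> w) < len w}"

definition karrow :: "'w \<Rightarrow> 'w \<Rightarrow> bool" where
  "karrow u v \<longleftrightarrow> u \<in> carrier W \<and> v \<in> carrier W \<and> \<not> ldes u \<subseteq> ldes v \<and> kmu u v \<noteq> 0"

lemma KL_lookup_up:
  assumes s: "s \<in> S" and w: "w \<in> carrier W" "len (s \<otimes> w) < len w"
    and y: "y \<in> carrier W" "len y < len (s \<otimes> y)"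
  shows "lk (KL w) y = - qv * lk (KL w) (s \<otimes> y)"
proof -
  have "lk (lam s (KL w)) y = lk (KL w) (s \<otimes> y)" using lookup_lam [OF s KL_EW [OF w(1)] y(1)] y(2) by simp
  then have "lk (KL w) (s \<otimes> y) = - qinv * lk (KL w) y" unfolding lam_KL_down [OF s w] by simp
  then show ?thesis by simp
qed

text \<open>The eigenvector equation for \<open>s\<close> ties the coefficient of q at
  \<open>y\<close> to the constant term at \<open>s y\<close>, and constant terms vanish off the
  diagonal. Hence arrows that raise the length come only from multiplication by a generator.\<close>

lemma mcoef_S_mult:
  assumes s: "s \<in> S" and w: "w \<in> carrier W" "len (s \<otimes> w) < len w"
    and y: "y \<in> carrier W" "len y < len (s \<otimes> y)"
  shows "mcoef (KL w) y = (if s \<otimes> y = w then 1 else 0)"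
proof -
  have m: "mcoef (KL w) y = lk (lk (KL w) (s \<otimes> y)) 0"
    unfolding mcoef_def KL_lookup_up [OF assms] by (simp add: lookup_qv_mult)
  show ?thesis
  proof (cases "s \<otimes> y = w")
    case True
    then show ?thesis using m w by simp
  next
    case False
    then show ?thesis using m KL_GG [OF w(1) False] by (auto simp: GG_def)
  qed
qed

lemma karrow_S_mult:
  assumes s: "s \<in> S" and w: "w \<in> carrier W" "len w < len (s \<otimes> w)"
  shows "karrow (s \<otimes> w) w"
proof -
  have lt: "bruhat_lt w (s \<otimes> w)" using bruhat_lt_S_left_iff [OF s w(1)] w by simp
  have "kmu (s \<otimes> w) w = 1"
    using mcoef_S_mult [OF s, of "s \<otimes> w" w] s w lt bruhat_lt_asym [OF lt] by (simp add: kmu_def)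
  moreover have "s \<in> ldes (s \<otimes> w)" "s \<notin> ldes w" using s w by (auto simp: ldes_def)
  ultimately show ?thesis using s w by (auto simp: karrow_def)
qed

text \<open>When \<open>s\<close> goes up at \<open>w\<close>, these are the coordinates of
  \<open>T_s C_w\<close> in the Kazhdan-Lusztig basis.\<close>

definition kstep :: "'w \<Rightarrow> 'w \<Rightarrow> ('w \<Rightarrow>\<^sub>0 laurent)" where
  "kstep s w = smul qv (bvec w) + bvec (s \<otimes> w) + (\<Sum>y\<in>Zset s w. smul (Poly_Mapping.single 0 (mcoef (KL w) y)) (bvec y))"

lemma finite_Zset: "finite (Zset s w)"
  unfolding Zset_def by (rule finite_subset [OF _ finite_bruhat_lower [of w]]) (auto simp: bruhat_lt_def)

lemma kstep_EW: "s \<in> S \<Longrightarrow> w \<in> carrier W \<Longrightarrow> kstep s w \<in> EW"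
  unfolding kstep_def by (intro EE_add EE_sum EE_smul EE_e) (auto simp: Zset_def dest: bruhat_ltD)

lemma lin_kstep:
  assumes "s \<in> S" "w \<in> carrier W" "len w < len (s \<otimes> w)"
  shows "lam s (KL w) = lin KL (kstep s w)"
  unfolding lam_KL_up [OF assms] kstep_def by (simp add: lin_add lin_smul lmap_sum)

lemma lookup_kstep:
  assumes s: "s \<in> S" and w: "w \<in> carrier W" "len w < len (s \<otimes> w)" and u: "u \<noteq> w"
  shows "lk (kstep s w) u = (if u = s \<otimes> w then 1
    else if u \<in> Zset s w then Poly_Mapping.single 0 (mcoef (KL w) u) else 0)"
proof -
  have "lk (\<Sum>y\<in>Zset s w. smul (Poly_Mapping.single 0 (mcoef (KL w) y)) (bvec y)) u =
      (\<Sum>y\<in>Zset s w. if y = u then Poly_Mapping.single 0 (mcoef (KL w) y) else 0)"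
    unfolding lookup_sum by (intro sum.cong) (auto simp: lookup_e when_def)
  moreover have "s \<otimes> w \<notin> Zset s w" using bruhat_lt_len w by (fastforce simp: Zset_def)
  ultimately show ?thesis using u finite_Zset by (auto simp: kstep_def lookup_add lookup_e)
qed

text \<open>Take \<open>s\<close> in the descent set of \<open>u\<close> but not of
  \<open>v\<close>. If \<open>u\<close> is below \<open>v\<close>, it is one of the correction terms
  of the recursion; otherwise the coefficient at \<open>v\<close> in \<open>KL u\<close> is nonzero
  only for \<open>u = s v\<close>, the leading term.\<close>

lemma karrow_kstep:
  assumes "karrow u v"
  shows "\<exists>s\<in>S. len v < len (s \<otimes> v) \<and> lk (kstep s v) u \<noteq> 0"
proof -
  have c: "u \<in> carrier W" "v \<in> carrier W" "kmu u v \<noteq> 0" using assms by (auto simp: karrow_def)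
  obtain s where "s \<in> ldes u" "s \<notin> ldes v" using assms by (auto simp: karrow_def)
  then have s: "s \<in> S" "len (s \<otimes> u) < len u" "len v < len (s \<otimes> v)"
    using len_S_mult [of s v] c by (auto simp: ldes_def)
  have uv: "u \<noteq> v" using s by auto
  show ?thesis
  proof (cases "bruhat_lt u v")
    case True
    then have "u \<in> Zset s v" "mcoef (KL v) u \<noteq> 0" using s c(3) by (auto simp: Zset_def kmu_def)
    then have "lk (kstep s v) u \<noteq> 0" using lookup_kstep [OF s(1) c(2) s(3) uv] by simp
    then show ?thesis using s by blast
  next
    case False
    then have "mcoef (KL u) v \<noteq> 0" using c(3) by (auto simp: kmu_def split: if_splits)
    then have "u = s \<otimes> v" using mcoef_S_mult [OF s(1) c(1) s(2) c(2) s(3)] by (auto split: if_splits)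
    then have "lk (kstep s v) u \<noteq> 0" using lookup_kstep [OF s(1) c(2) s(3) uv] by simp
    then show ?thesis using s by blast
  qed
qed

lemma kstep_karrow:
  assumes s: "s \<in> S" and w: "w \<in> carrier W" "len w < len (s \<otimes> w)" and u: "lk (kstep s w) u \<noteq> 0"
  shows "u = w \<or> karrow u w"
proof (rule disjCI)
  assume "\<not> karrow u w"
  show "u = w"
  proof (rule ccontr)
    assume uw: "u \<noteq> w"
    have "u \<noteq> s \<otimes> w" using \<open>\<not> karrow u w\<close> karrow_S_mult [OF s w] by auto
    then have Z: "u \<in> Zset s w" "mcoef (KL w) u \<noteq> 0"
      using u unfolding lookup_kstep [OF s w uw] by (auto split: if_splits)
    then have "bruhat_lt u w" "s \<in> ldes u" "s \<notin> ldes w" using s w by (auto simp: Zset_def ldes_def)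
    then have "karrow u w" using Z(2) w bruhat_ltD(2) by (auto simp: karrow_def kmu_def)
    then show False using \<open>\<not> karrow u w\<close> by blast
  qed
qed

lemma KL_tri: "w \<in> carrier W \<Longrightarrow> lk (KL w) w = 1 \<and> (\<forall>y. lk (KL w) y \<noteq> 0 \<longrightarrow> y = w \<or> len y < len w)"
  using unitri_tri [where l = len and R = bruhat_lt and v = KL and I = "carrier W" and w = w]
    unitri_KL bruhat_lt_len by blast

text \<open>Translates order-closed sets of vertices into left ideals. It is applied to the vertices
  of \<open>D_J wJ\<close> that lie outside the cell of \<open>wJ\<close>.\<close>

lemma span_KL_lam:
  assumes X: "X \<subseteq> carrier W" "\<And>u v. karrow u v \<Longrightarrow> v \<in> X \<Longrightarrow> u \<in> X"
    and s: "s \<in> S" and f: "f \<in> EE X"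
  shows "lam s (lin KL f) \<in> lin KL ` EE X"
proof -
  let ?g = "\<lambda>w. if len w < len (s \<otimes> w) then kstep s w else smul (- qinv) (bvec w)"
  have "lam s (lin KL f) = lin (\<lambda>w. lam s (KL w)) f" by (rule lmap_lin_expand) simp
  also have "\<dots> = lin (\<lambda>w. lin KL (?g w)) f"
  proof (rule lin_cong [OF f])
    fix w assume "w \<in> X"
    then have w: "w \<in> carrier W" using X by blast
    show "lam s (KL w) = lin KL (?g w)"
      using lin_kstep [OF s w] lam_KL_down [OF s w] len_S_mult [OF s w] by (auto simp: lin_smul)
  qed
  also have "\<dots> = lin KL (lin ?g f)" by (simp only: lin_lin)
  finally have eq: "lam s (lin KL f) = lin KL (lin ?g f)" .
  have "?g w \<in> EE X" if w: "w \<in> X" for w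
  proof (cases "len w < len (s \<otimes> w)")
    case True
    have "w \<in> carrier W" using w X by blast
    then have "u \<in> X" if "lk (kstep s w) u \<noteq> 0" for u using kstep_karrow [OF s _ True that] X(2) w by blast
    then show ?thesis using True by (auto simp: EE_iff)
  qed (use w in auto)
  then have "lin ?g f \<in> EE X" by (intro EE_lin [OF f])
  then show ?thesis unfolding eq by blast
qed

end

context coxeter_parabolic
begin

section \<open>The left ideal generated by the longest element of a parabolic subgroup\<close>

definition LL :: "('w \<Rightarrow>\<^sub>0 laurent) set" where
  "LL = {f \<in> EW. \<forall>r\<in>J. rho r f = smul (- qinv) f}"

lemma LL_EW: "f \<in> LL \<Longrightarrow> f \<in> EW"
  and LL_rho: "f \<in> LL \<Longrightarrow> r \<in> J \<Longrightarrow> rho r f = smul (- qinv) f"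
  and LL_I: "f \<in> EW \<Longrightarrow> (\<And>r. r \<in> J \<Longrightarrow> rho r f = smul (- qinv) f) \<Longrightarrow> f \<in> LL"
  by (auto simp: LL_def)

declare LL_EW [simp]

lemma LL_zero [simp]: "0 \<in> LL"
  by (rule LL_I) (simp_all add: lmap_zero)

lemma LL_add [simp]: "f \<in> LL \<Longrightarrow> g \<in> LL \<Longrightarrow> f + g \<in> LL"
  by (rule LL_I) (simp_all add: lmap_add LL_rho smul_add)

lemma LL_diff [simp]: "f \<in> LL \<Longrightarrow> g \<in> LL \<Longrightarrow> f - g \<in> LL"
  by (rule LL_I) (simp_all add: lmap_diff LL_rho smul_diff)

lemma LL_smul [simp]: "f \<in> LL \<Longrightarrow> smul a f \<in> LL"
  by (rule LL_I) (simp_all add: lmap_smul LL_rho smul_smul mult.commute)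

lemma LL_lam [simp]: "s \<in> S \<Longrightarrow> f \<in> LL \<Longrightarrow> lam s f \<in> LL"
proof (rule LL_I)
  fix r assume a: "s \<in> S" "f \<in> LL" "r \<in> J"
  then have "rho r (lam s f) = lam s (rho r f)" by (simp add: lam_rho)
  then show "rho r (lam s f) = smul (- qinv) (lam s f)" using a by (simp add: LL_rho lmap_smul)
qed simp

lemma LL_sum: "(\<And>i. i \<in> A \<Longrightarrow> f i \<in> LL) \<Longrightarrow> sum f A \<in> LL"
  by (induction A rule: infinite_finite_induct) auto

lemma LL_lin: "f \<in> EE A \<Longrightarrow> (\<And>w. w \<in> A \<Longrightarrow> g w \<in> LL) \<Longrightarrow> lin g f \<in> LL"
  unfolding lin_def by (intro LL_sum LL_smul) (auto simp: EE_def)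

lemma LL_barE: "f \<in> LL \<Longrightarrow> barE f \<in> LL"
proof -
  assume f: "f \<in> LL"
  have "rho r (barE f) = smul (- qinv) (barE f)" if r: "r \<in> J" for r
  proof -
    have "rho r (barE f) = barE (rho r f) + smul (qv - qinv) (barE f)"
      using barE_rho [of r f] r f by simp
    also have "barE (rho r f) = smul (- qv) (barE f)" using f r by (simp add: LL_rho smap_smul lbar_minus)
    finally show ?thesis by (simp flip: smul_add_left)
  qed
  then show ?thesis using f by (intro LL_I) auto
qed

lemma lookup_LL_up:
  assumes f: "f \<in> LL" and r: "r \<in> J" and y: "y \<in> carrier W" "len y < len (y \<otimes> r)"
  shows "lk f y = - qv * lk f (y \<otimes> r)"
proof -
  have "lk (rho r f) y = lk f (y \<otimes> r)" using lookup_rho [of r f y] f r y by simp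
  moreover have "rho r f = smul (- qinv) f" using f r by (rule LL_rho)
  ultimately have "lk f (y \<otimes> r) = - qinv * lk f y" by simp
  then show ?thesis by simp
qed

text \<open>Climbing the coset of \<open>d\<close> from \<open>u\<close> to \<open>wJ\<close> one
  generator at a time costs a factor \<open>-q\<close> per step. So an element of \<open>LL\<close>
  is known from its values at the tops of the cosets, which is how equalities in \<open>LL\<close>
  are proved.\<close>

lemma lookup_LL:
  assumes f: "f \<in> LL" and d: "d \<in> DJ" and u: "u \<in> WJ"
  shows "lk f (d \<otimes> u) = (- qv) ^ (len wJ - len u) * lk f (d \<otimes> wJ)"
  using u
proof (induction "len wJ - len u" arbitrary: u rule: less_induct)
  case less
  show ?case
  proof (cases "u = wJ")
    case False
    then obtain r where r: "r \<in> J" "\<not> len (u \<otimes> r) < len u" using wJ_unique less.prems by blast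
    then have ur: "len (u \<otimes> r) = Suc (len u)" using len_mult_S [of r u] less.prems by auto
    have urJ: "u \<otimes> r \<in> WJ" using less.prems r by simp
    have le: "len (u \<otimes> r) \<le> len wJ" using len_wJ urJ by blast
    have "lk f (d \<otimes> u) = - qv * lk f (d \<otimes> u \<otimes> r)"
      using len_DJ_mult [OF d less.prems] len_DJ_mult [OF d urJ] ur d less.prems r
      by (intro lookup_LL_up [OF f r(1)]) (auto simp: m_assoc)
    also have "d \<otimes> u \<otimes> r = d \<otimes> (u \<otimes> r)" using d less.prems r by (simp add: m_assoc)
    also have "lk f \<dots> = (- qv) ^ (len wJ - len (u \<otimes> r)) * lk f (d \<otimes> wJ)"
      using less.hyps urJ ur le by auto
    also have "- qv * \<dots> = (- qv) ^ Suc (len wJ - len (u \<otimes> r)) * lk f (d \<otimes> wJ)" by simp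
    also have "Suc (len wJ - len (u \<otimes> r)) = len wJ - len u" using ur le by simp
    finally show ?thesis .
  qed simp
qed

lemma LL_eqI:
  assumes "f \<in> LL" "g \<in> LL" "\<And>d. d \<in> DJ \<Longrightarrow> lk f (d \<otimes> wJ) = lk g (d \<otimes> wJ)"
  shows "f = g"
proof (rule EW_eqI)
  fix y assume "y \<in> carrier W"
  then obtain d u where "d \<in> DJ" "u \<in> WJ" "y = d \<otimes> u" using ex_min_reps [OF J_S] by blast
  then show "lk f y = lk g y" using lookup_LL assms by simp
qed (use assms in auto)

text \<open>This will be \<open>T_d C_{wJ}\<close>, the image of \<open>b^J_d\<close>: the
  coefficients are those of \<open>C_{wJ}\<close>, translated to the coset of
  \<open>d\<close>.\<close>

definition Bd :: "'w \<Rightarrow> ('w \<Rightarrow>\<^sub>0 laurent)" where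
  "Bd d = (\<Sum>u\<in>WJ. smul ((- qv) ^ (len wJ - len u)) (bvec (d \<otimes> u)))"

lemma Bd_EW [simp]: "d \<in> DJ \<Longrightarrow> Bd d \<in> EW"
  unfolding Bd_def by (intro EE_sum EE_smul EE_e) auto

lemma lookup_Bd:
  assumes d: "d \<in> DJ" "d' \<in> DJ" and u: "u \<in> WJ"
  shows "lk (Bd d) (d' \<otimes> u) = (if d = d' then (- qv) ^ (len wJ - len u) else 0)"
proof -
  have "lk (Bd d) (d' \<otimes> u) = (\<Sum>v\<in>WJ. if v = u then (if d = d' then (- qv) ^ (len wJ - len v) else 0) else 0)"
    unfolding Bd_def lookup_sum
  proof (rule sum.cong)
    fix v assume v: "v \<in> WJ"
    have "d \<otimes> v = d' \<otimes> u \<longleftrightarrow> d = d' \<and> v = u" using min_reps_unique [OF J_S d v u] by blast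
    then show "lk (smul ((- qv) ^ (len wJ - len v)) (bvec (d \<otimes> v))) (d' \<otimes> u) =
        (if v = u then (if d = d' then (- qv) ^ (len wJ - len v) else 0) else 0)"
      by (auto simp: lookup_e when_def)
  qed simp
  then show ?thesis using fin_J u by simp
qed

lemma lookup_Bd_wJ: "d \<in> DJ \<Longrightarrow> d' \<in> DJ \<Longrightarrow> lk (Bd d) (d' \<otimes> wJ) = (if d = d' then 1 else 0)"
  using lookup_Bd [of d d' wJ] wJ_WJ by simp

text \<open>Right multiplication by \<open>r\<close> pairs the elements of a coset, and the
  coefficients of a pair differ by the factor \<open>-q\<close>; this is exactly the eigenvector
  condition on a pair.\<close>

lemma Bd_LL [simp]: "d \<in> DJ \<Longrightarrow> Bd d \<in> LL"
proof -
  assume d: "d \<in> DJ"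
  have "rho r (Bd d) = smul (- qinv) (Bd d)" if r: "r \<in> J" for r
  proof (rule EW_eqI)
    fix y assume yc: "y \<in> carrier W"
    then obtain d' u where y: "d' \<in> DJ" "u \<in> WJ" "y = d' \<otimes> u" using ex_min_reps [OF J_S] by blast
    have ur: "u \<otimes> r \<in> WJ" "y \<otimes> r = d' \<otimes> (u \<otimes> r)" using y r by (simp_all add: m_assoc)
    have len: "len (y \<otimes> r) < len y \<longleftrightarrow> len (u \<otimes> r) < len u"
      unfolding ur(2) unfolding y(3) using len_DJ_mult [OF y(1)] ur y(2) by simp
    have le: "len u \<le> len wJ" "len (u \<otimes> r) \<le> len wJ" using len_wJ ur y(2) by auto
    show "lk (rho r (Bd d)) y = lk (smul (- qinv) (Bd d)) y"
    proof (cases "len (u \<otimes> r) < len u")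
      case True
      then have "len wJ - len (u \<otimes> r) = Suc (len wJ - len u)"
        using len_mult_S [of r u] r y(2) le by auto
      then have "lk (Bd d) (y \<otimes> r) = - qv * lk (Bd d) y"
        unfolding ur(2) unfolding y(3) using lookup_Bd [OF d y(1)] ur(1) y(2) by simp
      then show ?thesis using lookup_rho [of r "Bd d" y] d r yc True len
        by (simp add: algebra_simps)
    next
      case False
      then have "len wJ - len u = Suc (len wJ - len (u \<otimes> r))"
        using len_mult_S [of r u] r y(2) le by auto
      then have "lk (Bd d) y = - qv * lk (Bd d) (y \<otimes> r)"
        unfolding ur(2) unfolding y(3) using lookup_Bd [OF d y(1)] ur(1) y(2) by simp
      then show ?thesis using lookup_rho [of r "Bd d" y] d r yc False len by simp
    qed
  qed (use d r in auto)
  then show ?thesis using d by (intro LL_I) auto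
qed

lemma lam_Bd_up:
  assumes d: "d \<in> DJ" and s: "s \<in> S" and "s \<otimes> d \<in> DJ" "len d < len (s \<otimes> d)"
  shows "lam s (Bd d) = Bd (s \<otimes> d)"
proof -
  have "lam s (bvec (d \<otimes> u)) = bvec (s \<otimes> d \<otimes> u)" if u: "u \<in> WJ" for u
  proof -
    have "len (s \<otimes> (d \<otimes> u)) = len (s \<otimes> d) + len u" using len_DJ_mult [OF assms(3) u] u d s by (simp add: m_assoc)
    then show ?thesis using len_DJ_mult [OF d u] assms u by (simp add: lam_e m_assoc)
  qed
  then show ?thesis unfolding Bd_def by (simp add: lmap_sum lmap_smul)
qed

lemma lam_Bd_down:
  assumes d: "d \<in> DJ" and s: "s \<in> S" and "s \<otimes> d \<in> DJ" "len (s \<otimes> d) < len d"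
  shows "lam s (Bd d) = Bd (s \<otimes> d) + smul (qv - qinv) (Bd d)"
proof -
  have "Bd d = lam s (Bd (s \<otimes> d))" using lam_Bd_up [of "s \<otimes> d" s] assms by simp
  then show ?thesis using lam_lam [OF s, of "Bd (s \<otimes> d)"] assms by simp
qed

text \<open>Compare at the coset tops \<open>d' wJ\<close>. If \<open>s\<close> moves the coset of
  \<open>d'\<close>, neither that coset nor its image is the coset of \<open>d\<close>, which
  \<open>s\<close> fixes, so both sides vanish there. If \<open>s\<close> fixes it, the values are
  computed inside the coset.\<close>

lemma lam_Bd_fixed:
  assumes d: "d \<in> DJ" and s: "s \<in> S" and n: "s \<otimes> d \<notin> DJ"
  shows "lam s (Bd d) = smul (- qinv) (Bd d)"
proof (rule LL_eqI)
  fix d' assume d': "d' \<in> DJ"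
  have y: "d' \<otimes> wJ \<in> carrier W" using d' by simp
  have lam: "lk (lam s (Bd d)) (d' \<otimes> wJ) = lk (Bd d) (s \<otimes> (d' \<otimes> wJ)) +
      (if len (s \<otimes> (d' \<otimes> wJ)) < len (d' \<otimes> wJ) then (qv - qinv) * lk (Bd d) (d' \<otimes> wJ) else 0)"
    using lookup_lam [OF s Bd_EW [OF d] y] .
  show "lk (lam s (Bd d)) (d' \<otimes> wJ) = lk (smul (- qinv) (Bd d)) (d' \<otimes> wJ)"
  proof (cases "s \<otimes> d' \<in> DJ")
    case True
    have ne: "d \<noteq> d'" "d \<noteq> s \<otimes> d'" using True n s d' by auto
    have "s \<otimes> (d' \<otimes> wJ) = (s \<otimes> d') \<otimes> wJ" using s d' by (simp add: m_assoc)
    then have "lk (Bd d) (s \<otimes> (d' \<otimes> wJ)) = 0" using lookup_Bd_wJ [OF d True] ne by simp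
    then show ?thesis using lam lookup_Bd_wJ [OF d d'] ne by simp
  next
    case False
    obtain r where r: "r \<in> J" "s \<otimes> d' = d' \<otimes> r" "len (s \<otimes> (d' \<otimes> wJ)) < len (d' \<otimes> wJ)"
      using DJ_S_cases [OF d' s] False by metis
    have "s \<otimes> (d' \<otimes> wJ) = (s \<otimes> d') \<otimes> wJ" using s d' by (simp add: m_assoc)
    also have "\<dots> = d' \<otimes> (r \<otimes> wJ)" using d' r(1) unfolding r(2) by (simp add: m_assoc)
    finally have eq: "s \<otimes> (d' \<otimes> wJ) = d' \<otimes> (r \<otimes> wJ)" .
    have rw: "r \<otimes> wJ \<in> WJ" "len wJ - len (r \<otimes> wJ) = 1"
      using r(1) wJ_WJ wJ_descents(2) [OF r(1)] len_S_mult [of r wJ] by auto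
    \<comment> \<open>For \<open>d = d'\<close> this gives \<open>-q\<close> together with the
      descent term \<open>q - q^-1\<close>, hence the eigenvalue \<open>-q^-1\<close>.\<close>
    have "lk (Bd d) (s \<otimes> (d' \<otimes> wJ)) = (if d = d' then - qv else 0)"
      unfolding eq using lookup_Bd [OF d d' rw(1)] rw(2) by simp
    then show ?thesis using lam lookup_Bd_wJ [OF d d'] r(3) by simp
  qed
qed (use d s in auto)

text \<open>On \<^term>\<open>LL\<close> these are the coordinates with respect to the basis \<^term>\<open>Bd\<close>.\<close>

definition co :: "('w \<Rightarrow>\<^sub>0 laurent) \<Rightarrow> ('w \<Rightarrow>\<^sub>0 laurent)" where
  "co = lin (\<lambda>w. if w \<otimes> inv wJ \<in> DJ then bvec (w \<otimes> inv wJ) else 0)"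

lemma lmap_co [simp]: "lmap co"
  by (simp add: co_def)

lemma lookup_co: "f \<in> EW \<Longrightarrow> lk (co f) d = (if d \<in> DJ then lk f (d \<otimes> wJ) else 0)"
proof (induction rule: EE_induct)
  case (single k a)
  have "k \<otimes> inv wJ = d \<longleftrightarrow> k = d \<otimes> wJ" if "d \<in> DJ"
    using single that inv_solve_right' [of d k wJ] by (auto simp: m_assoc)
  then show ?case by (auto simp: co_def lookup_e lookup_single when_def)
qed (simp_all add: lmap_zero lmap_add lookup_add)

lemma co_EE [simp]: "f \<in> EW \<Longrightarrow> co f \<in> EE DJ"
  by (simp add: EE_iff lookup_co)

lemma lin_Bd_LL [simp]: "f \<in> EE DJ \<Longrightarrow> lin Bd f \<in> LL"
  by (erule LL_lin) simp

lemma co_lin_Bd [simp]: "f \<in> EE DJ \<Longrightarrow> co (lin Bd f) = f"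
proof -
  assume f: "f \<in> EE DJ"
  have "co (lin Bd f) = lin bvec f"
    unfolding lmap_lin_expand [OF lmap_co]
  proof (rule lin_cong [OF f])
    fix d assume d: "d \<in> DJ"
    show "co (Bd d) = bvec d"
      by (rule poly_mapping_eqI) (use d in \<open>auto simp: lookup_co lookup_Bd_wJ lookup_e when_def\<close>)
  qed
  then show ?thesis by (simp add: lin_id)
qed

lemma lin_Bd_co [simp]: "f \<in> LL \<Longrightarrow> lin Bd (co f) = f"
proof (rule LL_eqI)
  fix d assume f: "f \<in> LL" and d: "d \<in> DJ"
  have "lk (lin Bd (co f)) (d \<otimes> wJ) = lk (co (lin Bd (co f))) d"
    using lookup_co [of "lin Bd (co f)" d] f d by simp
  also have "\<dots> = lk (co f) d" using f by simp
  finally show "lk (lin Bd (co f)) (d \<otimes> wJ) = lk f (d \<otimes> wJ)" using f d by (simp add: lookup_co)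
qed simp_all

definition DwJ :: "'w set" where "DwJ = (\<lambda>d. d \<otimes> wJ) ` DJ"

lemma DwJ_carrier: "DwJ \<subseteq> carrier W"
  by (auto simp: DwJ_def)

lemma DwJ_iff: "w \<in> carrier W \<Longrightarrow> w \<in> DwJ \<longleftrightarrow> (\<forall>r\<in>J. len (w \<otimes> r) < len w)"
  using DJ_wJ_iff [of w] by (auto simp: DwJ_def)

lemma KL_LL: "w \<in> DwJ \<Longrightarrow> KL w \<in> LL"
proof (rule LL_I)
  assume w: "w \<in> DwJ"
  then have wc: "w \<in> carrier W" using DwJ_carrier by blast
  then show "KL w \<in> EW" by simp
  fix r assume "r \<in> J"
  then show "rho r (KL w) = smul (- qinv) (KL w)" using w wc DwJ_iff [OF wc] by (intro rho_KL_down) auto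
qed

text \<open>Remove the part supported on \<open>DwJ\<close> and take a longest \<open>w\<close> in
  what remains. Some \<open>r\<close> in \<open>J\<close> goes up at \<open>w\<close>, so membership
  in \<open>LL\<close> makes the coefficient at \<open>w\<close> a multiple of the one at
  \<open>w r\<close>, where nothing in the expansion reaches.\<close>

lemma LL_expand:
  assumes a: "a \<in> EW" and L: "lin KL a \<in> LL"
  shows "a \<in> EE DwJ"
proof (rule ccontr)
  assume "a \<notin> EE DwJ"
  then obtain x where x: "x \<notin> DwJ" "lk a x \<noteq> 0" by (auto simp: EE_iff)
  let ?b = "restr (- DwJ) a" and ?c = "restr DwJ a"
  have abc: "a = ?b + ?c" by (rule poly_mapping_eqI) (simp add: lookup_add)
  have c: "?c \<in> EE DwJ" using restr_EE [OF a, of DwJ] by (rule EE_mono) auto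
  have bW: "?b \<in> EW" using restr_EE [OF a, of "- DwJ"] by (rule EE_mono) auto
  have "lin KL ?c \<in> LL" using c KL_LL by (rule LL_lin)
  moreover have "lin KL ?b = lin KL a - lin KL ?c" using abc by (metis add_diff_cancel_right' lin_add)
  ultimately have bL: "lin KL ?b \<in> LL" using L by simp
  have "?b \<noteq> 0" using x by (metis ComplI lookup_restr lookup_zero)
  then obtain w where w: "w \<in> Poly_Mapping.keys ?b" "\<And>y. y \<in> Poly_Mapping.keys ?b \<Longrightarrow> len y \<le> len w"
    using ex_max_key [of ?b len] by blast
  have "lk ?b w \<noteq> 0" using w(1) by (simp only: in_keys_iff not_False_eq_True)
  then have wc: "w \<in> carrier W" "w \<notin> DwJ" using EE_in [OF bW] by (auto split: if_splits)
  then obtain r where r: "r \<in> J" "\<not> len (w \<otimes> r) < len w" using DwJ_iff by blast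
  then have up: "len w < len (w \<otimes> r)" using len_mult_S [of r w] wc by auto
  have "lk (lin KL ?b) w = lk ?b w"
    using lin_coeff_max(1) [where l = len, OF KL_tri bW w] .
  moreover have "lk (lin KL ?b) (w \<otimes> r) = 0"
    using lin_coeff_max(2) [where l = len, OF KL_tri bW w up] .
  moreover have "lk (lin KL ?b) w = - qv * lk (lin KL ?b) (w \<otimes> r)"
    using lookup_LL_up [OF bL r(1) wc(1) up] .
  ultimately show False using w(1) by (simp add: in_keys_iff)
qed

text \<open>An arrow into \<open>v\<close> is a nonzero coordinate of some \<open>T_s C_v\<close>.
  This vector stays in the left ideal \<open>LL\<close>, whose elements involve only vertices from
  \<open>DwJ\<close>.\<close>

lemma karrow_DwJ:
  assumes "karrow u v" "v \<in> DwJ"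
  shows "u \<in> DwJ"
proof -
  obtain s where s: "s \<in> S" "len v < len (s \<otimes> v)" "lk (kstep s v) u \<noteq> 0"
    using karrow_kstep [OF assms(1)] by blast
  have v: "v \<in> carrier W" using assms(2) DwJ_carrier by blast
  have "lin KL (kstep s v) \<in> LL" using lin_kstep [OF s(1) v s(2)] KL_LL [OF assms(2)] s(1) LL_lam by metis
  then have "kstep s v \<in> EE DwJ" using LL_expand kstep_EW [OF s(1) v] by blast
  then show ?thesis using s(3) by (rule EE_in)
qed

definition cK :: "'w \<Rightarrow> ('w \<Rightarrow>\<^sub>0 laurent)" where "cK d = co (KL (d \<otimes> wJ))"

lemma KL_LL_DJ [simp]: "d \<in> DJ \<Longrightarrow> KL (d \<otimes> wJ) \<in> LL"
  by (rule KL_LL) (auto simp: DwJ_def)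

lemma cK_EE [simp]: "d \<in> DJ \<Longrightarrow> cK d \<in> EE DJ"
  by (simp add: cK_def)

lemma lin_Bd_cK [simp]: "d \<in> DJ \<Longrightarrow> lin Bd (cK d) = KL (d \<otimes> wJ)"
  by (simp add: cK_def)

lemma bruhat_lt_wJ:
  "d \<in> DJ \<Longrightarrow> d' \<in> DJ \<Longrightarrow> bruhat_lt (d \<otimes> wJ) (d' \<otimes> wJ) \<Longrightarrow> bruhat_lt d d'"
  using bruhat_le_min_reps [OF J_S _ _ wJ_WJ wJ_WJ] by (auto simp: bruhat_lt_def)

lemma unitri_cK: "unitri bruhat_lt DJ cK"
  unfolding unitri_def
proof (intro ballI conjI allI impI)
  fix w assume w: "w \<in> DJ"
  show "cK w \<in> EE DJ" "lk (cK w) w = 1" using w by (simp_all add: cK_def lookup_co)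
  fix y assume y: "y \<noteq> w"
  show "lk (cK w) y \<in> QA" using w y KL_QA [of "w \<otimes> wJ" "y \<otimes> wJ"] QA_zero by (simp add: cK_def lookup_co)
  assume "lk (cK w) y \<noteq> 0"
  then have yD: "y \<in> DJ" "lk (KL (w \<otimes> wJ)) (y \<otimes> wJ) \<noteq> 0" using w by (auto simp: cK_def lookup_co split: if_splits)
  then have "bruhat_lt (y \<otimes> wJ) (w \<otimes> wJ)" using KL_le w y by (auto simp: bruhat_lt_def)
  then show "bruhat_lt y w" using bruhat_lt_wJ yD w by blast
qed

lemma mcoef_not_bruhat:
  "w \<in> carrier W \<Longrightarrow> \<not> bruhat_le y w \<Longrightarrow> mcoef (KL w) y = 0"
  using KL_le [of w y] by (cases "lk (KL w) y = 0") (simp_all add: mcoef_def)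

text \<open>On \<open>DJ\<close> the Bruhat order may hold without holding after multiplication by the longest element;
  in that case the coefficient vanishes anyway.\<close>

lemma kmu_wJ:
  assumes "y \<in> DJ" "w \<in> DJ"
  shows "kmu (y \<otimes> wJ) (w \<otimes> wJ) = (if bruhat_lt y w then mcoef (KL (w \<otimes> wJ)) (y \<otimes> wJ)
    else if bruhat_lt w y then mcoef (KL (y \<otimes> wJ)) (w \<otimes> wJ) else 0)"
proof -
  have z: "mcoef (KL (b \<otimes> wJ)) (a \<otimes> wJ) = 0" if "a \<in> DJ" "b \<in> DJ" "\<not> bruhat_lt (a \<otimes> wJ) (b \<otimes> wJ)" "a \<noteq> b" for a b
    using that mcoef_not_bruhat by (auto simp: bruhat_lt_def)
  have n: "bruhat_lt a b \<Longrightarrow> a \<noteq> b" for a b by auto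
  show ?thesis unfolding kmu_def
    using z [OF assms] z [OF assms(2,1)] bruhat_lt_wJ [OF assms] bruhat_lt_wJ [OF assms(2,1)]
      bruhat_lt_asym [of y w] n [of y w] n [of w y]
    by (cases "bruhat_lt y w"; cases "bruhat_lt w y"; cases "y = w") auto
qed

lemma ldes_wJ:
  assumes "d \<in> DJ"
  shows "ldes (d \<otimes> wJ) = Desc J d"
proof -
  have "s \<in> ldes (d \<otimes> wJ) \<longleftrightarrow> s \<in> Desc J d" if s: "s \<in> S" for s
  proof -
    note iff = bruhat_lt_S_left_iff [OF s DJ_closed [OF assms]]
    show ?thesis
      by (rule DJ_S_cases [OF assms s])
        (use s assms iff in \<open>auto simp: ldes_def Desc_def SD_def WD_def\<close>)
  qed
  then show ?thesis by (auto simp: ldes_def Desc_def SD_def WD_def)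
qed

end

lemma lin_add_fun: "lin (\<lambda>u. a u + b u) f = lin a f + lin b f"
  by (simp add: lin_def smul_add sum.distrib)

lemma lin_smul_fun: "lin (\<lambda>u. smul c (a u)) f = smul c (lin a f)"
  by (simp add: lin_def smul_sum smul_smul mult.commute)

section \<open>The Hecke algebra\<close>

lemma free_algebra_simps [simp]:
  "carrier (free_algebra A) = EE (lists A)"
  "\<one>\<^bsub>free_algebra A\<^esub> = bvec []" "\<zero>\<^bsub>free_algebra A\<^esub> = 0" "f \<oplus>\<^bsub>free_algebra A\<^esub> g = f + g"
  by (simp_all add: free_algebra_def EE_def bvec_def)

lemma free_algebra_mult: "f \<otimes>\<^bsub>free_algebra A\<^esub> g = lin (\<lambda>u. lin (\<lambda>v. bvec (u @ v)) g) f"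
  by (simp add: free_algebra_def lin_def smul_sum smul_smul flip: single_eq_smul)

lemma free_algebra_closed: "f \<in> EE (lists A) \<Longrightarrow> g \<in> EE (lists A) \<Longrightarrow> f \<otimes>\<^bsub>free_algebra A\<^esub> g \<in> EE (lists A)"
  unfolding free_algebra_mult by (intro EE_lin [where A = "lists A"] EE_e) simp_all

lemma ring_free_algebra: "ring (free_algebra A)"
proof (rule ringI)
  show "abelian_group (free_algebra A)"
  proof (rule abelian_groupI)
    fix f assume "f \<in> carrier (free_algebra A)"
    then show "\<exists>g\<in>carrier (free_algebra A). g \<oplus>\<^bsub>free_algebra A\<^esub> f = \<zero>\<^bsub>free_algebra A\<^esub>"
      by (intro bexI [of _ "- f"]) auto
  qed (auto simp: add.assoc add.commute)
  show "monoid (free_algebra A)"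
  proof (rule monoidI)
    fix f g h
    show "f \<otimes>\<^bsub>free_algebra A\<^esub> g \<otimes>\<^bsub>free_algebra A\<^esub> h = f \<otimes>\<^bsub>free_algebra A\<^esub> (g \<otimes>\<^bsub>free_algebra A\<^esub> h)"
      by (simp add: free_algebra_mult lin_lin)
  qed (simp_all add: free_algebra_closed, simp_all add: free_algebra_mult lin_id)
qed (simp_all add: free_algebra_mult lin_add lin_add_fun)

lemma free_algebra_scalar:
  "Poly_Mapping.single [] a \<otimes>\<^bsub>free_algebra A\<^esub> f = smul a f"
  "f \<otimes>\<^bsub>free_algebra A\<^esub> Poly_Mapping.single [] a = smul a f"
  by (simp_all add: free_algebra_mult lin_smul_fun lin_id)

context coxeter_system
begin

abbreviation "F \<equiv> free_algebra S"
abbreviation "FF \<equiv> EE (lists S)"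

lemma FF_basics [simp, intro]: "Poly_Mapping.single [] a \<in> FF" "s \<in> S \<Longrightarrow> Poly_Mapping.single [s] a \<in> FF"
  "ws \<in> lists S \<Longrightarrow> bvec ws \<in> FF"
  by (auto intro!: EE_single EE_e)

lemma hecke_relators_FF: "hecke_relators \<subseteq> FF"
  unfolding hecke_relators_def by (auto intro!: EE_diff EE_single alt_word_in_lists) (metis in_listsD alt_word_in_lists)+

lemma ideal_hecke: "ideal hecke_ideal F"
  unfolding hecke_ideal_def
  by (rule ring.genideal_ideal [OF ring_free_algebra]) (simp add: hecke_relators_FF)

lemma relators_in_ideal: "hecke_relators \<subseteq> hecke_ideal"
  unfolding hecke_ideal_def
  by (rule ring.genideal_self [OF ring_free_algebra]) (simp add: hecke_relators_FF)

lemma ideal_zero: "0 \<in> hecke_ideal"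
  and ideal_add: "f \<in> hecke_ideal \<Longrightarrow> g \<in> hecke_ideal \<Longrightarrow> f + g \<in> hecke_ideal"
  using additive_subgroup.zero_closed [OF ideal.axioms(1) [OF ideal_hecke]]
    additive_subgroup.a_closed [OF ideal.axioms(1) [OF ideal_hecke]] by simp_all

lemma ideal_smul: "f \<in> hecke_ideal \<Longrightarrow> smul a f \<in> hecke_ideal"
  using ideal.I_l_closed [OF ideal_hecke, of f "Poly_Mapping.single [] a"] by (simp add: free_algebra_scalar)

lemma ideal_minus: "f \<in> hecke_ideal \<Longrightarrow> - f \<in> hecke_ideal"
  using ideal_smul [of f "-1"] by (simp add: smul_minus_left)

lemma hclass_set: "hclass f = {i + f |i. i \<in> hecke_ideal}"
  unfolding hclass_def a_r_coset_def' by auto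

lemma hclass_eq_iff: "hclass f = hclass g \<longleftrightarrow> f - g \<in> hecke_ideal"
proof
  assume "hclass f = hclass g"
  then have "0 + f \<in> hclass g" using ideal_zero unfolding hclass_set by blast
  then obtain i where "f = i + g" "i \<in> hecke_ideal" unfolding hclass_set by auto
  then show "f - g \<in> hecke_ideal" by simp
next
  have sub: "hclass f \<subseteq> hclass g" if "f - g \<in> hecke_ideal" for f g
  proof
    fix x assume "x \<in> hclass f"
    then obtain i where "x = i + f" "i \<in> hecke_ideal" unfolding hclass_set by auto
    then have "x = (i + (f - g)) + g" "i + (f - g) \<in> hecke_ideal" using that ideal_add by auto
    then show "x \<in> hclass g" unfolding hclass_set by blast
  qed
  assume a: "f - g \<in> hecke_ideal"
  then have "g - f \<in> hecke_ideal" using ideal_minus by fastforce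
  then show "hclass f = hclass g" using sub a by blast
qed

lemma ring_H: "ring H"
  unfolding H_def by (rule ideal.quotient_is_ring [OF ideal_hecke])

sublocale H: ring H
  by (rule ring_H)

lemma hclass_hom: "hclass \<in> ring_hom F H"
  using ideal.rcos_ring_hom [OF ideal_hecke] unfolding H_def hclass_def [abs_def] .

lemma hclass_closed [simp, intro]: "f \<in> FF \<Longrightarrow> hclass f \<in> carrier H"
  and hclass_add: "f \<in> FF \<Longrightarrow> g \<in> FF \<Longrightarrow> hclass (f + g) = hclass f \<oplus>\<^bsub>H\<^esub> hclass g"
  and hclass_mult: "f \<in> FF \<Longrightarrow> g \<in> FF \<Longrightarrow> hclass (f \<otimes>\<^bsub>F\<^esub> g) = hclass f \<otimes>\<^bsub>H\<^esub> hclass g"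
  and hclass_one: "hclass (bvec []) = \<one>\<^bsub>H\<^esub>"
  using ring_hom_closed [OF hclass_hom] ring_hom_add [OF hclass_hom] ring_hom_mult [OF hclass_hom]
    ring_hom_one [OF hclass_hom] by simp_all

lemma hclass_surj: "h \<in> carrier H \<Longrightarrow> \<exists>f\<in>FF. h = hclass f"
  unfolding H_def FactRing_def A_RCOSETS_def' hclass_def by auto

lemma scal_closed [simp, intro]: "scal a \<in> carrier H"
  and Tgen_closed [simp, intro]: "s \<in> S \<Longrightarrow> Tgen s \<in> carrier H"
  unfolding scal_def Tgen_def by auto

lemma scal_hclass: "f \<in> FF \<Longrightarrow> scal a \<otimes>\<^bsub>H\<^esub> hclass f = hclass (smul a f)"
  and hclass_scal: "f \<in> FF \<Longrightarrow> hclass f \<otimes>\<^bsub>H\<^esub> scal a = hclass (smul a f)"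
  unfolding scal_def by (simp_all add: free_algebra_scalar flip: hclass_mult)

lemma scal_commute: "h \<in> carrier H \<Longrightarrow> h \<otimes>\<^bsub>H\<^esub> scal a = scal a \<otimes>\<^bsub>H\<^esub> h"
  using hclass_surj scal_hclass hclass_scal by metis

lemma scal_one: "scal 1 = \<one>\<^bsub>H\<^esub>"
  unfolding scal_def hclass_one [symmetric] bvec_def ..

lemma scal_zero: "scal 0 = \<zero>\<^bsub>H\<^esub>"
proof -
  have "scal 0 \<oplus>\<^bsub>H\<^esub> scal 0 = scal 0" unfolding scal_def using hclass_add [of 0 0] by simp
  then show ?thesis using H.add.l_cancel_one [of "scal 0" "scal 0"] by simp
qed

lemma scal_mult: "scal (a * b) = scal a \<otimes>\<^bsub>H\<^esub> scal b"
  unfolding scal_def by (simp add: free_algebra_scalar mult.commute flip: hclass_mult)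

lemma hclass_Cons: "s \<in> S \<Longrightarrow> ws \<in> lists S \<Longrightarrow> hclass (bvec (s # ws)) = Tgen s \<otimes>\<^bsub>H\<^esub> hclass (bvec ws)"
  unfolding Tgen_def by (simp add: free_algebra_mult flip: hclass_mult bvec_def)

lemma hclass_snoc: "s \<in> S \<Longrightarrow> ws \<in> lists S \<Longrightarrow> hclass (bvec (ws @ [s])) = hclass (bvec ws) \<otimes>\<^bsub>H\<^esub> Tgen s"
  unfolding Tgen_def by (simp add: free_algebra_mult flip: hclass_mult bvec_def)

lemma H_induct [consumes 1, case_names one add scal Tgen]:
  assumes h: "h \<in> carrier H" and one: "P \<one>\<^bsub>H\<^esub>"
    and add: "\<And>h k. h \<in> carrier H \<Longrightarrow> k \<in> carrier H \<Longrightarrow> P h \<Longrightarrow> P k \<Longrightarrow> P (h \<oplus>\<^bsub>H\<^esub> k)"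
    and scal: "\<And>a h. h \<in> carrier H \<Longrightarrow> P h \<Longrightarrow> P (scal a \<otimes>\<^bsub>H\<^esub> h)"
    and Tgen: "\<And>s h. s \<in> S \<Longrightarrow> h \<in> carrier H \<Longrightarrow> P h \<Longrightarrow> P (Tgen s \<otimes>\<^bsub>H\<^esub> h)"
  shows "P h"
proof -
  have word: "P (hclass (bvec ws))" if "ws \<in> lists S" for ws
    using that
  proof (induction ws)
    case Nil
    show ?case using one hclass_one by simp
  next
    case (Cons s ws)
    then show ?case using Tgen hclass_Cons by simp
  qed
  obtain f where f: "f \<in> FF" "h = hclass f" using hclass_surj h by blast
  show ?thesis unfolding f(2) using f(1)
  proof (induction rule: EE_induct)
    case (single ws a)
    then have "P (scal a \<otimes>\<^bsub>H\<^esub> hclass (bvec ws))" using word scal by simp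
    then show ?case using single by (simp add: scal_hclass single_eq_smul)
  next
    case zero
    have "P (scal 0 \<otimes>\<^bsub>H\<^esub> hclass (bvec []))" using word scal by simp
    then show ?case by (simp add: scal_hclass)
  next
    case (add f g)
    then show ?case using assms(3) by (simp add: hclass_add)
  qed
qed

lemma ideal_relator_zero: "r \<in> hecke_relators \<Longrightarrow> f - g = r \<Longrightarrow> hclass f = hclass g"
  using relators_in_ideal hclass_eq_iff by blast

lemma Tgen_sq:
  assumes s: "s \<in> S"
  shows "Tgen s \<otimes>\<^bsub>H\<^esub> Tgen s = \<one>\<^bsub>H\<^esub> \<oplus>\<^bsub>H\<^esub> scal (qv - qinv) \<otimes>\<^bsub>H\<^esub> Tgen s"
proof -
  have "bvec [s, s] - (bvec [] + smul (qv - qinv) (bvec [s])) \<in> hecke_relators"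
  proof -
    have "bvec [s, s] - (bvec [] + smul (qv - qinv) (bvec [s])) =
        Poly_Mapping.single [s, s] 1 - Poly_Mapping.single [] 1 - Poly_Mapping.single [s] (qv - qinv)"
      by (simp add: bvec_def)
    then show ?thesis using s unfolding hecke_relators_def by blast
  qed
  then have "hclass (bvec [s, s]) = hclass (bvec [] + smul (qv - qinv) (bvec [s]))"
    by (rule ideal_relator_zero) simp
  also have "\<dots> = \<one>\<^bsub>H\<^esub> \<oplus>\<^bsub>H\<^esub> scal (qv - qinv) \<otimes>\<^bsub>H\<^esub> Tgen s"
    using s by (simp add: hclass_add hclass_one scal_hclass Tgen_def flip: bvec_def)
  finally show ?thesis using hclass_Cons [of s "[s]"] s by (simp add: Tgen_def flip: bvec_def)
qed

lemma hclass_braid: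
  assumes "s \<in> S" "t \<in> S" "s \<noteq> t"
  shows "hclass (bvec (alt_word s t (ord (s \<otimes> t)))) = hclass (bvec (alt_word t s (ord (s \<otimes> t))))"
proof (rule ideal_relator_zero [OF _ refl])
  show "bvec (alt_word s t (ord (s \<otimes> t))) - bvec (alt_word t s (ord (s \<otimes> t))) \<in> hecke_relators"
    using assms unfolding hecke_relators_def bvec_def by blast
qed

text \<open>By Matsumoto's theorem the arbitrary choice of a reduced word inside \<open>T\<close>
  does no harm.\<close>

lemma hclass_reduced:
  assumes "reduced us w" "reduced vs w"
  shows "hclass (bvec us) = hclass (bvec vs)"
  by (rule matsumoto [where R = "\<lambda>us vs. hclass (bvec us) = hclass (bvec vs)", OF _ _ _ _ _ hclass_braid assms])
    (simp_all add: hclass_Cons hclass_snoc)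

lemma T_eq: "T w = hclass (bvec (word w))"
  by (simp add: T_def word_def bvec_def)

lemma word_lists [simp]: "w \<in> carrier W \<Longrightarrow> word w \<in> lists S"
  using reducedD(1) [OF reduced_word] by simp

lemma T_closed [simp, intro]: "w \<in> carrier W \<Longrightarrow> T w \<in> carrier H"
  by (simp add: T_eq)

lemma T_one: "T \<one> = \<one>\<^bsub>H\<^esub>"
  by (simp add: T_eq hclass_one)

lemma T_S_up:
  assumes "s \<in> S" "w \<in> carrier W" "len w < len (s \<otimes> w)"
  shows "T (s \<otimes> w) = Tgen s \<otimes>\<^bsub>H\<^esub> T w"
proof -
  have "reduced (s # word w) (s \<otimes> w)" by (intro reduced_ConsI reduced_word assms)
  from hclass_reduced [OF reduced_word this] show ?thesis using assms by (simp add: T_eq hclass_Cons)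
qed

lemma T_S_down:
  assumes s: "s \<in> S" and w: "w \<in> carrier W" "len (s \<otimes> w) < len w"
  shows "Tgen s \<otimes>\<^bsub>H\<^esub> T w = T (s \<otimes> w) \<oplus>\<^bsub>H\<^esub> scal (qv - qinv) \<otimes>\<^bsub>H\<^esub> T w"
proof -
  let ?v = "s \<otimes> w"
  have Tw: "T w = Tgen s \<otimes>\<^bsub>H\<^esub> T ?v" using T_S_up [OF s, of ?v] s w by simp
  have "Tgen s \<otimes>\<^bsub>H\<^esub> T w = (Tgen s \<otimes>\<^bsub>H\<^esub> Tgen s) \<otimes>\<^bsub>H\<^esub> T ?v"
    unfolding Tw using s w by (simp add: H.m_assoc)
  also have "\<dots> = T ?v \<oplus>\<^bsub>H\<^esub> scal (qv - qinv) \<otimes>\<^bsub>H\<^esub> (Tgen s \<otimes>\<^bsub>H\<^esub> T ?v)"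
    unfolding Tgen_sq [OF s] using s w by (simp add: H.l_distr H.m_assoc)
  finally show ?thesis unfolding Tw [symmetric] .
qed

section \<open>Identification of the Hecke algebra with the free module\<close>

definition Psi :: "('w \<Rightarrow>\<^sub>0 laurent) \<Rightarrow> 'w hecke" where
  "Psi f = hclass (lin (\<lambda>w. bvec (word w)) f)"

lemma Psi_FF: "f \<in> EW \<Longrightarrow> lin (\<lambda>w. bvec (word w)) f \<in> FF"
  by (erule EE_lin) auto

lemma Psi_closed [simp, intro]: "f \<in> EW \<Longrightarrow> Psi f \<in> carrier H"
  unfolding Psi_def using Psi_FF by blast

lemma Psi_add: "f \<in> EW \<Longrightarrow> g \<in> EW \<Longrightarrow> Psi (f + g) = Psi f \<oplus>\<^bsub>H\<^esub> Psi g"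
  unfolding Psi_def by (simp add: lin_add hclass_add Psi_FF)

lemma Psi_smul: "f \<in> EW \<Longrightarrow> Psi (smul a f) = scal a \<otimes>\<^bsub>H\<^esub> Psi f"
  unfolding Psi_def by (simp add: lin_smul scal_hclass Psi_FF)

lemma Psi_e: "Psi (bvec w) = T w"
  by (simp add: Psi_def T_eq)

lemma Psi_zero: "Psi 0 = \<zero>\<^bsub>H\<^esub>"
  using Psi_smul [of 0 0] by (simp add: scal_zero)

lemma Psi_lam:
  assumes s: "s \<in> S" and f: "f \<in> EW"
  shows "Psi (lam s f) = Tgen s \<otimes>\<^bsub>H\<^esub> Psi f"
  using f
proof (induction rule: EE_induct)
  case (single w a)
  have eq: "Psi (lam s (bvec w)) = Tgen s \<otimes>\<^bsub>H\<^esub> T w"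
    using s single T_S_up [OF s single] T_S_down [OF s single] len_S_mult [OF s single]
    by (auto simp: lam_e Psi_add Psi_smul Psi_e)
  have "Psi (lam s (smul a (bvec w))) = scal a \<otimes>\<^bsub>H\<^esub> (Tgen s \<otimes>\<^bsub>H\<^esub> T w)"
    using s single eq by (simp add: lmap_smul Psi_smul)
  also have "\<dots> = Tgen s \<otimes>\<^bsub>H\<^esub> (scal a \<otimes>\<^bsub>H\<^esub> T w)"
    using s single scal_commute [of "Tgen s" a] by (metis H.m_assoc T_closed Tgen_closed scal_closed)
  finally show ?case using single by (simp add: single_eq_smul Psi_smul Psi_e)
next
  case zero
  show ?case using s by (simp add: lmap_zero Psi_zero)
next
  case (add f g)
  then show ?case using s by (simp add: lmap_add Psi_add H.r_distr)
qed

definition actF :: "('w list \<Rightarrow>\<^sub>0 laurent) \<Rightarrow> ('w \<Rightarrow>\<^sub>0 laurent) \<Rightarrow> ('w \<Rightarrow>\<^sub>0 laurent)" where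
  "actF f x = lin (\<lambda>u. wact u x) f"

lemma actF_EW: "f \<in> FF \<Longrightarrow> x \<in> EW \<Longrightarrow> actF f x \<in> EW"
  unfolding actF_def by (erule EE_lin) auto

lemma actF_mult: "actF (f \<otimes>\<^bsub>F\<^esub> g) x = actF f (actF g x)"
  unfolding actF_def free_algebra_mult
  by (simp add: lin_lin lmap_lin_expand [OF lmap_wact, symmetric])

lemma actF_add: "actF (f + g) x = actF f x + actF g x"
  and actF_smul: "actF (smul a f) x = smul a (actF f x)"
  and actF_diff: "actF (f - g) x = actF f x - actF g x"
  and actF_e: "actF (bvec u) x = wact u x"
  and actF_zero: "actF 0 x = 0"
  by (simp_all add: actF_def lin_add lin_smul lmap_diff lmap_zero)

lemma lmap_actF: "lmap (actF f)"
  unfolding lmap_def actF_def by (simp add: lmap_add lmap_smul lin_add_fun lin_smul_fun)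

text \<open>The kernel of the action of the free algebra on the regular module. It is an ideal
  containing the relators, hence contains \<open>hecke_ideal\<close>, and so the action descends to
  \<open>H\<close>.\<close>

definition annih :: "('w list \<Rightarrow>\<^sub>0 laurent) set" where
  "annih = {f \<in> FF. \<forall>x\<in>EW. actF f x = 0}"

lemma ideal_annih: "ideal annih F"
proof (rule idealI [OF ring_free_algebra])
  interpret FR: ring F by (rule ring_free_algebra)
  show "subgroup annih (add_monoid F)"
  proof (rule FR.add.subgroupI)
    have "0 \<in> annih" by (simp add: annih_def actF_zero)
    then show "annih \<noteq> {}" by blast
  next
    fix f assume f: "f \<in> annih"
    have "- f \<in> FF" "f + (- f) = 0" "f \<in> FF" using f by (auto simp: annih_def)
    then have "\<ominus>\<^bsub>F\<^esub> f = - f" using FR.minus_equality [of "- f" f] by simp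
    moreover have "actF (- f) x = - actF f x" for x using actF_diff [of 0 f x] by (simp add: actF_zero)
    ultimately show "\<ominus>\<^bsub>F\<^esub> f \<in> annih" using f by (auto simp: annih_def)
  qed (auto simp: annih_def actF_add)
next
  fix f g assume "f \<in> annih" "g \<in> carrier F"
  then show "g \<otimes>\<^bsub>F\<^esub> f \<in> annih" "f \<otimes>\<^bsub>F\<^esub> g \<in> annih"
    by (auto simp: annih_def free_algebra_closed actF_mult actF_EW lmap_zero [OF lmap_actF])
qed

lemma hecke_ideal_annih: "hecke_ideal \<subseteq> annih"
  unfolding hecke_ideal_def
proof (rule ring.genideal_minimal [OF ring_free_algebra ideal_annih], rule subsetI)
  fix r assume r: "r \<in> hecke_relators"
  then have FF: "r \<in> FF" using hecke_relators_FF by blast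
  from r consider s where "s \<in> S" "r = bvec [s, s] - bvec [] - smul (qv - qinv) (bvec [s])"
    | s t where "s \<in> S" "t \<in> S" "r = bvec (alt_word s t (ord (s \<otimes> t))) - bvec (alt_word t s (ord (s \<otimes> t)))"
    unfolding hecke_relators_def bvec_def smul_single by auto
  then show "r \<in> annih"
  proof cases
    case 1
    then have "actF r x = 0" if "x \<in> EW" for x
      using that by (simp add: actF_diff actF_smul actF_e lam_lam)
    then show ?thesis using FF by (simp add: annih_def)
  next
    case 2
    then have "actF r x = 0" if "x \<in> EW" for x
      using that wact_braid by (simp add: actF_diff actF_e)
    then show ?thesis using FF by (simp add: annih_def)
  qed
qed

definition act :: "'w hecke \<Rightarrow> ('w \<Rightarrow>\<^sub>0 laurent) \<Rightarrow> ('w \<Rightarrow>\<^sub>0 laurent)" where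
  "act h x = actF (SOME f. f \<in> FF \<and> h = hclass f) x"

lemma act_hclass:
  assumes f: "f \<in> FF" and x: "x \<in> EW"
  shows "act (hclass f) x = actF f x"
proof -
  let ?g = "SOME g. g \<in> FF \<and> hclass f = hclass g"
  have g: "?g \<in> FF \<and> hclass f = hclass ?g" by (rule someI [of _ f]) (use f in simp)
  then have "f - ?g \<in> annih" using hclass_eq_iff hecke_ideal_annih by blast
  then have "actF f x - actF ?g x = 0" using x by (simp add: annih_def actF_diff)
  then show ?thesis by (simp add: act_def)
qed

lemma act_EW [simp, intro]: "h \<in> carrier H \<Longrightarrow> x \<in> EW \<Longrightarrow> act h x \<in> EW"
  using hclass_surj act_hclass actF_EW by metis

lemma act_add: "h \<in> carrier H \<Longrightarrow> k \<in> carrier H \<Longrightarrow> x \<in> EW \<Longrightarrow> act (h \<oplus>\<^bsub>H\<^esub> k) x = act h x + act k x"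
  using hclass_surj [of h] hclass_surj [of k] by (auto simp: act_hclass actF_add simp flip: hclass_add)

lemma act_mult: "h \<in> carrier H \<Longrightarrow> k \<in> carrier H \<Longrightarrow> x \<in> EW \<Longrightarrow> act (h \<otimes>\<^bsub>H\<^esub> k) x = act h (act k x)"
  using hclass_surj [of h] hclass_surj [of k] free_algebra_closed [of _ S]
  by (auto simp: act_hclass actF_mult actF_EW simp flip: hclass_mult)

lemma act_one [simp]: "x \<in> EW \<Longrightarrow> act \<one>\<^bsub>H\<^esub> x = x"
  unfolding hclass_one [symmetric] by (simp add: act_hclass actF_e)

lemma act_scal [simp]: "x \<in> EW \<Longrightarrow> act (scal a) x = smul a x"
  unfolding scal_def by (simp add: act_hclass single_eq_smul actF_smul actF_e)

lemma act_Tgen [simp]: "s \<in> S \<Longrightarrow> x \<in> EW \<Longrightarrow> act (Tgen s) x = lam s x"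
  unfolding Tgen_def by (simp add: act_hclass single_eq_smul actF_e)

lemma act_plus: "h \<in> carrier H \<Longrightarrow> x \<in> EW \<Longrightarrow> y \<in> EW \<Longrightarrow> act h (x + y) = act h x + act h y"
  using hclass_surj [of h] by (auto simp: act_hclass lmap_add [OF lmap_actF])

lemma act_smul: "h \<in> carrier H \<Longrightarrow> x \<in> EW \<Longrightarrow> act h (smul a x) = smul a (act h x)"
  using hclass_surj [of h] by (auto simp: act_hclass lmap_smul [OF lmap_actF])

lemma act_zero: "h \<in> carrier H \<Longrightarrow> act h 0 = 0"
  using act_smul [of h 0 0] by simp

definition Phi :: "'w hecke \<Rightarrow> ('w \<Rightarrow>\<^sub>0 laurent)" where "Phi h = act h (bvec \<one>)"

lemma Phi_EW [simp, intro]: "h \<in> carrier H \<Longrightarrow> Phi h \<in> EW"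
  by (simp add: Phi_def)

lemma Phi_add: "h \<in> carrier H \<Longrightarrow> k \<in> carrier H \<Longrightarrow> Phi (h \<oplus>\<^bsub>H\<^esub> k) = Phi h + Phi k"
  and Phi_mult: "h \<in> carrier H \<Longrightarrow> k \<in> carrier H \<Longrightarrow> Phi (h \<otimes>\<^bsub>H\<^esub> k) = act h (Phi k)"
  and Phi_one: "Phi \<one>\<^bsub>H\<^esub> = bvec \<one>"
  by (simp_all add: Phi_def act_add act_mult)

lemma Phi_Psi [simp]: "f \<in> EW \<Longrightarrow> Phi (Psi f) = f"
proof -
  assume f: "f \<in> EW"
  have "Phi (Psi f) = lin (\<lambda>w. wact (word w) (bvec \<one>)) f"
    unfolding Phi_def Psi_def using f by (simp add: act_hclass Psi_FF actF_def lin_lin)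
  also have "\<dots> = lin bvec f" by (rule lin_cong [OF f]) (use wact_e_one reduced_word in blast)
  finally show ?thesis by (simp add: lin_id)
qed

lemma Psi_Phi [simp]: "h \<in> carrier H \<Longrightarrow> Psi (Phi h) = h"
proof (induction rule: H_induct)
  case one
  show ?case by (simp add: Phi_one Psi_e T_one)
qed (simp_all add: Phi_add Phi_mult Psi_add Psi_smul Psi_lam)

text \<open>Elements of \<open>H\<close> are determined by what they do to
  \<open>bvec \<one>\<close>; equations in \<open>H\<close> are proved by computing there.\<close>

lemma Phi_inj: "h \<in> carrier H \<Longrightarrow> k \<in> carrier H \<Longrightarrow> Phi h = Phi k \<Longrightarrow> h = k"
  using Psi_Phi by metis

lemma Phi_T: "w \<in> carrier W \<Longrightarrow> Phi (T w) = bvec w"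
  using Phi_Psi [of "bvec w"] by (simp add: Psi_e)

lemma act_T: "w \<in> carrier W \<Longrightarrow> x \<in> EW \<Longrightarrow> act (T w) x = wact (word w) x"
  by (simp add: T_eq act_hclass actF_e)

lemma T_mult:
  assumes x: "x \<in> carrier W" and y: "y \<in> carrier W" and len: "len (x \<otimes> y) = len x + len y"
  shows "T (x \<otimes> y) = T x \<otimes>\<^bsub>H\<^esub> T y"
proof -
  have red: "reduced (word x @ word y) (x \<otimes> y)"
    using reducedD [OF reduced_word [OF x]] reducedD [OF reduced_word [OF y]] len
    by (simp add: reduced_def word_prod_append)
  have "wact (word x) (bvec y) = bvec (x \<otimes> y)"
    using wact_e_one [OF red] wact_e_one [OF reduced_word [OF y]] by simp
  then show ?thesis using x y by (intro Phi_inj) (simp_all add: Phi_mult Phi_T act_T)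
qed

subsection \<open>The bar involution\<close>

definition Tinv :: "'w \<Rightarrow> 'w hecke" where
  "Tinv s = Tgen s \<oplus>\<^bsub>H\<^esub> scal (- (qv - qinv))"

lemma Tinv_closed [simp, intro]: "s \<in> S \<Longrightarrow> Tinv s \<in> carrier H"
  by (simp add: Tinv_def)

lemma act_Tinv: "s \<in> S \<Longrightarrow> x \<in> EW \<Longrightarrow> act (Tinv s) x = lami s x"
  unfolding Tinv_def lami_def by (simp add: act_add smul_diff_left)

lemma inv_Tgen: "s \<in> S \<Longrightarrow> inv\<^bsub>H\<^esub> (Tgen s) = Tinv s"
proof (rule H.inv_char)
  assume s: "s \<in> S"
  show "Tgen s \<otimes>\<^bsub>H\<^esub> Tinv s = \<one>\<^bsub>H\<^esub>"
    using s by (intro Phi_inj) (auto simp: Phi_def act_mult act_Tinv)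
  show "Tinv s \<otimes>\<^bsub>H\<^esub> Tgen s = \<one>\<^bsub>H\<^esub>"
    using s by (intro Phi_inj) (auto simp: Phi_def act_mult act_Tinv)
qed auto

definition hb :: "'w hecke \<Rightarrow> 'w hecke" where "hb h = Psi (barE (Phi h))"

lemma hb_closed [simp, intro]: "h \<in> carrier H \<Longrightarrow> hb h \<in> carrier H"
  by (simp add: hb_def)

lemma hb_add: "h \<in> carrier H \<Longrightarrow> k \<in> carrier H \<Longrightarrow> hb (h \<oplus>\<^bsub>H\<^esub> k) = hb h \<oplus>\<^bsub>H\<^esub> hb k"
  by (simp add: hb_def Phi_add smap_add Psi_add)

lemma hb_scal_mult: "k \<in> carrier H \<Longrightarrow> hb (scal a \<otimes>\<^bsub>H\<^esub> k) = scal (lbar a) \<otimes>\<^bsub>H\<^esub> hb k"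
  by (simp add: hb_def Phi_mult smap_smul Psi_smul)

lemma hb_Tgen_mult: "s \<in> S \<Longrightarrow> k \<in> carrier H \<Longrightarrow> hb (Tgen s \<otimes>\<^bsub>H\<^esub> k) = Tinv s \<otimes>\<^bsub>H\<^esub> hb k"
  by (rule Phi_inj) (simp_all add: hb_def Phi_mult barE_lam act_Tinv)

lemma hb_one: "hb \<one>\<^bsub>H\<^esub> = \<one>\<^bsub>H\<^esub>"
  by (simp add: hb_def Phi_one Psi_e T_one)

lemma hb_mult: "h \<in> carrier H \<Longrightarrow> k \<in> carrier H \<Longrightarrow> hb (h \<otimes>\<^bsub>H\<^esub> k) = hb h \<otimes>\<^bsub>H\<^esub> hb k"
proof (induction rule: H_induct)
  case one
  then show ?case by (simp add: hb_one)
next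
  case (add h h')
  then show ?case by (simp add: H.l_distr hb_add)
next
  case (scal a h)
  then show ?case by (simp add: H.m_assoc hb_scal_mult)
next
  case (Tgen s h)
  then show ?case by (simp add: H.m_assoc hb_Tgen_mult)
qed

lemma hb_hb: "h \<in> carrier H \<Longrightarrow> hb (hb h) = h"
  by (simp add: hb_def)

text \<open>Justifies the definite description. Existence is transported from \<open>barE\<close>;
  for uniqueness, a ring homomorphism with given values on scalars and generators is determined on
  \<open>H\<close>, and extensionality fixes the values elsewhere.\<close>

lemma hbar_eq: "hbar = restrict hb (carrier H)"
  unfolding hbar_def
proof (rule the_equality)
  let ?b = "restrict hb (carrier H)"
  have "hb (scal a) = scal (lbar a)" for a using hb_scal_mult [of "\<one>\<^bsub>H\<^esub>" a] by (simp add: hb_one)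
  moreover have "hb (Tgen s) = Tinv s" if "s \<in> S" for s using hb_Tgen_mult [OF that, of "\<one>\<^bsub>H\<^esub>"] that by (simp add: hb_one)
  ultimately show "?b \<in> extensional (carrier H) \<and> ?b \<in> ring_hom H H \<and> (\<forall>x\<in>carrier H. ?b (?b x) = x) \<and>
      (\<forall>a. ?b (scal a) = scal (lbar a)) \<and> (\<forall>s\<in>S. ?b (Tgen s) = inv\<^bsub>H\<^esub> (Tgen s))"
    by (auto intro!: ring_hom_memI simp: hb_mult hb_add hb_one hb_hb inv_Tgen)
next
  fix \<beta> assume \<beta>: "\<beta> \<in> extensional (carrier H) \<and> \<beta> \<in> ring_hom H H \<and> (\<forall>x\<in>carrier H. \<beta> (\<beta> x) = x) \<and>
      (\<forall>a. \<beta> (scal a) = scal (lbar a)) \<and> (\<forall>s\<in>S. \<beta> (Tgen s) = inv\<^bsub>H\<^esub> (Tgen s))"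
  then have hom: "\<beta> \<in> ring_hom H H" by blast
  have "\<beta> h = hb h" if "h \<in> carrier H" for h
    using that
  proof (induction rule: H_induct)
    case one
    show ?case using ring_hom_one [OF hom] hb_one by simp
  next
    case (add h k)
    then show ?case using ring_hom_add [OF hom] by (simp add: hb_add)
  next
    case (scal a h)
    then show ?case using ring_hom_mult [OF hom] \<beta> by (simp add: hb_scal_mult)
  next
    case (Tgen s h)
    then show ?case using ring_hom_mult [OF hom] \<beta> by (simp add: hb_Tgen_mult inv_Tgen)
  qed
  then show "\<beta> = restrict hb (carrier H)" using \<beta> by (intro extensionalityI [of _ "carrier H"]) auto
qed

lemma Phi_hbar: "h \<in> carrier H \<Longrightarrow> Phi (hbar h) = barE (Phi h)"
  by (simp add: hbar_eq hb_def)

lemma hbar_closed [simp, intro]: "h \<in> carrier H \<Longrightarrow> hbar h \<in> carrier H"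
  by (simp add: hbar_eq)

lemma barE_act:
  assumes "h \<in> carrier H" "x \<in> EW"
  shows "barE (act h x) = act (hbar h) (barE x)"
proof -
  have "barE (Phi (h \<otimes>\<^bsub>H\<^esub> Psi x)) = Phi (hbar (h \<otimes>\<^bsub>H\<^esub> Psi x))" using assms by (simp add: Phi_hbar)
  also have "hbar (h \<otimes>\<^bsub>H\<^esub> Psi x) = hbar h \<otimes>\<^bsub>H\<^esub> hbar (Psi x)" using assms by (simp add: hbar_eq hb_mult)
  finally show ?thesis using assms by (simp add: Phi_mult Phi_hbar)
qed

subsection \<open>Kazhdan--Lusztig polynomials\<close>

definition klcoef :: "nat \<Rightarrow> int poly \<Rightarrow> laurent" where
  "klcoef n p = (- qv) ^ n * poly (map_poly of_int p) (qinv ^ 2)"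

lemma qv_power: "qv ^ n = Poly_Mapping.single (int n) 1" and qinv_power: "qinv ^ n = Poly_Mapping.single (- int n) 1"
  by (induction n) (simp_all add: qv_def qinv_def mult_single)

text \<open>Different coefficients of the polynomial land in different degrees, so the polynomial
  can be read back from the Laurent polynomial.\<close>

lemma lookup_klcoef:
  "lk (klcoef n p) j = (if even (int n - j) \<and> j \<le> int n then (- 1) ^ n * coeff p (nat ((int n - j) div 2)) else 0)"
proof -
  have "poly (map_poly of_int p) (qinv ^ 2) = (\<Sum>k\<le>Polynomial.degree p. of_int (coeff p k) * (qinv ^ 2) ^ k)"
    unfolding poly_altdef by (simp add: degree_map_poly coeff_map_poly)
  also have "\<dots> = (\<Sum>k\<le>Polynomial.degree p. Poly_Mapping.single (- 2 * int k) (coeff p k))"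
  proof (intro sum.cong refl)
    fix k
    have "(qinv ^ 2) ^ k = qinv ^ (2 * k)" by (simp only: power_mult)
    then have "(qinv ^ 2) ^ k = Poly_Mapping.single (- 2 * int k) 1" by (simp only: qinv_power) simp
    moreover have "(of_int (coeff p k) :: laurent) = Poly_Mapping.single 0 (of_int (coeff p k))"
      by (rule single_of_int [symmetric])
    ultimately show "of_int (coeff p k) * (qinv ^ 2) ^ k = Poly_Mapping.single (- 2 * int k) (coeff p k)"
      by (simp add: mult_single)
  qed
  finally have P: "poly (map_poly of_int p) (qinv ^ 2) = \<dots>" .
  have q: "(- qv) ^ n = Poly_Mapping.single (int n) ((- 1) ^ n)"
    by (cases "even n") (simp_all add: qv_power single_uminus)
  have "lk (klcoef n p) j = (\<Sum>k\<le>Polynomial.degree p. (- 1) ^ n * (coeff p k when - 2 * int k = j - int n))"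
    unfolding klcoef_def P q lookup_single_mult lookup_sum sum_distrib_left by (simp add: lookup_single)
  also have "\<dots> = (if even (int n - j) \<and> j \<le> int n then (- 1) ^ n * coeff p (nat ((int n - j) div 2)) else 0)"
  proof (cases "even (int n - j) \<and> j \<le> int n")
    case True
    let ?k = "nat ((int n - j) div 2)"
    have k: "- 2 * int k = j - int n \<longleftrightarrow> k = ?k" for k using True by auto
    have "(\<Sum>k\<le>Polynomial.degree p. (- 1) ^ n * (coeff p k when - 2 * int k = j - int n)) =
        (\<Sum>k\<le>Polynomial.degree p. if k = ?k then (- 1) ^ n * coeff p k else 0)"
      unfolding k by (intro sum.cong) (auto simp: when_def)
    also have "\<dots> = (- 1) ^ n * coeff p ?k" by (auto simp: coeff_eq_0)
    finally show ?thesis using True by simp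
  next
    case False
    have "- 2 * int k \<noteq> j - int n" for k
    proof
      assume "- 2 * int k = j - int n"
      then have "int n - j = 2 * int k" by simp
      then have "even (int n - j) \<and> j \<le> int n" by simp
      then show False using False by blast
    qed
    then have "(\<Sum>k\<le>Polynomial.degree p. (- 1) ^ n * (coeff p k when - 2 * int k = j - int n)) = 0"
      by (intro sum.neutral) (simp add: when_def)
    then show ?thesis by (simp only: if_not_P [OF False])
  qed
  finally show ?thesis .
qed

definition KLpred :: "('w \<Rightarrow> 'w \<Rightarrow> int poly) \<Rightarrow> bool" where
  "KLpred P \<longleftrightarrow> (\<forall>w\<in>carrier W. P w w = 1) \<and>
     (\<forall>y w. \<not> bruhat_le y w \<longrightarrow> P y w = 0) \<and>
     (\<forall>y w. bruhat_lt y w \<longrightarrow> 2 * Polynomial.degree (P y w) + 1 \<le> len w - len y) \<and>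
     (\<forall>w\<in>carrier W. hbar (KL_elem P w) = KL_elem P w)"

lemma Phi_finsum:
  assumes "finite A" "\<And>y. y \<in> A \<Longrightarrow> g y \<in> carrier H"
  shows "Phi (finsum H g A) = (\<Sum>y\<in>A. Phi (g y)) \<and> finsum H g A \<in> carrier H"
  using assms
proof (induction A rule: finite_induct)
  case empty
  have "Phi \<zero>\<^bsub>H\<^esub> = 0" using Phi_Psi [of 0] Psi_zero by simp
  then show ?case by simp
next
  case (insert x A)
  then show ?case by (simp add: H.finsum_insert Phi_add Pi_def)
qed

lemma KL_elem_closed: "KL_elem P w \<in> carrier H"
  and Phi_KL_elem: "Phi (KL_elem P w) = (\<Sum>y\<in>{y. bruhat_le y w}. smul (klcoef (len w - len y) (P y w)) (bvec y))"
  unfolding KL_elem_def klcoef_def [symmetric]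
  using Phi_finsum [where A = "{y. bruhat_le y w}" and
      g = "\<lambda>y. scal (klcoef (len w - len y) (P y w)) \<otimes>\<^bsub>H\<^esub> T y"] finite_bruhat_lower [of w]
  by (simp_all add: bruhat_leD Phi_mult Phi_T)

lemma lookup_Phi_KL_elem:
  "lk (Phi (KL_elem P w)) y = (if bruhat_le y w then klcoef (len w - len y) (P y w) else 0)"
proof -
  have "lk (Phi (KL_elem P w)) y =
      (\<Sum>z\<in>{z. bruhat_le z w}. if z = y then klcoef (len w - len z) (P z w) else 0)"
    unfolding Phi_KL_elem lookup_sum by (intro sum.cong) (auto simp: lookup_e when_def)
  then show ?thesis using finite_bruhat_lower by simp
qed

text \<open>The degree bound on \<open>P y w\<close> says precisely that \<open>q^n P(q^-2)\<close>
  has only positive degrees, so the characterisation of \<open>KL\<close> by smallness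
  applies.\<close>

lemma KLpred_KL:
  assumes P: "KLpred P" and w: "w \<in> carrier W"
  shows "Phi (KL_elem P w) = KL w"
proof (rule KL_eqI [OF w])
  show "Phi (KL_elem P w) \<in> EW" using KL_elem_closed by blast
  have "hbar (KL_elem P w) = KL_elem P w" using P w by (simp add: KLpred_def)
  then show "barE (Phi (KL_elem P w)) = Phi (KL_elem P w)" using Phi_hbar [OF KL_elem_closed] by metis
  show "lk (Phi (KL_elem P w)) w = 1" using P w by (simp add: lookup_Phi_KL_elem KLpred_def klcoef_def)
  fix y assume ne: "y \<noteq> w"
  show "lk (Phi (KL_elem P w)) y \<in> QA"
  proof (cases "bruhat_le y w")
    case True
    then have lt: "bruhat_lt y w" using ne by (simp add: bruhat_lt_def)
    then have deg: "2 * Polynomial.degree (P y w) + 1 \<le> len w - len y" using P by (simp add: KLpred_def)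
    have "lk (klcoef (len w - len y) (P y w)) k = 0" if k: "k \<le> 0" for k
    proof -
      have "Polynomial.degree (P y w) < nat ((int (len w - len y) - k) div 2)" if ev: "even (int (len w - len y) - k)"
      proof -
        have "2 * int (Polynomial.degree (P y w)) + 1 \<le> int (len w - len y) - k" using deg k by linarith
        moreover obtain m where "int (len w - len y) - k = 2 * m" using ev by blast
        ultimately show ?thesis by simp
      qed
      then show ?thesis by (auto simp: lookup_klcoef coeff_eq_0)
    qed
    then show ?thesis unfolding QA_iff lookup_Phi_KL_elem using True by simp
  next
    case False
    then show ?thesis using QA_zero by (simp add: lookup_Phi_KL_elem)
  qed
qed

text \<open>Reads the polynomial off the vector \<open>KL w\<close>. With n the length difference,
  the coefficient of degree k stands at \<open>q^(n - 2k)\<close>, the power of -1 undoes the sign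
  in \<open>(-q)^n\<close>, and the range of summation ends at the last k with
  \<open>n - 2k \<ge> 1\<close>.\<close>

definition KLp :: "'w \<Rightarrow> 'w \<Rightarrow> int poly" where
  "KLp y w = (if y = w \<and> w \<in> carrier W then 1 else if bruhat_lt y w then
     (\<Sum>k\<le>(len w - len y - 1) div 2. Polynomial.monom ((- 1) ^ (len w - len y) *
        lk (lk (KL w) y) (int (len w - len y) - 2 * int k)) k) else 0)"

lemma coeff_KLp:
  assumes "bruhat_lt y w"
  shows "coeff (KLp y w) k = (if k \<le> (len w - len y - 1) div 2
    then (- 1) ^ (len w - len y) * lk (lk (KL w) y) (int (len w - len y) - 2 * int k) else 0)"
proof -
  have "y \<noteq> w" using assms by auto
  then show ?thesis using assms unfolding KLp_def by (simp add: coeff_sum when_def)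
qed

lemma klcoef_KLp:
  assumes "bruhat_lt y w"
  shows "klcoef (len w - len y) (KLp y w) = lk (KL w) y"
proof (rule poly_mapping_eqI)
  fix j
  let ?n = "len w - len y"
  have n: "?n > 0" using bruhat_lt_len [OF assms] by simp
  have w: "w \<in> carrier W" "y \<noteq> w" using assms bruhat_ltD by auto
  have GG: "lk (lk (KL w) y) j \<noteq> 0 \<Longrightarrow> 1 \<le> j \<and> j \<le> int ?n \<and> even (int ?n - j)"
    using KL_GG [OF w] by (simp add: GG_def)
  show "lk (klcoef ?n (KLp y w)) j = lk (lk (KL w) y) j"
  proof (cases "even (int ?n - j) \<and> j \<le> int ?n")
    case True
    then obtain m where "int ?n - j = 2 * m" by (meson evenE)
    with True have m: "int ?n - j = 2 * m" "m \<ge> 0" by simp_all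
    have k: "nat ((int ?n - j) div 2) = nat m" "int ?n - 2 * int (nat m) = j" using m by auto
    have "nat m \<le> (?n - 1) div 2 \<longleftrightarrow> 1 \<le> j" using m n by (auto; linarith)
    then show ?thesis using True GG unfolding lookup_klcoef k(1) coeff_KLp [OF assms] k(2)
      by (auto simp flip: power_add mult.assoc mult_2)
  next
    case False
    then show ?thesis using GG by (auto simp: lookup_klcoef)
  qed
qed

lemma KLpred_KLp: "KLpred KLp"
  unfolding KLpred_def
proof (intro conjI allI ballI impI)
  fix w assume w: "w \<in> carrier W"
  show "KLp w w = 1" using w by (simp add: KLp_def)
  have "Phi (KL_elem KLp w) = KL w"
  proof (rule poly_mapping_eqI)
    fix y
    show "lk (Phi (KL_elem KLp w)) y = lk (KL w) y"
    proof (cases "y = w")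
      case True
      then show ?thesis using w by (simp add: lookup_Phi_KL_elem KLp_def klcoef_def)
    next
      case False
      then show ?thesis using klcoef_KLp [of y w] KL_le [OF w, of y]
        by (auto simp: lookup_Phi_KL_elem bruhat_lt_def)
    qed
  qed
  then show "hbar (KL_elem KLp w) = KL_elem KLp w"
    using w by (intro Phi_inj) (auto simp: Phi_hbar KL_elem_closed)
next
  fix y w assume "\<not> bruhat_le y w"
  then show "KLp y w = 0" by (auto simp: KLp_def bruhat_lt_def)
next
  fix y w assume lt: "bruhat_lt y w"
  have "Polynomial.degree (KLp y w) \<le> (len w - len y - 1) div 2"
    by (rule degree_le) (simp add: coeff_KLp [OF lt])
  then show "2 * Polynomial.degree (KLp y w) + 1 \<le> len w - len y" using bruhat_lt_len [OF lt] by linarith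
qed

lemma KL_poly_eq: "KL_poly = KLp"
  unfolding KL_poly_def KLpred_def [symmetric]
proof (rule the_equality [where P = KLpred, OF KLpred_KLp])
  fix P assume P: "KLpred P"
  show "P = KLp"
  proof (intro ext)
    fix y w
    consider "\<not> bruhat_le y w" | "bruhat_lt y w" | "y = w" "w \<in> carrier W"
      by (auto simp: bruhat_lt_def dest: bruhat_leD)
    then show "P y w = KLp y w"
    proof cases
      case 2
      then have w: "w \<in> carrier W" using bruhat_ltD by blast
      have "klcoef (len w - len y) (P y w) = lk (KL w) y"
        using lookup_Phi_KL_elem [of P w y] KLpred_KL [OF P w] bruhat_ltD(1) [OF 2] by simp
      then have eq: "klcoef (len w - len y) (P y w) = klcoef (len w - len y) (KLp y w)" using klcoef_KLp [OF 2] by simp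
      show ?thesis
      proof (rule poly_eqI)
        fix k
        have "lk (klcoef (len w - len y) (P y w)) (int (len w - len y) - 2 * int k) =
            lk (klcoef (len w - len y) (KLp y w)) (int (len w - len y) - 2 * int k)" using eq by simp
        then show "coeff (P y w) k = coeff (KLp y w) k" unfolding lookup_klcoef by simp
      qed
    qed (use P KLpred_KLp in \<open>auto simp: KLpred_def\<close>)
  qed
qed

text \<open>For odd length difference n the coefficient of degree \<open>(n - 1)/2\<close> stands at
  \<open>q^1\<close>, and \<open>(-1)^n = -1\<close> is the sign built into \<open>mcoef\<close>.
  For even n the parity condition of \<open>GG\<close> excludes degree 1.\<close>

lemma KL_mu_lt_eq:
  assumes lt: "bruhat_lt y w"
  shows "KL_mu_lt y w = mcoef (KL w) y"
proof -
  let ?n = "len w - len y"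
  have w: "w \<in> carrier W" "y \<noteq> w" using assms bruhat_ltD by auto
  show ?thesis
  proof (cases "odd ?n")
    case True
    then obtain b where "?n = 2 * b + 1" by (rule oddE)
    then have n: "int ?n - 2 * int ((?n - 1) div 2) = 1" by (simp only:) simp
    show ?thesis unfolding KL_mu_lt_def KL_poly_eq coeff_KLp [OF lt] n mcoef_def using True by simp
  next
    case False
    then have "lk (lk (KL w) y) 1 = 0" using KL_GG [OF w] by (auto simp: GG_def)
    then show ?thesis using False by (simp add: KL_mu_lt_def mcoef_def)
  qed
qed

lemma KL_graph_arrow: "wg_arrow KL_graph u v \<longleftrightarrow> karrow u v"
proof -
  have mu: "mu KL_graph u v = kmu u v" by (simp add: KL_graph_def kmu_def KL_mu_lt_eq)
  have "tau KL_graph x = ldes x" if "x \<in> carrier W" for x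
    using that by (auto simp: KL_graph_def ldes_def bruhat_lt_S_left_iff)
  then show ?thesis by (auto simp: wg_arrow_def karrow_def mu) (auto simp: KL_graph_def)
qed

end

context coxeter_parabolic
begin

section \<open>The induced module\<close>

abbreviation "CJ \<equiv> KL wJ"
abbreviation "TF \<equiv> carrier H \<times> (UNIV :: laurent set)"
abbreviation "N \<equiv> tensor_kernel J"

lemma tensor_relatorsI:
  "h \<in> carrier H \<Longrightarrow> h' \<in> carrier H \<Longrightarrow>
    frag_of (h \<oplus>\<^bsub>H\<^esub> h', a) - frag_of (h, a) - frag_of (h', a) \<in> tensor_relators J"
  "h \<in> carrier H \<Longrightarrow> frag_of (h, a + a') - frag_of (h, a) - frag_of (h, a') \<in> tensor_relators J"
  "h \<in> carrier H \<Longrightarrow> u \<in> WJ \<Longrightarrow>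
    frag_of (h \<otimes>\<^bsub>H\<^esub> (scal c \<otimes>\<^bsub>H\<^esub> T u), a) - frag_of (h, c * (- qinv) ^ len u * a) \<in> tensor_relators J"
  unfolding tensor_relators_def
  by (rule UnI1, rule UnI1, rule CollectI, intro exI conjI, rule refl, assumption, assumption)
    (rule UnI1, rule UnI2, rule CollectI, intro exI conjI, rule refl, assumption,
     rule UnI2, rule CollectI, intro exI conjI, rule refl, assumption, assumption)

lemma tensor_relatorsE:
  assumes "p \<in> tensor_relators J"
  obtains h h' a where "h \<in> carrier H" "h' \<in> carrier H"
      "p = frag_of (h \<oplus>\<^bsub>H\<^esub> h', a) - frag_of (h, a) - frag_of (h', a)"
    | h a a' where "h \<in> carrier H" "p = frag_of (h, a + a') - frag_of (h, a) - frag_of (h, a')"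
    | h c u a where "h \<in> carrier H" "u \<in> WJ"
      "p = frag_of (h \<otimes>\<^bsub>H\<^esub> (scal c \<otimes>\<^bsub>H\<^esub> T u), a) - frag_of (h, c * (- qinv) ^ len u * a)"
  using assms unfolding tensor_relators_def
  by (elim UnE CollectE exE conjE)
    (rule that(1), assumption, assumption, assumption, rule that(2), assumption, assumption,
     rule that(3), assumption, assumption, assumption)

lemma relators_keys: "p \<in> tensor_relators J \<Longrightarrow> Poly_Mapping.keys p \<subseteq> TF"
proof -
  have keys3: "Poly_Mapping.keys (frag_of x - frag_of y - frag_of z) \<subseteq> A" if "x \<in> A" "y \<in> A" "z \<in> A"
    for x y z :: "'w hecke \<times> laurent" and A
    using that keys_diff [of "frag_of x - frag_of y" "frag_of z"] keys_diff [of "frag_of x" "frag_of y"] by auto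
  have keys2: "Poly_Mapping.keys (frag_of x - frag_of y) \<subseteq> A" if "x \<in> A" "y \<in> A"
    for x y :: "'w hecke \<times> laurent" and A
    using that keys_diff [of "frag_of x" "frag_of y"] by auto
  assume p: "p \<in> tensor_relators J"
  show ?thesis
  using p proof (cases rule: tensor_relatorsE)
    case 1
    then show ?thesis by (simp only:) (rule keys3, auto)
  next
    case 2
    then show ?thesis by (simp only:) (rule keys3, auto)
  next
    case 3
    then show ?thesis by (simp only:) (rule keys2, auto)
  qed
qed

lemma relators_carrier: "tensor_relators J \<subseteq> carrier tensor_free"
  unfolding tensor_free_def using relators_keys by auto

lemma tensor_free_simps [simp]: "x \<otimes>\<^bsub>tensor_free\<^esub> y = x + y" "\<one>\<^bsub>tensor_free\<^esub> = 0"
  "x \<in> carrier tensor_free \<longleftrightarrow> Poly_Mapping.keys x \<subseteq> TF"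
  "Poly_Mapping.keys x \<subseteq> TF \<Longrightarrow> inv\<^bsub>tensor_free\<^esub> x = - x"
  unfolding tensor_free_def by simp_all

lemma comm_group_tensor_free: "comm_group tensor_free"
  unfolding tensor_free_def by (rule abelian_free_Abelian_group)

lemma subgroup_N: "subgroup N tensor_free"
  unfolding tensor_kernel_def
  by (rule group.generate_is_subgroup [OF comm_group.axioms(2) [OF comm_group_tensor_free] relators_carrier])

lemma normal_N: "N \<lhd> tensor_free"
  using comm_group.subgroup_imp_normal [OF comm_group_tensor_free subgroup_N] .

lemma N_keys: "p \<in> N \<Longrightarrow> Poly_Mapping.keys p \<subseteq> TF"
  using subgroup.mem_carrier [OF subgroup_N] by simp

lemma N_zero [simp]: "0 \<in> N"
  using subgroup.one_closed [OF subgroup_N] by simp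

lemma N_add: "p \<in> N \<Longrightarrow> p' \<in> N \<Longrightarrow> p + p' \<in> N"
  using subgroup.m_closed [OF subgroup_N] by simp

lemma N_minus: "p \<in> N \<Longrightarrow> - p \<in> N"
  using subgroup.m_inv_closed [OF subgroup_N, of p] N_keys [of p] by simp

lemma N_diff: "p \<in> N \<Longrightarrow> p' \<in> N \<Longrightarrow> p - p' \<in> N"
  using N_add [of p "- p'"] N_minus by simp

lemma N_relator: "p \<in> tensor_relators J \<Longrightarrow> p \<in> N"
  unfolding tensor_kernel_def by (rule generate.incl)

lemma N_induct [consumes 1, case_names relator minus add zero]:
  assumes "p \<in> N" "\<And>p. p \<in> tensor_relators J \<Longrightarrow> P p"
    "\<And>p. Poly_Mapping.keys p \<subseteq> TF \<Longrightarrow> P p \<Longrightarrow> P (- p)"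
    "\<And>p p'. P p \<Longrightarrow> P p' \<Longrightarrow> P (p + p')" "P 0"
  shows "P p"
  using assms(1) unfolding tensor_kernel_def
proof (induction rule: generate.induct)
  case (inv h)
  then show ?case using assms(2,3) [of h] relators_keys [of h] by simp
qed (use assms in auto)

definition cls :: "('w hecke \<times> laurent \<Rightarrow>\<^sub>0 int) \<Rightarrow> ('w hecke \<times> laurent \<Rightarrow>\<^sub>0 int) set" where
  "cls p = N #>\<^bsub>tensor_free\<^esub> p"

lemma cls_set: "cls p = {k + p |k. k \<in> N}"
  unfolding cls_def r_coset_def by auto

lemma cls_eq_iff: "cls p = cls p' \<longleftrightarrow> p - p' \<in> N"
proof
  assume "cls p = cls p'"
  then have "0 + p \<in> cls p'" using N_zero unfolding cls_set by blast
  then show "p - p' \<in> N" unfolding cls_set by auto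
next
  have sub: "cls f \<subseteq> cls g" if fg: "f - g \<in> N" for f g
  proof
    fix x assume "x \<in> cls f"
    then obtain i where "x = i + f" "i \<in> N" unfolding cls_set by auto
    then have "x = (i + (f - g)) + g" "i + (f - g) \<in> N" using fg N_add by auto
    then show "x \<in> cls g" unfolding cls_set by blast
  qed
  assume a: "p - p' \<in> N"
  then have "p' - p \<in> N" using N_minus by fastforce
  then show "cls p = cls p'" using sub a by blast
qed

abbreviation "M \<equiv> induced_module J"

lemma M_carrier: "carrier M = {cls p |p. Poly_Mapping.keys p \<subseteq> TF}"
  unfolding induced_module_def by (auto simp: FactGroup_def RCOSETS_def cls_def)

lemma cls_carrier [simp, intro]: "Poly_Mapping.keys p \<subseteq> TF \<Longrightarrow> cls p \<in> carrier M"
  unfolding M_carrier by blast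

lemma M_cases:
  assumes "K \<in> carrier M"
  obtains p where "K = cls p" "Poly_Mapping.keys p \<subseteq> TF"
  using assms unfolding M_carrier by blast

lemma M_add: "Poly_Mapping.keys p \<subseteq> TF \<Longrightarrow> Poly_Mapping.keys p' \<subseteq> TF \<Longrightarrow> cls p \<oplus>\<^bsub>M\<^esub> cls p' = cls (p + p')"
  unfolding induced_module_def cls_def using normal.rcos_sum [OF normal_N, of p p'] by simp

lemma cls_zero: "cls 0 = N"
  unfolding cls_set by auto

lemma M_zero: "\<zero>\<^bsub>M\<^esub> = cls 0"
  unfolding induced_module_def cls_zero by simp

lemma keys_add_TF: "Poly_Mapping.keys p \<subseteq> A \<Longrightarrow> Poly_Mapping.keys p' \<subseteq> A \<Longrightarrow> Poly_Mapping.keys (p + p') \<subseteq> A"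
  using keys_add [of p p'] by blast

lemma abelian_group_M: "abelian_group M"
proof (rule abelian_groupI)
  show "x \<oplus>\<^bsub>M\<^esub> y \<in> carrier M" if "x \<in> carrier M" "y \<in> carrier M" for x y
    using that by (auto elim!: M_cases simp: M_add keys_add_TF)
  show "\<zero>\<^bsub>M\<^esub> \<in> carrier M" unfolding M_zero by auto
  show "x \<oplus>\<^bsub>M\<^esub> y \<oplus>\<^bsub>M\<^esub> z = x \<oplus>\<^bsub>M\<^esub> (y \<oplus>\<^bsub>M\<^esub> z)" if "x \<in> carrier M" "y \<in> carrier M" "z \<in> carrier M" for x y z
    using that by (elim M_cases) (simp add: M_add keys_add_TF add.assoc)
  show "x \<oplus>\<^bsub>M\<^esub> y = y \<oplus>\<^bsub>M\<^esub> x" if "x \<in> carrier M" "y \<in> carrier M" for x y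
    using that by (elim M_cases) (simp add: M_add add.commute)
  show "\<zero>\<^bsub>M\<^esub> \<oplus>\<^bsub>M\<^esub> x = x" if "x \<in> carrier M" for x
    using that by (elim M_cases) (simp add: M_zero M_add)
  show "\<exists>y\<in>carrier M. y \<oplus>\<^bsub>M\<^esub> x = \<zero>\<^bsub>M\<^esub>" if x: "x \<in> carrier M" for x
  proof -
    obtain p where p: "x = cls p" "Poly_Mapping.keys p \<subseteq> TF" using x by (rule M_cases)
    then have "cls (- p) \<oplus>\<^bsub>M\<^esub> x = \<zero>\<^bsub>M\<^esub>" by (simp add: M_add M_zero)
    then show ?thesis using p by (intro bexI [of _ "cls (- p)"]) auto
  qed
qed

sublocale M: abelian_group M
  by (rule abelian_group_M)

definition fr :: "'w hecke \<Rightarrow> ('w hecke \<times> laurent \<Rightarrow>\<^sub>0 int) \<Rightarrow> ('w hecke \<times> laurent \<Rightarrow>\<^sub>0 int)" where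
  "fr h = frag_extend (\<lambda>(h', a). frag_of (h \<otimes>\<^bsub>H\<^esub> h', a))"

lemma fr_simps [simp]: "fr h 0 = 0" "fr h (frag_of (h', a)) = frag_of (h \<otimes>\<^bsub>H\<^esub> h', a)"
  "fr h (p + p') = fr h p + fr h p'" "fr h (p - p') = fr h p - fr h p'" "fr h (- p) = - fr h p"
  by (simp_all add: fr_def frag_extend_add frag_extend_diff frag_extend_minus)

lemma fr_keys: "h \<in> carrier H \<Longrightarrow> Poly_Mapping.keys p \<subseteq> TF \<Longrightarrow> Poly_Mapping.keys (fr h p) \<subseteq> TF"
proof -
  assume h: "h \<in> carrier H" "Poly_Mapping.keys p \<subseteq> TF"
  have "Poly_Mapping.keys (fr h p) \<subseteq>
      (\<Union>x\<in>Poly_Mapping.keys p. Poly_Mapping.keys ((\<lambda>(h', a). frag_of (h \<otimes>\<^bsub>H\<^esub> h', a)) x :: _ \<Rightarrow>\<^sub>0 int))"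
    unfolding fr_def by (rule keys_frag_extend)
  also have "\<dots> \<subseteq> TF" using h by (auto split: prod.splits)
  finally show ?thesis .
qed

text \<open>Each of the three kinds of relators only changes its left factor, so left multiplication
  passes to the tensor product.\<close>

lemma fr_relator:
  assumes h: "h \<in> carrier H" and p: "p \<in> tensor_relators J"
  shows "fr h p \<in> tensor_relators J"
proof -
  show ?thesis
  using p proof (cases rule: tensor_relatorsE)
    case (1 k k' a)
    then have "fr h p = frag_of (h \<otimes>\<^bsub>H\<^esub> k \<oplus>\<^bsub>H\<^esub> h \<otimes>\<^bsub>H\<^esub> k', a) - frag_of (h \<otimes>\<^bsub>H\<^esub> k, a) - frag_of (h \<otimes>\<^bsub>H\<^esub> k', a)"
      using h by (simp add: H.r_distr)
    then show ?thesis using tensor_relatorsI(1) 1 h by simp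
  next
    case (2 k a a')
    then have "fr h p = frag_of (h \<otimes>\<^bsub>H\<^esub> k, a + a') - frag_of (h \<otimes>\<^bsub>H\<^esub> k, a) - frag_of (h \<otimes>\<^bsub>H\<^esub> k, a')"
      using h by simp
    then show ?thesis using tensor_relatorsI(2) 2 h by simp
  next
    case (3 k c u a)
    then have "fr h p = frag_of (h \<otimes>\<^bsub>H\<^esub> k \<otimes>\<^bsub>H\<^esub> (scal c \<otimes>\<^bsub>H\<^esub> T u), a) -
        frag_of (h \<otimes>\<^bsub>H\<^esub> k, c * (- qinv) ^ len u * a)"
      using h by (simp add: H.m_assoc)
    then show ?thesis using tensor_relatorsI(3) 3 h by simp
  qed
qed

lemma fr_N: "h \<in> carrier H \<Longrightarrow> p \<in> N \<Longrightarrow> fr h p \<in> N"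
  using N_induct [where P = "\<lambda>p. fr h p \<in> N" and p = p]
  by (simp add: fr_relator N_relator N_minus N_add)

text \<open>The action is a union over all representatives of a coset; they all yield the same
  coset, and the union is nonempty.\<close>

lemma M_smult:
  assumes h: "h \<in> carrier H"
  shows "h \<odot>\<^bsub>M\<^esub> cls p = cls (fr h p)"
proof -
  have "h \<odot>\<^bsub>M\<^esub> cls p = (\<Union>p'\<in>cls p. cls (fr h p'))"
    unfolding induced_module_def fr_def cls_def by simp
  also have "\<dots> = (\<Union>p'\<in>cls p. cls (fr h p))"
  proof (intro SUP_cong refl)
    fix p' assume "p' \<in> cls p"
    then obtain k where "k \<in> N" "p' = k + p" unfolding cls_set by blast
    then show "cls (fr h p') = cls (fr h p)" using fr_N [OF h] by (simp add: cls_eq_iff)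
  qed
  also have "\<dots> = cls (fr h p)"
  proof -
    have "0 + p \<in> cls p" unfolding cls_set using N_zero by blast
    then show ?thesis by auto
  qed
  finally show ?thesis .
qed

lemma M_smult_closed: "h \<in> carrier H \<Longrightarrow> x \<in> carrier M \<Longrightarrow> h \<odot>\<^bsub>M\<^esub> x \<in> carrier M"
  by (auto elim!: M_cases simp: M_smult fr_keys)

text \<open>The isomorphism from the induced module onto \<^term>\<open>LL\<close>, $h \otimes a \mapsto a h C_{w_J}$.\<close>

definition th :: "('w hecke \<times> laurent \<Rightarrow>\<^sub>0 int) \<Rightarrow> ('w \<Rightarrow>\<^sub>0 laurent)" where
  "th p = (\<Sum>x\<in>Poly_Mapping.keys p. smul (of_int (lk p x) * snd x) (act (fst x) CJ))"

lemma th_add: "th (p + p') = th p + th p'"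
  unfolding th_def
  by (rule setsum_keys_plus_distrib) (simp_all add: smul_add_left distrib_right)

lemma th_zero [simp]: "th 0 = 0"
  by (simp add: th_def)

lemma th_minus: "th (- p) = - th p"
  using th_add [of p "- p"] by (simp add: eq_neg_iff_add_eq_0 add.commute)

lemma th_diff: "th (p - p') = th p - th p'"
  using th_add [of p "- p'"] th_minus by simp

lemma th_of [simp]: "th (frag_of (h, a)) = smul a (act h CJ)"
  by (simp add: th_def)

lemma CJ_LL: "CJ \<in> LL"
  using KL_LL_DJ [OF one_DJ] by simp

lemma wact_CJ: "us \<in> lists J \<Longrightarrow> wact us CJ = smul ((- qinv) ^ length us) CJ"
proof (induction us)
  case (Cons r us)
  then have "r \<in> J" "wact us CJ = smul ((- qinv) ^ length us) CJ" by auto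
  then show ?case using lam_KL_down [of r wJ] wJ_descents(2)
    by (simp add: lmap_smul smul_smul mult.commute)
qed simp

lemma act_T_CJ: "u \<in> WJ \<Longrightarrow> act (T u) CJ = smul ((- qinv) ^ len u) CJ"
proof -
  assume u: "u \<in> WJ"
  obtain us where us: "us \<in> lists J" "reduced us u" using parabolic_reduced [OF J_S u] .
  have "T u = hclass (bvec us)" unfolding T_eq using hclass_reduced [OF reduced_word us(2)] u by simp
  then have "act (T u) CJ = wact us CJ" using reducedD(1) [OF us(2)] by (simp add: act_hclass actF_e)
  then show ?thesis using wact_CJ [OF us(1)] reducedD(3) [OF us(2)] by simp
qed

lemma th_relator:
  assumes p: "p \<in> tensor_relators J"
  shows "th p = 0"
proof -
  show ?thesis
  using p proof (cases rule: tensor_relatorsE)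
    case 1
    then show ?thesis by (simp add: th_diff act_add smul_add)
  next
    case 2
    then show ?thesis by (simp add: th_diff smul_add_left)
  next
    case 3
    then show ?thesis by (simp add: th_diff act_mult act_T_CJ act_smul smul_smul ac_simps)
  qed
qed

lemma th_N: "p \<in> N \<Longrightarrow> th p = 0"
  by (induction rule: N_induct) (simp_all add: th_relator th_minus th_add)

lemma th_fr:
  assumes h: "h \<in> carrier H" and p: "Poly_Mapping.keys p \<subseteq> TF"
  shows "th (fr h p) = act h (th p) \<and> th p \<in> EW"
  using p
proof (induction p rule: free_Abelian_group_induct [consumes 1, case_names zero diff gen])
  case zero
  show ?case using act_zero [OF h] by simp
next
  case (diff x y)
  have "act h (th x - th y) = act h (th x) - act h (th y)"
    using act_plus [OF h, of "th x - th y" "th y"] diff by (simp add: eq_diff_eq)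
  then show ?case using diff by (simp add: th_diff)
next
  case (gen x)
  then show ?case using gen h by (cases x) (simp add: act_mult act_smul)
qed

text \<open>Both sides lie in \<open>LL\<close>, so the coset tops decide, and
  \<open>d wJ \<le> wJ\<close> forces \<open>d = \<one>\<close> by projection to \<open>D_J\<close>.
  In effect this is the closed formula for \<open>C_{wJ}\<close>.\<close>

lemma Bd_one: "Bd \<one> = CJ"
proof (rule LL_eqI)
  fix d assume d: "d \<in> DJ"
  have "lk CJ (d \<otimes> wJ) = (if \<one> = d then 1 else 0)"
  proof (cases "\<one> = d")
    case False
    have "lk CJ (d \<otimes> wJ) = 0"
    proof (rule ccontr)
      assume "lk CJ (d \<otimes> wJ) \<noteq> 0"
      then have "bruhat_le (d \<otimes> wJ) (\<one> \<otimes> wJ)" using KL_le by simp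
      then have "bruhat_le d \<one>" using bruhat_le_min_reps [OF J_S d one_DJ wJ_WJ wJ_WJ] by simp
      then show False using bruhat_le_len False by fastforce
    qed
    then show ?thesis using False by simp
  qed auto
  then show "lk (Bd \<one>) (d \<otimes> wJ) = lk CJ (d \<otimes> wJ)" using lookup_Bd_wJ [OF one_DJ d] by simp
qed (simp_all add: CJ_LL)

lemma act_T_Bd: "d \<in> DJ \<Longrightarrow> act (T d) CJ = Bd d"
proof (induction "len d" arbitrary: d rule: less_induct)
  case less
  show ?case
  proof (cases "d = \<one>")
    case True
    then show ?thesis by (simp add: T_one Bd_one)
  next
    case False
    then obtain s where s: "s \<in> S" "len (s \<otimes> d) < len d"
      using ex_left_descent [OF DJ_closed [OF less.prems]] by blast
    have sd: "s \<otimes> d \<in> DJ" using min_reps_suffix [OF J_S less.prems s] .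
    have dd: "s \<otimes> (s \<otimes> d) = d" using s less.prems by simp
    have "T d = Tgen s \<otimes>\<^bsub>H\<^esub> T (s \<otimes> d)" using T_S_up [OF s(1), of "s \<otimes> d"] s sd dd by simp
    then have "act (T d) CJ = lam s (Bd (s \<otimes> d))" using less.hyps [OF s(2) sd] s sd by (simp add: act_mult)
    then show ?thesis using lam_Bd_up [OF sd s(1)] dd less.prems s(2) by simp
  qed
qed

lemma DJ_sub: "f \<in> EE DJ \<Longrightarrow> f \<in> EW"
  by (erule EE_mono) auto

lemma act_Psi: "f \<in> EE DJ \<Longrightarrow> act (Psi f) CJ = lin Bd f"
proof (induction rule: EE_induct)
  case (single d a)
  then show ?case by (simp add: single_eq_smul Psi_smul act_mult Psi_e act_T_Bd lin_smul)
next
  case zero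
  show ?case using act_scal [of CJ 0] by (simp add: Psi_zero scal_zero lmap_zero)
next
  case (add f g)
  then show ?case using DJ_sub by (simp add: Psi_add act_add lin_add)
qed

section \<open>Normal forms in the tensor product\<close>

abbreviation br :: "'w hecke \<Rightarrow> ('w hecke \<times> laurent \<Rightarrow>\<^sub>0 int)" where "br h \<equiv> frag_of (h, 1)"

lemma br_add: "h \<in> carrier H \<Longrightarrow> k \<in> carrier H \<Longrightarrow> br (h \<oplus>\<^bsub>H\<^esub> k) - br h - br k \<in> N"
  by (intro N_relator tensor_relatorsI)

lemma br_scal: "h \<in> carrier H \<Longrightarrow> frag_of (h, a) - br (scal a \<otimes>\<^bsub>H\<^esub> h) \<in> N"
proof -
  assume h: "h \<in> carrier H"
  \<comment> \<open>The relator for \<open>u = \<one>\<close> is what moves scalars across the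
    tensor sign.\<close>
  have "frag_of (h \<otimes>\<^bsub>H\<^esub> (scal a \<otimes>\<^bsub>H\<^esub> T \<one>), 1) - frag_of (h, a * (- qinv) ^ len \<one> * 1) \<in> N"
    using h by (intro N_relator tensor_relatorsI generate.one)
  then have "br (scal a \<otimes>\<^bsub>H\<^esub> h) - frag_of (h, a) \<in> N" using h by (simp add: T_one scal_commute)
  then show ?thesis using N_minus by fastforce
qed

lemma br_T: "h \<in> carrier H \<Longrightarrow> u \<in> WJ \<Longrightarrow>
    br (h \<otimes>\<^bsub>H\<^esub> T u) - br (scal ((- qinv) ^ len u) \<otimes>\<^bsub>H\<^esub> h) \<in> N"
proof -
  assume h: "h \<in> carrier H" "u \<in> WJ"
  have "frag_of (h \<otimes>\<^bsub>H\<^esub> (scal 1 \<otimes>\<^bsub>H\<^esub> T u), 1) - frag_of (h, 1 * (- qinv) ^ len u * 1) \<in> N"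
    using h by (intro N_relator tensor_relatorsI)
  then have "br (h \<otimes>\<^bsub>H\<^esub> T u) - frag_of (h, (- qinv) ^ len u) \<in> N" using h by (simp add: scal_one)
  from N_add [OF this br_scal [OF h(1), of "(- qinv) ^ len u"]] show ?thesis by simp
qed

lemma br_zero: "br (Psi 0) \<in> N"
  using br_add [of "Psi 0" "Psi 0"] N_minus [of "- br (Psi 0)"] by (simp add: Psi_zero)

lemma br_Psi_add: "f \<in> EW \<Longrightarrow> g \<in> EW \<Longrightarrow> br (Psi (f + g)) - br (Psi f) - br (Psi g) \<in> N"
  using br_add by (simp add: Psi_add)

text \<open>Factor \<open>T_w = T_d T_u\<close> with \<open>d\<close> in \<open>D_J\<close> and
  \<open>u\<close> in \<open>W_J\<close>; lengths add, and \<open>T_u\<close> is absorbed by the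
  right factor as the scalar \<open>(-q^-1)^l(u)\<close>.\<close>

lemma br_normal_form:
  assumes "g \<in> EW" shows "\<exists>f\<in>EE DJ. br (Psi g) - br (Psi f) \<in> N"
  using assms
proof (induction rule: EE_induct)
  case (single w a)
  obtain d u where w: "d \<in> DJ" "u \<in> WJ" "w = d \<otimes> u" using ex_min_reps [OF J_S single] by blast
  let ?c = "(- qinv) ^ len u"
  have "T w = T d \<otimes>\<^bsub>H\<^esub> T u" unfolding w(3) using w len_DJ_mult by (intro T_mult) auto
  then have "Psi (Poly_Mapping.single w a) = (scal a \<otimes>\<^bsub>H\<^esub> T d) \<otimes>\<^bsub>H\<^esub> T u"
    using w single by (simp add: single_eq_smul Psi_smul Psi_e H.m_assoc)
  moreover have "scal ?c \<otimes>\<^bsub>H\<^esub> (scal a \<otimes>\<^bsub>H\<^esub> T d) = Psi (smul (?c * a) (bvec d))"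
    using w by (simp add: Psi_smul Psi_e scal_mult H.m_assoc)
  ultimately have "br (Psi (Poly_Mapping.single w a)) - br (Psi (smul (?c * a) (bvec d))) \<in> N"
    using br_T [of "scal a \<otimes>\<^bsub>H\<^esub> T d" u] w by simp
  then show ?case using w by (intro bexI [of _ "smul (?c * a) (bvec d)"]) auto
next
  case zero
  show ?case using N_zero by (intro bexI [of _ 0]) auto
next
  case (add g g')
  then obtain f f' where f: "f \<in> EE DJ" "br (Psi g) - br (Psi f) \<in> N" "f' \<in> EE DJ" "br (Psi g') - br (Psi f') \<in> N"
    by blast
  note N_diff [OF N_add [OF N_add [OF br_Psi_add [OF add(1,2)] f(2)] f(4)]
      br_Psi_add [OF DJ_sub [OF f(1)] DJ_sub [OF f(3)]]]
  then have "br (Psi (g + g')) - br (Psi (f + f')) \<in> N" by (simp add: algebra_simps)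
  then show ?case using f by blast
qed

lemma normal_form:
  assumes "Poly_Mapping.keys p \<subseteq> TF" shows "\<exists>f\<in>EE DJ. p - br (Psi f) \<in> N"
  using assms
proof (induction p rule: free_Abelian_group_induct [consumes 1, case_names zero diff gen])
  case zero
  show ?case using N_minus [OF br_zero] by (intro bexI [of _ 0]) auto
next
  case (diff x y)
  then obtain f g where f: "f \<in> EE DJ" "x - br (Psi f) \<in> N" "g \<in> EE DJ" "y - br (Psi g) \<in> N" by blast
  note N_add [OF N_diff [OF f(2,4)] br_Psi_add [OF DJ_sub [OF EE_diff [OF f(1,3)]] DJ_sub [OF f(3)]]]
  then have "x - y - br (Psi (f - g)) \<in> N" by (simp add: algebra_simps)
  then show ?case using f by (intro bexI [of _ "f - g"]) auto
next
  case (gen x)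
  then obtain h a where x: "x = (h, a)" "h \<in> carrier H" by auto
  then obtain f where f: "f \<in> EE DJ" "br (scal a \<otimes>\<^bsub>H\<^esub> h) - br (Psi f) \<in> N"
    using br_normal_form [of "Phi (scal a \<otimes>\<^bsub>H\<^esub> h)"] by auto
  have "frag_of (h, a) - br (Psi f) \<in> N" using N_add [OF br_scal [OF x(2), of a] f(2)] by simp
  then show ?case using f x by blast
qed

lemma th_normal_form:
  assumes f: "f \<in> EE DJ" and p: "p - br (Psi f) \<in> N"
  shows "th p = lin Bd f"
proof -
  have "th p - th (br (Psi f)) = 0" using th_N [OF p] by (simp add: th_diff)
  then show ?thesis using f by (simp add: act_Psi)
qed

lemma th_LL: "Poly_Mapping.keys p \<subseteq> TF \<Longrightarrow> th p \<in> LL"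
  using normal_form th_normal_form lin_Bd_LL by metis

text \<open>In normal form \<open>th\<close> becomes \<open>lin Bd\<close>, whose coefficients
  \<open>co\<close> recovers. So the normal forms are not only spanning but independent, and no
  relation beyond the given ones exists.\<close>

lemma th_kernel:
  assumes "Poly_Mapping.keys p \<subseteq> TF" "th p = 0"
  shows "p \<in> N"
proof -
  obtain f where f: "f \<in> EE DJ" "p - br (Psi f) \<in> N" using normal_form [OF assms(1)] by blast
  have "lin Bd f = 0" using th_normal_form [OF f] assms(2) by simp
  then have "f = 0" using co_lin_Bd [OF f(1)] by (simp add: lmap_zero)
  then show ?thesis using N_add [OF f(2) br_zero] by simp
qed

section \<open>The isomorphism of the induced module with the left ideal\<close>

definition TH :: "('w hecke \<times> laurent \<Rightarrow>\<^sub>0 int) set \<Rightarrow> ('w \<Rightarrow>\<^sub>0 laurent)" where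
  "TH K = th (SOME p. Poly_Mapping.keys p \<subseteq> TF \<and> K = cls p)"

lemma TH_cls:
  assumes p: "Poly_Mapping.keys p \<subseteq> TF" shows "TH (cls p) = th p"
proof -
  let ?q = "SOME q. Poly_Mapping.keys q \<subseteq> TF \<and> cls p = cls q"
  have "Poly_Mapping.keys ?q \<subseteq> TF \<and> cls p = cls ?q" by (rule someI [of _ p]) (use p in simp)
  then have "th (p - ?q) = 0" using th_N cls_eq_iff by blast
  then show ?thesis by (simp add: TH_def th_diff)
qed

lemma TH_LL [simp, intro]: "K \<in> carrier M \<Longrightarrow> TH K \<in> LL"
  by (auto elim!: M_cases simp: TH_cls th_LL)

lemma TH_add: "K \<in> carrier M \<Longrightarrow> K' \<in> carrier M \<Longrightarrow> TH (K \<oplus>\<^bsub>M\<^esub> K') = TH K + TH K'"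
  by (elim M_cases) (simp add: M_add TH_cls keys_add_TF th_add)

lemma TH_zero: "TH \<zero>\<^bsub>M\<^esub> = 0"
  by (simp add: M_zero TH_cls)

lemma TH_smult: "h \<in> carrier H \<Longrightarrow> K \<in> carrier M \<Longrightarrow> TH (h \<odot>\<^bsub>M\<^esub> K) = act h (TH K)"
  by (elim M_cases) (simp add: M_smult TH_cls fr_keys th_fr)

lemma TH_inj:
  assumes "K \<in> carrier M" "K' \<in> carrier M" "TH K = TH K'"
  shows "K = K'"
proof -
  obtain p p' where p: "K = cls p" "Poly_Mapping.keys p \<subseteq> TF" "K' = cls p'" "Poly_Mapping.keys p' \<subseteq> TF"
    using assms(1,2) by (metis M_cases)
  then have "th (p - p') = 0" using assms(3) by (simp add: TH_cls th_diff)
  moreover have "Poly_Mapping.keys (p - p') \<subseteq> TF" using p keys_diff [of p p'] by blast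
  ultimately show ?thesis using th_kernel p cls_eq_iff by blast
qed

definition THi :: "('w \<Rightarrow>\<^sub>0 laurent) \<Rightarrow> ('w hecke \<times> laurent \<Rightarrow>\<^sub>0 int) set" where
  "THi x = cls (br (Psi (co x)))"

lemma THi_closed [simp, intro]: "x \<in> LL \<Longrightarrow> THi x \<in> carrier M"
  unfolding THi_def using DJ_sub by (intro cls_carrier) auto

lemma TH_THi [simp]: "x \<in> LL \<Longrightarrow> TH (THi x) = x"
  unfolding THi_def using DJ_sub act_Psi [of "co x"] by (subst TH_cls) auto

lemma THi_TH [simp]: "K \<in> carrier M \<Longrightarrow> THi (TH K) = K"
  by (rule TH_inj) auto

lemma bJ_closed [simp, intro]: "d \<in> DJ \<Longrightarrow> bJ J d \<in> carrier M"
  and TH_bJ: "d \<in> DJ \<Longrightarrow> TH (bJ J d) = Bd d"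
  unfolding bJ_def tensor_def cls_def [symmetric] by (auto simp: TH_cls act_T_Bd)

lemma TH_asmult: "K \<in> carrier M \<Longrightarrow> TH (asmult M a K) = smul a (TH K)"
  unfolding asmult_def by (simp add: TH_smult)

lemma asmult_closed [simp, intro]: "K \<in> carrier M \<Longrightarrow> asmult M a K \<in> carrier M"
  unfolding asmult_def by (simp add: M_smult_closed)

lemma TH_finsum:
  assumes "finite A" "\<And>y. y \<in> A \<Longrightarrow> g y \<in> carrier M"
  shows "TH (finsum M g A) = (\<Sum>y\<in>A. TH (g y)) \<and> finsum M g A \<in> carrier M"
  using assms
proof (induction A rule: finite_induct)
  case empty
  show ?case by (simp add: TH_zero)
next
  case (insert x A)
  then show ?case by (simp add: M.finsum_insert TH_add Pi_def)
qed

lemma TH_finsum_lin: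
  assumes "c \<in> DJ \<rightarrow> carrier M" "Poly_Mapping.keys a \<subseteq> DJ"
  shows "TH (finsum M (\<lambda>w. asmult M (lk a w) (c w)) (Poly_Mapping.keys a)) = lin (\<lambda>w. TH (c w)) a"
    and "finsum M (\<lambda>w. asmult M (lk a w) (c w)) (Poly_Mapping.keys a) \<in> carrier M"
proof -
  have c: "c w \<in> carrier M" if "w \<in> Poly_Mapping.keys a" for w using assms that by auto
  then show "TH (finsum M (\<lambda>w. asmult M (lk a w) (c w)) (Poly_Mapping.keys a)) = lin (\<lambda>w. TH (c w)) a"
    "finsum M (\<lambda>w. asmult M (lk a w) (c w)) (Poly_Mapping.keys a) \<in> carrier M"
    using TH_finsum [of "Poly_Mapping.keys a" "\<lambda>w. asmult M (lk a w) (c w)"] by (simp_all add: TH_asmult lin_def)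
qed

text \<open>The vector \<open>bJ J \<one>\<close> generates the module, so a semilinear involution
  fixing it and compatible with \<open>hbar\<close> is unique. This removes the freedom in the
  existentially quantified bar of \<open>wgraph_basis\<close>.\<close>

lemma TH_module_bar:
  assumes bar: "module_bar M (bJ J) \<beta>" and x: "x \<in> carrier M"
  shows "TH (\<beta> x) = barE (TH x)"
proof -
  let ?h = "Psi (co (TH x))"
  have f: "co (TH x) \<in> EE DJ" using x by simp
  have h: "?h \<in> carrier H" using f DJ_sub by blast
  have TH: "TH x = act ?h CJ" using act_Psi [OF f] x by simp
  have b: "bJ J \<one> \<in> carrier M" "TH (bJ J \<one>) = CJ" by (simp_all add: TH_bJ Bd_one)
  have "x = ?h \<odot>\<^bsub>M\<^esub> bJ J \<one>" using x h b TH by (intro TH_inj) (auto simp: TH_smult M_smult_closed)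
  then have "\<beta> x = \<beta> (?h \<odot>\<^bsub>M\<^esub> bJ J \<one>)" by simp
  also have "\<dots> = hbar ?h \<odot>\<^bsub>M\<^esub> bJ J \<one>" using bar h b(1) unfolding module_bar_def by metis
  finally have "TH (\<beta> x) = act (hbar ?h) CJ" using h b by (simp add: TH_smult)
  moreover have "barE (TH x) = barE (act ?h CJ)" using TH by (rule arg_cong)
  ultimately show ?thesis using barE_act [OF h] by simp
qed

definition betaM :: "('w hecke \<times> laurent \<Rightarrow>\<^sub>0 int) set \<Rightarrow> ('w hecke \<times> laurent \<Rightarrow>\<^sub>0 int) set" where
  "betaM x = THi (barE (TH x))"

lemma module_bar_betaM: "module_bar M (bJ J) betaM"
  unfolding module_bar_def
proof (intro conjI ballI allI)
  show "betaM \<in> carrier M \<rightarrow> carrier M" by (auto simp: betaM_def LL_barE)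
  fix x assume x: "x \<in> carrier M"
  show "betaM (betaM x) = x" using x by (simp add: betaM_def LL_barE)
  show "betaM (asmult M a x) = asmult M (lbar a) (betaM x)" for a
    using x by (intro TH_inj) (auto simp: betaM_def LL_barE TH_asmult smap_smul)
  show "betaM (x \<oplus>\<^bsub>M\<^esub> y) = betaM x \<oplus>\<^bsub>M\<^esub> betaM y" if "y \<in> carrier M" for y
    using x that by (intro TH_inj) (auto simp: betaM_def LL_barE TH_add smap_add)
  show "betaM (h \<odot>\<^bsub>M\<^esub> x) = hbar h \<odot>\<^bsub>M\<^esub> betaM x" if "h \<in> carrier H" for h
  proof (rule TH_inj)
    have hx: "h \<odot>\<^bsub>M\<^esub> x \<in> carrier M" using x that by (rule M_smult_closed [rotated])
    then show "betaM (h \<odot>\<^bsub>M\<^esub> x) \<in> carrier M" by (simp add: betaM_def LL_barE)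
    show "hbar h \<odot>\<^bsub>M\<^esub> betaM x \<in> carrier M" using x that by (intro M_smult_closed) (auto simp: betaM_def LL_barE)
    have "barE (TH (h \<odot>\<^bsub>M\<^esub> x)) \<in> LL" using hx LL_barE by blast
    then show "TH (betaM (h \<odot>\<^bsub>M\<^esub> x)) = TH (hbar h \<odot>\<^bsub>M\<^esub> betaM x)"
      using x that by (simp add: betaM_def LL_barE TH_smult barE_act)
  qed
next
  show "betaM (bJ J \<one>) = bJ J \<one>"
    by (rule TH_inj) (auto simp: betaM_def LL_barE TH_bJ Bd_one CJ_LL)
qed

end

section \<open>Cells\<close>

lemma cellsD:
  assumes "C \<in> cells \<Gamma>" "x \<in> C"
  shows "x \<in> verts \<Gamma>" "C = {u \<in> verts \<Gamma>. wg_le \<Gamma> u x \<and> wg_le \<Gamma> x u}"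
proof -
  obtain y where y: "y \<in> verts \<Gamma>"
    "C = {(u, v). u \<in> verts \<Gamma> \<and> v \<in> verts \<Gamma> \<and> wg_le \<Gamma> u v \<and> wg_le \<Gamma> v u} `` {y}"
    using assms(1) unfolding cells_def by (auto elim: quotientE)
  have xy: "x \<in> verts \<Gamma>" "wg_le \<Gamma> x y" "wg_le \<Gamma> y x" using assms(2) y by auto
  then show "x \<in> verts \<Gamma>" by blast
  have trans: "wg_le \<Gamma> a b \<Longrightarrow> wg_le \<Gamma> b c \<Longrightarrow> wg_le \<Gamma> a c" for a b c
    unfolding wg_le_def by (rule rtranclp_trans)
  show "C = {u \<in> verts \<Gamma>. wg_le \<Gamma> u x \<and> wg_le \<Gamma> x u}"
  proof (intro equalityI subsetI)
    fix u assume "u \<in> C"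
    then have "u \<in> verts \<Gamma>" "wg_le \<Gamma> u y" "wg_le \<Gamma> y u" using y by auto
    then show "u \<in> {u \<in> verts \<Gamma>. wg_le \<Gamma> u x \<and> wg_le \<Gamma> x u}"
      using trans [OF _ xy(3)] trans [OF xy(2)] by simp
  next
    fix u assume "u \<in> {u \<in> verts \<Gamma>. wg_le \<Gamma> u x \<and> wg_le \<Gamma> x u}"
    then have u: "u \<in> verts \<Gamma>" "wg_le \<Gamma> u x" "wg_le \<Gamma> x u" by auto
    show "u \<in> C" using y(1) u(1) trans [OF u(2) xy(2)] trans [OF xy(3) u(3)] unfolding y(2) by simp
  qed
qed

lemma cellsI:
  assumes "x \<in> verts \<Gamma>"
  shows "{u \<in> verts \<Gamma>. wg_le \<Gamma> u x \<and> wg_le \<Gamma> x u} \<in> cells \<Gamma>"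
proof -
  have "{u \<in> verts \<Gamma>. wg_le \<Gamma> u x \<and> wg_le \<Gamma> x u} =
      {(u, v). u \<in> verts \<Gamma> \<and> v \<in> verts \<Gamma> \<and> wg_le \<Gamma> u v \<and> wg_le \<Gamma> v u} `` {x}" using assms by auto
  then show ?thesis unfolding cells_def by (simp only: quotientI [OF assms])
qed

lemma cells_nonempty: "C \<in> cells \<Gamma> \<Longrightarrow> \<exists>x. x \<in> C"
  unfolding cells_def by (auto elim!: quotientE simp: wg_le_def)

lemma maximal_cells_top:
  assumes x: "x \<in> verts \<Gamma>" and top: "\<And>v. v \<in> verts \<Gamma> \<Longrightarrow> wg_le \<Gamma> v x"
  shows "maximal_cells \<Gamma> = {{u \<in> verts \<Gamma>. wg_le \<Gamma> u x \<and> wg_le \<Gamma> x u}}"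
proof -
  let ?C = "{u \<in> verts \<Gamma>. wg_le \<Gamma> u x \<and> wg_le \<Gamma> x u}"
  have xC: "x \<in> ?C" using x by (simp add: wg_le_def)
  have "C' = ?C" if C': "C' \<in> cells \<Gamma>" and le: "cell_le \<Gamma> ?C C'" for C'
  proof -
    obtain u v where uv: "u \<in> ?C" "v \<in> C'" "wg_le \<Gamma> u v" using le unfolding cell_le_def by blast
    have v: "v \<in> verts \<Gamma>" using cellsD(1) [OF C' uv(2)] .
    have "wg_le \<Gamma> x v" using uv unfolding wg_le_def by auto
    then have "v \<in> ?C" using v top by blast
    then show ?thesis using cellsD(2) [OF C' uv(2)] cellsD(2) [OF cellsI [OF x], of v] by simp
  qed
  moreover have "C' = ?C" if C': "C' \<in> cells \<Gamma>" and max: "\<forall>C''\<in>cells \<Gamma>. cell_le \<Gamma> C' C'' \<longrightarrow> C'' = C'" for C'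
  proof -
    obtain v where v: "v \<in> C'" using cells_nonempty C' by blast
    then have "wg_le \<Gamma> v x" using top cellsD(1) [OF C'] by blast
    then have "cell_le \<Gamma> C' ?C" unfolding cell_le_def using v xC by blast
    then show ?thesis using max cellsI [OF x] by auto
  qed
  ultimately show ?thesis unfolding maximal_cells_def using cellsI [OF x] by blast
qed

lemma QA_mult_Aplus: "a \<in> QA \<Longrightarrow> b \<in> Aplus \<Longrightarrow> a * b \<in> QA"
  using Aplus_mult by (auto simp: mult.assoc)

lemma QA_Aplus: "a \<in> QA \<Longrightarrow> a \<in> Aplus"
  unfolding QA_iff Aplus_iff by auto

lemma one_Aplus: "1 \<in> Aplus"
  by (auto simp: Aplus_iff lookup_one)

lemma Aplus_diff: "a \<in> Aplus \<Longrightarrow> b \<in> Aplus \<Longrightarrow> a - b \<in> Aplus"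
  by (simp add: Aplus_iff lookup_minus)

context coxeter_parabolic
begin

section \<open>The W-graph basis of the induced module\<close>

text \<open>The inverse of the matrix \<open>cK\<close>: the column of \<open>w\<close> expresses
  \<open>b^J_w\<close> in the basis \<open>c^J\<close>. The first order clause is kept because it
  determines mu.\<close>

definition uK :: "'w \<Rightarrow> ('w \<Rightarrow>\<^sub>0 laurent)" where
  "uK = (SOME u. unitri bruhat_lt DJ u \<and> (\<forall>w\<in>DJ. lin cK (u w) = bvec w \<and> lin u (cK w) = bvec w) \<and>
    (\<forall>w\<in>DJ. \<forall>y. y \<noteq> w \<longrightarrow> lk (lk (u w) y) 1 = - lk (lk (cK w) y) 1))"

lemma uK: "unitri bruhat_lt DJ uK" "w \<in> DJ \<Longrightarrow> lin cK (uK w) = bvec w" "w \<in> DJ \<Longrightarrow> lin uK (cK w) = bvec w"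
  "w \<in> DJ \<Longrightarrow> y \<noteq> w \<Longrightarrow> lk (lk (uK w) y) 1 = - lk (lk (cK w) y) 1"
proof -
  have "\<exists>u. unitri bruhat_lt DJ u \<and> (\<forall>w\<in>DJ. lin cK (u w) = bvec w \<and> lin u (cK w) = bvec w) \<and>
    (\<forall>w\<in>DJ. \<forall>y. y \<noteq> w \<longrightarrow> lk (lk (u w) y) 1 = - lk (lk (cK w) y) 1)"
    by (rule unitri_inverse [where l = len]) (use unitri_cK bruhat_lt_len bruhat_lt_trans in blast)+
  from someI_ex [OF this] show "unitri bruhat_lt DJ uK" "w \<in> DJ \<Longrightarrow> lin cK (uK w) = bvec w"
    "w \<in> DJ \<Longrightarrow> lin uK (cK w) = bvec w"
    "w \<in> DJ \<Longrightarrow> y \<noteq> w \<Longrightarrow> lk (lk (uK w) y) 1 = - lk (lk (cK w) y) 1"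
    unfolding uK_def [symmetric] by blast+
qed

lemma uK_EE [simp]: "w \<in> DJ \<Longrightarrow> uK w \<in> EE DJ"
  and uK_self [simp]: "w \<in> DJ \<Longrightarrow> lk (uK w) w = 1"
  and uK_QA: "w \<in> DJ \<Longrightarrow> y \<noteq> w \<Longrightarrow> lk (uK w) y \<in> QA"
  and uK_lt: "w \<in> DJ \<Longrightarrow> y \<noteq> w \<Longrightarrow> lk (uK w) y \<noteq> 0 \<Longrightarrow> bruhat_lt y w"
  using uK(1) unfolding unitri_def by blast+

lemma lin_uK_EE [simp]: "f \<in> EE DJ \<Longrightarrow> lin uK f \<in> EE DJ"
  and lin_cK_EE [simp]: "f \<in> EE DJ \<Longrightarrow> lin cK f \<in> EE DJ"
  by (erule EE_lin, simp)+

lemma lin_uK_cK [simp]: "f \<in> EE DJ \<Longrightarrow> lin uK (lin cK f) = f"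
  and lin_cK_uK [simp]: "f \<in> EE DJ \<Longrightarrow> lin cK (lin uK f) = f"
  unfolding lin_lin using lin_cong [of f DJ "\<lambda>w. lin uK (cK w)" bvec] lin_cong [of f DJ "\<lambda>w. lin cK (uK w)" bvec] uK
  by (simp_all add: lin_id)

text \<open>From coordinates in the basis \<open>C_{d wJ}\<close> to elements of \<open>LL\<close>;
  \<open>kc\<close> goes back. In these coordinates the bar is conjugation of coefficients.\<close>

definition kl :: "('w \<Rightarrow>\<^sub>0 laurent) \<Rightarrow> ('w \<Rightarrow>\<^sub>0 laurent)" where "kl = lin (\<lambda>d. KL (d \<otimes> wJ))"

definition kc :: "('w \<Rightarrow>\<^sub>0 laurent) \<Rightarrow> ('w \<Rightarrow>\<^sub>0 laurent)" where "kc x = lin uK (co x)"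

lemma lmap_kl [simp]: "lmap kl"
  by (simp add: kl_def)

lemma lmap_kc [simp]: "lmap kc"
  unfolding kc_def by (rule lmap_comp) simp_all

lemma kl_eq: "f \<in> EE DJ \<Longrightarrow> kl f = lin Bd (lin cK f)"
  unfolding kl_def lin_lin by (rule lin_cong) auto

lemma kl_e [simp]: "kl (bvec d) = KL (d \<otimes> wJ)"
  by (simp add: kl_def)

lemma kl_LL [simp]: "f \<in> EE DJ \<Longrightarrow> kl f \<in> LL"
  by (simp add: kl_eq)

lemma kc_EE [simp]: "x \<in> LL \<Longrightarrow> kc x \<in> EE DJ"
  by (simp add: kc_def)

lemma kc_kl [simp]: "f \<in> EE DJ \<Longrightarrow> kc (kl f) = f"
  by (simp add: kc_def kl_eq)

lemma kl_kc [simp]: "x \<in> LL \<Longrightarrow> kl (kc x) = x"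
  unfolding kc_def by (subst kl_eq) simp_all

lemma kl_uK [simp]: "d \<in> DJ \<Longrightarrow> kl (uK d) = Bd d"
  by (simp add: kl_eq uK)

lemma kc_Bd: "d \<in> DJ \<Longrightarrow> kc (Bd d) = uK d"
  using kc_kl [of "uK d"] by simp

lemma barE_kl: "f \<in> EE DJ \<Longrightarrow> barE (kl f) = kl (bmap f)"
  unfolding kl_def smap_lin [OF smap_barE] by (rule lin_cong [of _ DJ]) auto

lemma bmap_kc: "x \<in> LL \<Longrightarrow> bmap (kc x) = kc (barE x)"
  using barE_kl [of "kc x"] kc_kl [of "bmap (kc x)"] by simp

text \<open>The coefficients \<open>q_{y,w}\<close> of the W-graph basis: the coefficient of
  \<open>c_y\<close> in \<open>b_w\<close> is q times this.\<close>

definition QQ :: "'w \<Rightarrow> 'w \<Rightarrow> laurent" where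
  "QQ y w = (if w \<in> DJ \<and> y \<noteq> w then qinv * lk (uK w) y else 0)"

lemma QQ_Aplus: "QQ y w \<in> Aplus"
  using uK_QA QA_qinv by (auto simp: QQ_def)

lemma Bd_expand:
  assumes w: "w \<in> DJ"
  shows "Bd w = KL (w \<otimes> wJ) + smul qv (\<Sum>y\<in>{y \<in> DJ. bruhat_lt y w}. smul (QQ y w) (KL (y \<otimes> wJ)))"
proof -
  let ?A = "{y \<in> DJ. bruhat_lt y w}"
  have fin: "finite ?A" by (rule finite_bruhat_lt)
  have "Poly_Mapping.keys (uK w) \<subseteq> insert w ?A"
    using uK_lt [OF w] uK_EE [OF w] by (auto simp: in_keys_iff EE_iff)
  then have "kl (uK w) = (\<Sum>y\<in>insert w ?A. smul (lk (uK w) y) (KL (y \<otimes> wJ)))"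
    unfolding kl_def using fin by (intro lin_superset) auto
  also have "\<dots> = KL (w \<otimes> wJ) + (\<Sum>y\<in>?A. smul (lk (uK w) y) (KL (y \<otimes> wJ)))"
    using fin w by simp
  also have "(\<Sum>y\<in>?A. smul (lk (uK w) y) (KL (y \<otimes> wJ))) = smul qv (\<Sum>y\<in>?A. smul (QQ y w) (KL (y \<otimes> wJ)))"
    unfolding smul_sum using w by (intro sum.cong) (auto simp: QQ_def smul_smul)
  finally show ?thesis using w by simp
qed

definition c0 :: "'w \<Rightarrow> ('w hecke \<times> laurent \<Rightarrow>\<^sub>0 int) set" where "c0 w = THi (KL (w \<otimes> wJ))"

lemma c0_closed [simp]: "w \<in> DJ \<Longrightarrow> c0 w \<in> carrier M"
  and TH_c0 [simp]: "w \<in> DJ \<Longrightarrow> TH (c0 w) = KL (w \<otimes> wJ)"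
  by (simp_all add: c0_def)

lemma is_basis_c0: "is_basis M DJ c0"
  unfolding is_basis_def
proof (intro conjI ballI)
  show c: "c0 \<in> DJ \<rightarrow> carrier M" by simp
  fix x assume x: "x \<in> carrier M"
  have eq: "x = finsum M (\<lambda>w. asmult M (lk a w) (c0 w)) (Poly_Mapping.keys a) \<longleftrightarrow> a = kc (TH x)"
    if a: "Poly_Mapping.keys a \<subseteq> DJ" for a
  proof -
    let ?s = "finsum M (\<lambda>w. asmult M (lk a w) (c0 w)) (Poly_Mapping.keys a)"
    have aE: "a \<in> EE DJ" using a by (simp add: EE_def)
    have s: "TH ?s = lin (\<lambda>w. TH (c0 w)) a" "?s \<in> carrier M" using TH_finsum_lin [OF c a] by auto
    have "lin (\<lambda>w. TH (c0 w)) a = kl a" unfolding kl_def by (rule lin_cong [OF aE]) simp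
    then have Ts: "TH ?s = kl a" using s by simp
    have "x = ?s \<longleftrightarrow> TH x = TH ?s" using TH_inj [OF x s(2)] by fast
    also have "\<dots> \<longleftrightarrow> TH x = kl a" unfolding Ts ..
    also have "\<dots> \<longleftrightarrow> a = kc (TH x)" using aE x by auto
    finally show ?thesis .
  qed
  have "kc (TH x) \<in> EE DJ" using x by simp
  then have "Poly_Mapping.keys (kc (TH x)) \<subseteq> DJ" by (simp add: EE_def)
  then show "\<exists>!a. Poly_Mapping.keys a \<subseteq> DJ \<and> x = finsum M (\<lambda>w. asmult M (lk a w) (c0 w)) (Poly_Mapping.keys a)"
    using eq by blast
qed

lemma TH_wgraph_equation:
  assumes w: "w \<in> DJ" and c: "c \<in> DJ \<rightarrow> carrier M"
  shows "TH (c w \<oplus>\<^bsub>M\<^esub> asmult M qv (finsum M (\<lambda>y. asmult M (Q y w) (c y)) {y \<in> DJ. bruhat_lt y w})) =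
      TH (c w) + smul qv (\<Sum>y\<in>{y \<in> DJ. bruhat_lt y w}. smul (Q y w) (TH (c y)))" (is "_ = ?r")
    and "c w \<oplus>\<^bsub>M\<^esub> asmult M qv (finsum M (\<lambda>y. asmult M (Q y w) (c y)) {y \<in> DJ. bruhat_lt y w}) \<in> carrier M"
proof -
  have cc: "c y \<in> carrier M" if "y \<in> DJ" for y using c that by auto
  let ?s = "finsum M (\<lambda>y. asmult M (Q y w) (c y)) {y \<in> DJ. bruhat_lt y w}"
  have s: "TH ?s = (\<Sum>y\<in>{y \<in> DJ. bruhat_lt y w}. TH (asmult M (Q y w) (c y)))" "?s \<in> carrier M"
    using TH_finsum [OF finite_bruhat_lt, of DJ w "\<lambda>y. asmult M (Q y w) (c y)"] cc by auto
  have "TH ?s = (\<Sum>y\<in>{y \<in> DJ. bruhat_lt y w}. smul (Q y w) (TH (c y)))"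
    unfolding s(1) using cc by (intro sum.cong) (auto simp: TH_asmult)
  then show "TH (c w \<oplus>\<^bsub>M\<^esub> asmult M qv ?s) = ?r" "c w \<oplus>\<^bsub>M\<^esub> asmult M qv ?s \<in> carrier M"
    using s(2) cc w by (simp_all add: TH_add TH_asmult)
qed

lemma wgraph_basis_c0: "wgraph_basis DJ M (bJ J) c0 QQ"
  unfolding wgraph_basis_def
proof (intro conjI)
  show "is_basis M DJ c0" by (rule is_basis_c0)
  have "betaM (c0 w) = c0 w" if "w \<in> DJ" for w
    using that by (intro TH_inj) (auto simp: betaM_def LL_barE)
  then show "\<exists>\<beta>. module_bar M (bJ J) \<beta> \<and> (\<forall>w\<in>DJ. \<beta> (c0 w) = c0 w)" using module_bar_betaM by blast
  show "\<forall>y w. QQ y w \<in> Aplus" using QQ_Aplus by blast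
  show "\<forall>w\<in>DJ. bJ J w = c0 w \<oplus>\<^bsub>M\<^esub>
      asmult M qv (finsum M (\<lambda>y. asmult M (QQ y w) (c0 y)) {y \<in> DJ. bruhat_lt y w})"
  proof
    fix w assume w: "w \<in> DJ"
    have c: "c0 \<in> DJ \<rightarrow> carrier M" by simp
    show "bJ J w = c0 w \<oplus>\<^bsub>M\<^esub>
      asmult M qv (finsum M (\<lambda>y. asmult M (QQ y w) (c0 y)) {y \<in> DJ. bruhat_lt y w})"
      by (rule TH_inj) (use w TH_wgraph_equation [OF w c, of QQ] in \<open>simp_all add: TH_bJ Bd_expand\<close>)
  qed
qed

lemma KL_Aplus: "w \<in> carrier W \<Longrightarrow> lk (KL w) y \<in> Aplus"
  using KL_QA QA_Aplus one_Aplus by (cases "y = w") auto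

text \<open>Needed because \<open>cJ\<close> and \<open>wcoeff\<close> are picked by a choice
  operator. By induction the lower vectors agree. The difference of the two candidates for the top
  vector is bar invariant and small, hence zero, and independence of the basis then equates the
  coefficients.\<close>

lemma wgraph_basis_unique:
  assumes wb: "wgraph_basis DJ M (bJ J) c Q" and "w \<in> DJ"
  shows "TH (c w) = KL (w \<otimes> wJ) \<and> (\<forall>y\<in>DJ. bruhat_lt y w \<longrightarrow> Q y w = QQ y w)"
  using assms(2)
proof (induction "len w" arbitrary: w rule: less_induct)
  case less
  note w = less.prems
  have c: "c \<in> DJ \<rightarrow> carrier M" using wb unfolding wgraph_basis_def is_basis_def by blast
  then have cw: "c w \<in> carrier M" using w by auto
  obtain \<beta> where \<beta>: "module_bar M (bJ J) \<beta>" "\<beta> (c w) = c w" using wb w unfolding wgraph_basis_def by blast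
  have bar: "barE (TH (c w)) = TH (c w)" using TH_module_bar [OF \<beta>(1) cw] \<beta>(2) by simp
  have QA: "Q y w \<in> Aplus" for y using wb unfolding wgraph_basis_def by blast
  let ?A = "{y \<in> DJ. bruhat_lt y w}"
  have IH: "TH (c y) = KL (y \<otimes> wJ)" if "y \<in> ?A" for y using less.hyps that bruhat_lt_len by blast
  have "bJ J w = c w \<oplus>\<^bsub>M\<^esub> asmult M qv (finsum M (\<lambda>y. asmult M (Q y w) (c y)) ?A)"
    using wb w unfolding wgraph_basis_def by blast
  then have "Bd w = TH (c w) + smul qv (\<Sum>y\<in>?A. smul (Q y w) (TH (c y)))"
    using TH_wgraph_equation(1) [OF w c, of Q] TH_bJ [OF w] by simp
  also have "(\<Sum>y\<in>?A. smul (Q y w) (TH (c y))) = (\<Sum>y\<in>?A. smul (Q y w) (KL (y \<otimes> wJ)))"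
    using IH by (intro sum.cong) auto
  finally have B: "Bd w = TH (c w) + smul qv (\<Sum>y\<in>?A. smul (Q y w) (KL (y \<otimes> wJ)))" .
  \<comment> \<open>The coordinates of the difference of the two top vectors, obtained by equating
    the two expansions of \<open>Bd w\<close>.\<close>
  define g where "g = (\<Sum>y\<in>?A. smul (qv * (QQ y w - Q y w)) (bvec y))"
  define D where "D = TH (c w) - KL (w \<otimes> wJ)"
  have gE: "g \<in> EE DJ" unfolding g_def by (intro EE_sum EE_smul EE_e) auto
  have "kl g = (\<Sum>y\<in>?A. smul (qv * (QQ y w - Q y w)) (KL (y \<otimes> wJ)))"
    unfolding g_def by (simp add: lmap_sum lmap_smul)
  also have "\<dots> = smul qv (\<Sum>y\<in>?A. smul (QQ y w) (KL (y \<otimes> wJ))) - smul qv (\<Sum>y\<in>?A. smul (Q y w) (KL (y \<otimes> wJ)))"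
    unfolding smul_sum by (simp add: smul_smul sum_subtractf [symmetric] smul_diff_left [symmetric] right_diff_distrib)
  also have "\<dots> = D" using B Bd_expand [OF w] unfolding D_def by (simp add: algebra_simps)
  finally have klg: "kl g = D" .
  have "D = 0"
  proof (rule barE_invariant_QA)
    show "D \<in> EW" unfolding D_def using cw w by (intro EE_diff LL_EW) auto
    show "barE D = D" unfolding D_def using bar w by (simp add: smap_diff)
    fix z
    have "lk D z = (\<Sum>y\<in>?A. (qv * (QQ y w - Q y w)) * lk (KL (y \<otimes> wJ)) z)"
      unfolding klg [symmetric] g_def by (simp add: lmap_sum lmap_smul lookup_sum)
    also have "\<dots> \<in> QA"
    proof (rule QA_sum)
      fix y assume "y \<in> ?A"
      then have "lk (KL (y \<otimes> wJ)) z \<in> Aplus" by (intro KL_Aplus) auto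
      moreover have "qv * (QQ y w - Q y w) \<in> QA" using Aplus_diff [OF QQ_Aplus QA] by blast
      ultimately show "qv * (QQ y w - Q y w) * lk (KL (y \<otimes> wJ)) z \<in> QA" by (rule QA_mult_Aplus [rotated])
    qed
    finally show "lk D z \<in> QA" .
  qed
  then have "g = 0" using kc_kl [OF gE] klg by (simp add: lmap_zero)
  have "Q y w = QQ y w" if y: "y \<in> ?A" for y
  proof -
    have "lk g y = (\<Sum>x\<in>?A. if x = y then qv * (QQ x w - Q x w) else 0)"
      unfolding g_def lookup_sum by (intro sum.cong) (auto simp: lookup_e when_def)
    then have "qv * (QQ y w - Q y w) = 0" using y finite_bruhat_lt [of DJ w] \<open>g = 0\<close> by simp
    moreover have "QQ y w - Q y w = qinv * (qv * (QQ y w - Q y w))" by (simp only: qv_qinv)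
    ultimately have "QQ y w - Q y w = 0" by (metis mult_zero_right)
    then show ?thesis by simp
  qed
  then show ?case using \<open>D = 0\<close> unfolding D_def by auto
qed

lemma wgraph_basis_cJ: "wgraph_basis DJ M (bJ J) (cJ J) (wcoeff DJ M (bJ J))"
proof -
  let ?P = "\<lambda>(c, Q). wgraph_basis DJ M (bJ J) c Q"
  have "?P (SOME cQ. ?P cQ)" by (rule someI [of ?P "(c0, QQ)"]) (simp add: wgraph_basis_c0)
  moreover obtain c Q where cQ: "(SOME cQ. ?P cQ) = (c, Q)" by (cases "SOME cQ. ?P cQ") 
  ultimately show ?thesis unfolding cJ_def wbasis_def wcoeff_def cQ by simp
qed

lemma TH_cJ [simp]: "w \<in> DJ \<Longrightarrow> TH (cJ J w) = KL (w \<otimes> wJ)"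
  and wcoeff_QQ: "w \<in> DJ \<Longrightarrow> y \<in> DJ \<Longrightarrow> bruhat_lt y w \<Longrightarrow> wcoeff DJ M (bJ J) y w = QQ y w"
  using wgraph_basis_unique [OF wgraph_basis_cJ] by blast+

lemma KL_inj: "w \<in> carrier W \<Longrightarrow> w' \<in> carrier W \<Longrightarrow> KL w = KL w' \<Longrightarrow> w = w'"
proof (rule ccontr)
  assume a: "w \<in> carrier W" "w' \<in> carrier W" "KL w = KL w'" "w \<noteq> w'"
  then have "bruhat_le w w'" "bruhat_le w' w" using KL_le [of w' w] KL_le [of w w'] KL_self [of w] KL_self [of w'] by auto
  then show False using a bruhat_le_len [of w w'] bruhat_le_len [of w' w] by auto
qed

lemma cJ_inj: "inj_on (cJ J) DJ"
proof (rule inj_onI)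
  fix w w' assume a: "w \<in> DJ" "w' \<in> DJ" "cJ J w = cJ J w'"
  then have "KL (w \<otimes> wJ) = KL (w' \<otimes> wJ)" using TH_cJ by metis
  then have "w \<otimes> wJ = w' \<otimes> wJ" using KL_inj a by simp
  then show "w = w'" using a by simp
qed

text \<open>Dividing by q turns the coefficient of q in the inverse matrix into a constant term. Its
  sign change under inversion meets the minus sign in \<open>mcoef\<close>, so mu agrees on the
  nose.\<close>

lemma const_QQ:
  assumes "y \<in> DJ" "w \<in> DJ" "bruhat_lt y w"
  shows "lk (QQ y w) 0 = mcoef (KL (w \<otimes> wJ)) (y \<otimes> wJ)"
proof -
  have "y \<noteq> w" using assms by auto
  then show ?thesis using assms uK(4) by (simp add: QQ_def lookup_qinv_mult mcoef_def cK_def lookup_co)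
qed

section \<open>The W-graph of the induced module inside the Kazhdan-Lusztig graph\<close>

abbreviation "GJ \<equiv> Gamma_CJ J"

lemma GJ_verts: "verts GJ = cJ J ` DJ"
  unfolding Gamma_CJ_def ideal_graph_def cJ_def by (simp add: Let_def)

lemma GJ_arrow:
  assumes y: "y \<in> DJ" and w: "w \<in> DJ"
  shows "wg_arrow GJ (cJ J y) (cJ J w) \<longleftrightarrow> karrow (y \<otimes> wJ) (w \<otimes> wJ)"
proof -
  have ix: "inv_into DJ (cJ J) (cJ J x) = x" if "x \<in> DJ" for x using cJ_inj that by (rule inv_into_f_f)
  have tau: "tau GJ (cJ J x) = ldes (x \<otimes> wJ)" if "x \<in> DJ" for x
    unfolding Gamma_CJ_def ideal_graph_def cJ_def [symmetric] using that by (simp add: Let_def ix ldes_wJ)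
  have "mu GJ (cJ J y) (cJ J w) = (if bruhat_lt y w then lk (wcoeff DJ M (bJ J) y w) 0
      else if bruhat_lt w y then lk (wcoeff DJ M (bJ J) w y) 0 else 0)"
    unfolding Gamma_CJ_def ideal_graph_def cJ_def [symmetric] using y w by (simp add: Let_def ix)
  also have "\<dots> = kmu (y \<otimes> wJ) (w \<otimes> wJ)"
    unfolding kmu_wJ [OF y w] using y w by (simp add: wcoeff_QQ const_QQ)
  finally have mu: "mu GJ (cJ J y) (cJ J w) = kmu (y \<otimes> wJ) (w \<otimes> wJ)" .
  show ?thesis unfolding wg_arrow_def karrow_def mu tau [OF y] tau [OF w] using y w by (simp add: GJ_verts)
qed

abbreviation "kle \<equiv> karrow\<^sup>*\<^sup>*"

lemma GJ_le_imp:
  assumes "wg_le GJ u (cJ J w)" "w \<in> DJ"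
  shows "\<exists>y\<in>DJ. u = cJ J y \<and> kle (y \<otimes> wJ) (w \<otimes> wJ)"
  using assms(1) unfolding wg_le_def
proof (induction rule: converse_rtranclp_induct)
  case (step u v)
  then obtain y where y: "y \<in> DJ" "v = cJ J y" "kle (y \<otimes> wJ) (w \<otimes> wJ)" by blast
  have "u \<in> verts GJ" using step(1) by (simp add: wg_arrow_def)
  then obtain x where x: "x \<in> DJ" "u = cJ J x" unfolding GJ_verts by blast
  then have "karrow (x \<otimes> wJ) (y \<otimes> wJ)" using step(1) y GJ_arrow by simp
  then have "kle (x \<otimes> wJ) (w \<otimes> wJ)" using y(3) by (rule converse_rtranclp_into_rtranclp)
  then show ?case using x by blast
qed (use assms in blast)

text \<open>A path descending from a vertex of \<open>D_J wJ\<close> cannot leave this set, so it is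
  already a path of the smaller graph.\<close>

lemma kle_imp:
  assumes "kle u (w \<otimes> wJ)" "w \<in> DJ"
  shows "\<exists>y\<in>DJ. u = y \<otimes> wJ \<and> wg_le GJ (cJ J y) (cJ J w)"
  using assms(1)
proof (induction rule: converse_rtranclp_induct)
  case base
  show ?case using assms(2) by (auto simp: wg_le_def)
next
  case (step u v)
  then obtain y where y: "y \<in> DJ" "v = y \<otimes> wJ" "wg_le GJ (cJ J y) (cJ J w)" by blast
  then have "u \<in> DwJ" using karrow_DwJ step(1) by (auto simp: DwJ_def)
  then obtain x where x: "x \<in> DJ" "u = x \<otimes> wJ" by (auto simp: DwJ_def)
  then have "wg_arrow GJ (cJ J x) (cJ J y)" using step(1) y GJ_arrow by simp
  then have "wg_le GJ (cJ J x) (cJ J w)" using y(3) unfolding wg_le_def by (rule converse_rtranclp_into_rtranclp)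
  then show ?case using x by blast
qed

lemma GJ_le_iff:
  assumes y: "y \<in> DJ" and w: "w \<in> DJ"
  shows "wg_le GJ (cJ J y) (cJ J w) \<longleftrightarrow> kle (y \<otimes> wJ) (w \<otimes> wJ)"
proof
  assume "wg_le GJ (cJ J y) (cJ J w)"
  then obtain x where x: "x \<in> DJ" "cJ J y = cJ J x" "kle (x \<otimes> wJ) (w \<otimes> wJ)" using GJ_le_imp w by blast
  then have "y = x" using cJ_inj y by (auto dest: inj_onD)
  then show "kle (y \<otimes> wJ) (w \<otimes> wJ)" using x by simp
next
  assume "kle (y \<otimes> wJ) (w \<otimes> wJ)"
  then obtain x where x: "x \<in> DJ" "y \<otimes> wJ = x \<otimes> wJ" "wg_le GJ (cJ J x) (cJ J w)" using kle_imp w by blast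
  then have "y = x" using y by simp
  then show "wg_le GJ (cJ J y) (cJ J w)" using x by simp
qed

lemma karrow_suffix:
  assumes w: "w \<in> DJ" and s: "s \<in> S" and less: "len (s \<otimes> w) < len w"
  shows "s \<otimes> w \<in> DJ" "karrow (w \<otimes> wJ) (s \<otimes> w \<otimes> wJ)"
proof -
  show sw: "s \<otimes> w \<in> DJ" using min_reps_suffix [OF J_S w s less] .
  have eq: "s \<otimes> (s \<otimes> w \<otimes> wJ) = w \<otimes> wJ" using s w by (simp add: m_assoc)
  have "len (s \<otimes> w \<otimes> wJ) < len (s \<otimes> (s \<otimes> w \<otimes> wJ))"
    unfolding eq using less len_DJ_mult [OF sw wJ_WJ] len_DJ_mult [OF w wJ_WJ] by simp
  from karrow_S_mult [OF s _ this] show "karrow (w \<otimes> wJ) (s \<otimes> w \<otimes> wJ)" unfolding eq using sw by simp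
qed

text \<open>Each left descent stripped from \<open>w\<close> is an arrow of weight 1 from the longer
  to the shorter element, and the chain ends at \<open>wJ\<close>.\<close>

lemma kle_top: "w \<in> DJ \<Longrightarrow> kle (w \<otimes> wJ) wJ"
proof (induction "len w" arbitrary: w rule: less_induct)
  case less
  show ?case
  proof (cases "w = \<one>")
    case False
    then obtain s where s: "s \<in> S" "len (s \<otimes> w) < len w"
      using ex_left_descent [OF DJ_closed [OF less.prems]] by blast
    note ks = karrow_suffix [OF less.prems s]
    have "kle (s \<otimes> w \<otimes> wJ) wJ" using less.hyps [OF s(2) ks(1)] .
    then show ?thesis using ks(2) by (rule converse_rtranclp_into_rtranclp [rotated])
  qed simp
qed

text \<open>Everything in \<open>D_J wJ\<close> is below \<open>wJ\<close> in the left preorder, so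
  lying in its cell amounts to the opposite relation.\<close>

definition I1 :: "'w set" where "I1 = {d \<in> DJ. kle wJ (d \<otimes> wJ)}"

lemma I1_DJ: "I1 \<subseteq> DJ"
  by (auto simp: I1_def)

lemma one_I1: "\<one> \<in> I1"
  by (simp add: I1_def)

lemma left_cell_eq:
  assumes "C \<in> left_cells" "wJ \<in> C"
  shows "C = (\<lambda>w. w \<otimes> wJ) ` I1"
proof -
  have le: "wg_le KL_graph = kle"
    unfolding wg_le_def by (rule arg_cong [of _ _ rtranclp]) (auto intro!: ext simp: KL_graph_arrow)
  have "C = {u \<in> carrier W. kle u wJ \<and> kle wJ u}"
    using cellsD(2) [of C KL_graph wJ] assms unfolding left_cells_def le by (simp add: KL_graph_def)
  moreover have "\<exists>y\<in>DJ. u = y \<otimes> wJ" if "kle u wJ" for u using kle_imp [of u \<one>] that by auto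
  ultimately show ?thesis using kle_top by (auto simp: I1_def)
qed

lemma maximal_cells_GJ: "maximal_cells GJ = {cJ J ` I1}"
proof -
  have one: "cJ J \<one> \<in> verts GJ" by (simp add: GJ_verts)
  have top: "wg_le GJ v (cJ J \<one>)" if "v \<in> verts GJ" for v
    using that kle_top GJ_le_iff [of _ \<one>] by (auto simp: GJ_verts)
  have "{u \<in> verts GJ. wg_le GJ u (cJ J \<one>) \<and> wg_le GJ (cJ J \<one>) u} = cJ J ` I1"
    using top GJ_le_iff [of \<one>] by (auto simp: GJ_verts I1_def)
  then show ?thesis using maximal_cells_top [OF one top] by simp
qed

section \<open>The W-graph ideal\<close>

lemma I1_suffix:
  assumes w: "w \<in> I1" and s: "s \<in> S" and less: "len (s \<otimes> w) < len w"
  shows "s \<otimes> w \<in> I1"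
proof -
  have "w \<in> DJ" "kle wJ (w \<otimes> wJ)" using w by (auto simp: I1_def)
  then show ?thesis using karrow_suffix [OF _ s less] by (auto simp: I1_def)
qed

lemma weak_ideal_I1: "weak_ideal I1"
  unfolding weak_ideal_def
proof (intro conjI ballI allI impI)
  show "I1 \<subseteq> carrier W" using I1_DJ by auto
  fix w u assume w: "w \<in> I1" and le: "left_weak_le u w"
  let ?x = "w \<otimes> inv u"
  have c: "u \<in> carrier W" "w \<in> carrier W" "len w = len ?x + len u" using le by (auto simp: left_weak_le_def)
  \<comment> \<open>Peel the letters of a reduced word of \<open>w u^-1\<close> from the left; since
    the lengths stay additive, each step is a left descent, and the one-letter case applies.\<close>
  have claim: "u \<in> I1" if "reduced xs x" "v = x \<otimes> u" "len v = len x + len u" "v \<in> I1" for xs x v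
    using that
  proof (induction xs arbitrary: x v)
    case Nil
    then show ?case using c by (auto simp: reduced_def)
  next
    case (Cons s xs)
    note r = reduced_ConsD [OF Cons.prems(1)]
    have x: "x \<in> carrier W" using reducedD(4) [OF Cons.prems(1)] .
    have v: "v \<in> carrier W" using Cons.prems(2) x c by simp
    have sv: "s \<otimes> v = s \<otimes> x \<otimes> u" using Cons.prems(2) x r c by (simp add: m_assoc)
    have "len (s \<otimes> v) \<le> len (s \<otimes> x) + len u" unfolding sv using x r c by (intro len_mult_le) auto
    moreover have "len v \<le> Suc (len (s \<otimes> v))" using len_S_mult [OF r(1) v] by auto
    ultimately have l: "len (s \<otimes> v) = len (s \<otimes> x) + len u" "len (s \<otimes> v) < len v"
      using Cons.prems(3) r(3) by auto
    show ?case using Cons.IH [OF r(2) sv l(1)] I1_suffix [OF Cons.prems(4) r(1) l(2)] by blast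
  qed
  have "?x \<in> carrier W" using c by simp
  then obtain xs where "reduced xs ?x" using ex_reduced by blast
  then show "u \<in> I1" using claim [of xs ?x w] c w by (simp add: m_assoc)
qed

lemma J_Pos_I1: "J \<subseteq> Pos I1"
  using I1_DJ DJ_lt J_S unfolding Pos_def by blast

lemma act_LL: "h \<in> carrier H \<Longrightarrow> x \<in> LL \<Longrightarrow> act h x \<in> LL"
  by (induction h rule: H_induct) (simp_all add: act_add act_mult)

abbreviation "D2 \<equiv> DJ - I1"

lemma kl_D2_lam:
  assumes s: "s \<in> S" and g: "g \<in> EE D2"
  shows "\<exists>g'\<in>EE D2. lam s (kl g) = kl g'"
proof -
  let ?X = "(\<lambda>d. d \<otimes> wJ) ` D2"
  have X: "?X \<subseteq> carrier W" by auto
  \<comment> \<open>If \<open>u\<close> were in the cell of \<open>wJ\<close>, then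
    \<open>wJ \<le> u \<le> v\<close> would put \<open>v\<close> there as well.\<close>
  have down: "u \<in> ?X" if uv: "karrow u v" and v: "v \<in> ?X" for u v
  proof -
    obtain d where d: "d \<in> DJ" "d \<notin> I1" "v = d \<otimes> wJ" using v by blast
    then have "u \<in> DwJ" using karrow_DwJ [OF uv] by (auto simp: DwJ_def)
    then obtain x where x: "x \<in> DJ" "u = x \<otimes> wJ" by (auto simp: DwJ_def)
    have "x \<notin> I1"
    proof
      assume "x \<in> I1"
      then have "kle wJ v" using uv x by (auto simp: I1_def)
      then show False using d by (simp add: I1_def)
    qed
    then show ?thesis using x by blast
  qed
  let ?f = "lin (\<lambda>d. bvec (d \<otimes> wJ)) g"
  have f: "?f \<in> EE ?X" using g by (rule EE_lin) auto
  have klf: "kl g = lin KL ?f" unfolding kl_def by (simp add: lin_lin)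
  have "lam s (kl g) \<in> lin KL ` EE ?X"
    unfolding klf by (rule span_KL_lam [OF X _ s f]) (rule down)
  then obtain f' where f': "f' \<in> EE ?X" "lam s (kl g) = lin KL f'" by (elim imageE)
  let ?g = "lin (\<lambda>w. bvec (w \<otimes> inv wJ)) f'"
  have gE: "?g \<in> EE D2" using f'(1) by (rule EE_lin) (auto simp: m_assoc)
  have "kl ?g = lin KL f'" unfolding kl_def lin_lin using f'(1) by (rule lin_cong) (auto simp: m_assoc)
  then have "lam s (kl g) = kl ?g" using f'(2) by simp
  then show ?thesis using gE by blast
qed

lemma kl_D2_act:
  assumes "h \<in> carrier H" "g \<in> EE D2"
  shows "\<exists>g'\<in>EE D2. act h (kl g) = kl g'"
  using assms
proof (induction h arbitrary: g rule: H_induct)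
  have D: "f \<in> EE DJ" if "f \<in> EE D2" for f :: "'w \<Rightarrow>\<^sub>0 laurent" using that by (rule EE_mono) auto
  have klW: "kl f \<in> EW" if "f \<in> EE D2" for f using D [OF that] by simp
  {
    case one
    then show ?case using klW by auto
  next
    case (add h k)
    then obtain f f' where "f \<in> EE D2" "act h (kl g) = kl f" "f' \<in> EE D2" "act k (kl g) = kl f'" by blast
    then show ?case using add klW by (intro bexI [of _ "f + f'"]) (auto simp: act_add lmap_add)
  next
    case (scal a h)
    then obtain f where "f \<in> EE D2" "act h (kl g) = kl f" by blast
    then show ?case using scal klW by (intro bexI [of _ "smul a f"]) (auto simp: act_mult lmap_smul)
  next
    case (Tgen s h)
    then obtain f where f: "f \<in> EE D2" "act h (kl g) = kl f" by blast
    then have "act (Tgen s \<otimes>\<^bsub>H\<^esub> h) (kl g) = lam s (kl f)" using Tgen klW by (simp add: act_mult)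
    then show ?case using kl_D2_lam [OF Tgen(1) f(1)] by simp
  }
qed

text \<open>The action on the quotient by the span of the $C_{d w_J}$ with \<open>d \<notin> I1\<close>.\<close>

definition qop :: "'w hecke \<Rightarrow> ('w \<Rightarrow>\<^sub>0 laurent) \<Rightarrow> ('w \<Rightarrow>\<^sub>0 laurent)" where
  "qop h f = restr I1 (kc (act h (kl f)))"

lemma I1_EE: "f \<in> EE I1 \<Longrightarrow> f \<in> EE DJ"
  by (erule EE_mono) (rule I1_DJ)

lemma restr_I1 [simp]: "f \<in> EE DJ \<Longrightarrow> restr I1 f \<in> EE I1"
  by (auto simp: EE_iff)

lemma kl_EW [simp]: "f \<in> EE DJ \<Longrightarrow> kl f \<in> EW"
  by simp

lemma qop_EE [simp]: "h \<in> carrier H \<Longrightarrow> f \<in> EE DJ \<Longrightarrow> qop h f \<in> EE I1"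
  unfolding qop_def by (simp add: act_LL)

text \<open>The coordinates outside \<open>I1\<close> span a submodule, which \<open>h\<close> maps
  into itself and the restriction kills. This is the well-definedness of the action on the quotient,
  and associativity follows from it.\<close>

lemma qop_restr:
  assumes h: "h \<in> carrier H" and f: "f \<in> EE DJ"
  shows "qop h (restr I1 f) = qop h f"
proof -
  let ?g = "f - restr I1 f"
  have g: "?g \<in> EE D2" using f by (auto simp: EE_iff lookup_minus)
  obtain g' where g': "g' \<in> EE D2" "act h (kl ?g) = kl g'" using kl_D2_act [OF h g] by blast
  have r: "restr I1 f \<in> EE DJ" using f by (auto simp: EE_iff)
  have "act h (kl f) = act h (kl (restr I1 f)) + kl g'"
  proof -
    have "kl f = kl (restr I1 f) + kl ?g" by (simp flip: lmap_add)
    moreover have "kl ?g \<in> EW" using f r by (intro kl_EW EE_diff)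
    ultimately show ?thesis using act_plus [OF h kl_EW [OF r]] g'(2) by simp
  qed
  moreover have "kc (kl g') = g'" using g'(1) by (intro kc_kl) (auto simp: EE_iff)
  moreover have "restr I1 g' = 0" using g'(1) by (intro poly_mapping_eqI) (auto simp: EE_iff)
  ultimately show ?thesis unfolding qop_def by (simp add: lmap_add)
qed

lemma qop_mult:
  assumes h: "h \<in> carrier H" and k: "k \<in> carrier H" and f: "f \<in> EE DJ"
  shows "qop (h \<otimes>\<^bsub>H\<^esub> k) f = qop h (qop k f)"
proof -
  have L: "act k (kl f) \<in> LL" using k f by (simp add: act_LL)
  have "qop h (qop k f) = qop h (kc (act k (kl f)))"
    unfolding qop_def [of k] using h L by (simp add: qop_restr)
  also have "\<dots> = qop (h \<otimes>\<^bsub>H\<^esub> k) f" unfolding qop_def using L h k f by (simp add: act_mult)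
  finally show ?thesis ..
qed

definition MI :: "('w hecke, 'w \<Rightarrow>\<^sub>0 laurent) module" where
  "MI = \<lparr>carrier = EE I1, monoid.mult = undefined, one = undefined, ring.zero = 0, add = (+), module.smult = qop\<rparr>"

lemma MI_simps [simp]: "carrier MI = EE I1" "\<zero>\<^bsub>MI\<^esub> = 0" "x \<oplus>\<^bsub>MI\<^esub> y = x + y" "h \<odot>\<^bsub>MI\<^esub> x = qop h x"
  by (simp_all add: MI_def)

lemma abelian_group_MI: "abelian_group MI"
proof (rule abelian_groupI)
  fix x assume "x \<in> carrier MI"
  then show "\<exists>y\<in>carrier MI. y \<oplus>\<^bsub>MI\<^esub> x = \<zero>\<^bsub>MI\<^esub>" by (intro bexI [of _ "- x"]) auto
qed (auto simp: add.assoc add.commute)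

sublocale MI: abelian_group MI
  by (rule abelian_group_MI)

lemma qop_scal [simp]: "f \<in> EE I1 \<Longrightarrow> qop (scal a) f = smul a f"
  unfolding qop_def using I1_EE [of f] restr_id [of f I1] by (simp add: lmap_smul)

lemma asmult_MI: "f \<in> EE I1 \<Longrightarrow> asmult MI a f = smul a f"
  by (simp add: asmult_def)

lemma left_module_MI: "left_module H MI"
proof (intro left_module.intro ring_H abelian_group_MI left_module_axioms.intro)
  fix h k x y
  assume "h \<in> carrier H" "x \<in> carrier MI"
  then have h: "h \<in> carrier H" "x \<in> EE DJ" using I1_EE by auto
  then show "h \<odot>\<^bsub>MI\<^esub> x \<in> carrier MI" by simp
  show "(h \<oplus>\<^bsub>H\<^esub> k) \<odot>\<^bsub>MI\<^esub> x = h \<odot>\<^bsub>MI\<^esub> x \<oplus>\<^bsub>MI\<^esub> k \<odot>\<^bsub>MI\<^esub> x" if "k \<in> carrier H"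
    using h that by (simp add: qop_def act_add lmap_add)
  show "(h \<otimes>\<^bsub>H\<^esub> k) \<odot>\<^bsub>MI\<^esub> x = h \<odot>\<^bsub>MI\<^esub> (k \<odot>\<^bsub>MI\<^esub> x)" if "k \<in> carrier H"
    using h that by (simp add: qop_mult)
  show "h \<odot>\<^bsub>MI\<^esub> (x \<oplus>\<^bsub>MI\<^esub> y) = h \<odot>\<^bsub>MI\<^esub> x \<oplus>\<^bsub>MI\<^esub> h \<odot>\<^bsub>MI\<^esub> y" if "y \<in> carrier MI"
    using h that I1_EE [of y] by (simp add: qop_def act_plus lmap_add)
next
  fix x assume "x \<in> carrier MI"
  then show "\<one>\<^bsub>H\<^esub> \<odot>\<^bsub>MI\<^esub> x = x" using I1_EE [of x] restr_id [of x I1] by (simp add: qop_def)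
qed

lemma MI_finsum: "finite A \<Longrightarrow> (\<And>y. y \<in> A \<Longrightarrow> g y \<in> EE I1) \<Longrightarrow> finsum MI g A = sum g A"
proof (induction A rule: finite_induct)
  case (insert x A)
  then have "finsum MI g (insert x A) = g x \<oplus>\<^bsub>MI\<^esub> finsum MI g A" by (intro MI.finsum_insert) auto
  then show ?case using insert by simp
qed simp

lemma MI_minus: "x \<in> EE I1 \<Longrightarrow> y \<in> EE I1 \<Longrightarrow> x \<ominus>\<^bsub>MI\<^esub> y = x - y"
proof -
  assume xy: "x \<in> EE I1" "y \<in> EE I1"
  have "\<ominus>\<^bsub>MI\<^esub> y = - y" using MI.minus_equality [of "- y" y] xy by simp
  then show ?thesis by (simp add: a_minus_def)
qed

text \<open>The image of \<open>b^J_w\<close> in the quotient. It is meant for all \<open>w\<close>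
  in \<open>D_J\<close>: the images for \<open>w\<close> outside \<open>I1\<close> are what appears
  at weak ascents.\<close>

definition bI :: "'w \<Rightarrow> ('w \<Rightarrow>\<^sub>0 laurent)" where "bI w = restr I1 (uK w)"

lemma bI_EE [simp]: "w \<in> DJ \<Longrightarrow> bI w \<in> EE I1"
  by (simp add: bI_def)

lemma lookup_bI: "lk (bI w) y = (if y \<in> I1 then lk (uK w) y else 0)"
  by (simp add: bI_def)

lemma qop_Tgen_bI:
  assumes "s \<in> S" "w \<in> DJ"
  shows "qop (Tgen s) (bI w) = restr I1 (kc (lam s (Bd w)))"
  unfolding bI_def using assms by (simp add: qop_restr) (simp add: qop_def)

lemma unitri_bI: "unitri bruhat_lt I1 bI"
  unfolding unitri_def using I1_DJ QA_zero
  by (auto simp: lookup_bI uK_QA uK_lt dest: subsetD)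

lemma bI_bij: "bij_betw (lin bI) (EE I1) (EE I1)"
  by (rule unitri_bij [where l = len]) (use unitri_bI bruhat_lt_len bruhat_lt_trans in blast)+

text \<open>Since \<open>x\<close> is outside \<open>I1\<close>, restriction cuts off the diagonal
  entry 1 and leaves small coefficients at elements below \<open>x\<close>. Changing from the images
  of the c to those of the b multiplies by the inverse of a unitriangular matrix, which preserves
  smallness and the order bound.\<close>

lemma bI_expand:
  assumes x: "x \<in> DJ" "x \<notin> I1"
  shows "\<exists>z\<in>EE I1. bI x = lin bI z \<and> (\<forall>y. lk z y \<in> QA \<and> (lk z y \<noteq> 0 \<longrightarrow> bruhat_lt y x))"
proof -
  obtain t where t: "unitri bruhat_lt I1 t" "\<And>w. w \<in> I1 \<Longrightarrow> lin bI (t w) = bvec w"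
    using unitri_inverse [where l = len and R = bruhat_lt and I = I1 and v = bI]
      unitri_bI bruhat_lt_len bruhat_lt_trans by metis
  have tE: "t w \<in> EE I1" if "w \<in> I1" for w using t(1) that by (simp add: unitri_def)
  let ?z = "lin t (bI x)"
  have b: "bI x \<in> EE I1" using x by simp
  have z: "?z \<in> EE I1" using b tE by (rule EE_lin)
  have "lin bI ?z = lin bvec (bI x)" unfolding lin_lin using b t(2) by (rule lin_cong)
  then have eq: "bI x = lin bI ?z" by (simp add: lin_id)
  have coef: "lk (bI x) y \<in> QA" "lk (bI x) y \<noteq> 0 \<Longrightarrow> bruhat_lt y x" "y \<in> Poly_Mapping.keys (bI x) \<Longrightarrow> y \<in> I1" for y
    using x uK_QA [OF x(1), of y] uK_lt [OF x(1), of y] QA_zero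
    by (auto simp: lookup_bI in_keys_iff split: if_splits)
  have tc: "lk (t y) v \<in> Aplus" "lk (t y) v \<noteq> 0 \<Longrightarrow> v = y \<or> bruhat_lt v y" if "y \<in> I1" for y v
    using t(1) that QA_Aplus one_Aplus unfolding unitri_def by metis+
  have "lk ?z v \<in> QA" for v
    unfolding lookup_lin using coef tc by (intro QA_sum QA_mult_Aplus) auto
  moreover have "bruhat_lt v x" if v: "lk ?z v \<noteq> 0" for v
  proof -
    obtain y where y: "y \<in> Poly_Mapping.keys (bI x)" "lk (bI x) y * lk (t y) v \<noteq> 0"
      using v unfolding lookup_lin by (meson sum.not_neutral_contains_not_neutral)
    then have "bruhat_lt y x" "v = y \<or> bruhat_lt v y" using coef tc by (metis mult_zero_left mult_zero_right)+
    then show ?thesis using bruhat_lt_trans by blast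
  qed
  ultimately show ?thesis using z eq by blast
qed

lemma is_basis_bI: "is_basis MI I1 bI"
  unfolding is_basis_def
proof (intro conjI ballI)
  show "bI \<in> I1 \<rightarrow> carrier MI" using I1_DJ by auto
  fix x assume x: "x \<in> carrier MI"
  have eq: "finsum MI (\<lambda>w. asmult MI (lk a w) (bI w)) (Poly_Mapping.keys a) = lin bI a"
    if a: "Poly_Mapping.keys a \<subseteq> I1" for a
  proof -
    have bE: "bI w \<in> EE I1" if "w \<in> Poly_Mapping.keys a" for w using that a I1_DJ by auto
    then have "finsum MI (\<lambda>w. asmult MI (lk a w) (bI w)) (Poly_Mapping.keys a) =
        (\<Sum>w\<in>Poly_Mapping.keys a. asmult MI (lk a w) (bI w))" by (intro MI_finsum) (auto simp: asmult_MI)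
    also have "\<dots> = lin bI a" unfolding lin_def using bE by (intro sum.cong) (auto simp: asmult_MI)
    finally show ?thesis .
  qed
  have "x \<in> lin bI ` EE I1" using bij_betw_imp_surj_on [OF bI_bij] x by simp
  then obtain a where a: "a \<in> EE I1" "x = lin bI a" by blast
  show "\<exists>!a. Poly_Mapping.keys a \<subseteq> I1 \<and> x = finsum MI (\<lambda>w. asmult MI (lk a w) (bI w)) (Poly_Mapping.keys a)"
  proof (intro ex1I conjI)
    show ka: "Poly_Mapping.keys a \<subseteq> I1" using a(1) by (simp add: EE_def)
    then show "x = finsum MI (\<lambda>w. asmult MI (lk a w) (bI w)) (Poly_Mapping.keys a)" using eq a(2) by simp
    fix a' assume a': "Poly_Mapping.keys a' \<subseteq> I1 \<and>
      x = finsum MI (\<lambda>w. asmult MI (lk a' w) (bI w)) (Poly_Mapping.keys a')"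
    then have "a' \<in> EE I1" "lin bI a' = lin bI a" using eq [of a'] a(2) by (simp_all add: EE_def)
    then show "a' = a" using bij_betw_imp_inj_on [OF bI_bij] a(1) by (blast dest: inj_onD)
  qed
qed

lemma ideal_module_MI: "ideal_module J I1 MI bI"
  unfolding ideal_module_def
proof (intro conjI ballI left_module_MI is_basis_bI)
  fix w s assume w: "w \<in> I1"
  then have wD: "w \<in> DJ" and wc: "w \<in> carrier W" using I1_DJ by auto
  have bw: "bI w \<in> EE I1" using wD by simp
  {
    assume "s \<in> SA I1 w"
    then have s: "s \<in> S" "s \<otimes> w \<in> I1" "len w < len (s \<otimes> w)"
      using bruhat_lt_S_left_iff wc by (auto simp: SA_def)
    then have sw: "s \<otimes> w \<in> DJ" using I1_DJ by blast
    show "Tgen s \<odot>\<^bsub>MI\<^esub> bI w = bI (s \<otimes> w)"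
      using qop_Tgen_bI [OF s(1) wD] lam_Bd_up [OF wD s(1) sw s(3)] kc_Bd [OF sw] by (simp add: bI_def)
  next
    assume "s \<in> SD w"
    then have s: "s \<in> S" "len (s \<otimes> w) < len w" using bruhat_lt_S_left_iff wc by (auto simp: SD_def)
    have sw: "s \<otimes> w \<in> DJ" using min_reps_suffix [OF J_S wD s] .
    show "Tgen s \<odot>\<^bsub>MI\<^esub> bI w = bI (s \<otimes> w) \<oplus>\<^bsub>MI\<^esub> asmult MI (qv - qinv) (bI w)"
      using qop_Tgen_bI [OF s(1) wD] lam_Bd_down [OF wD s(1) sw s(2)] kc_Bd [OF sw] kc_Bd [OF wD]
      by (simp add: asmult_MI [OF bw] lmap_add lmap_smul) (simp add: bI_def)
  next
    assume "s \<in> WD J w"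
    then have s: "s \<in> S" "s \<otimes> w \<notin> DJ" by (auto simp: WD_def)
    show "Tgen s \<odot>\<^bsub>MI\<^esub> bI w = asmult MI (- qinv) (bI w)"
      using qop_Tgen_bI [OF s(1) wD] lam_Bd_fixed [OF wD s] kc_Bd [OF wD]
      by (simp add: asmult_MI [OF bw] lmap_smul) (simp add: bI_def)
  next
    assume "s \<in> WA J I1 w"
    then have s: "s \<in> S" "s \<otimes> w \<in> DJ" "s \<otimes> w \<notin> I1" "len w < len (s \<otimes> w)" "bruhat_lt w (s \<otimes> w)"
      using bruhat_lt_S_left_iff wc by (auto simp: WA_def)
    obtain z where z: "z \<in> EE I1" "bI (s \<otimes> w) = lin bI z" "\<And>y. lk z y \<in> QA"
      "\<And>y. lk z y \<noteq> 0 \<Longrightarrow> bruhat_lt y (s \<otimes> w)" using bI_expand [OF s(2,3)] by blast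
    let ?A = "{y \<in> I1. bruhat_lt y (s \<otimes> w)}"
    \<comment> \<open>The generator sends \<open>b_w\<close> to the image of \<open>b_{sw}\<close>,
      with no summand \<open>q b_w\<close>. The prescribed form demands one, so it is cancelled by
      adding q to the coefficient at \<open>w\<close>; this is allowed because
      \<open>w < s w\<close> and q is itself in \<open>q A+\<close>.\<close>
    define r where "r y = (if y = w then qv else 0) - lk z y" for y
    have rQA: "r y \<in> QA" for y unfolding r_def using z(3) QA_qv QA_zero by (intro QA_diff) auto
    have fin: "finite ?A" by (rule finite_bruhat_lt)
    have bE: "bI y \<in> EE I1" if "y \<in> ?A" for y using that I1_DJ by auto
    have keys: "Poly_Mapping.keys z \<subseteq> ?A" using z(1,4) by (auto simp: in_keys_iff EE_iff)
    have "finsum MI (\<lambda>y. asmult MI (r y) (bI y)) ?A = (\<Sum>y\<in>?A. asmult MI (r y) (bI y))"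
      using fin bE by (intro MI_finsum) (auto simp: asmult_MI)
    also have "\<dots> = (\<Sum>y\<in>?A. smul (r y) (bI y))" using bE by (intro sum.cong) (auto simp: asmult_MI)
    also have "\<dots> = (\<Sum>y\<in>?A. smul (if y = w then qv else 0) (bI y)) - (\<Sum>y\<in>?A. smul (lk z y) (bI y))"
      unfolding r_def by (simp add: smul_diff_left sum_subtractf)
    also have "(\<Sum>y\<in>?A. smul (if y = w then qv else 0) (bI y)) = (\<Sum>y\<in>?A. if y = w then smul qv (bI y) else 0)"
      by (intro sum.cong) auto
    also have "\<dots> = smul qv (bI w)" using fin w s(5) by simp
    also have "(\<Sum>y\<in>?A. smul (lk z y) (bI y)) = bI (s \<otimes> w)"
      unfolding z(2) using lin_superset [OF fin keys, of bI] by simp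
    finally have sum: "finsum MI (\<lambda>y. asmult MI (r y) (bI y)) ?A = smul qv (bI w) - bI (s \<otimes> w)" .
    have bsw: "bI (s \<otimes> w) \<in> EE I1" using s by simp
    have T: "Tgen s \<odot>\<^bsub>MI\<^esub> bI w = bI (s \<otimes> w)"
      using qop_Tgen_bI [OF s(1) wD] lam_Bd_up [OF wD s(1,2,4)] kc_Bd [OF s(2)] by (simp add: bI_def)
    have "Tgen s \<odot>\<^bsub>MI\<^esub> bI w = asmult MI qv (bI w) \<ominus>\<^bsub>MI\<^esub> finsum MI (\<lambda>y. asmult MI (r y) (bI y)) ?A"
      unfolding sum T asmult_MI [OF bw] using bw bsw by (subst MI_minus) auto
    then show "\<exists>r. (\<forall>y. r y \<in> QA) \<and>
           Tgen s \<odot>\<^bsub>MI\<^esub> bI w = asmult MI qv (bI w) \<ominus>\<^bsub>MI\<^esub>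
             finsum MI (\<lambda>y. asmult MI (r y) (bI y)) {y \<in> I1. bruhat_lt y (s \<otimes> w)}" using rQA by blast
  }
qed

lemma bI_one: "bI \<one> = bvec \<one>"
proof (rule poly_mapping_eqI)
  fix y
  show "lk (bI \<one>) y = lk (bvec \<one>) y"
  proof (cases "y = \<one>")
    case False
    then have "lk (uK \<one>) y = 0" using uK_lt [OF one_DJ False] bruhat_lt_len by fastforce
    then show ?thesis using False by (simp add: lookup_bI lookup_e)
  qed (use one_I1 in \<open>simp add: lookup_bI lookup_e\<close>)
qed

text \<open>The coordinates refer to a bar invariant basis, so \<open>barE\<close> acts by
  conjugating them, and this commutes with dropping the coordinates outside
  \<open>I1\<close>.\<close>

lemma module_bar_MI: "module_bar MI bI bmap"
  unfolding module_bar_def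
proof (intro conjI ballI allI)
  show "bmap \<in> carrier MI \<rightarrow> carrier MI" by auto
  show "bmap (bI \<one>) = bI \<one>" by (simp add: bI_one)
  fix x assume x: "x \<in> carrier MI"
  then have xE: "x \<in> EE I1" and xD: "x \<in> EE DJ" using I1_EE by auto
  show "bmap (x \<oplus>\<^bsub>MI\<^esub> y) = bmap x \<oplus>\<^bsub>MI\<^esub> bmap y" for y by (simp add: bmap_add)
  show "bmap (asmult MI a x) = asmult MI (lbar a) (bmap x)" for a using xE by (simp add: asmult_MI bmap_smul)
  show "bmap (bmap x) = x" by simp
  show "bmap (h \<odot>\<^bsub>MI\<^esub> x) = hbar h \<odot>\<^bsub>MI\<^esub> bmap x" if h: "h \<in> carrier H" for h
    using barE_act [OF h kl_EW [OF xD]] act_LL [OF h kl_LL [OF xD]] xD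
    by (simp add: qop_def bmap_restr bmap_kc barE_kl)
qed

lemma wgraph_ideal_I1: "wgraph_ideal J I1"
  unfolding wgraph_ideal_def
  using weak_ideal_I1 one_I1 J_Pos_I1 ideal_module_MI module_bar_MI by blast

end

theorem theorem5p4:
  fixes W :: "('w, 'x) monoid_scheme" and S J C :: "'w set" and w\<^sub>J :: 'w
  assumes "coxeter_system W S"
    and "J \<subseteq> S"
    and "finite (generate W J)"
    and "is_arg_max (coxeter_system.len W S) (\<lambda>u. u \<in> generate W J) w\<^sub>J"
    and "C \<in> coxeter_system.left_cells W S"
    and "w\<^sub>J \<in> C"
  shows "\<exists>I\<^sub>1. I\<^sub>1 \<subseteq> coxeter_system.min_reps W S J \<and>
    coxeter_system.wgraph_ideal W S J I\<^sub>1 \<and>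
    C = (\<lambda>w. w \<otimes>\<^bsub>W\<^esub> w\<^sub>J) ` I\<^sub>1 \<and>
    maximal_cells (coxeter_system.Gamma_CJ W S J) = {coxeter_system.cJ W S J ` I\<^sub>1}"
proof -
  interpret coxeter_parabolic W S J w\<^sub>J
    using assms(1-4) by (intro coxeter_parabolic.intro coxeter_parabolic_axioms.intro)
  show ?thesis
    using I1_DJ wgraph_ideal_I1 left_cell_eq [OF assms(5,6)] maximal_cells_GJ by blast
qed

end
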